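(* Let $M$ be an orientable once-punctured torus bundle over the circle with pseudo-Anosov monodromy, equipped with an incomplete hyperbolic structure obtained by deforming its complete finite-volume hyperbolic structure. Suppose $M$ has discrete length spectrum on its torus fiber. Then $$\sum_{\sigma\in\mathscr S}\log\left(\frac{e^{\nu}+e^{l(\sigma)}}{e^{-\nu}+e^{l(\sigma)}}\right)=0\mod 2\pi i,$$ where the sum converges absolutely.
   Context: $M$ is the mapping torus of a homeomorphism of a once-punctured torus $\mathbb T$ whose mapping class $H\in\mathrm{SL}(2,\mathbf Z)$ is hyperbolic ($|\mathrm{tr}\,H|>2$). $M$ carries a unique complete finite-volume hyperbolic structure, decomposed into ideal hyperbolic tetrahedra (Floyd–Hatcher). The incomplete structures considered are those obtained (following Thurston) by changing the edge invariants of these ideal tetrahedra while keeping the gluing consistency conditions, i.e. by deforming the complete structure slightly in the representation space of $\pi_1(M)$. The holonomy $\pi_1(M)\to\mathrm{PSL}(2,\mathbf C)$ of the incomplete structure lifts to $\rho:\pi_1(M)\to\mathrm{SL}(2,\mathbf C)$. Let $\Gamma=\pi_1(\mathbb T)\triangleleft\pi_1(M)$ be the fiber subgroup, free on $a,b$; put $\tau=\mathrm{tr}\,\rho(aba^{-1}b^{-1})$, where $\tau\ne2$, $\mu=\tau+2$, and $\nu=\cosh^{-1}(1-\mu/2)=\cosh^{-1}(-\tau/2)$. $\mathscr S$ is the set of closed geodesics of $M$ homotopic in $M$ to non-trivial, non-peripheral simple closed curves in the fiber; it is identified with the set of free homotopy classes of (unoriented) non-trivial non-peripheral simple closed curves on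 $\mathbb T$ modulo the action of the cyclic group $\langle H\rangle$. It is understood that each such curve is represented by a closed geodesic, i.e. $\mathrm{tr}\,\rho(g)\notin[-2,2]$ for $g\in\Gamma$ representing it. The complex length $l(\sigma)\in\mathbf C/2\pi i\mathbf Z$ of $\sigma\in\mathscr S$ (real part the hyperbolic length, imaginary part the rotation angle) is $l(\sigma)=2\cosh^{-1}(\tfrac12\mathrm{tr}\,\rho(g))$ for $g\in\Gamma$ representing $\sigma$. $M$ has discrete length spectrum on its torus fiber if for each $\kappa>0$ only finitely many $\sigma\in\mathscr S$ have length $\Re\,l(\sigma)\le\kappa$. Conventions: $\cosh^{-1}$ takes values with nonnegative real part and imaginary part in $(-\pi,\pi]$ (nonnegative imaginary part if the real part is $0$); $\log$ takes values with imaginary part in $(-\pi,\pi]$. *)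

theory Defs
  imports "HOL-Analysis.Analysis"
begin

section \<open>The once-punctured torus and its simple closed curves\<close>

definition punctured_torus :: "(complex \<times> complex) set" where
  "punctured_torus = (sphere 0 1 \<times> sphere 0 1) - {(1, 1)}"

definition torus_base :: "complex \<times> complex" where
  "torus_base = (-1, -1)"

text \<open>The standard free generators of the fundamental group of the punctured torus, and
  the loop \<open>a b a\<inverse> b\<inverse>\<close> around the puncture.\<close>

definition loop_a :: "real \<Rightarrow> complex \<times> complex" where
  "loop_a s = (- cis (2 * pi * s), -1)"

definition loop_b :: "real \<Rightarrow> complex \<times> complex" where
  "loop_b s = (-1, - cis (2 * pi * s))"

definition loop_commutator :: "real \<Rightarrow> complex \<times> complex" where
  "loop_commutator = (loop_a +++ loop_b) +++ (reversepath loop_a +++ reversepath loop_b)"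

text \<open>In angular coordinates this is the linear action of \<open>H\<close> on column vectors modulo
  \<open>2 \<pi>\<close>; it fixes the puncture when \<open>det H = 1\<close>.\<close>

definition torus_linear :: "int^2^2 \<Rightarrow> complex \<times> complex \<Rightarrow> complex \<times> complex" where
  "torus_linear H = (\<lambda>(z, w). (z powi (H$1$1) * w powi (H$1$2), z powi (H$2$1) * w powi (H$2$2)))"

text \<open>A self-homeomorphism has mapping class \<open>H\<close> if it is isotopic to the linear one.\<close>

definition has_mapping_class :: "(complex \<times> complex \<Rightarrow> complex \<times> complex) \<Rightarrow> int^2^2 \<Rightarrow> bool" where
  "has_mapping_class f H \<longleftrightarrow>
     det H = 1 \<and>
     homotopic_with_canon (\<lambda>h. \<exists>h'. homeomorphism punctured_torus punctured_torus h h')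
       punctured_torus punctured_torus f (torus_linear H)"

definition loop_in :: "'a::topological_space set \<Rightarrow> (real \<Rightarrow> 'a) \<Rightarrow> bool" where
  "loop_in S p \<longleftrightarrow> path p \<and> path_image p \<subseteq> S \<and> pathfinish p = pathstart p"

definition trivial_loop :: "(real \<Rightarrow> complex \<times> complex) \<Rightarrow> bool" where
  "trivial_loop c \<longleftrightarrow> (\<exists>x. homotopic_loops punctured_torus c (\<lambda>s. x))"

definition peripheral_loop :: "(real \<Rightarrow> complex \<times> complex) \<Rightarrow> bool" where
  "peripheral_loop c \<longleftrightarrow>
     (\<forall>e>0. \<exists>d. homotopic_loops punctured_torus c d \<and> path_image d \<subseteq> ball (1, 1) e)"

definition essential_scc :: "(real \<Rightarrow> complex \<times> complex) \<Rightarrow> bool" where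
  "essential_scc c \<longleftrightarrow>
     loop_in punctured_torus c \<and> simple_path c \<and> \<not> trivial_loop c \<and> \<not> peripheral_loop c"

definition unoriented_homotopic ::
    "(real \<Rightarrow> complex \<times> complex) \<Rightarrow> (real \<Rightarrow> complex \<times> complex) \<Rightarrow> bool" where
  "unoriented_homotopic c d \<longleftrightarrow>
     homotopic_loops punctured_torus c d \<or> homotopic_loops punctured_torus c (reversepath d)"

definition same_orbit :: "(complex \<times> complex \<Rightarrow> complex \<times> complex) \<Rightarrow>
    (real \<Rightarrow> complex \<times> complex) \<Rightarrow> (real \<Rightarrow> complex \<times> complex) \<Rightarrow> bool" where
  "same_orbit f c d \<longleftrightarrow>
     (\<exists>n::nat. unoriented_homotopic ((f ^^ n) \<circ> c) d \<or> unoriented_homotopic c ((f ^^ n) \<circ> d))"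

text \<open>The index set of the sum: unoriented free homotopy classes of essential simple closed
  curves on the fibre, modulo the cyclic group generated by the monodromy. A class stands for
  the closed geodesic of the bundle homotopic to its members.\<close>

definition fiber_geodesics :: "(complex \<times> complex \<Rightarrow> complex \<times> complex) \<Rightarrow>
    (real \<Rightarrow> complex \<times> complex) set set" where
  "fiber_geodesics f = {{d. essential_scc d \<and> same_orbit f c d} | c. essential_scc c}"

section \<open>The punctured torus bundle and representations of its fundamental group\<close>

text \<open>\<open>M\<close> is the mapping torus of \<open>f\<close>: the quotient, via \<open>q\<close>, of \<open>punctured_torus \<times> \<real>\<close> by the
  cyclic group generated by \<open>(x, t) \<mapsto> (f x, t - 1)\<close>. The fibre is the image of
  \<open>punctured_torus \<times> {0}\<close>.\<close>

definition mapping_torus :: "(complex \<times> complex \<Rightarrow> complex \<times> complex) \<Rightarrow>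
    'm::topological_space set \<Rightarrow> ((complex \<times> complex) \<times> real \<Rightarrow> 'm) \<Rightarrow> bool" where
  "mapping_torus f M q \<longleftrightarrow>
     quotient_map (top_of_set (punctured_torus \<times> UNIV)) (top_of_set M) q \<and>
     (\<forall>x\<in>punctured_torus. \<forall>y\<in>punctured_torus. \<forall>s t.
        q (x, s) = q (y, t) \<longleftrightarrow>
        (\<exists>n::nat. (y = (f ^^ n) x \<and> t = s - real n) \<or> (x = (f ^^ n) y \<and> s = t - real n)))"

definition bundle_base :: "((complex \<times> complex) \<times> real \<Rightarrow> 'm) \<Rightarrow> 'm" where
  "bundle_base q = q (torus_base, 0)"

definition fiber_loop :: "((complex \<times> complex) \<times> real \<Rightarrow> 'm) \<Rightarrow>
    (real \<Rightarrow> complex \<times> complex) \<Rightarrow> real \<Rightarrow> 'm" where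
  "fiber_loop q c = (\<lambda>s. q (c s, 0))"

text \<open>Elements of the fundamental group are handled through based loops: a homomorphism from
  \<open>\<pi>\<^sub>1(M, x0)\<close> to \<open>SL(2, \<complex>)\<close> is a homotopy invariant, multiplicative function of loops.\<close>

definition based_loop :: "'m::topological_space set \<Rightarrow> 'm \<Rightarrow> (real \<Rightarrow> 'm) \<Rightarrow> bool" where
  "based_loop M x0 p \<longleftrightarrow> loop_in M p \<and> pathstart p = x0"

definition SL2_representation ::
    "'m::topological_space set \<Rightarrow> 'm \<Rightarrow> ((real \<Rightarrow> 'm) \<Rightarrow> complex^2^2) \<Rightarrow> bool" where
  "SL2_representation M x0 \<rho> \<longleftrightarrow>
     (\<forall>p. based_loop M x0 p \<longrightarrow> det (\<rho> p) = 1) \<and>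
     (\<forall>p p'. based_loop M x0 p \<and> homotopic_paths M p p' \<longrightarrow> \<rho> p = \<rho> p') \<and>
     (\<forall>p p'. based_loop M x0 p \<and> based_loop M x0 p' \<longrightarrow> \<rho> (p +++ p') = \<rho> p ** \<rho> p')"

section \<open>Hyperbolic structures\<close>

text \<open>Hyperbolic space in the upper half-space model, with the action of \<open>SL(2, \<complex>)\<close> (which
  factors through \<open>PSL(2, \<complex>)\<close>) by the Poincare extension of Moebius transformations.\<close>

definition hyp3 :: "(complex \<times> real) set" where
  "hyp3 = {(z, t). t > 0}"

definition poincare_extension :: "complex^2^2 \<Rightarrow> complex \<times> real \<Rightarrow> complex \<times> real" where
  "poincare_extension g = (\<lambda>(z, t).
     let a = g$1$1; b = g$1$2; c = g$2$1; d = g$2$2;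
         N = (cmod (c * z + d))\<^sup>2 + (cmod c)\<^sup>2 * t\<^sup>2
     in (((a * z + b) * cnj (c * z + d) + a * cnj c * of_real (t\<^sup>2)) / of_real N, t / N))"

definition hyp3_volume :: "(complex \<times> real) set \<Rightarrow> ennreal" where
  "hyp3_volume F = (\<integral>\<^sup>+x\<in>F. ennreal (1 / (snd x) ^ 3) \<partial>lborel)"

definition path_from :: "'m::topological_space set \<Rightarrow> 'm \<Rightarrow> (real \<Rightarrow> 'm) \<Rightarrow> bool" where
  "path_from M x0 p \<longleftrightarrow> path p \<and> path_image p \<subseteq> M \<and> pathstart p = x0"

text \<open>A (possibly incomplete) hyperbolic structure on \<open>M\<close>, given by a developing map \<open>D\<close> and
  a lift \<open>\<rho>\<close> of its holonomy. The universal cover of \<open>M\<close> is the set of homotopy classes of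
  paths issuing from \<open>x0\<close>, so \<open>D\<close> is a homotopy invariant function of such paths. In the third
  clause \<open>\<phi>\<close> is the local chart of the structure obtained from \<open>D\<close> by continuing \<open>p\<close> inside \<open>V\<close>.\<close>

definition hyperbolic_structure :: "'m::topological_space set \<Rightarrow> 'm \<Rightarrow>
    ((real \<Rightarrow> 'm) \<Rightarrow> complex \<times> real) \<Rightarrow> ((real \<Rightarrow> 'm) \<Rightarrow> complex^2^2) \<Rightarrow> bool" where
  "hyperbolic_structure M x0 D \<rho> \<longleftrightarrow>
     SL2_representation M x0 \<rho> \<and>
     (\<forall>p p'. path_from M x0 p \<and> homotopic_paths M p p' \<longrightarrow> D p = D p') \<and>
     (\<forall>p. path_from M x0 p \<longrightarrow>
        (\<exists>V W \<phi> \<phi>'. openin (top_of_set M) V \<and> pathfinish p \<in> V \<and> open W \<and> W \<subseteq> hyp3 \<and>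
           homeomorphism V W \<phi> \<phi>' \<and>
           (\<forall>r. path_from V (pathfinish p) r \<longrightarrow> D (p +++ r) = \<phi> (pathfinish r)))) \<and>
     (\<forall>g p. based_loop M x0 g \<and> path_from M x0 p \<longrightarrow>
        D (g +++ p) = poincare_extension (\<rho> g) (D p))"

text \<open>The structure is complete if the developing map is a covering of \<open>hyp3\<close>; both spaces
  being simply connected, this means that it is a bijection from the universal cover.\<close>

definition complete_developing :: "'m::topological_space set \<Rightarrow> 'm \<Rightarrow>
    ((real \<Rightarrow> 'm) \<Rightarrow> complex \<times> real) \<Rightarrow> bool" where
  "complete_developing M x0 D \<longleftrightarrow>
     D ` {p. path_from M x0 p} = hyp3 \<and>
     (\<forall>p p'. path_from M x0 p \<and> path_from M x0 p' \<and> D p = D p' \<longrightarrow> homotopic_paths M p p')"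

definition finite_covolume :: "'m::topological_space set \<Rightarrow> 'm \<Rightarrow>
    ((real \<Rightarrow> 'm) \<Rightarrow> complex^2^2) \<Rightarrow> bool" where
  "finite_covolume M x0 \<rho> \<longleftrightarrow>
     (\<exists>F \<in> sets lborel. F \<subseteq> hyp3 \<and> hyp3_volume F < \<infinity> \<and>
        hyp3 \<subseteq> (\<Union>g\<in>{g. based_loop M x0 g}. poincare_extension (\<rho> g) ` F))"

text \<open>\<open>\<rho>\<close> is (a lift of) the holonomy of an incomplete hyperbolic structure obtained by deforming
  the complete finite-volume one: it is joined to the complete holonomy by a path of holonomies
  of hyperbolic structures in the representation space. Since \<open>\<pi>\<^sub>1(M)\<close> is finitely generated,
  the topology of the representation space is that of pointwise convergence.\<close>

definition incomplete_deformation :: "'m::topological_space set \<Rightarrow> 'm \<Rightarrow>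
    ((real \<Rightarrow> 'm) \<Rightarrow> complex^2^2) \<Rightarrow> bool" where
  "incomplete_deformation M x0 \<rho> \<longleftrightarrow>
     (\<exists>R :: real \<Rightarrow> (real \<Rightarrow> 'm) \<Rightarrow> complex^2^2.
        (\<exists>D. hyperbolic_structure M x0 D (R 0) \<and> complete_developing M x0 D \<and>
             finite_covolume M x0 (R 0)) \<and>
        (\<forall>u\<in>{0..1}. \<exists>D. hyperbolic_structure M x0 D (R u)) \<and>
        (\<forall>g. based_loop M x0 g \<longrightarrow> continuous_on {0..1} (\<lambda>u. R u g)) \<and>
        R 1 = \<rho> \<and>
        (\<exists>D. hyperbolic_structure M x0 D \<rho> \<and> \<not> complete_developing M x0 D))"

section \<open>Complex lengths\<close>

text \<open>The branch of the inverse hyperbolic cosine with nonnegative real part and imaginary part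
  in \<open>(-\<pi>, \<pi>]\<close>, nonnegative when the real part vanishes.\<close>

definition arcosh_branch :: "complex \<Rightarrow> complex \<Rightarrow> bool" where
  "arcosh_branch z w \<longleftrightarrow>
     cosh w = z \<and> Re w \<ge> 0 \<and> -pi < Im w \<and> Im w \<le> pi \<and> (Re w = 0 \<longrightarrow> Im w \<ge> 0)"

definition carcosh :: "complex \<Rightarrow> complex" where
  "carcosh z = (THE w. arcosh_branch z w)"

lemma cosh_eq_cosh_complex:
  fixes w w' :: complex
  shows "cosh w = cosh w' \<longleftrightarrow>
    (\<exists>n::int. w = w' + 2 * of_int n * of_real pi * \<i> \<or> w = - w' + 2 * of_int n * of_real pi * \<i>)"
proof -
  have c: "cosh w = cos (\<i> * w)" for w :: complex
    by (simp add: cosh_conv_cos)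
  have ex: "(\<exists>x\<in>\<int>. P x) \<longleftrightarrow> (\<exists>n::int. P (of_int n))" for P :: "real \<Rightarrow> bool"
    by (auto simp: Ints_def)
  have im: "\<i> * w = \<i> * w' + of_real (2 * of_int n * pi) \<longleftrightarrow> w = w' + 2 * of_int (- n) * of_real pi * \<i>"
    and im': "\<i> * w = - (\<i> * w') + of_real (2 * of_int n * pi) \<longleftrightarrow> w = - w' + 2 * of_int (- n) * of_real pi * \<i>"
    for n :: int by (auto simp: complex_eq_iff)
  have "cosh w = cosh w' \<longleftrightarrow> (\<exists>n::int. \<i> * w = \<i> * w' + of_real (2 * of_int n * pi) \<or>
      \<i> * w = - (\<i> * w') + of_real (2 * of_int n * pi))"
    unfolding c complex_cos_eq ex ..
  also have "\<dots> \<longleftrightarrow> (\<exists>n::int. w = w' + 2 * of_int (- n) * of_real pi * \<i> \<or>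
      w = - w' + 2 * of_int (- n) * of_real pi * \<i>)"
    unfolding im im' ..
  also have "\<dots> \<longleftrightarrow> (\<exists>n::int. w = w' + 2 * of_int n * of_real pi * \<i> \<or>
      w = - w' + 2 * of_int n * of_real pi * \<i>)"
    by (metis minus_minus)
  finally show ?thesis .
qed

lemma arcosh_branch_ex1: "\<exists>!w. arcosh_branch z w"
proof (rule ex_ex1I)
  have strip: "\<exists>w'. cosh w' = cosh w \<and> Re w' = Re w \<and> -pi < Im w' \<and> Im w' \<le> pi" for w :: complex
  proof -
    define n :: int where "n = \<lceil>(Im w - pi) / (2 * pi)\<rceil>"
    define w' where "w' = w + 2 * of_int (- n) * of_real pi * \<i>"
    have "cosh w' = cosh w"
      unfolding cosh_eq_cosh_complex w'_def by blast
    moreover have "Re w' = Re w" and "Im w' = Im w - 2 * pi * n"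
      by (simp_all add: w'_def)
    moreover have "(Im w - pi) / (2 * pi) \<le> n" "n < (Im w - pi) / (2 * pi) + 1"
      unfolding n_def by linarith+
    then have "Im w - 2 * pi * n \<le> pi" "-pi < Im w - 2 * pi * n"
      by (simp_all add: field_simps)
    ultimately show ?thesis by auto
  qed
  have "cosh (\<i> * Arccos z) = z"
    by (simp add: cosh_conv_cos)
  then obtain w0 where w0: "cosh w0 = z" "Re w0 \<ge> 0"
    by (metis cosh_minus linear neg_0_le_iff_le uminus_complex.sel(1))
  obtain w where w: "cosh w = z" "Re w \<ge> 0" "-pi < Im w" "Im w \<le> pi"
    using strip[of w0] w0 by auto
  show "\<exists>w. arcosh_branch z w"
  proof (cases "Re w = 0 \<and> Im w < 0")
    case True
    then have "arcosh_branch z (- w)"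
      using w by (auto simp: arcosh_branch_def)
    then show ?thesis ..
  next
    case False
    then show ?thesis using w by (auto simp: arcosh_branch_def)
  qed
next
  fix w w' assume b: "arcosh_branch z w" "arcosh_branch z w'"
  then have "cosh w = cosh w'" by (simp add: arcosh_branch_def)
  then obtain n :: int where n: "w = w' + 2 * of_int n * of_real pi * \<i> \<or>
      w = - w' + 2 * of_int n * of_real pi * \<i>"
    unfolding cosh_eq_cosh_complex by blast
  have range: "n = 0" if "-(2 * pi) < 2 * n * pi" "2 * n * pi < 2 * pi"
  proof -
    have "pi * (-1) < pi * real_of_int n" "pi * real_of_int n < pi * 1"
      using that by (simp_all add: algebra_simps)
    then have "-1 < real_of_int n" "real_of_int n < 1"
      by (simp_all only: mult_less_cancel_left_pos[OF pi_gt_zero])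
    then show ?thesis by linarith
  qed
  from n show "w = w'"
  proof
    assume eq: "w = w' + 2 * of_int n * of_real pi * \<i>"
    then have "Im w = Im w' + 2 * n * pi" by simp
    moreover from b have "-pi < Im w" "Im w \<le> pi" "-pi < Im w'" "Im w' \<le> pi"
      by (simp_all add: arcosh_branch_def)
    ultimately have "n = 0" by (intro range) linarith+
    with eq show ?thesis by simp
  next
    assume eq: "w = - w' + 2 * of_int n * of_real pi * \<i>"
    then have im: "Im w + Im w' = 2 * n * pi" and re: "Re w = - Re w'" by simp_all
    from re b have z: "Re w = 0" "Re w' = 0" "0 \<le> Im w" "0 \<le> Im w'" "Im w \<le> pi" "Im w' \<le> pi"
      by (auto simp: arcosh_branch_def)
    show ?thesis
    proof (cases "2 * n * pi < 2 * pi")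
      case True
      with z im have "n = 0" by (intro range) (use pi_gt_zero in linarith)+
      with im z show ?thesis by (simp add: complex_eq_iff)
    next
      case False
      with z im have "Im w = pi" "Im w' = pi" by linarith+
      with z show ?thesis by (simp add: complex_eq_iff)
    qed
  qed
qed

definition represents :: "(real \<Rightarrow> complex \<times> complex) \<Rightarrow>
    (real \<Rightarrow> complex \<times> complex) set \<Rightarrow> bool" where
  "represents g \<sigma> \<longleftrightarrow> based_loop punctured_torus torus_base g \<and>
     (\<exists>c\<in>\<sigma>. homotopic_loops punctured_torus g c)"

text \<open>The value does not depend on the representative chosen, as traces of \<open>SL(2, \<complex>)\<close>
  representations are invariant under conjugation and inversion.\<close>

definition geodesic_trace :: "((complex \<times> complex) \<times> real \<Rightarrow> 'm) \<Rightarrow>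
    ((real \<Rightarrow> 'm) \<Rightarrow> complex^2^2) \<Rightarrow> (real \<Rightarrow> complex \<times> complex) set \<Rightarrow> complex" where
  "geodesic_trace q \<rho> \<sigma> = trace (\<rho> (fiber_loop q (SOME g. represents g \<sigma>)))"

text \<open>A representative in \<open>\<complex>\<close> of the complex length, which is defined modulo \<open>2 \<pi> \<i>\<close>;
  only its real part and its exponential are used.\<close>

definition complex_length :: "((complex \<times> complex) \<times> real \<Rightarrow> 'm) \<Rightarrow>
    ((real \<Rightarrow> 'm) \<Rightarrow> complex^2^2) \<Rightarrow> (real \<Rightarrow> complex \<times> complex) set \<Rightarrow> complex" where
  "complex_length q \<rho> \<sigma> = 2 * carcosh (geodesic_trace q \<rho> \<sigma> / 2)"

definition discrete_fiber_spectrum :: "(complex \<times> complex \<Rightarrow> complex \<times> complex) \<Rightarrow>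
    ((complex \<times> complex) \<times> real \<Rightarrow> 'm) \<Rightarrow> ((real \<Rightarrow> 'm) \<Rightarrow> complex^2^2) \<Rightarrow> bool" where
  "discrete_fiber_spectrum f q \<rho> \<longleftrightarrow>
     (\<forall>\<kappa>>0. finite {\<sigma> \<in> fiber_geodesics f. Re (complex_length q \<rho> \<sigma>) \<le> \<kappa>})"

definition boundary_trace :: "((complex \<times> complex) \<times> real \<Rightarrow> 'm) \<Rightarrow>
    ((real \<Rightarrow> 'm) \<Rightarrow> complex^2^2) \<Rightarrow> complex" where
  "boundary_trace q \<rho> = trace (\<rho> (fiber_loop q loop_commutator))"

definition mcshane_term :: "complex \<Rightarrow> complex \<Rightarrow> complex" where
  "mcshane_term \<nu> l = Ln ((exp \<nu> + exp l) / (exp (-\<nu>) + exp l))"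

end

theory Submission
  imports Defs "HOL-Complex_Analysis.Complex_Analysis"
begin

text \<open>
  Winding numbers and an analysis of the annular cover show that the essential simple closed curves
  on the punctured torus are, up to homotopy, the images of the standard horizontal curve under
  \<open>SL(2, \<int>)\<close>; hence they correspond to primitive integer vectors, and unoriented ones to
  primitive vectors up to sign. On these vectors the trace of the representation is a Markoff map:
  \<open>x (u + v) + x (u - v) = x u * x v\<close> for every basis \<open>u, v\<close>, together with the vertex relation
  with constant \<open>\<mu>\<close>, and it is invariant under \<open>H\<close> because the monodromy is a conjugation in
  the fundamental group of the bundle.

  Following Bowditch, to an edge \<open>u, v\<close> of the Farey tree one attaches a number \<open>R u v\<close> satisfying
  \<open>R u v = F (u + v) * R u (u + v) * R v (u + v)\<close>, where \<open>F\<close> is the exponential of the summand. In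
  a cone on which \<open>x\<close> takes each bounded region of values only finitely often, \<open>x\<close> grows
  exponentially, \<open>R\<close> tends to 1 fast enough, and so \<open>R u v\<close> is the product of \<open>F\<close> over the cone.
  After a change of basis \<open>\<plusminus>H\<close> has positive entries and maps the positive cone into itself;
  the difference of the two cones is a fundamental domain, and since \<open>R\<close> takes the same value on the
  edges of the two cones, the product of \<open>F\<close> over the difference is 1.
\<close>

text \<open>Discreteness of the spectrum concerns curves modulo \<open>H\<close>, so it limits how
  often small values of \<open>x\<close> occur on the fundamental domain only. On the full positive
  cone every value recurs along the orbits of \<open>H\<close>, and the finiteness behind the
  product formula fails. The formula is therefore applied to the cones that branch off the path of
  the tree from the edge of the large cone to the edge of the small one: each of them lies in the
  domain. The recursion for \<open>R\<close> divides by \<open>x\<^sup>2 - \<mu>\<close>. That this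
  never vanishes is not among the hypotheses; a zero would produce a fan of infinitely many distinct
  bounded values of \<open>x\<close>, against discreteness. The sum is obtained only modulo
  \<open>2 * pi * \<i>\<close> because what is computed is the product of the \<open>F\<close>, not
  the sum of principal logarithms. On the topological side, a lifted simple loop has to be
  straightened in a plane with infinitely many punctures. The Riemann map of its inside supplies the
  coordinates: one deck transformation acts there as a univalent contraction, so the Schwarz lemma
  keeps shrinking concentric circles away from the punctures.\<close>

no_notation fps_nth (infixl "$" 75)

section \<open>Simple loops in the plane punctured along a geometric progression\<close>

text \<open>Division by \<open>z\<close> removes the zero of \<open>\<psi>\<close>, and injectivity
  keeps both the quotient and the derivative at 0 from vanishing; the disc being contractible, the
  quotient has a logarithm \<open>h\<close>. Scaling \<open>h\<close> then deforms
  \<open>\<psi>\<close> to the identity without creating zeros.\<close>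

lemma injective_holomorphic_factor_exp:
  fixes \<psi> :: "complex \<Rightarrow> complex"
  assumes hol: "\<psi> holomorphic_on ball 0 1" and inj: "inj_on \<psi> (ball 0 1)" and zero: "\<psi> 0 = 0"
  obtains h where "h holomorphic_on ball 0 1" "\<And>z. z \<in> ball 0 1 \<Longrightarrow> \<psi> z = z * exp (h z)"
proof -
  obtain g where g: "g holomorphic_on ball 0 1" "\<And>z. norm z < 1 \<Longrightarrow> \<psi> z = z * g z" and g0: "deriv \<psi> 0 = g 0"
    using Schwarz3[OF hol zero] by metis
  have "g z \<noteq> 0" if z: "z \<in> ball 0 1" for z
  proof (cases "z = 0")
    case True
    then show ?thesis using holomorphic_injective_imp_regular[OF hol open_ball inj z] g0 by simp
  next
    case False
    then have "\<psi> z \<noteq> \<psi> 0" using inj z by (auto simp: inj_on_def)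
    then show ?thesis using g(2)[of z] z zero by auto
  qed
  then obtain h where "h holomorphic_on ball 0 1" "\<And>z. z \<in> ball 0 1 \<Longrightarrow> g z = exp (h z)"
    using contractible_imp_holomorphic_log[OF g(1) convex_imp_contractible[OF convex_ball]] by blast
  then show ?thesis using g(2) by (intro that[of h]) auto
qed

text \<open>Each point of the complement of the cover lies on an unbounded connected part of that
  complement: a right half-plane if it sits over the exterior of the ball, and otherwise a lift of
  the curve \<open>\<psi> (exp s * z)\<close>, \<open>s \<le> 0\<close>, which runs off to the left
  while its image tends to 0.\<close>

lemma exp_cover_inside_empty:
  assumes hol: "\<psi> holomorphic_on ball 0 1" and inj: "inj_on \<psi> (ball 0 1)" and zero: "\<psi> 0 = 0"
    and \<rho>: "\<rho> < 1"
  shows "inside {w. exp w \<in> ball 0 R - \<psi> ` cball 0 \<rho>} = {}"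
proof -
  define L where "L = {w::complex. exp w \<in> ball 0 R - \<psi> ` cball 0 \<rho>}"
  have sub: "cball 0 \<rho> \<subseteq> ball 0 (1::real)" using \<rho> by auto
  obtain h where h: "h holomorphic_on ball 0 1" "\<And>z. z \<in> ball 0 1 \<Longrightarrow> \<psi> z = z * exp (h z)"
    using injective_holomorphic_factor_exp[OF hol inj zero] by blast
  have conth: "continuous_on (cball 0 \<rho>) h"
    using \<rho> by (intro continuous_on_subset[OF holomorphic_on_imp_continuous_on[OF h(1)]]) auto
  have "bounded (h ` cball 0 \<rho>)"
    by (intro compact_imp_bounded compact_continuous_image conth compact_cball)
  then obtain B where B: "\<And>z. z \<in> cball 0 \<rho> \<Longrightarrow> norm (h z) \<le> B"
    unfolding bounded_iff by blast
  have ray: "\<exists>S. connected S \<and> x \<in> S \<and> S \<subseteq> - L \<and> \<not> bounded S" if x: "x \<in> - L" for x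
  proof (cases "R \<le> norm (exp x)")
    case True
    define S where "S = {w. Re w \<ge> Re x}"
    have "connected S" unfolding S_def
      by (intro convex_connected convex_halfspace_Re_ge)
    moreover have "x \<in> S" by (simp add: S_def)
    moreover have "S \<subseteq> - L"
    proof
      fix w assume "w \<in> S"
      then have "norm (exp x) \<le> norm (exp w)" by (simp add: S_def)
      then have "\<not> norm (exp w) < R" using True by linarith
      then show "w \<in> - L" unfolding L_def by simp
    qed
    moreover have "\<not> bounded S"
    proof
      assume "bounded S"
      then obtain b where b: "\<And>w. w \<in> S \<Longrightarrow> norm w \<le> b" unfolding bounded_iff by blast
      have "norm (complex_of_real (max (Re x) (b + 1))) \<le> b"
        by (intro b) (simp add: S_def)
      then show False by simp
    qed
    ultimately show ?thesis by blast
  next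
    case False
    then obtain z where z: "z \<in> cball 0 \<rho>" "exp x = \<psi> z" using x by (auto simp: L_def)
    have zin: "of_real (exp s) * z \<in> cball 0 \<rho>" if "s \<le> 0" for s
    proof -
      have "exp s * norm z \<le> 1 * norm z" using that by (intro mult_right_mono) auto
      then show ?thesis using z(1) by (simp add: norm_mult)
    qed
    \<comment> \<open>A continuous logarithm of \<open>\<psi> (exp s * z)\<close> starting at
      \<open>x\<close>; since \<open>h\<close> is bounded, its real part tends to minus infinity
      with \<open>s\<close>.\<close>
    define w where "w = (\<lambda>s. x + of_real s + h (of_real (exp s) * z) - h z)"
    have w0: "w 0 = x" by (simp add: w_def)
    have contw: "continuous_on {..0} w" unfolding w_def
      by (intro continuous_intros continuous_on_compose2[OF conth]) (use zin in auto)
    have expw: "exp (w s) \<in> \<psi> ` cball 0 \<rho>" if "s \<le> 0" for s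
    proof -
      have "exp (w s) = exp x * of_real (exp s) * exp (h (of_real (exp s) * z)) / exp (h z)"
        by (simp add: w_def exp_add exp_diff exp_of_real)
      also have "\<dots> = of_real (exp s) * z * exp (h (of_real (exp s) * z))"
        using z h(2)[of z] \<rho> by simp
      also have "\<dots> = \<psi> (of_real (exp s) * z)"
        using h(2)[of "of_real (exp s) * z"] zin[OF that] \<rho> by simp
      finally show ?thesis using zin[OF that] by blast
    qed
    have "connected (w ` {..0})"
      by (intro connected_continuous_image contw) auto
    moreover have "x \<in> w ` {..0}" using w0 by force
    moreover have "w ` {..0} \<subseteq> - L" using expw by (auto simp: L_def)
    moreover have "\<not> bounded (w ` {..0})"
    proof
      assume "bounded (w ` {..0})"
      then obtain b where b: "\<And>s. s \<le> 0 \<Longrightarrow> norm (w s) \<le> b" unfolding bounded_iff by blast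
      define s where "s = - (\<bar>b\<bar> + norm x + 2 * \<bar>B\<bar> + 1)"
      have s: "s \<le> 0" unfolding s_def using norm_ge_zero[of x] by linarith
      have "norm (h (of_real (exp s) * z)) \<le> \<bar>B\<bar>" "norm (h z) \<le> \<bar>B\<bar>"
        using B[OF zin[OF s]] B[OF z(1)] by linarith+
      moreover have "of_real s = w s - x - h (of_real (exp s) * z) + h z" by (simp add: w_def)
      then have "norm (of_real s :: complex) \<le> norm (w s) + norm x + norm (h (of_real (exp s) * z)) + norm (h z)"
        by (smt (verit) norm_triangle_ineq norm_triangle_ineq4)
      ultimately have "\<bar>s\<bar> \<le> b + norm x + 2 * \<bar>B\<bar>" using b[OF s] by simp
      then show False by (simp add: s_def)
    qed
    ultimately show ?thesis by blast
  qed
  have "x \<notin> inside L" for x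
  proof
    assume "x \<in> inside L"
    then have x: "x \<in> - L" "bounded (connected_component_set (- L) x)" by (auto simp: inside_def)
    obtain S where "connected S" "x \<in> S" "S \<subseteq> - L" "\<not> bounded S" using ray[OF x(1)] by blast
    then show False using connected_component_maximal bounded_subset x(2) by metis
  qed
  then show ?thesis by (auto simp: L_def)
qed

lemma compact_injective_image_cball:
  assumes hol: "\<psi> holomorphic_on ball 0 1" and inj: "inj_on \<psi> (ball 0 1)" and \<rho>: "\<rho> < 1"
  shows "compact (\<psi> ` cball 0 \<rho> :: complex set)" "connected (- \<psi> ` cball 0 \<rho>)"
proof -
  have cont: "continuous_on (cball 0 \<rho>) \<psi>"
    using \<rho> by (intro continuous_on_subset[OF holomorphic_on_imp_continuous_on[OF hol]]) auto
  show "compact (\<psi> ` cball 0 \<rho>)" by (intro compact_continuous_image cont compact_cball)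
  have "inj_on \<psi> (cball 0 \<rho>)" using \<rho> by (intro inj_on_subset[OF inj]) auto
  then have "(\<psi> ` cball 0 \<rho>) homeomorphic cball (0::complex) \<rho>"
    using homeomorphic_compact[OF compact_cball cont refl] homeomorphic_sym by blast
  then show "connected (- \<psi> ` cball 0 \<rho>)"
    by (intro connected_complement_homeomorphic_convex_compact[OF _ convex_cball compact_cball]) auto
qed

text \<open>Between \<open>K\<close> and the boundary of the ball lies a round annulus
  \<open>m < |w| < R\<close>, whose preimage under \<open>exp\<close> is the single strip
  \<open>S\<close>. Any path in the base that ends at \<open>p0\<close> in this annulus lifts to a
  path ending in \<open>S\<close>, so all sheets are joined through \<open>S\<close>.\<close>

lemma exp_cover_connected:
  assumes hol: "\<psi> holomorphic_on ball 0 1" and inj: "inj_on \<psi> (ball 0 1)" and zero: "\<psi> 0 = 0"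
    and \<rho>: "0 < \<rho>" "\<rho> < 1" and sub: "\<psi> ` ball 0 1 \<subseteq> ball 0 R"
  shows "path_connected {w. exp w \<in> ball 0 R - \<psi> ` cball 0 \<rho>}"
proof -
  define K where "K = \<psi> ` cball 0 \<rho>"
  define L where "L = {w::complex. exp w \<in> ball 0 R - K}"
  have K: "compact K" "connected (- K)" unfolding K_def
    using compact_injective_image_cball[OF hol inj \<rho>(2)] by auto
  have KR: "K \<subseteq> ball 0 R" using sub \<rho> by (auto simp: K_def)
  have K0: "0 \<in> K" using zero \<rho> by (force simp: K_def)
  have Rpos: "R > 0" using K0 KR by auto
  obtain m where m: "m < R" "K \<subseteq> cball 0 m" "m > 0"
  proof -
    obtain z where z: "z \<in> K" "\<And>y. y \<in> K \<Longrightarrow> norm y \<le> norm z"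
      using continuous_attains_sup[of K norm] K(1) K0 by (metis continuous_on_norm_id empty_iff)
    have "norm z < R" using z KR by auto
    moreover have "K \<subseteq> cball 0 (max (norm z) (R/2))" using z(2) by (auto simp: le_max_iff_disj)
    ultimately show ?thesis using that[of "max (norm z) (R/2)"] Rpos by auto
  qed
  have conn: "path_connected (ball 0 R - K)"
  proof -
    have disj: "K \<inter> - ball 0 R = {}" using KR by blast
    have "connected (- (K \<union> - ball 0 R))"
      by (intro Janiszewski_connected K) (auto simp: disj closed_def)
    moreover have "- (K \<union> - ball 0 R) = ball 0 R - K" by blast
    ultimately have "connected (ball 0 R - K)" by simp
    then show ?thesis using K(1) by (intro connected_open_path_connected) (auto intro: open_Diff compact_imp_closed)
  qed
  define p0 where "p0 = complex_of_real ((m + R)/2)"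
  define S where "S = {w. ln m < Re w \<and> Re w < ln R}"
  have S: "path_connected S"
  proof -
    have "S = {w. ln m < Re w} \<inter> {w. Re w < ln R}" by (auto simp: S_def)
    then show ?thesis
      by (simp add: convex_imp_path_connected convex_Int convex_halfspace_Re_gt convex_halfspace_Re_lt)
  qed
  have SL: "S \<subseteq> L"
  proof
    fix w assume "w \<in> S"
    then have "exp (ln m) < exp (Re w)" "exp (Re w) < exp (ln R)"
      by (simp_all only: exp_less_cancel_iff) (simp_all add: S_def)
    then have "m < exp (Re w)" "exp (Re w) < R" using m Rpos by simp_all
    then show "w \<in> L" using m(2) by (auto simp: L_def)
  qed
  have p0: "p0 \<in> ball 0 R - K"
  proof -
    have "norm p0 = (m + R)/2" unfolding p0_def norm_of_real using m by simp
    then show ?thesis using m by (auto dest!: subsetD[OF m(2)])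
  qed
  have toS: "\<exists>y\<in>S. path_component L w y" if w: "w \<in> L" for w
  proof -
    have "exp w \<in> ball 0 R - K" using w by (simp add: L_def)
    then obtain g where g: "path g" "path_image g \<subseteq> ball 0 R - K" "pathstart g = exp w" "pathfinish g = p0"
      using conn p0 unfolding path_connected_def by blast
    have "0 \<notin> path_image g" using g(2) K0 by auto
    then obtain q where q: "path q" "\<And>t. t \<in> {0..1} \<Longrightarrow> g t = 0 + exp (q t)"
      using winding_number_as_continuous_log[OF g(1)] by metis
    define q' where "q' = (\<lambda>t. q t - q 0 + w)"
    have e: "exp (q' t) = g t" if "t \<in> {0..1}" for t
    proof -
      have "exp (q 0) = exp w" using q(2)[of 0] g(3) by (simp add: pathstart_def)
      then show ?thesis using q(2)[OF that] by (simp add: q'_def exp_add exp_diff)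
    qed
    have "path q'" using q(1) unfolding q'_def path_def by (intro continuous_intros)
    moreover have "path_image q' \<subseteq> L"
    proof
      fix y assume "y \<in> path_image q'"
      then obtain t where t: "t \<in> {0..1}" "y = q' t" by (auto simp: path_image_def)
      then have "g t \<in> path_image g" by (simp add: path_image_def)
      then show "y \<in> L" using e[OF t(1)] g(2) t(2) unfolding L_def by fastforce
    qed
    moreover have "pathstart q' = w" by (simp add: q'_def pathstart_def)
    moreover have "pathfinish q' \<in> S"
    proof -
      have "exp (q' 1) = p0" using e[of 1] g(4) by (simp add: pathfinish_def)
      then have "norm (exp (q' 1)) = (m + R)/2" unfolding p0_def using m by (simp only: norm_of_real) simp
      then have "exp (Re (q' 1)) = (m + R)/2" by simp
      then have "Re (q' 1) = ln ((m + R)/2)" by (metis ln_exp)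
      then show ?thesis using m by (simp add: S_def pathfinish_def)
    qed
    ultimately show ?thesis unfolding path_component_def by blast
  qed
  have "path_component L x y" if xy: "x \<in> L" "y \<in> L" for x y
  proof -
    obtain x' y' where *: "x' \<in> S" "y' \<in> S" "path_component L x x'" "path_component L y y'" using toS xy by meson
    have "path_component S x' y'" using S * by (simp add: path_connected_component)
    then have "path_component L x' y'" using path_component_of_subset[OF SL] by blast
    then show ?thesis using * path_component_trans path_component_sym by metis
  qed
  then show ?thesis unfolding path_connected_component L_def K_def by blast
qed

text \<open>Loops with the same winding number lift through \<open>exp\<close> to paths whose ends
  differ by the same period \<open>c\<close>. In the simply connected cover the lift of
  \<open>g1\<close> may be replaced by \<open>\<eta>\<close>, the lift of \<open>g2\<close>, and the
  translate of \<open>\<eta>\<close> by \<open>c\<close> run backwards. As \<open>exp c = 1\<close>,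
  the outer pieces project to one path and its reverse, a conjugation that free homotopy
  ignores.\<close>

lemma annulus_homotopic_loops:
  assumes hol: "\<psi> holomorphic_on ball 0 1" and inj: "inj_on \<psi> (ball 0 1)" and zero: "\<psi> 0 = 0"
    and \<rho>: "0 < \<rho>" "\<rho> < 1" and sub: "\<psi> ` ball 0 1 \<subseteq> ball 0 R"
    and g1: "path g1" "pathfinish g1 = pathstart g1" "path_image g1 \<subseteq> ball 0 R - \<psi> ` cball 0 \<rho>"
    and g2: "path g2" "pathfinish g2 = pathstart g2" "path_image g2 \<subseteq> ball 0 R - \<psi> ` cball 0 \<rho>"
    and w: "winding_number g1 0 = winding_number g2 0"
  shows "homotopic_loops (ball 0 R - \<psi> ` cball 0 \<rho>) g1 g2"
proof -
  define A where "A = ball 0 R - \<psi> ` cball 0 \<rho>"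
  define L where "L = {w::complex. exp w \<in> A}"
  have oA: "open A" unfolding A_def
    using compact_injective_image_cball(1)[OF hol inj \<rho>(2)] by (intro open_Diff compact_imp_closed) auto
  have oL: "open L" 
    using oA continuous_open_vimage[of A exp] by (auto simp: L_def vimage_def continuous_on_eq_continuous_at[symmetric] intro!: continuous_intros)
  have pL: "path_connected L" using exp_cover_connected[OF assms(1-6)] by (simp add: L_def A_def)
  have sL: "simply_connected L"
    using simply_connected_eq_empty_inside[OF oL] exp_cover_inside_empty[OF hol inj zero \<rho>(2)]
      path_connected_imp_connected[OF pL] by (simp add: L_def A_def)
  have nz: "0 \<notin> A" using zero \<rho> by (force simp: A_def)
  obtain q1 where q1: "path q1" "pathfinish q1 - pathstart q1 = 2 * of_real pi * \<i> * winding_number g1 0"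
      "\<And>t. t \<in> {0..1} \<Longrightarrow> g1 t = 0 + exp (q1 t)"
    using winding_number_as_continuous_log[OF g1(1), of 0] g1(3) nz by (metis A_def subsetD)
  obtain q2 where q2: "path q2" "pathfinish q2 - pathstart q2 = 2 * of_real pi * \<i> * winding_number g2 0"
      "\<And>t. t \<in> {0..1} \<Longrightarrow> g2 t = 0 + exp (q2 t)"
    using winding_number_as_continuous_log[OF g2(1), of 0] g2(3) nz by (metis A_def subsetD)
  have lift: "path_image q \<subseteq> L" if "path_image g \<subseteq> A" "\<And>t. t \<in> {0..1} \<Longrightarrow> g t = 0 + exp (q t)" for g q
  proof
    fix y assume "y \<in> path_image q"
    then obtain t where t: "t \<in> {0..1}" "y = q t" by (auto simp: path_image_def)
    then have "g t \<in> A" using that(1) by (auto simp: path_image_def)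
    then show "y \<in> L" using that(2)[OF t(1)] t(2) unfolding L_def by simp
  qed
  have im: "path_image q1 \<subseteq> L" "path_image q2 \<subseteq> L"
    using lift[OF _ q1(3)] lift[OF _ q2(3)] g1(3) g2(3) by (simp_all add: A_def)
  obtain \<eta> where \<eta>: "path \<eta>" "path_image \<eta> \<subseteq> L" "pathstart \<eta> = pathstart q1" "pathfinish \<eta> = pathstart q2"
    using pL im unfolding path_connected_def by (metis pathstart_in_path_image subsetD)
  define c where "c = 2 * of_real pi * \<i> * winding_number g1 0"
  have expc: "exp c = 1"
  proof -
    have "winding_number g1 0 \<in> \<int>" using g1 nz by (intro integer_winding_number) (auto simp: A_def)
    then show ?thesis by (auto simp: c_def Ints_def exp_eq_1 intro!: exI)
  qed
  define \<eta>' where "\<eta>' = (\<lambda>t. \<eta> t + c)"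
  have \<eta>': "path \<eta>'" "path_image \<eta>' \<subseteq> L" "pathstart \<eta>' = pathfinish q1" "pathfinish \<eta>' = pathfinish q2"
  proof -
    show "path \<eta>'" using \<eta>(1) unfolding \<eta>'_def path_def by (intro continuous_intros)
    show "path_image \<eta>' \<subseteq> L" using \<eta>(2) by (auto simp: path_image_def \<eta>'_def L_def exp_add expc)
    show "pathstart \<eta>' = pathfinish q1" using \<eta>(3) q1(2) by (simp add: \<eta>'_def pathstart_def pathfinish_def c_def algebra_simps)
    show "pathfinish \<eta>' = pathfinish q2" using \<eta>(4) q2(2) w by (simp add: \<eta>'_def pathstart_def pathfinish_def c_def algebra_simps)
  qed
  have "path (\<eta> +++ q2 +++ reversepath \<eta>')" "path_image (\<eta> +++ q2 +++ reversepath \<eta>') \<subseteq> L"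
      "pathstart (\<eta> +++ q2 +++ reversepath \<eta>') = pathstart q1"
      "pathfinish (\<eta> +++ q2 +++ reversepath \<eta>') = pathfinish q1"
    using \<eta> \<eta>' im q1(1) q2(1) by (auto simp: path_image_join)
  then have "homotopic_paths L q1 (\<eta> +++ q2 +++ reversepath \<eta>')"
    using sL im(1) q1(1) unfolding simply_connected_eq_homotopic_paths by simp
  then have "homotopic_paths A (exp \<circ> q1) (exp \<circ> (\<eta> +++ q2 +++ reversepath \<eta>'))"
    by (rule homotopic_paths_continuous_image) (auto simp: L_def intro!: continuous_intros)
  moreover have "exp \<circ> reversepath \<eta>' = reversepath (exp \<circ> \<eta>)"
    by (auto simp: fun_eq_iff reversepath_def \<eta>'_def exp_add expc)
  ultimately have h1: "homotopic_paths A (exp \<circ> q1) ((exp \<circ> \<eta>) +++ (exp \<circ> q2) +++ reversepath (exp \<circ> \<eta>))"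
    by (simp add: path_compose_join)
  have eq1: "homotopic_loops A g1 (exp \<circ> q1)" using g1 q1(3) by (intro homotopic_loops_eq) (auto simp: A_def)
  have eq2: "homotopic_loops A g2 (exp \<circ> q2)" using g2 q2(3) by (intro homotopic_loops_eq) (auto simp: A_def)
  note l1 = homotopic_loops_imp_loop[OF eq1] and l2 = homotopic_loops_imp_loop[OF eq2]
  have "homotopic_loops A ((exp \<circ> \<eta>) +++ (exp \<circ> q2) +++ reversepath (exp \<circ> \<eta>)) (exp \<circ> q2)"
  proof (rule homotopic_loops_conjugate)
    show "path (exp \<circ> \<eta>)" using \<eta>(1) by (intro path_continuous_image continuous_intros)
    show "path (exp \<circ> q2)" using q2(1) by (intro path_continuous_image continuous_intros)
    show "path_image (exp \<circ> \<eta>) \<subseteq> A" using \<eta>(2) by (auto simp: path_image_compose L_def)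
    show "path_image (exp \<circ> q2) \<subseteq> A" using im(2) by (auto simp: path_image_compose L_def)
    show "pathfinish (exp \<circ> \<eta>) = pathstart (exp \<circ> q2)" by (simp add: pathfinish_compose pathstart_compose \<eta>)
    show "pathfinish (exp \<circ> q2) = pathstart (exp \<circ> q2)" using l2 by simp
  qed
  moreover have "homotopic_loops A (exp \<circ> q1) ((exp \<circ> \<eta>) +++ (exp \<circ> q2) +++ reversepath (exp \<circ> \<eta>))"
    using h1 l1 \<eta> by (intro homotopic_paths_imp_homotopic_loops) (auto simp: pathfinish_compose pathstart_compose)
  ultimately show ?thesis
    using eq1 eq2 unfolding A_def by (meson homotopic_loops_trans homotopic_loops_sym)
qed

section \<open>Riemann maps and simple loops disjoint from their dilates\<close>

lemma riemann_map_fixing_zero: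
  assumes "open S" "simply_connected S" "0 \<in> S" "S \<noteq> UNIV"
  obtains \<phi> \<phi>' where "\<phi> holomorphic_on ball 0 1" "\<phi>' holomorphic_on S" "\<phi> 0 = (0::complex)"
    "inj_on \<phi> (ball 0 1)" "\<And>z. z \<in> ball 0 1 \<Longrightarrow> \<phi> z \<in> S \<and> \<phi>' (\<phi> z) = z"
    "\<And>z. z \<in> S \<Longrightarrow> \<phi>' z \<in> ball 0 1 \<and> \<phi> (\<phi>' z) = z"
proof -
  obtain f g where f: "f holomorphic_on S" and g: "g holomorphic_on ball 0 1"
    and fg: "\<forall>z \<in> S. f z \<in> ball 0 1 \<and> g(f z) = z" and gf: "\<forall>z \<in> ball 0 1. g z \<in> S \<and> f(g z) = z"
    using Riemann_mapping_theorem[of S] assms by auto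
  have "f 0 \<in> ball 0 1" using fg assms(3) by blast
  then obtain F G where F: "F (f 0) = 0" "F holomorphic_on ball 0 1" "F ` ball 0 1 \<subseteq> ball 0 1"
    and G: "G holomorphic_on ball 0 1" "G ` ball 0 1 \<subseteq> ball 0 1"
    and FG: "\<And>z. z \<in> ball 0 1 \<Longrightarrow> F (G z) = z" and GF: "\<And>z. z \<in> ball 0 1 \<Longrightarrow> G (F z) = z"
    using ball_biholomorphism_exists by metis
  have 1: "g (G z) \<in> S \<and> F (f (g (G z))) = z" if "z \<in> ball 0 1" for z
    using that gf G(2) FG by (metis image_subset_iff)
  have 2: "F (f z) \<in> ball 0 1 \<and> g (G (F (f z))) = z" if "z \<in> S" for z
    using that fg F(3) GF by (metis image_subset_iff)
  show ?thesis
  proof (rule that[of "g \<circ> G" "F \<circ> f"])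
    show "g \<circ> G holomorphic_on ball 0 1"
      using G g by (meson holomorphic_on_compose_gen)
    show "F \<circ> f holomorphic_on S"
      using F f fg by (intro holomorphic_on_compose_gen[of f S F "ball 0 1"]) auto
    show "(g \<circ> G) 0 = 0" using 2[OF assms(3)] F(1) by simp
    show "inj_on (g \<circ> G) (ball 0 1)" using 1 by (intro inj_on_inverseI[of _ "F \<circ> f"]) auto
  qed (use 1 2 in auto)
qed

text \<open>With \<open>\<psi> z = z * exp (h z)\<close>, multiplying \<open>h\<close> by a
  parameter from 0 to 1 is a homotopy from \<open>g\<close> to \<open>\<psi> \<circ> g\<close> that
  never meets 0.\<close>

lemma winding_number_injective_holomorphic:
  assumes hol: "\<psi> holomorphic_on ball 0 1" and inj: "inj_on \<psi> (ball 0 1)" and zero: "\<psi> 0 = 0"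
    and g: "path g" "pathfinish g = pathstart g" "path_image g \<subseteq> ball 0 1 - {0}"
  shows "winding_number (\<psi> \<circ> g) 0 = winding_number g 0"
proof -
  obtain h where h: "h holomorphic_on ball 0 1" "\<And>z. z \<in> ball 0 1 \<Longrightarrow> \<psi> z = z * exp (h z)"
    using injective_holomorphic_factor_exp[OF hol inj zero] by blast
  have gim: "g s \<in> ball 0 1" "g s \<noteq> 0" if "s \<in> {0..1}" for s
    using g(3) imageI[OF that, of g] by (auto simp flip: path_image_def)
  have contg: "continuous_on {0..1} g" using g(1) by (simp add: path_def)
  define k where "k = (\<lambda>y::real \<times> real. g (snd y) * exp (of_real (fst y) * h (g (snd y))))"
  have "continuous_on ({0..1} \<times> {0..1}) k"
    unfolding k_def
    by (intro continuous_intros continuous_on_compose2[OF contg]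
        continuous_on_compose2[OF holomorphic_on_imp_continuous_on[OF h(1)]]) (use gim in auto)
  then have "homotopic_loops (- {0}) g (\<psi> \<circ> g)"
    unfolding homotopic_loops using gim h(2) g(2)
    by (intro exI[of _ k]) (auto simp: k_def pathstart_def pathfinish_def)
  then show ?thesis using winding_number_homotopic_loops by metis
qed

text \<open>\<open>J\<close> and its image under division by \<open>r\<close> are disjoint, so the
  connected image lies wholly inside or wholly outside \<open>J\<close>. Outside is impossible: the
  closure of \<open>U\<close> would be contained in its own shrunken copy, against the existence of
  a point of largest norm.\<close>

lemma nested_dilates:
  fixes g :: "real \<Rightarrow> complex"
  assumes g: "simple_path g" "pathfinish g = pathstart g" and zero: "0 \<in> inside (path_image g)"
    and r: "r > 1" and disj: "\<And>s t. s \<in> {0..1} \<Longrightarrow> t \<in> {0..1} \<Longrightarrow> g s \<noteq> of_real r * g t"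
    and z: "z \<in> inside (path_image g) \<union> path_image g"
  shows "z / of_real r \<in> inside (path_image g)"
proof -
  define J where "J = path_image g"
  define U where "U = inside J"
  define O' where "O' = outside J"
  define m where "m = (\<lambda>z::complex. z / of_real r)"
  have jd: "open U" "connected U" "bounded U" "open O'" "connected O'" "\<not> bounded O'" "U \<inter> O' = {}"
    "U \<union> O' = - J" "frontier U = J" "frontier O' = J"
    using Jordan_inside_outside[OF g] unfolding U_def O'_def J_def by auto
  have 0: "0 \<in> U" using zero by (simp add: U_def J_def)
  have contm: "continuous_on S m" for S unfolding m_def by (intro continuous_intros) (use r in auto)
  have m0: "m 0 = 0" by (simp add: m_def)
  have compJ: "compact J" using g unfolding J_def by (simp add: compact_path_image simple_path_imp_path)
  have conJ: "connected J" using g unfolding J_def by (simp add: connected_path_image simple_path_imp_path)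
  have clU: "closure U = U \<union> J" using jd(1,9) by (metis closure_Un_frontier)
  have disjm: "J \<inter> m ` J = {}"
  proof -
    have False if "a \<in> J" "b \<in> J" "a = m b" for a b
    proof -
      obtain s t where "s \<in> {0..1}" "t \<in> {0..1}" "a = g s" "b = g t" using \<open>a \<in> J\<close> \<open>b \<in> J\<close> unfolding J_def path_image_def by blast
      moreover have "b = of_real r * a" using that(3) r by (simp add: m_def)
      ultimately show False using disj by metis
    qed
    then show ?thesis by blast
  qed
  have mU: "open (m ` U)"
  proof -
    have "m ` U = (*\<^sub>R) (1/r) ` U" unfolding m_def by (auto simp: scaleR_conv_of_real image_def field_simps)
    then show ?thesis using jd(1) r by (simp add: open_scaling)
  qed
  have frm: "frontier (m ` U) \<subseteq> m ` J"
  proof -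
    have "closed (m ` (U \<union> J))"
      using jd(3) clU by (intro compact_imp_closed compact_continuous_image contm) (metis compact_closure)
    then have "closure (m ` U) \<subseteq> m ` (U \<union> J)" by (intro closure_minimal) auto
    then show ?thesis using mU by (auto simp: frontier_def interior_open)
  qed
  have "connected (m ` J)" by (intro connected_continuous_image contm conJ)
  then have "m ` J \<subseteq> U \<or> m ` J \<subseteq> O'"
    using connectedD[of "m ` J" U O'] jd disjm by blast
  moreover have "\<not> m ` J \<subseteq> O'"
  proof
    assume mO: "m ` J \<subseteq> O'"
    have "closure U \<subseteq> m ` U"
    proof (rule ccontr)
      assume "\<not> closure U \<subseteq> m ` U"
      moreover have "0 \<in> closure U \<inter> m ` U" using 0 m0 clU by force
      ultimately have "closure U \<inter> frontier (m ` U) \<noteq> {}"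
        using connected_Int_frontier[of "closure U" "m ` U"] jd(2) connected_imp_connected_closure by blast
      then show False using frm mO clU jd(7) disjm by blast
    qed
    moreover obtain w where w: "w \<in> closure U" "\<And>y. y \<in> closure U \<Longrightarrow> norm y \<le> norm w"
      using continuous_attains_sup[of "closure U" norm] jd(3) 0 clU
      by (metis compact_closure continuous_on_norm_id empty_iff UnI1)
    ultimately obtain y where y: "y \<in> U" "w = m y" by blast
    then have "norm y \<le> norm y / r" using w(2)[of y] clU r by (simp add: m_def norm_divide)
    moreover have "norm y / r < norm y" if "y \<noteq> 0" using r that by (simp add: field_simps)
    ultimately have "y = 0" by fastforce
    then have "U \<subseteq> {0}" using w(2) y clU by (auto simp: m_def)
    then show False using jd(1) 0 not_open_singleton by (metis empty_iff subset_singletonD)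
  qed
  ultimately have mJ: "m ` J \<subseteq> U" by blast
  \<comment> \<open>The outside is connected and unbounded; if it met the bounded shrunken copy of
    \<open>U\<close>, it would meet the frontier of that copy, which is already known to lie in
    \<open>U\<close>.\<close>
  have "O' \<inter> m ` U = {}"
  proof (rule ccontr)
    assume ne: "O' \<inter> m ` U \<noteq> {}"
    have "bounded (m ` (U \<union> J))"
      using jd(3) clU by (intro compact_imp_bounded compact_continuous_image contm) (metis compact_closure)
    then have "\<not> O' \<subseteq> m ` U" using jd(6) bounded_subset by (metis image_mono sup_ge1)
    then have "O' \<inter> frontier (m ` U) \<noteq> {}" using connected_Int_frontier[OF jd(5) ne] by blast
    then show False using frm mJ jd(7) by blast
  qed
  then have "closure O' \<inter> m ` U = {}" using mU by (metis Int_commute open_Int_closure_eq_empty)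
  moreover have "J \<subseteq> closure O'" using jd(10) by (auto simp: frontier_def)
  ultimately have "m ` U \<subseteq> U" using \<open>O' \<inter> m ` U = {}\<close> jd(8) by blast
  then show ?thesis using mJ z unfolding m_def J_def U_def by blast
qed

text \<open>For \<open>r = exp (2 * pi)\<close> this is the infinite cyclic cover of the punctured
  torus by \<open>annulus_cover\<close>: the powers of \<open>r\<close> lie over the
  puncture.\<close>

definition punctures_complement :: "real \<Rightarrow> complex set" where
  "punctures_complement r = {z. z \<noteq> 0 \<and> (\<forall>n::int. z \<noteq> of_real (r powi n))}"

lemma punctures_complementI:
  assumes "z \<noteq> 0" "\<And>k::nat. z \<noteq> of_real r ^ k" "\<And>k::nat. z * of_real r ^ k \<noteq> 1" "r > 0"
  shows "z \<in> punctures_complement r"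
proof -
  have "z \<noteq> of_real (r powi n)" for n :: int
  proof (cases n rule: int_cases2)
    case (nonneg k)
    then show ?thesis using assms(2)[of k] by (simp add: power_int_def)
  next
    case (nonpos k)
    then show ?thesis using assms(3)[of k] assms(4) by (auto simp: power_int_minus)
  qed
  then show ?thesis using assms(1) by (simp add: punctures_complement_def)
qed

lemma univalent_iterated_contraction:
  fixes \<phi> :: "complex \<Rightarrow> complex"
  assumes step: "\<And>z. z \<in> ball 0 1 \<Longrightarrow> \<exists>w. \<phi> z / of_real r = \<phi> w \<and> norm w \<le> T * norm z"
    and T: "0 \<le> T" "T \<le> 1" and z: "z \<in> ball 0 1"
  shows "\<exists>w. \<phi> z / of_real r ^ k = \<phi> w \<and> norm w \<le> norm z \<and> (k > 0 \<longrightarrow> norm w \<le> T * norm z)"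
proof (induction k)
  case 0
  then show ?case by (intro exI[of _ z]) auto
next
  case (Suc k)
  then obtain w where w: "\<phi> z / of_real r ^ k = \<phi> w" "norm w \<le> norm z" by blast
  obtain w' where w': "\<phi> w / of_real r = \<phi> w'" "norm w' \<le> T * norm w" using step[of w] w z by auto
  have "norm w' \<le> T * norm z" using w' w T by (meson mult_left_mono order_trans)
  moreover have "T * norm z \<le> norm z" using T by (simp add: mult_left_le_one_le)
  moreover have "\<phi> z / of_real r ^ Suc k = \<phi> w'" using w'(1) unfolding w(1)[symmetric] by (simp add: mult.commute)
  ultimately show ?case by (intro exI[of _ w']) auto
qed

text \<open>A quotient \<open>r ^ k\<close> would mean \<open>\<phi> z1 / r ^ k = \<phi> z2\<close>.
  For \<open>k > 0\<close> the left side is \<open>\<phi> w\<close> with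
  \<open>norm w \<le> T * norm z1 < norm z2\<close>, which injectivity excludes;
  \<open>k = 0\<close> fails since the norms differ, and inverse powers would put \<open>z1\<close>
  no farther out than \<open>z2\<close>.\<close>

lemma univalent_ratio_avoids_powers:
  fixes \<phi> :: "complex \<Rightarrow> complex"
  assumes step: "\<And>z. z \<in> ball 0 1 \<Longrightarrow> \<exists>w. \<phi> z / of_real r = \<phi> w \<and> norm w \<le> T * norm z"
    and T: "0 \<le> T" "T \<le> 1" and r: "r > 1"
    and inj: "inj_on \<phi> (ball 0 1)" and zero: "\<phi> 0 = 0"
    and z: "z1 \<in> ball 0 1" "T * norm z1 < norm z2" "norm z2 < norm z1" 
  shows "\<phi> z1 / \<phi> z2 \<in> punctures_complement r"
proof (rule punctures_complementI)
  have z2: "z2 \<in> ball 0 1" "z2 \<noteq> 0" "z1 \<noteq> 0" using z T by (auto, smt (verit) mult_nonneg_nonneg norm_ge_zero)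
  have nz: "\<phi> z1 \<noteq> 0" "\<phi> z2 \<noteq> 0"
    using inj_onD[OF inj, of z1 0] inj_onD[OF inj, of z2 0] z z2 zero by auto
  then show "\<phi> z1 / \<phi> z2 \<noteq> 0" by simp
  note eqD = inj_onD[OF inj]
  show "\<phi> z1 / \<phi> z2 \<noteq> of_real r ^ k" for k
  proof
    assume "\<phi> z1 / \<phi> z2 = of_real r ^ k"
    then have eq: "\<phi> z1 / of_real r ^ k = \<phi> z2" using nz r by (simp add: field_simps)
    obtain w where w: "\<phi> z1 / of_real r ^ k = \<phi> w" "norm w \<le> norm z1" "k > 0 \<longrightarrow> norm w \<le> T * norm z1"
      using univalent_iterated_contraction[OF step T z(1)] by blast
    have "w = z2" using eqD[of w z2] w eq z z2 by auto
    moreover have "k = 0 \<Longrightarrow> z1 = z2" using eqD[of z1 z2] eq z z2 by auto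
    ultimately show False using w(3) z by (cases "k = 0") auto
  qed
  show "\<phi> z1 / \<phi> z2 * of_real r ^ k \<noteq> 1" for k
  proof
    assume "\<phi> z1 / \<phi> z2 * of_real r ^ k = 1"
    then have eq: "\<phi> z2 / of_real r ^ k = \<phi> z1" using nz r by (simp add: field_simps)
    obtain w where w: "\<phi> z2 / of_real r ^ k = \<phi> w" "norm w \<le> norm z2"
      using univalent_iterated_contraction[OF step T z2(1)] by blast
    have "w = z1" using eqD[of w z1] w eq z z2 by auto
    then show False using w z by auto
  qed
qed (use r in auto)

text \<open>The map \<open>\<phi>\<close> will be the Riemann map of the interior of a simple loop which is disjoint from its
  multiples by the powers of \<open>r\<close>. By the Schwarz lemma division by \<open>r\<close> contracts the disc, so the
  quotients of \<open>\<phi>\<close> on the circle of radius \<open>u b\<close> by \<open>\<phi> (u a)\<close> avoid the punctures, and letting \<open>u\<close>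
  tend to 0 deforms the image of a circle into a round circle.\<close>

lemma shrink_univalent_image_of_circle:
  fixes \<phi> :: "complex \<Rightarrow> complex"
  assumes hol: "\<phi> holomorphic_on ball 0 1"
    and step: "\<And>z. z \<in> ball 0 1 \<Longrightarrow> \<exists>w. \<phi> z / of_real r = \<phi> w \<and> norm w \<le> T * norm z"
    and T: "0 < T" "T < 1" "1 / T < r" and r: "r > 1"
    and inj: "inj_on \<phi> (ball 0 1)" and zero: "\<phi> 0 = 0"
    and a: "T < a" "a < b" "b < 1" and e: "e \<in> {1, -1}"
  shows "homotopic_loops (punctures_complement r) (\<lambda>s. of_real (b / a) * cis (e * (2 * pi * s)))
      (\<lambda>s. \<phi> (of_real b * cis (e * (2 * pi * s))) / \<phi> (of_real a))"
proof -
  obtain h where h: "h holomorphic_on ball 0 1" "\<And>z. z \<in> ball 0 1 \<Longrightarrow> \<phi> z = z * exp (h z)"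
    using injective_holomorphic_factor_exp[OF hol inj zero] by blast
  have conth: "continuous_on (ball 0 1) h" using h(1) holomorphic_on_imp_continuous_on by blast
  define c where "c = (\<lambda>s::real. of_real b * cis (e * (2 * pi * s)))"
  \<comment> \<open>For \<open>u > 0\<close> this is the quotient of \<open>\<phi>\<close> at
    \<open>u * c s\<close> by \<open>\<phi>\<close> at \<open>u * a\<close>; writing it through the
    logarithm \<open>h\<close> makes it continuous up to \<open>u = 0\<close>, where it is the round
    circle of radius \<open>b / a\<close>.\<close>
  define k where "k = (\<lambda>y::real \<times> real. of_real (b / a) * cis (e * (2 * pi * snd y)) *
      exp (h (of_real (fst y) * c (snd y)) - h (of_real (fst y * a))))"
  have pos: "0 < a" "0 < b" using T a by auto
  have inb: "of_real u * c s \<in> ball 0 1" "of_real (u * a) \<in> ball (0::complex) 1" if "u \<in> {0..1}" for u s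
  proof -
    have "u * b \<le> 1 * b" "u * a \<le> 1 * a" using that pos by (intro mult_right_mono; simp)+
    then have "u * b < 1" "u * a < 1" using a by linarith+
    then show "of_real u * c s \<in> ball 0 1" "of_real (u * a) \<in> ball (0::complex) 1"
      using that pos by (simp_all add: c_def norm_mult del: of_real_mult)
  qed
  have ratio: "k (u, s) = \<phi> (of_real u * c s) / \<phi> (of_real (u * a))" if "u \<in> {0<..1}" for u s
    using h(2)[OF inb(1), of u s] h(2)[OF inb(2), of u] that pos
    by (simp add: k_def c_def exp_diff field_simps)
  have e2: "e * (2 * pi) = 2 * pi \<or> e * (2 * pi) = - (2 * pi)" using e by auto
  have cl: "cis (e * (2 * pi * 1)) = 1" using e by (auto simp: cis_cnj[symmetric])
  have "continuous_on ({0..1} \<times> {0..1}) k" unfolding k_def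
    by (intro continuous_intros continuous_on_compose2[OF conth])
      (use inb in \<open>auto simp: c_def intro!: continuous_intros\<close>)
  moreover have "k (u, s) \<in> punctures_complement r" if us: "u \<in> {0..1}" "s \<in> {0..1}" for u s
  proof (cases "u = 0")
    case True
    \<comment> \<open>The limiting circle lies strictly between the consecutive punctures 1 and
      \<open>r\<close>, because \<open>b < 1\<close> and \<open>a > T > 1 / r\<close>.\<close>
    have ba: "1 < b / a" "b / a < r"
    proof -
      show "1 < b / a" using a pos by (simp add: field_simps)
      have "b / a \<le> 1 / a" using a pos by (intro divide_right_mono) auto
      also have "1 / a < 1 / T" using T a by (intro divide_strict_left_mono) auto
      finally show "b / a < r" using T by simp
    qed
    have n: "norm (k (u, s)) = b / a" using True pos by (simp add: k_def norm_mult norm_divide)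
    have "k (u, s) \<noteq> of_real r ^ j" for j
    proof
      assume "k (u, s) = of_real r ^ j"
      then have "b / a = r ^ j" using n r by (simp add: norm_power)
      moreover have "j = 0 \<or> r ^ j \<ge> r" using r by (cases j) auto
      ultimately show False using ba by auto
    qed
    moreover have "k (u, s) * of_real r ^ j \<noteq> 1" for j
    proof
      assume "k (u, s) * of_real r ^ j = 1"
      then have "norm (k (u, s)) * r ^ j = 1" using r by (metis norm_mult norm_of_real norm_one norm_power abs_of_pos less_trans zero_less_one)
      moreover have "r ^ j \<ge> 1" using r by simp
      moreover have "(b / a) * 1 \<le> (b / a) * r ^ j" using r pos by (intro mult_left_mono) auto
      ultimately have "(b / a) * 1 \<le> 1" using n by metis
      then show False using ba by linarith
    qed
    ultimately show ?thesis using n pos r by (intro punctures_complementI) auto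
  next
    case False
    then have u: "u \<in> {0<..1}" using us by auto
    have "T * (u * b) < u * a"
    proof -
      have "T * b < T * 1" using T a by (intro mult_strict_left_mono) auto
      then have "T * b < a" using a by simp
      then have "u * (T * b) < u * a" using u by (intro mult_strict_left_mono) auto
      then show ?thesis by (simp add: mult_ac)
    qed
    then show ?thesis unfolding ratio[OF u]
      using univalent_ratio_avoids_powers[OF step _ _ r inj zero inb(1)[OF us(1)], of s "of_real (u * a)"] T a u pos
      by (simp add: c_def norm_mult)
  qed
  ultimately show ?thesis unfolding homotopic_loops
    using ratio[of 1] cl by (intro exI[of _ k]) (auto simp: k_def c_def pathstart_def pathfinish_def)
qed

text \<open>Division by \<open>r\<close> maps the closed inside of \<open>g\<close> into its inside
  \<open>U\<close>, so \<open>U - C\<close> is the region between consecutive copies of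
  \<open>g\<close>; it contains a puncture \<open>r powi n\<close>. The divisor is moved through
  \<open>U - C\<close> from this puncture to \<open>p\<close>, the image of \<open>a\<close> under
  \<open>\<phi>\<close>. Then \<open>annulus_homotopic_loops\<close> replaces \<open>g\<close> by
  the image of a circle under \<open>\<phi>\<close>, and
  \<open>shrink_univalent_image_of_circle\<close> makes that image round.\<close>

lemma simple_loop_around_annulus:
  fixes g :: "real \<Rightarrow> complex"
  assumes g: "simple_path g" "pathfinish g = pathstart g" and zero: "0 \<in> inside (path_image g)"
    and r: "r > 1"
    and disj: "\<And>s t (n::int). s \<in> {0..1} \<Longrightarrow> t \<in> {0..1} \<Longrightarrow> n \<noteq> 0 \<Longrightarrow> g s \<noteq> of_real (r powi n) * g t"
    and avoid: "path_image g \<subseteq> punctures_complement r"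
  obtains n :: int and R e where "e \<in> {1, -1}" "1 < R" "R < r"
    "homotopic_loops (punctures_complement r) (\<lambda>s. g s / of_real (r powi n)) (\<lambda>s. of_real R * cis (e * (2 * pi * s)))"
proof -
  define J where "J = path_image g"
  define U where "U = inside J"
  define m where "m = (\<lambda>z::complex. z / of_real r)"
  have jd: "open U" "connected U" "bounded U" "connected (outside J)" "U \<inter> outside J = {}"
    "U \<union> outside J = - J" "frontier U = J"
    using Jordan_inside_outside[OF g] unfolding U_def J_def by auto
  have pg: "path g" using g simple_path_imp_path by blast
  have 0: "0 \<in> U" using zero by (simp add: U_def J_def)
  have clU: "closure U = U \<union> J" using jd(1,7) by (metis closure_Un_frontier)
  have UJ: "U \<inter> J = {}" using jd by blast
  have contm: "continuous_on S m" for S unfolding m_def by (intro continuous_intros) (use r in auto)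
  have mcl: "m z \<in> U" if "z \<in> U \<union> J" for z
  proof -
    have "g s \<noteq> of_real r * g t" if "s \<in> {0..1}" "t \<in> {0..1}" for s t using disj[of s t 1] that by simp
    then show ?thesis using nested_dilates[OF g zero r] that unfolding m_def U_def J_def by blast
  qed
  have comp: "compact (U \<union> J)" using clU jd(3) by (metis compact_closure)
  have scU: "simply_connected U" unfolding U_def J_def by (rule simply_connected_inside_simple_path[OF g(1)])
  obtain \<phi> \<phi>' where \<phi>: "\<phi> holomorphic_on ball 0 1" "\<phi>' holomorphic_on U" "\<phi> 0 = 0"
    "inj_on \<phi> (ball 0 1)" "\<And>z. z \<in> ball 0 1 \<Longrightarrow> \<phi> z \<in> U \<and> \<phi>' (\<phi> z) = z"
    "\<And>z. z \<in> U \<Longrightarrow> \<phi>' z \<in> ball 0 1 \<and> \<phi> (\<phi>' z) = z"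
    using riemann_map_fixing_zero[OF jd(1) scU 0] jd(3) by (metis not_bounded_UNIV)
  define C where "C = m ` (U \<union> J)"
  have C: "compact C" "C \<subseteq> U" using comp mcl by (auto simp: C_def intro!: compact_continuous_image contm)
  have "compact (\<phi>' ` C)"
    using C holomorphic_on_imp_continuous_on[OF \<phi>(2)] by (intro compact_continuous_image continuous_on_subset[OF _ C(2)])
  moreover have "\<phi>' ` C \<noteq> {}" using 0 by (auto simp: C_def)
  ultimately obtain y0 where y0: "y0 \<in> \<phi>' ` C" "\<And>y. y \<in> \<phi>' ` C \<Longrightarrow> norm y \<le> norm y0"
    using continuous_attains_sup[of "\<phi>' ` C" norm] continuous_on_norm_id by metis
  have y01: "norm y0 < 1" using y0(1) C(2) \<phi>(6) by auto
  \<comment> \<open>\<open>T\<close> exceeds the norms of the disc coordinates of \<open>C\<close>,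
    which gives the contraction factor, and it exceeds \<open>1 / r\<close>, which keeps the final
    radius \<open>b / a\<close> below \<open>r\<close>.\<close>
  obtain T where T: "norm y0 < T" "1 / r < T" "T < 1"
    using dense[of "max (norm y0) (1/r)" 1] y01 r by auto
  obtain a where a: "T < a" "a < 1" using dense T by blast
  obtain b where b: "a < b" "b < 1" using dense a by blast
  have Tpos: "0 < T" using T(1) norm_ge_zero by (rule order.strict_trans1[rotated])
  have Tr: "1 / T < r" using T(2) Tpos r by (simp add: field_simps)
  have small: "norm (\<phi>' (m z)) < T" if "z \<in> U \<union> J" for z
    using y0(2)[of "\<phi>' (m z)"] that T(1) unfolding C_def by fastforce
  define \<psi> where "\<psi> = (\<lambda>z. \<phi>' (m (\<phi> z)) / of_real T)"
  have \<psi>hol: "\<psi> holomorphic_on ball 0 1"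
  proof -
    have "(\<lambda>z. m (\<phi> z)) holomorphic_on ball 0 1" unfolding m_def using r by (intro holomorphic_intros \<phi>(1)) auto
    moreover have "(\<lambda>z. m (\<phi> z)) ` ball 0 1 \<subseteq> U" using \<phi>(5) mcl by auto
    ultimately have "(\<phi>' \<circ> (\<lambda>z. m (\<phi> z))) holomorphic_on ball 0 1" using \<phi>(2) by (metis holomorphic_on_compose_gen)
    then show ?thesis unfolding \<psi>_def using Tpos by (auto intro!: holomorphic_intros simp: o_def)
  qed
  have \<psi>0: "\<psi> 0 = 0" using \<phi>(3) \<phi>(5)[of 0] by (simp add: \<psi>_def m_def)
  have \<psi>b: "norm (\<psi> z) < 1" if "norm z < 1" for z
    using small[of "\<phi> z"] \<phi>(5)[of z] that Tpos by (simp add: \<psi>_def norm_divide)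
  have \<phi>\<psi>: "\<phi> (of_real T * \<psi> z) = m (\<phi> z)" if "z \<in> ball 0 1" for z
    using \<phi>(6)[of "m (\<phi> z)"] mcl[of "\<phi> z"] \<phi>(5)[OF that] Tpos by (simp add: \<psi>_def)
  have \<psi>inj: "inj_on \<psi> (ball 0 1)"
  proof (rule inj_onI)
    fix x y assume xy: "x \<in> ball 0 1" "y \<in> ball 0 1" "\<psi> x = \<psi> y"
    then have "m (\<phi> x) = m (\<phi> y)" using \<phi>\<psi> by metis
    then show "x = y" using xy inj_onD[OF \<phi>(4)] r by (simp add: m_def)
  qed
  have step: "\<exists>w. \<phi> z / of_real r = \<phi> w \<and> norm w \<le> T * norm z" if "z \<in> ball 0 1" for z
  proof -
    have "norm (\<psi> z) \<le> norm z" using Schwarz_Lemma(1)[OF \<psi>hol \<psi>0 \<psi>b] that by simp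
    then show ?thesis using \<phi>\<psi>[OF that] Tpos
      by (intro exI[of _ "of_real T * \<psi> z"]) (simp add: m_def norm_mult)
  qed
  define p where "p = \<phi> (of_real a)"
  have ain: "complex_of_real a \<in> ball 0 1" using a Tpos by simp
  have bin: "of_real b * cis x \<in> ball 0 1" for x using a b Tpos by (simp add: norm_mult)
  have p: "p \<in> U" "p \<noteq> 0" "p \<notin> C"
  proof -
    show "p \<in> U" using \<phi>(5)[OF ain] by (simp add: p_def)
    show "p \<noteq> 0" using inj_onD[OF \<phi>(4), of "of_real a" 0] ain \<phi>(3) a Tpos by (auto simp: p_def)
    show "p \<notin> C"
    proof
      assume "p \<in> C"
      then have "norm (\<phi>' p) < T" using y0(2) T(1) by (meson image_eqI order.strict_trans1)
      then show False using \<phi>(5)[OF ain] a Tpos by (simp add: p_def)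
    qed
  qed
  have downU: "z / of_real r ^ k \<in> U" if "z \<in> U" for z k
  proof (induction k)
    case 0
    then show ?case using that by simp
  next
    case (Suc k)
    then show ?case using mcl[of "z / of_real r ^ k"] by (simp add: m_def field_simps)
  qed
  have downC: "z / of_real r ^ Suc k \<in> C" if "z \<in> U \<union> J" for z k
  proof (cases k)
    case 0
    then show ?thesis using that by (auto simp: C_def m_def)
  next
    case (Suc j)
    have "m z / of_real r ^ j \<in> U" using downU mcl that by blast
    moreover have "z / of_real r ^ Suc k = m (m z / of_real r ^ j)" using Suc by (simp add: m_def field_simps)
    ultimately show ?thesis by (auto simp: C_def)
  qed
  have gJ: "g s \<in> J" if "s \<in> {0..1}" for s using that by (auto simp: J_def path_image_def)
  have avoidU: "g s / y \<in> punctures_complement r" if s: "s \<in> {0..1}" and y: "y \<in> U - C" "y \<noteq> 0" for s y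
  proof (rule punctures_complementI)
    have gs: "g s \<noteq> 0" using avoid gJ[OF s] by (auto simp: J_def punctures_complement_def)
    then show "g s / y \<noteq> 0" using y by simp
    show "g s / y \<noteq> of_real r ^ k" for k
    proof
      assume "g s / y = of_real r ^ k"
      then have eq: "g s / of_real r ^ k = y" using y r by (simp add: field_simps)
      then show False using downC[of "g s" "k - 1"] gJ[OF s] y UJ by (cases k) auto
    qed
    show "g s / y * of_real r ^ k \<noteq> 1" for k
    proof
      assume "g s / y * of_real r ^ k = 1"
      then have "y / of_real r ^ k = g s" using y r by (simp add: field_simps)
      then show False using downU[of y k] gJ[OF s] y UJ by auto
    qed
  qed (use r in auto)
  \<comment> \<open>The largest power of \<open>r\<close> lying in \<open>U\<close>: its
    \<open>r\<close>-fold multiple is not in \<open>U\<close>, nor on \<open>J\<close> because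
    \<open>g\<close> avoids the punctures, so the power itself is not in \<open>C\<close>.\<close>
  obtain n :: int where n: "of_real (r powi n) \<in> U - C"
  proof -
    obtain B where B: "\<And>z. z \<in> U \<union> J \<Longrightarrow> norm z \<le> B" using compact_imp_bounded[OF comp] unfolding bounded_iff by metis
    obtain N where N: "B < r ^ N" using real_arch_pow[OF r] by blast
    have up: "(of_real (r powi (int N - int k)) :: complex) \<in> U" if "k = M" and "of_real (r ^ N) / of_real r ^ M \<in> U" for k M
      using that r by (simp add: power_int_diff)
    obtain e where e: "e > 0" "ball 0 e \<subseteq> U" using jd(1) 0 by (meson openE)
    obtain M where M: "r ^ N / e < r ^ M" using real_arch_pow[OF r] by blast
    have "r ^ N / r ^ M < e" using M e r by (simp add: field_simps)
    then have "of_real (r powi (int N - int M)) \<in> U" using e r by (auto simp: power_int_diff norm_divide norm_power intro!: subsetD[OF e(2)])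
    then have ex: "\<exists>k. of_real (r powi (int N - int k)) \<in> U" by blast
    define k where "k = (LEAST k. of_real (r powi (int N - int k)) \<in> U)"
    have k: "of_real (r powi (int N - int k)) \<in> U" unfolding k_def using ex by (rule LeastI_ex)
    have "k \<noteq> 0"
    proof
      assume "k = 0"
      then have "norm (complex_of_real (r powi int N)) \<le> B" using k by (intro B) auto
      then show False using N r by (simp add: norm_power)
    qed
    then obtain j where j: "k = Suc j" using not0_implies_Suc by blast
    have nU: "of_real (r powi (int N - int j)) \<notin> U" using not_less_Least[of j "\<lambda>k. of_real (r powi (int N - int k)) \<in> U"] j by (simp add: k_def)
    have "of_real (r powi (int N - int k)) \<notin> C"
    proof
      assume "of_real (r powi (int N - int k)) \<in> C"
      then obtain z where z: "z \<in> U \<union> J" "of_real (r powi (int N - int k)) = z / of_real r" by (auto simp: C_def m_def)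
      have "z = of_real (r powi (int N - int k) * r)" using z(2) r by (simp add: field_simps)
      also have "r powi (int N - int k) * r = r powi (int N - int j)" using power_int_add_1[of r "int N - int k"] r j by simp
      finally have zj: "z = of_real (r powi (int N - int j))" .
      then have "z \<in> J" using z(1) nU by blast
      then show False using avoid zj by (auto simp: J_def punctures_complement_def)
    qed
    then show ?thesis using k that by blast
  qed
  have "connected (- (C \<union> - U))"
  proof (rule Janiszewski_connected)
    have "- C = (\<lambda>z. z / of_real r) ` outside J"
    proof -
      have "bij m" unfolding m_def using r by (intro bij_betwI[of _ _ _ "\<lambda>z. z * of_real r"]) auto
      then have "- C = m ` (- (U \<union> J))" unfolding C_def by (rule bij_image_Compl_eq[symmetric])
      also have "- (U \<union> J) = outside J" using jd by blast
      finally show ?thesis by (simp add: m_def)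
    qed
    then show "connected (- C)" using connected_continuous_image[OF contm jd(4)] by (simp add: m_def)
    have "C \<inter> - U = {}" using C by blast
    then show "connected (C \<inter> - U)" by simp
  qed (use C jd in auto)
  moreover have "- (C \<union> - U) = U - C" by blast
  ultimately have "path_connected (U - C)" 
    using jd(1) C(1) by (intro connected_open_path_connected) (auto simp: open_Diff compact_imp_closed)
  then obtain \<eta> where \<eta>: "path \<eta>" "path_image \<eta> \<subseteq> U - C" "pathstart \<eta> = of_real (r powi n)" "pathfinish \<eta> = p"
    using n p unfolding path_connected_def by blast
  have \<eta>in: "\<eta> u \<in> U - C" "\<eta> u \<noteq> 0" if "u \<in> {0..1}" for u
  proof -
    have "0 \<in> C" using 0 by (force simp: C_def m_def)
    moreover show "\<eta> u \<in> U - C" using \<eta>(2) imageI[OF that, of \<eta>] by (auto simp flip: path_image_def)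
    ultimately show "\<eta> u \<noteq> 0" by auto
  qed
  have cg: "continuous_on {0..1} g" and c\<eta>: "continuous_on {0..1} \<eta>" using pg \<eta>(1) by (simp_all add: path_def)
  \<comment> \<open>The divisor moves along \<open>\<eta>\<close> inside \<open>U - C\<close>. No
    quotient becomes a power of \<open>r\<close>, since dividing a point of \<open>J\<close> by a
    positive power of \<open>r\<close> lands in \<open>C\<close>, while dividing a point of
    \<open>U\<close> by a power stays in \<open>U\<close>, off \<open>J\<close>.\<close>
  have h1: "homotopic_loops (punctures_complement r) (\<lambda>s. g s / of_real (r powi n)) (\<lambda>s. g s / p)"
    unfolding homotopic_loops
  proof (intro exI[of _ "\<lambda>y. g (snd y) / \<eta> (fst y)"] conjI)
    show "continuous_on ({0..1} \<times> {0..1}) (\<lambda>y. g (snd y) / \<eta> (fst y))"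
      using \<eta>in by (intro continuous_intros continuous_on_compose2[OF cg] continuous_on_compose2[OF c\<eta>]) auto
    show "(\<lambda>y. g (snd y) / \<eta> (fst y)) \<in> {0..1} \<times> {0..1} \<rightarrow> punctures_complement r"
      using avoidU \<eta>in by auto
  qed (use \<eta>(3,4) g(2) in \<open>auto simp: pathstart_def pathfinish_def\<close>)
  define P where "P = (\<lambda>z. \<phi>' (m z) / of_real T)"
  define Q where "Q = (\<lambda>y. of_real r * \<phi> (of_real T * y))"
  have Tin: "of_real T * y \<in> ball 0 1" if "y \<in> ball 0 1" for y :: complex
  proof -
    have "T * norm y \<le> 1 * norm y" using T(3) by (intro mult_right_mono) auto
    then have "T * norm y < 1" using that by simp
    then show ?thesis using Tpos by (simp add: norm_mult)
  qed
  have QP: "Q (P z) = z" "P z \<in> ball 0 1" if "z \<in> U \<union> J" for z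
    using \<phi>(6)[OF mcl[OF that]] small[OF that] Tpos r by (auto simp: P_def Q_def m_def norm_divide)
  have contP: "continuous_on (U \<union> J) P" unfolding P_def
    by (intro continuous_intros continuous_on_compose2[OF holomorphic_on_imp_continuous_on[OF \<phi>(2)] contm]) (use mcl Tpos in auto)
  have Qhol: "Q holomorphic_on ball 0 1"
  proof -
    have "\<phi> \<circ> (\<lambda>y. of_real T * y) holomorphic_on ball 0 1" 
      using Tin by (intro holomorphic_on_compose_gen[OF _ \<phi>(1)] holomorphic_intros) auto
    then show ?thesis unfolding Q_def by (auto intro!: holomorphic_intros simp: o_def)
  qed
  have Qinj: "inj_on Q (ball 0 1)"
  proof (rule inj_onI)
    fix x y assume xy: "x \<in> ball 0 1" "y \<in> ball 0 1" "Q x = Q y"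
    then have "of_real T * x = of_real T * y" using Tin inj_onD[OF \<phi>(4), of "of_real T * x" "of_real T * y"] r by (simp add: Q_def)
    then show "x = y" using Tpos by simp
  qed
  have Q0: "Q 0 = 0" using \<phi>(3) by (simp add: Q_def)
  have P\<psi>: "P (\<phi> z) = \<psi> z" for z by (simp add: P_def \<psi>_def)
  define A where "A = ball 0 1 - \<psi> ` cball 0 a"
  have Pg: "path (P \<circ> g)" "pathfinish (P \<circ> g) = pathstart (P \<circ> g)" "path_image (P \<circ> g) \<subseteq> A"
  proof -
    show "path (P \<circ> g)" using pg by (intro path_continuous_image continuous_on_subset[OF contP]) (auto simp: J_def)
    show "pathfinish (P \<circ> g) = pathstart (P \<circ> g)" using g(2) by (simp add: pathfinish_compose pathstart_compose)
    have "P (g s) \<in> A" if "s \<in> {0..1}" for s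
    proof -
      have "P (g s) \<noteq> \<psi> z" if "z \<in> cball 0 a" for z
      proof
        assume "P (g s) = \<psi> z"
        then have "g s = \<phi> z" using QP[of "g s"] QP[of "\<phi> z"] gJ[OF \<open>s \<in> {0..1}\<close>] \<phi>(5)[of z] \<open>z \<in> cball 0 a\<close> a P\<psi>
          by (metis UnI1 UnI2 ball_subset_cball mem_ball_0 mem_cball_0 order.strict_trans1)
        then show False using gJ[OF \<open>s \<in> {0..1}\<close>] \<phi>(5)[of z] that a UJ by auto
      qed
      then have "P (g s) \<notin> \<psi> ` cball 0 a" by blast
      then show ?thesis using QP(2)[of "g s"] gJ[OF that] unfolding A_def by blast
    qed
    then show "path_image (P \<circ> g) \<subseteq> A" by (auto simp: path_image_def)
  qed
  have A0: "0 \<notin> A" using \<psi>0 a Tpos by (force simp: A_def)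
  have wg: "winding_number (P \<circ> g) 0 = winding_number g 0"
  proof -
    have "winding_number (Q \<circ> (P \<circ> g)) 0 = winding_number (P \<circ> g) 0"
      using Pg A0 by (intro winding_number_injective_holomorphic Qhol Qinj Q0) (auto simp: A_def)
    moreover have "winding_number (Q \<circ> (P \<circ> g)) 0 = winding_number g 0"
    proof -
      have "homotopic_loops (-{0}) g (Q \<circ> (P \<circ> g))" using pg g(2) avoid QP gJ
        by (intro homotopic_loops_eq) (auto simp: J_def punctures_complement_def)
      then show ?thesis using winding_number_homotopic_loops by metis
    qed
    ultimately show ?thesis by simp
  qed
  have "winding_number g 0 \<in> {1, -1}" using simple_closed_path_winding_number_inside[OF g(1)] zero by (metis insertI1 insertI2 singletonI)
  then obtain e where e: "e \<in> {1, -1}" "winding_number g 0 = of_real e"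
    by (metis insertE empty_iff insertI1 insertI2 of_real_1 of_real_minus)
  define c where "c = (\<lambda>s::real. of_real b * cis (e * (2 * pi * s)))"
  have c: "path c" "pathfinish c = pathstart c" "path_image c \<subseteq> ball 0 1 - {0}" "winding_number c 0 = of_real e"
  proof -
    show pc: "path c" unfolding c_def path_def by (intro continuous_intros)
    show lc: "pathfinish c = pathstart c" using e by (auto simp: c_def pathstart_def pathfinish_def cis_cnj[symmetric])
    show "path_image c \<subseteq> ball 0 1 - {0}" using bin a b Tpos by (auto simp: c_def path_image_def)
    have cp: "circlepath 0 b s = of_real b * cis (2 * pi * s)" for s by (simp add: circlepath cis_conv_exp mult_ac)
    have b0: "b > 0" using a b Tpos by auto
    have w1: "winding_number (circlepath 0 b) 0 = 1" using b0 by (simp add: winding_number_circlepath)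
    show "winding_number c 0 = of_real e"
    proof (cases "e = 1")
      case True
      then have "c = circlepath 0 b" by (auto simp: cp c_def)
      then show ?thesis using w1 True by simp
    next
      case False
      then have e1: "e = -1" using e(1) by auto
      have "cis (2 * pi - x) = cis (- x)" for x by (simp add: complex_eq_iff)
      then have "c = reversepath (circlepath 0 b)"
        by (simp add: c_def cp reversepath_def fun_eq_iff e1 right_diff_distrib)
      then show ?thesis using w1 e1 b0 by (simp add: winding_number_reversepath)
    qed
  qed
  have \<psi>c: "path (\<psi> \<circ> c)" "pathfinish (\<psi> \<circ> c) = pathstart (\<psi> \<circ> c)" "path_image (\<psi> \<circ> c) \<subseteq> A"
  proof -
    show "path (\<psi> \<circ> c)" using c by (intro path_continuous_image continuous_on_subset[OF holomorphic_on_imp_continuous_on[OF \<psi>hol]]) auto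
    show "pathfinish (\<psi> \<circ> c) = pathstart (\<psi> \<circ> c)" using c(2) by (simp add: pathfinish_compose pathstart_compose)
    have "\<psi> (c s) \<in> A" for s
    proof -
      have "norm (c s) = b" using a b Tpos by (simp add: c_def norm_mult)
      then have "\<psi> (c s) \<noteq> \<psi> z" if "z \<in> cball 0 a" for z
        using inj_onD[OF \<psi>inj, of "c s" z] that a b by auto
      then have "\<psi> (c s) \<notin> \<psi> ` cball 0 a" by blast
      moreover have "norm (c s) < 1" using \<open>norm (c s) = b\<close> b by simp
      ultimately show ?thesis using \<psi>b[of "c s"] unfolding A_def by auto
    qed
    then show "path_image (\<psi> \<circ> c) \<subseteq> A" by (auto simp: path_image_def)
  qed
  have "homotopic_loops A (P \<circ> g) (\<psi> \<circ> c)"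
    unfolding A_def
  proof (rule annulus_homotopic_loops[OF \<psi>hol \<psi>inj \<psi>0])
    show "winding_number (P \<circ> g) 0 = winding_number (\<psi> \<circ> c) 0"
      using wg e winding_number_injective_holomorphic[OF \<psi>hol \<psi>inj \<psi>0 c(1-3)] c(4) by simp
  qed (use Pg \<psi>c a Tpos \<psi>b in \<open>auto simp: A_def\<close>)
  then have h3: "homotopic_loops (punctures_complement r) ((\<lambda>y. Q y / p) \<circ> (P \<circ> g)) ((\<lambda>y. Q y / p) \<circ> (\<psi> \<circ> c))"
  proof (rule homotopic_loops_continuous_image)
    show "continuous_on A (\<lambda>y. Q y / p)" using p(2)
      by (intro continuous_intros continuous_on_subset[OF holomorphic_on_imp_continuous_on[OF Qhol]]) (auto simp: A_def)
    have "Q y / p \<in> punctures_complement r" if y: "y \<in> A" for y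
    proof (rule punctures_complementI)
      have yb: "y \<in> ball 0 1" "y \<noteq> 0" using y A0 by (auto simp: A_def)
      have Qn: "Q y \<noteq> 0" using inj_onD[OF Qinj, of y 0] Q0 yb by auto
      then show "Q y / p \<noteq> 0" using p by simp
      show "Q y / p \<noteq> of_real r ^ k" for k
      proof
        assume eq: "Q y / p = of_real r ^ k"
        show False
        proof (cases k)
          case 0
          then have "Q y = \<phi> (of_real a)" using eq p by (simp add: p_def)
          then have "P (\<phi> (of_real a)) = y" using QP(1)[of "\<phi> (of_real a)"] QP(2)[of "\<phi> (of_real a)"] \<phi>(5)[OF ain] inj_onD[OF Qinj] yb by auto
          then show False using y a Tpos P\<psi> by (force simp: A_def)
        next
          case (Suc j)
          obtain w where w: "\<phi> (of_real T * y) / of_real r ^ j = \<phi> w" "norm w \<le> norm (of_real T * y)"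
            using univalent_iterated_contraction[OF step _ _ Tin[OF yb(1)], of j] Tpos T(3) by auto
          have "\<phi> w = \<phi> (of_real a)" using w(1) eq Suc r p by (simp add: Q_def p_def field_simps)
          moreover have "norm w < T" using w(2) yb Tpos by (simp add: norm_mult) (smt (verit) mult_less_cancel_left2)
          ultimately show False using inj_onD[OF \<phi>(4), of w "of_real a"] ain T(3) a Tpos by auto
        qed
      qed
      show "Q y / p * of_real r ^ k \<noteq> 1" for k
      proof
        assume "Q y / p * of_real r ^ k = 1"
        then have eq: "Q y = \<phi> (of_real a) / of_real r ^ k" using r p by (simp add: p_def field_simps)
        obtain w where w: "\<phi> (of_real a) / of_real r ^ k = \<phi> w" "norm w \<le> norm (complex_of_real a)"
          using univalent_iterated_contraction[OF step _ _ ain, of k] Tpos T(3) by auto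
        have wb: "w \<in> ball 0 1" "w \<in> cball 0 a" using w(2) a Tpos by auto
        have "P (\<phi> w) = y" using QP[of "\<phi> w"] \<phi>(5)[OF wb(1)] eq w(1) inj_onD[OF Qinj] yb by auto
        then show False using y wb P\<psi> by (force simp: A_def)
      qed
    qed (use r in auto)
    then show "(\<lambda>y. Q y / p) \<in> A \<rightarrow> punctures_complement r" by blast
  qed
  have h2: "homotopic_loops (punctures_complement r) (\<lambda>s. g s / p) ((\<lambda>y. Q y / p) \<circ> (P \<circ> g))"
  proof (rule homotopic_loops_eq)
    show "path (\<lambda>s. g s / p)" using cg p unfolding path_def by (intro continuous_intros) auto
    show "path_image (\<lambda>s. g s / p) \<subseteq> punctures_complement r" using avoidU p by (auto simp: path_image_def)
  qed (use g(2) QP(1) gJ in \<open>auto simp: pathstart_def pathfinish_def\<close>)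
  have h4: "(\<lambda>y. Q y / p) \<circ> (\<psi> \<circ> c) = (\<lambda>s. \<phi> (of_real b * cis (e * (2 * pi * s))) / \<phi> (of_real a))"
  proof
    fix s
    have "Q (\<psi> (c s)) = \<phi> (c s)" using QP(1)[of "\<phi> (c s)"] \<phi>(5)[of "c s"] bin[of "e * (2 * pi * s)"] P\<psi>
      unfolding c_def by auto
    then show "((\<lambda>y. Q y / p) \<circ> (\<psi> \<circ> c)) s = \<phi> (of_real b * cis (e * (2 * pi * s))) / \<phi> (of_real a)"
      by (simp add: p_def c_def)
  qed
  have h5: "homotopic_loops (punctures_complement r) (\<lambda>s. of_real (b / a) * cis (e * (2 * pi * s)))
      (\<lambda>s. \<phi> (of_real b * cis (e * (2 * pi * s))) / \<phi> (of_real a))"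
    by (rule shrink_univalent_image_of_circle[OF \<phi>(1) step Tpos T(3) Tr r \<phi>(4,3) a(1) b e(1)])
  have "homotopic_loops (punctures_complement r) (\<lambda>s. g s / of_real (r powi n))
      (\<lambda>s. of_real (b / a) * cis (e * (2 * pi * s)))"
    by (rule homotopic_loops_trans[OF h1 homotopic_loops_trans[OF h2 homotopic_loops_trans[OF
          h3[unfolded h4] homotopic_loops_sym[OF h5]]]])
  moreover have "1 < b / a" "b / a < r"
  proof -
    show "1 < b / a" using a b Tpos by simp
    have "b / a \<le> 1 / a" using a b Tpos by (intro divide_right_mono) auto
    also have "1 / a < 1 / T" using Tpos a by (intro divide_strict_left_mono) auto
    finally show "b / a < r" using Tr by simp
  qed
  ultimately show ?thesis using that[OF e(1)] by blast
qed

section \<open>Shrinking a simple loop to a small circle by inversion\<close>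

lemma winding_number_inverse_nonzero:
  assumes g: "path g" "pathfinish g = pathstart g" "d \<notin> path_image g"
    and w: "winding_number g d \<noteq> 0"
  shows "winding_number (\<lambda>s. 1 / (g s - d)) 0 \<noteq> 0"
proof
  assume w0: "winding_number (\<lambda>s. 1 / (g s - d)) 0 = 0"
  have nz: "g s \<noteq> d" if "s \<in> {0..1}" for s using g(3) that by (auto simp: path_image_def)
  have pi: "path (\<lambda>s. 1 / (g s - d))"
    using g(1) nz unfolding path_def by (intro continuous_intros) auto
  have "0 \<notin> path_image (\<lambda>s. 1 / (g s - d))" using nz by (auto simp: path_image_def)
  then obtain q where q: "path q" "pathfinish q - pathstart q = 0" "\<And>s. s \<in> {0..1} \<Longrightarrow> 1 / (g s - d) = 0 + exp (q s)"
    using winding_number_as_continuous_log[OF pi] w0 by (metis mult_zero_right)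
  have qg: "d + exp (- q s) = g s" if "s \<in> {0..1}" for s
  proof -
    have "exp (- q s) = inverse (1 / (g s - d))" using q(3)[OF that] by (simp add: exp_minus)
    then show ?thesis by simp
  qed
  have cq: "continuous_on {0..1} q" using q(1) by (simp add: path_def)
  \<comment> \<open>Winding number 0 makes the logarithm \<open>q\<close> of
    \<open>1 / (g - d)\<close> a closed path; scaling \<open>q\<close> to 0 contracts
    \<open>g\<close> in the complement of \<open>d\<close>.\<close>
  have "homotopic_loops (- {d}) (\<lambda>s. d + 1) g"
    unfolding homotopic_loops
  proof (intro exI[of _ "\<lambda>y. d + exp (- (of_real (fst y) * q (snd y)))"] conjI)
    show "continuous_on ({0..1} \<times> {0..1}) (\<lambda>y. d + exp (- (of_real (fst y) * q (snd y))))"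
      by (intro continuous_intros continuous_on_compose2[OF cq]) auto
  qed (use qg q(2) in \<open>auto simp: pathstart_def pathfinish_def\<close>)
  then have "winding_number g d = winding_number (\<lambda>s. d + 1) d" using winding_number_homotopic_loops by metis
  also have "\<dots> = 0" using winding_number_trivial[of d "d + 1"] by (simp add: linepath_refl)
  finally show False using w by simp
qed

lemma winding_number_nonzero_in_inside:
  assumes "simple_path g" "pathfinish g = pathstart g" "z \<notin> path_image g" "winding_number g z \<noteq> 0"
  shows "z \<in> inside (path_image g)"
  using assms winding_number_zero_in_outside[of g z] simple_path_imp_path inside_Un_outside[of "path_image g"] by blast

text \<open>The inversion \<open>j\<close> at \<open>d\<close> sends the outside of \<open>g\<close>
  into the inside \<open>Q\<close> of the inverted loop, so the inverted points of
  \<open>\<Lambda>\<close> lie in \<open>Q\<close> and can accumulate only at 0; the image of one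
  disc \<open>cball 0 \<rho>\<close> under the Riemann map contains them all. Around that image the
  inverted loop is homotopic to a large circle of radius \<open>N\<close>, and inverting back gives
  a circle of radius \<open>1 / N\<close> about \<open>d\<close>.\<close>

lemma simple_loop_homotopic_small_circle:
  fixes g :: "real \<Rightarrow> complex"
  assumes g: "simple_path g" "pathfinish g = pathstart g" and d: "d \<in> inside (path_image g)"
    and fin: "\<And>B. finite (\<Lambda> \<inter> cball d B)"
    and out: "\<And>q. q \<in> \<Lambda> \<Longrightarrow> q \<noteq> d \<Longrightarrow> q \<in> outside (path_image g)"
    and \<epsilon>: "\<epsilon> > 0"
  obtains \<delta> e :: real where "0 < \<delta>" "\<delta> \<le> \<epsilon>" "homotopic_loops (- \<Lambda> - {d}) g (\<lambda>s. d + of_real \<delta> * cis (e * (2 * pi * s)))"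
    "e \<in> {1, -1}"
proof -
  define j where "j = (\<lambda>z::complex. 1 / (z - d))"
  define J where "J = path_image g"
  have dJ: "d \<notin> J" using d by (auto simp: J_def inside_def)
  have pg: "path g" using g simple_path_imp_path by blast
  have cg: "continuous_on {0..1} g" using pg by (simp add: path_def)
  have gd: "g s \<noteq> d" if "s \<in> {0..1}" for s using dJ that by (auto simp: J_def path_image_def)
  define g' where "g' = (\<lambda>s. 1 / (g s - d))"
  have g'nz: "0 \<notin> path_image g'" using gd by (auto simp: g'_def path_image_def)
  have g': "simple_path g'" "pathfinish g' = pathstart g'"
  proof -
    have "path g'" unfolding g'_def path_def using gd by (intro continuous_intros cg) auto
    moreover have "g s = g t" if "s \<in> {0..1}" "t \<in> {0..1}" "g' s = g' t" for s t
      using that gd by (simp add: g'_def)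
    ultimately show "simple_path g'" using g(1) unfolding simple_path_def loop_free_def by meson
    show "pathfinish g' = pathstart g'" using g(2) by (simp add: g'_def pathstart_def pathfinish_def)
  qed
  have wgd: "winding_number g d \<noteq> 0"
    using simple_closed_path_norm_winding_number_inside[OF g(1) d] by auto
  have w0: "winding_number g' 0 \<noteq> 0" unfolding g'_def
    by (rule winding_number_inverse_nonzero[OF pg g(2)]) (use dJ wgd in \<open>auto simp: J_def\<close>)
  define Q where "Q = inside (path_image g')"
  have Q0: "0 \<in> Q" unfolding Q_def by (rule winding_number_nonzero_in_inside[OF g' g'nz w0])
  have Q: "open Q" "bounded Q" "frontier Q = path_image g'" "Q \<inter> path_image g' = {}"
    using Jordan_inside_outside[OF g'] unfolding Q_def by (auto simp: inside_no_overlap)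
  have scQ: "simply_connected Q" unfolding Q_def by (rule simply_connected_inside_simple_path[OF g'(1)])
  obtain \<phi> \<phi>' where \<phi>: "\<phi> holomorphic_on ball 0 1" "\<phi>' holomorphic_on Q" "\<phi> 0 = 0"
    "inj_on \<phi> (ball 0 1)" "\<And>z. z \<in> ball 0 1 \<Longrightarrow> \<phi> z \<in> Q \<and> \<phi>' (\<phi> z) = z"
    "\<And>z. z \<in> Q \<Longrightarrow> \<phi>' z \<in> ball 0 1 \<and> \<phi> (\<phi>' z) = z"
    using riemann_map_fixing_zero[OF Q(1) scQ Q0] Q(2) by (metis not_bounded_UNIV)
  obtain N0 where N0: "path_image g' \<union> Q \<subseteq> ball 0 N0" 
  proof -
    have "bounded (path_image g' \<union> Q)" using Q(2) g'(1) simple_path_imp_path bounded_path_image by (metis bounded_Un)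
    then show ?thesis using that bounded_subset_ballD[of _ 0] by blast
  qed
  define N where "N = max (max N0 1) (1 / \<epsilon>)"
  have N: "N \<ge> N0" "N > 0" "1 / N \<le> \<epsilon>"
  proof -
    show "N \<ge> N0" "N > 0" by (auto simp: N_def)
    have "1 / \<epsilon> \<le> N" by (simp add: N_def)
    then show "1 / N \<le> \<epsilon>" using \<open>N > 0\<close> \<epsilon> by (simp add: field_simps)
  qed
  have jout: "j q \<in> Q" if "q \<in> outside J" for q
  proof -
    have dout: "d \<notin> outside J" using d inside_Int_outside[of J] unfolding J_def by blast
    have conn: "connected (j ` outside J)" unfolding j_def
      using Jordan_inside_outside[OF g] dout by (intro connected_continuous_image continuous_intros) (auto simp: J_def)
    obtain \<eta> where \<eta>: "\<eta> > 0" "ball 0 \<eta> \<subseteq> Q" using Q(1) Q0 openE by blast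
    have "j ` outside J \<inter> Q \<noteq> {}"
    proof -
      have "\<not> bounded (outside J)" using Jordan_inside_outside[OF g] by (auto simp: J_def)
      then obtain z where z: "z \<in> outside J" "norm z > norm d + 1 / \<eta>" 
        unfolding bounded_iff by (meson not_le)
      have "norm (z - d) > 1 / \<eta>" using z(2) norm_triangle_ineq2[of z d] by linarith
      moreover from this have "norm (z - d) > 0" using \<eta>(1) by (meson less_trans zero_less_divide_1_iff)
      ultimately have "norm (j z) < \<eta>" using \<eta>(1) by (simp add: j_def norm_divide field_simps)
      then have "j z \<in> Q" using \<eta>(2) by (auto simp: subset_eq)
      then show ?thesis using z(1) by blast
    qed
    moreover have "j ` outside J \<inter> frontier Q = {}"
    proof -
      have False if "z \<in> outside J" "s \<in> {0..1}" "j z = g' s" for z s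
      proof -
        have "z = g s" using that(1,3) dout gd[OF that(2)] by (simp add: j_def g'_def)
        then have "z \<in> J" using that(2) by (auto simp: J_def path_image_def)
        then show False using that(1) outside_no_overlap by blast
      qed
      then show ?thesis unfolding Q(3) path_image_def by blast
    qed
    ultimately have "j ` outside J \<subseteq> Q" using connected_Int_frontier[OF conn] by blast
    then show ?thesis using that by blast
  qed
  obtain \<rho> where \<rho>: "0 < \<rho>" "\<rho> < 1" "\<And>q. q \<in> \<Lambda> \<Longrightarrow> q \<noteq> d \<Longrightarrow> j q \<in> \<phi> ` cball 0 \<rho>"
  proof -
    have "open (\<phi> ` ball 0 (1/2))"
      by (intro open_mapping_thm3 holomorphic_on_subset[OF \<phi>(1)] inj_on_subset[OF \<phi>(4)]) auto
    moreover have "0 \<in> \<phi> ` ball 0 (1/2)" using \<phi>(3) by force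
    ultimately obtain \<eta> where \<eta>: "\<eta> > 0" "ball 0 \<eta> \<subseteq> \<phi> ` ball 0 (1/2)" using openE by blast
    \<comment> \<open>Points of \<open>\<Lambda>\<close> far from \<open>d\<close> invert into the
      image of \<open>ball 0 (1/2)\<close>; only the finitely many near ones decide by how much
      \<open>\<rho>\<close> must exceed 1/2.\<close>
    define F where "F = insert (1/2) ((\<lambda>q. norm (\<phi>' (j q))) ` (\<Lambda> \<inter> cball d (1/\<eta>) - {d}))"
    have F: "finite F" "F \<noteq> {}" using fin[of "1/\<eta>"] by (auto simp: F_def)
    have "Max F < 1" using F out jout \<phi>(6) by (auto simp: F_def J_def)
    moreover have "1/2 \<le> Max F" by (rule Max_ge[OF F(1)]) (simp add: F_def)
    moreover have "j q \<in> \<phi> ` cball 0 (Max F)" if q: "q \<in> \<Lambda>" "q \<noteq> d" for q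
    proof (cases "q \<in> cball d (1/\<eta>)")
      case True
      then have "norm (\<phi>' (j q)) \<le> Max F" using q F(1) by (intro Max_ge) (auto simp: F_def)
      then show ?thesis using \<phi>(6)[OF jout] out[OF q] by (intro image_eqI[of _ _ "\<phi>' (j q)"]) (auto simp: J_def)
    next
      case False
      then have "1 / \<eta> < norm (q - d)" by (simp add: dist_norm norm_minus_commute)
      then have "norm (j q) < \<eta>" using q(2) \<eta>(1) by (simp add: j_def norm_divide field_simps)
      then have "j q \<in> \<phi> ` ball 0 (1/2)" using \<eta>(2) by auto
      then show ?thesis using \<open>1/2 \<le> Max F\<close> by auto
    qed
    ultimately show ?thesis using that[of "Max F"] by fastforce
  qed
  have "winding_number g' 0 \<in> {1, -1}" 
    using simple_closed_path_winding_number_cases[OF g' g'nz] w0 by auto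
  then obtain e where e: "e \<in> {1, -1}" "winding_number g' 0 = of_real e"
    by (metis insertE empty_iff insertI1 insertI2 of_real_1 of_real_minus)
  define c where "c = (\<lambda>s::real. of_real N * cis (e * (2 * pi * s)))"
  have c: "path c" "pathfinish c = pathstart c" "winding_number c 0 = of_real e"
  proof -
    show "path c" unfolding c_def path_def by (intro continuous_intros)
    show "pathfinish c = pathstart c" using e by (auto simp: c_def pathstart_def pathfinish_def cis_cnj[symmetric])
    have cp: "circlepath 0 N s = of_real N * cis (2 * pi * s)" for s by (simp add: circlepath cis_conv_exp mult_ac)
    have w1: "winding_number (circlepath 0 N) 0 = 1" using N by (simp add: winding_number_circlepath)
    show "winding_number c 0 = of_real e"
    proof (cases "e = 1")
      case True
      then have "c = circlepath 0 N" by (auto simp: cp c_def)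
      then show ?thesis using w1 True by simp
    next
      case False
      then have e1: "e = -1" using e(1) by auto
      have "cis (2 * pi - x) = cis (- x)" for x by (simp add: complex_eq_iff)
      then have "c = reversepath (circlepath 0 N)"
        by (simp add: c_def cp reversepath_def fun_eq_iff e1 right_diff_distrib)
      then show ?thesis using w1 e1 N by (simp add: winding_number_reversepath)
    qed
  qed
  have nc: "norm (c s) = N" for s using N by (simp add: c_def norm_mult)
  have im\<phi>: "\<phi> ` ball 0 1 \<subseteq> Q" using \<phi>(5) by auto
  define A where "A = ball 0 (N + 1) - \<phi> ` cball 0 \<rho>"
  have K: "\<phi> ` cball 0 \<rho> \<subseteq> Q" using im\<phi> \<rho> by force
  have cA: "path_image c \<subseteq> A"
  proof -
    have "c s \<in> A" for s
    proof -
      have "c s \<notin> Q" using N0 nc[of s] N(1) by force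
      then show ?thesis using nc[of s] K by (auto simp: A_def)
    qed
    then show ?thesis by (auto simp: path_image_def)
  qed
  have "homotopic_loops A g' c" unfolding A_def
  proof (rule annulus_homotopic_loops[OF \<phi>(1,4,3) \<rho>(1,2)])
    show "\<phi> ` ball 0 1 \<subseteq> ball 0 (N + 1)" using im\<phi> N0 N(1) by force
    show "path_image g' \<subseteq> ball 0 (N + 1) - \<phi> ` cball 0 \<rho>" using N0 N(1) Q(4) K by force
    show "path_image c \<subseteq> ball 0 (N + 1) - \<phi> ` cball 0 \<rho>" using cA by (simp add: A_def)
  qed (use g' c e simple_path_imp_path in auto)
  then have h: "homotopic_loops (- \<Lambda> - {d}) ((\<lambda>z. d + 1 / z) \<circ> g') ((\<lambda>z. d + 1 / z) \<circ> c)"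
  proof (rule homotopic_loops_continuous_image)
    have A0: "0 \<notin> A" using \<phi>(3) \<rho>(1) by (force simp: A_def)
    then show "continuous_on A (\<lambda>z. d + 1 / z)" by (intro continuous_intros) auto
    have "d + 1 / z \<notin> \<Lambda>" if z: "z \<in> A" for z
    proof
      assume "d + 1 / z \<in> \<Lambda>"
      moreover have "z \<noteq> 0" using z A0 by metis
      ultimately have "j (d + 1 / z) \<in> \<phi> ` cball 0 \<rho>" by (intro \<rho>(3)) auto
      then show False using z by (simp add: j_def A_def)
    qed
    then show "(\<lambda>z. d + 1 / z) \<in> A \<rightarrow> - \<Lambda> - {d}" using A0 by auto
  qed
  have gA: "g s \<in> - \<Lambda> - {d}" if "s \<in> {0..1}" for s
  proof -
    have "g s \<in> J" using that by (auto simp: J_def path_image_def)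
    then show ?thesis using out[of "g s"] outside_no_overlap[of J] dJ unfolding J_def by blast
  qed
  have h1: "homotopic_loops (- \<Lambda> - {d}) g ((\<lambda>z. d + 1 / z) \<circ> g')"
  proof (rule homotopic_loops_eq[OF pg])
    show "path_image g \<subseteq> - \<Lambda> - {d}" using gA unfolding path_image_def by blast
  qed (simp_all add: g'_def g(2))
  have e2: "(\<lambda>z. d + 1 / z) \<circ> c = (\<lambda>s. d + of_real (1 / N) * cis (- e * (2 * pi * s)))"
    by (simp add: c_def fun_eq_iff divide_inverse)
  show ?thesis
    by (rule that[of "1 / N" "- e"]) (use homotopic_loops_trans[OF h1 h] N e in \<open>auto simp: e2\<close>)
qed

text \<open>The counterpart of \<open>nested_dilates\<close> for translations. The translate of
  \<open>J\<close> is connected and misses \<open>J\<close>. If it lies inside, the translation maps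
  the closed inside into itself; if it lies outside although \<open>z\<close> and
  \<open>z + v\<close> are both inside, the closed inside is contained in its translate. A point
  extremal in the direction \<open>v\<close> contradicts either.\<close>

lemma inside_translate_disjoint:
  fixes g :: "real \<Rightarrow> complex"
  assumes g: "simple_path g" "pathfinish g = pathstart g" and v: "v \<noteq> 0"
    and disj: "\<And>s t. s \<in> {0..1} \<Longrightarrow> t \<in> {0..1} \<Longrightarrow> g s \<noteq> g t + v"
    and z: "z \<in> inside (path_image g)" 
  shows "z + v \<notin> inside (path_image g)"
proof
  assume zv: "z + v \<in> inside (path_image g)"
  define J where "J = path_image g"
  define U where "U = inside J"
  define O' where "O' = outside J"
  define m where "m = (\<lambda>z::complex. z + v)"
  have jd: "open U" "connected U" "bounded U" "open O'" "connected O'" "\<not> bounded O'" "U \<inter> O' = {}"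
    "U \<union> O' = - J" "frontier U = J" "frontier O' = J" 
    using Jordan_inside_outside[OF g] unfolding U_def O'_def J_def by auto
  have contm: "continuous_on S m" for S unfolding m_def by (intro continuous_intros)
  have conJ: "connected J" using g unfolding J_def by (simp add: connected_path_image simple_path_imp_path)
  have clU: "closure U = U \<union> J" using jd(1,9) by (metis closure_Un_frontier)
  have disjm: "J \<inter> m ` J = {}" using disj unfolding J_def path_image_def m_def by blast
  have mU: "open (m ` U)" using open_translation[OF jd(1), of v] by (simp add: m_def add.commute)
  have cm: "closure (m ` U) = m ` (U \<union> J)" using closure_translation[of v U] clU by (simp add: m_def add.commute)
  have frm: "frontier (m ` U) \<subseteq> m ` J" using mU cm by (auto simp: frontier_def interior_open)
  have cU: "compact (closure U)" using jd(3) by simp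
  have cin: "continuous_on (closure U) (\<lambda>x. x \<bullet> v)" by (intro continuous_intros)
  have neU: "closure U \<noteq> {}" using z clU by (auto simp: U_def J_def)
  have inn: "y \<bullet> v < (y + v) \<bullet> v" for y using v by (simp add: inner_add_left)
  have "connected (m ` J)" by (intro connected_continuous_image contm conJ)
  then have "m ` J \<subseteq> U \<or> m ` J \<subseteq> O'"
    using connectedD[of "m ` J" U O'] jd disjm by blast
  then show False
  proof
    assume mJ: "m ` J \<subseteq> U"
    have "O' \<inter> m ` U = {}"
    proof (rule ccontr)
      assume ne: "O' \<inter> m ` U \<noteq> {}"
      have "bounded (m ` U)" using bounded_translation[OF jd(3), of v] by (simp add: m_def add.commute)
      then have "\<not> O' \<subseteq> m ` U" using jd(6) bounded_subset by blast
      then have "O' \<inter> frontier (m ` U) \<noteq> {}" using connected_Int_frontier[OF jd(5) ne] by blast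
      then show False using frm mJ jd(7) by blast
    qed
    then have "closure O' \<inter> m ` U = {}" using mU by (metis Int_commute open_Int_closure_eq_empty)
    moreover have "J \<subseteq> closure O'" using jd(10) by (auto simp: frontier_def)
    ultimately have "m ` U \<subseteq> U" using \<open>O' \<inter> m ` U = {}\<close> jd(8) by blast
    then have mU': "m ` closure U \<subseteq> closure U" using mJ unfolding clU by blast
    obtain y where y: "y \<in> closure U" "\<And>x. x \<in> closure U \<Longrightarrow> x \<bullet> v \<le> y \<bullet> v"
      using continuous_attains_sup[OF cU neU cin] by blast
    have "y + v \<in> closure U" using mU' y(1) by (auto simp: m_def)
    then show False using y(2) inn[of y] by fastforce
  next
    assume mO: "m ` J \<subseteq> O'"
    have "z + v \<in> m ` U" "z + v \<in> U" using z zv by (auto simp: U_def J_def m_def)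
    then have "U \<subseteq> m ` U" using connected_Int_frontier[OF jd(2), of "m ` U"] frm mO jd(7) by blast
    then have "closure U \<subseteq> closure (m ` U)" by (rule closure_mono)
    then have sub: "closure U \<subseteq> m ` U" using \<open>U \<subseteq> m ` U\<close> disjm unfolding cm clU image_Un by blast
    obtain y where y: "y \<in> closure U" "\<And>x. x \<in> closure U \<Longrightarrow> y \<bullet> v \<le> x \<bullet> v"
      using continuous_attains_inf[OF cU neU cin] by blast
    obtain x where "x \<in> U" "y = x + v" using sub y(1) by (auto simp: m_def)
    then show False using y(2)[of x] inn[of x] clU by fastforce
  qed
qed

section \<open>Homology classes of loops on the torus\<close>

text \<open>The class in the first homology of the closed torus, read off from the two circle
  coordinates. It is a relation because \<open>winding_number\<close> is complex valued.\<close>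

definition homology_class :: "(real \<Rightarrow> complex \<times> complex) \<Rightarrow> int^2 \<Rightarrow> bool" where
  "homology_class c v \<longleftrightarrow> winding_number (fst \<circ> c) 0 = of_int (v$1) \<and> winding_number (snd \<circ> c) 0 = of_int (v$2)"

definition torus_cover :: "complex \<Rightarrow> complex \<times> complex" where
  "torus_cover z = (cis (Re z), cis (Im z))"

text \<open>The cover of the torus by the plane without 0: the argument is the first angle, the
  logarithm of the modulus the second. Loops with vanishing second homology coordinate lift to
  closed loops, and the deck group is multiplication by powers of
  \<open>exp (2 * pi)\<close>.\<close>

definition annulus_cover :: "complex \<Rightarrow> complex \<times> complex" where
  "annulus_cover z = (sgn z, cis (ln (norm z)))"

lemma punctured_torus_iff:
  "p \<in> punctured_torus \<longleftrightarrow> norm (fst p) = 1 \<and> norm (snd p) = 1 \<and> p \<noteq> (1, 1)"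
  by (cases p) (auto simp: punctured_torus_def)

lemma homology_class_unique: "homology_class c v \<Longrightarrow> homology_class c w \<Longrightarrow> v = w"
  by (auto simp: homology_class_def vec_eq_iff forall_2)

lemma homology_class_homotopic:
  assumes "homotopic_loops punctured_torus c d"
  shows "homology_class c v \<longleftrightarrow> homology_class d v"
proof -
  have "homotopic_loops (- {0}) (fst \<circ> c) (fst \<circ> d)" "homotopic_loops (- {0}) (snd \<circ> c) (snd \<circ> d)"
    by (rule homotopic_loops_continuous_image[OF assms]; force simp: punctured_torus_iff intro!: continuous_intros)+
  then show ?thesis unfolding homology_class_def by (metis winding_number_homotopic_loops)
qed

lemma winding_number_cis:
  assumes "continuous_on {0..1} b"
  shows "winding_number (\<lambda>s. cis (b s)) 0 = of_real ((b 1 - b 0) / (2 * pi))"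
proof -
  define p where "p = (\<lambda>s. \<i> * of_real (b s))"
  have "path p" unfolding path_def p_def by (intro continuous_intros assms)
  moreover have "exp \<circ> p = (\<lambda>s. cis (b s))" by (auto simp: p_def cis_conv_exp)
  ultimately have "winding_number (\<lambda>s. cis (b s)) 0 = (p 1 - p 0) / (2 * of_real pi * \<i>)"
    using winding_number_compose_exp[of p] by (simp add: pathfinish_def pathstart_def)
  also have "p 1 - p 0 = \<i> * of_real (b 1 - b 0)" by (simp add: p_def algebra_simps)
  finally show ?thesis by simp
qed

lemma winding_number_eq_on:
  assumes "path p" "0 \<notin> path_image p" "pathfinish p = pathstart p" "\<And>s. s \<in> {0..1} \<Longrightarrow> p s = q s"
  shows "winding_number p 0 = winding_number q (0::complex)"
  using homotopic_loops_eq[of p "- {0}" q] assms winding_number_homotopic_loops[of 0 p q] by auto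

lemma homology_classI:
  fixes v :: "int^2"
  assumes "continuous_on {0..1} b1" "continuous_on {0..1} b2" "\<And>s. s \<in> {0..1} \<Longrightarrow> c s = (cis (b1 s), cis (b2 s))"
    "b1 1 - b1 0 = 2 * pi * of_int (v$1)" "b2 1 - b2 0 = 2 * pi * of_int (v$2)"
  shows "homology_class c v"
proof -
  have *: "winding_number p 0 = of_int n"
    if "continuous_on {0..1} b" "b 1 - b 0 = 2 * pi * of_int n" "\<And>s. s \<in> {0..1} \<Longrightarrow> p s = cis (b s)" for b p n
  proof -
    have "winding_number (\<lambda>s. cis (b s)) 0 = winding_number p 0"
    proof (rule winding_number_eq_on)
      show "path (\<lambda>s. cis (b s))" unfolding path_def by (intro continuous_intros that)
      have "b 1 = b 0 + 2 * pi * of_int n" using that by simp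
      then show "pathfinish (\<lambda>s. cis (b s)) = pathstart (\<lambda>s. cis (b s))"
        by (simp add: pathfinish_def pathstart_def flip: cis_mult)
    qed (use that in \<open>auto simp: path_image_def\<close>)
    then show ?thesis using winding_number_cis[OF that(1)] that(2) by simp
  qed
  show ?thesis unfolding homology_class_def
    using *[OF assms(1,4), of "fst \<circ> c"] *[OF assms(2,5), of "snd \<circ> c"] assms(3) by auto
qed

lemma unit_circle_path_angle:
  assumes "path z" "pathfinish z = pathstart z" "\<And>s. s \<in> {0..1} \<Longrightarrow> norm (z s) = 1"
  obtains b n where "continuous_on {0..1} b" "\<And>s. s \<in> {0..1} \<Longrightarrow> z s = cis (b s)" "b 1 - b 0 = 2 * pi * of_int n"
proof -
  have nz: "0 \<notin> path_image z" using assms(3) by (force simp: path_image_def)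
  obtain q where q: "path q" "pathfinish q - pathstart q = 2 * of_real pi * \<i> * winding_number z 0"
    "\<And>t. t \<in> {0..1} \<Longrightarrow> z t = 0 + exp (q t)"
    using winding_number_as_continuous_log[OF assms(1) nz] by blast
  obtain n where n: "winding_number z 0 = of_int n"
    using integer_winding_number[OF assms(1,2) nz] by (auto simp: Ints_def)
  show ?thesis
  proof (rule that[of "\<lambda>s. Im (q s)" n])
    show "continuous_on {0..1} (\<lambda>s. Im (q s))" using q(1) unfolding path_def by (intro continuous_intros)
    show "z s = cis (Im (q s))" if "s \<in> {0..1}" for s
    proof -
      have "Re (q s) = 0" using q(3)[OF that] assms(3)[OF that] by simp
      then have "q s = \<i> * of_real (Im (q s))" by (simp add: complex_eq_iff)
      then show ?thesis using q(3)[OF that] by (metis cis_conv_exp add_0)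
    qed
    have "Im (pathfinish q - pathstart q) = 2 * pi * of_int n" unfolding q(2) n by simp
    then show "Im (q 1) - Im (q 0) = 2 * pi * of_int n" by (simp add: pathfinish_def pathstart_def)
  qed
qed

lemma torus_loop_angles:
  assumes "loop_in punctured_torus c"
  obtains b1 b2 and v :: "int^2" where "continuous_on {0..1} b1" "continuous_on {0..1} b2"
    "\<And>s. s \<in> {0..1} \<Longrightarrow> c s = (cis (b1 s), cis (b2 s))"
    "b1 1 - b1 0 = 2 * pi * of_int (v$1)" "b2 1 - b2 0 = 2 * pi * of_int (v$2)" "homology_class c v"
proof -
  have c: "path c" "pathfinish c = pathstart c" "\<And>s. s \<in> {0..1} \<Longrightarrow> c s \<in> punctured_torus"
    using assms by (auto simp: loop_in_def path_image_def)
  have p: "path (\<lambda>s. fst (c s))" "path (\<lambda>s. snd (c s))"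
    using c(1) unfolding path_def by (intro continuous_intros; simp)+
  obtain b1 n1 where b1: "continuous_on {0..1} b1" "\<And>s. s \<in> {0..1} \<Longrightarrow> fst (c s) = cis (b1 s)" "b1 1 - b1 0 = 2 * pi * of_int n1"
    using unit_circle_path_angle[OF p(1)] c(2,3) by (auto simp: pathfinish_def pathstart_def punctured_torus_iff)
  obtain b2 n2 where b2: "continuous_on {0..1} b2" "\<And>s. s \<in> {0..1} \<Longrightarrow> snd (c s) = cis (b2 s)" "b2 1 - b2 0 = 2 * pi * of_int n2"
    using unit_circle_path_angle[OF p(2)] c(2,3) by (auto simp: pathfinish_def pathstart_def punctured_torus_iff)
  define v :: "int^2" where "v = vector [n1, n2]"
  have e: "c s = (cis (b1 s), cis (b2 s))" if "s \<in> {0..1}" for s using b1(2) b2(2) that by (metis prod.collapse)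
  have v: "b1 1 - b1 0 = 2 * pi * of_int (v$1)" "b2 1 - b2 0 = 2 * pi * of_int (v$2)" using b1(3) b2(3) by (simp_all add: v_def)
  show ?thesis using that[OF b1(1) b2(1) e v homology_classI[OF b1(1) b2(1) e v]] by blast
qed

lemma cis_eq_1: "cis x = 1 \<longleftrightarrow> (\<exists>n::int. x = 2 * pi * of_int n)"
proof
  assume "cis x = 1"
  then have "cos x = 1" by (metis cis.simps(1) one_complex.simps(1))
  then show "\<exists>n::int. x = 2 * pi * of_int n" by (auto simp: cos_one_2pi_int mult_ac)
qed auto

lemma torus_cover_in_punctured_torus: "torus_cover z \<in> punctured_torus \<longleftrightarrow> torus_cover z \<noteq> (1, 1)"
  by (simp add: punctured_torus_iff torus_cover_def)

lemma continuous_on_torus_cover: "continuous_on S torus_cover"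
  unfolding torus_cover_def by (intro continuous_intros)

lemma finite_puncture_lattice: "finite ({z. torus_cover z = (1, 1)} \<inter> cball d B)"
proof -
  define k where "k = \<lceil>\<bar>B\<bar> + norm d\<rceil>"
  have "{z. torus_cover z = (1, 1)} \<inter> cball d B
    \<subseteq> (\<lambda>(m, n). Complex (2 * pi * of_int m) (2 * pi * of_int n)) ` ({- k..k} \<times> {- k..k})"
  proof
    fix z assume z: "z \<in> {z. torus_cover z = (1, 1)} \<inter> cball d B"
    then obtain m n :: int where mn: "Re z = 2 * pi * of_int m" "Im z = 2 * pi * of_int n"
      by (auto simp: torus_cover_def cis_eq_1)
    have nz: "norm z \<le> \<bar>B\<bar> + norm d" using z norm_triangle_ineq[of "z - d" d] by (auto simp: dist_norm norm_minus_commute)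
    have *: "i \<in> {- k..k}" if "\<bar>2 * pi * of_int i\<bar> \<le> norm z" for i :: int
    proof -
      have "1 * \<bar>real_of_int i\<bar> \<le> \<bar>2 * pi\<bar> * \<bar>of_int i\<bar>" using pi_gt3 by (intro mult_right_mono) auto
      then have "\<bar>real_of_int i\<bar> \<le> \<bar>B\<bar> + norm d" using that nz by (simp add: abs_mult)
      then show ?thesis unfolding k_def by (simp add: abs_le_iff) linarith
    qed
    have "m \<in> {- k..k}" "n \<in> {- k..k}" using *[of m] *[of n] mn abs_Re_le_cmod[of z] abs_Im_le_cmod[of z] by auto
    then show "z \<in> (\<lambda>(m, n). Complex (2 * pi * of_int m) (2 * pi * of_int n)) ` ({- k..k} \<times> {- k..k})"
      using mn by (intro image_eqI[of _ _ "(m, n)"]) (auto simp: complex_eq_iff)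
  qed
  then show ?thesis by (rule finite_subset) auto
qed

text \<open>The lift \<open>g\<close> to the plane is a closed simple curve disjoint from its
  nontrivial translates by the puncture lattice, so by \<open>inside_translate_disjoint\<close> it
  encloses at most one puncture. It shrinks to small circles about that puncture, or about an
  ordinary point if there is none.\<close>

lemma null_homologous_simple_loop:
  assumes c: "loop_in punctured_torus c" "simple_path c" and h: "homology_class c 0"
  shows "trivial_loop c \<or> peripheral_loop c"
proof -
  obtain b1 b2 and v :: "int^2" where b: "continuous_on {0..1} b1" "continuous_on {0..1} b2"
    "\<And>s. s \<in> {0..1} \<Longrightarrow> c s = (cis (b1 s), cis (b2 s))"
    "b1 1 - b1 0 = 2 * pi * of_int (v$1)" "b2 1 - b2 0 = 2 * pi * of_int (v$2)" "homology_class c v"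
    using torus_loop_angles[OF c(1)] by blast
  have v: "v = 0" using homology_class_unique[OF b(6) h] .
  define g where "g = (\<lambda>s. Complex (b1 s) (b2 s))"
  have cg: "c s = torus_cover (g s)" if "s \<in> {0..1}" for s using b(3)[OF that] by (simp add: g_def torus_cover_def)
  have gl: "pathfinish g = pathstart g" using b(4,5) v by (simp add: g_def pathfinish_def pathstart_def)
  have pg: "path g" unfolding g_def path_def Complex_eq by (intro continuous_intros b(1,2))
  have inj: "s = t \<or> s = 0 \<and> t = 1 \<or> s = 1 \<and> t = 0" if "s \<in> {0..1}" "t \<in> {0..1}" "c s = c t" for s t
    using c(2) that unfolding simple_path_def loop_free_def by blast
  have gs: "simple_path g"
    unfolding simple_path_def loop_free_def using pg inj cg by metis
  have trans: "u = 0" if "s \<in> {0..1}" "t \<in> {0..1}" "g s = g t + u" "torus_cover (g t + u) = torus_cover (g t)" for s t u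
  proof -
    have "c s = c t" using that cg by metis
    then have "g s = g t" using inj[OF that(1,2)] gl by (auto simp: pathfinish_def pathstart_def)
    then show ?thesis using that(3) by simp
  qed
  define \<Lambda> where "\<Lambda> = {z. torus_cover z = (1, 1)}"
  have per: "torus_cover (z + (q - q')) = torus_cover z" if "q \<in> \<Lambda>" "q' \<in> \<Lambda>" for z q q'
  proof -
    have *: "cis (x + (y - y')) = cis x" if "cis y = 1" "cis y' = 1" for x y y' :: real
      using that by (simp add: cis_mult[symmetric] cis_divide[symmetric])
    show ?thesis using that by (simp add: \<Lambda>_def torus_cover_def *)
  qed
  have cT: "c s \<in> punctured_torus" if "s \<in> {0..1}" for s using c(1) that by (auto simp: loop_in_def path_image_def)
  have g\<Lambda>: "g s \<notin> \<Lambda>" if "s \<in> {0..1}" for s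
    using cT[OF that] cg[OF that] by (auto simp: \<Lambda>_def punctured_torus_iff)
  have uniq: "q = q'" if q: "q \<in> \<Lambda>" "q' \<in> \<Lambda>" "q \<in> inside (path_image g)" "q' \<in> inside (path_image g)" for q q'
  proof (rule ccontr)
    assume "q \<noteq> q'"
    have "q' + (q - q') \<notin> inside (path_image g)"
    proof (rule inside_translate_disjoint[OF gs gl _ _ q(4)])
      show "q - q' \<noteq> 0" using \<open>q \<noteq> q'\<close> by simp
      then show "g s \<noteq> g t + (q - q')" if "s \<in> {0..1}" "t \<in> {0..1}" for s t
        using trans[OF that _ per[OF q(1,2)]] by blast
    qed
    then show False using q by simp
  qed
  obtain d where d: "d \<in> inside (path_image g)" "\<And>q. q \<in> \<Lambda> \<Longrightarrow> q \<in> inside (path_image g) \<Longrightarrow> q = d"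
  proof (cases "\<exists>q\<in>\<Lambda>. q \<in> inside (path_image g)")
    case True
    then obtain q where "q \<in> \<Lambda>" "q \<in> inside (path_image g)" by blast
    then show ?thesis using that[of q] uniq by blast
  next
    case False
    obtain d where "d \<in> inside (path_image g)" using Jordan_inside_outside[OF gs gl] by blast
    then show ?thesis using that[of d] False by blast
  qed
  have out: "q \<in> outside (path_image g)" if "q \<in> \<Lambda>" "q \<noteq> d" for q
  proof -
    have "q \<notin> path_image g" using that g\<Lambda> by (auto simp: path_image_def)
    then show ?thesis using d(2)[OF that(1)] that(2) inside_Un_outside[of "path_image g"] by blast
  qed
  have fin: "finite (\<Lambda> \<inter> cball d B)" for B unfolding \<Lambda>_def by (rule finite_puncture_lattice)
  have circ: "\<exists>\<delta> e. 0 < \<delta> \<and> \<delta> \<le> \<epsilon> \<and> e \<in> {1, -1} \<and>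
      homotopic_loops punctured_torus c (\<lambda>s. torus_cover (d + of_real \<delta> * cis (e * (2 * pi * s))))" if "\<epsilon> > 0" for \<epsilon> :: real
  proof -
    obtain \<delta> e where \<delta>: "0 < \<delta>" "\<delta> \<le> \<epsilon>" "homotopic_loops (- \<Lambda> - {d}) g (\<lambda>s. d + of_real \<delta> * cis (e * (2 * pi * s)))" "e \<in> {1, -1::real}"
      using simple_loop_homotopic_small_circle[OF gs gl d(1) fin out \<open>\<epsilon> > 0\<close>] by blast
    have "homotopic_loops punctured_torus (torus_cover \<circ> g) (torus_cover \<circ> (\<lambda>s. d + of_real \<delta> * cis (e * (2 * pi * s))))"
      by (rule homotopic_loops_continuous_image[OF \<delta>(3) continuous_on_torus_cover])
        (auto simp: torus_cover_in_punctured_torus \<Lambda>_def)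
    moreover have "homotopic_loops punctured_torus c (torus_cover \<circ> g)"
      using c(1) cg by (intro homotopic_loops_eq) (auto simp: loop_in_def)
    ultimately show ?thesis using \<delta> homotopic_loops_trans unfolding o_def by blast
  qed
  show ?thesis
  proof (cases "d \<in> \<Lambda>")
    case True
    have "peripheral_loop c" unfolding peripheral_loop_def
    proof (intro allI impI)
      fix e :: real assume "e > 0"
      then obtain \<epsilon> where \<epsilon>: "\<epsilon> > 0" "\<And>z. dist z d < \<epsilon> \<Longrightarrow> dist (torus_cover z) (torus_cover d) < e"
        using \<open>e > 0\<close> continuous_on_torus_cover[of UNIV] unfolding continuous_on_iff by (metis UNIV_I)
      obtain \<delta> e' where \<delta>: "0 < \<delta>" "\<delta> \<le> \<epsilon>/2" "homotopic_loops punctured_torus c (\<lambda>s. torus_cover (d + of_real \<delta> * cis (e' * (2 * pi * s))))"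
        using circ[of "\<epsilon>/2"] \<epsilon> by auto
      have "path_image (\<lambda>s. torus_cover (d + of_real \<delta> * cis (e' * (2 * pi * s)))) \<subseteq> ball (1, 1) e"
      proof -
        have "torus_cover (d + of_real \<delta> * cis x) \<in> ball (1, 1) e" for x
        proof -
          have "dist (d + of_real \<delta> * cis x) d < \<epsilon>" using \<delta> \<epsilon>(1) by (simp add: dist_norm norm_mult)
          then have "dist (torus_cover (d + of_real \<delta> * cis x)) (torus_cover d) < e" by (rule \<epsilon>(2))
          then show ?thesis using True by (simp add: \<Lambda>_def dist_commute)
        qed
        then show ?thesis by (auto simp: path_image_def)
      qed
      then show "\<exists>d. homotopic_loops punctured_torus c d \<and> path_image d \<subseteq> ball (1, 1) e" using \<delta>(3) by blast
    qed
    then show ?thesis ..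
  next
    case False
    have "open (inside (path_image g))" using Jordan_inside_outside[OF gs gl] by blast
    then obtain \<epsilon> where \<epsilon>: "\<epsilon> > 0" "ball d \<epsilon> \<subseteq> inside (path_image g)" using d(1) openE by blast
    obtain \<delta> e where \<delta>: "0 < \<delta>" "\<delta> \<le> \<epsilon>/2" "e \<in> {1, -1}"
        "homotopic_loops punctured_torus c (\<lambda>s. torus_cover (d + of_real \<delta> * cis (e * (2 * pi * s))))"
      using circ[of "\<epsilon>/2"] \<epsilon> by auto
    have nl: "z \<notin> \<Lambda>" if "dist z d \<le> \<delta>" for z
    proof
      assume "z \<in> \<Lambda>"
      moreover have "z \<in> ball d \<epsilon>" using that \<delta> \<epsilon> by (simp add: dist_commute)
      ultimately show False using d(2) \<epsilon>(2) False by blast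
    qed
    have "homotopic_loops punctured_torus (\<lambda>s. torus_cover (d + of_real \<delta> * cis (e * (2 * pi * s)))) (\<lambda>s. torus_cover d)"
      unfolding homotopic_loops
    proof (intro exI[of _ "\<lambda>y. torus_cover (d + of_real ((1 - fst y) * \<delta>) * cis (e * (2 * pi * snd y)))"] conjI)
      show "continuous_on ({0..1} \<times> {0..1}) (\<lambda>y. torus_cover (d + of_real ((1 - fst y) * \<delta>) * cis (e * (2 * pi * snd y))))"
        by (intro continuous_on_compose2[OF continuous_on_torus_cover[of UNIV]] continuous_intros) auto
      have "torus_cover (d + of_real ((1 - u) * \<delta>) * cis x) \<in> punctured_torus" if "u \<in> {0..1}" for u x
      proof -
        have "(1 - u) * \<delta> \<le> 1 * \<delta>" using that \<delta> by (intro mult_right_mono) auto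
        then have "dist (d + of_real ((1 - u) * \<delta>) * cis x) d \<le> \<delta>" using that \<delta> 
          by (simp add: dist_norm norm_mult del: of_real_mult of_real_diff)
        then show ?thesis using nl by (auto simp: torus_cover_in_punctured_torus \<Lambda>_def)
      qed
      then show "(\<lambda>y. torus_cover (d + of_real ((1 - fst y) * \<delta>) * cis (e * (2 * pi * snd y)))) \<in> {0..1} \<times> {0..1} \<rightarrow> punctured_torus"
        by auto
      have "cis (e * (2 * pi)) = 1" using \<delta>(3) by (auto simp: cis_cnj[symmetric])
      then show "\<forall>t\<in>{0..1}. pathfinish ((\<lambda>y. torus_cover (d + of_real ((1 - fst y) * \<delta>) * cis (e * (2 * pi * snd y)))) \<circ> Pair t) =
          pathstart ((\<lambda>y. torus_cover (d + of_real ((1 - fst y) * \<delta>) * cis (e * (2 * pi * snd y)))) \<circ> Pair t)"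
        by (auto simp: pathfinish_def pathstart_def)
    qed auto
    then have "homotopic_loops punctured_torus c (\<lambda>s. torus_cover d)" using \<delta>(4) homotopic_loops_trans by blast
    then show ?thesis unfolding trivial_loop_def by blast
  qed
qed

lemma annulus_cover_mult:
  "z \<noteq> 0 \<Longrightarrow> annulus_cover (z / of_real (exp (2 * pi) powi n)) = annulus_cover z"
proof -
  assume z: "z \<noteq> 0"
  have e: "exp (2 * pi) powi n = exp (of_int n * (2 * pi))"
    by (simp add: exp_power_int)
  have "ln (norm (z / of_real (exp (2 * pi) powi n))) = ln (norm z) - of_int n * (2 * pi)"
    using z by (simp only: e norm_divide norm_of_real abs_exp_cancel) (simp add: ln_div)
  then have "cis (ln (norm (z / of_real (exp (2 * pi) powi n)))) = cis (ln (norm z)) / cis (2 * pi * of_int n)"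
    by (simp add: cis_divide mult_ac)
  moreover have "sgn (z / of_real (exp (2 * pi) powi n)) = sgn z"
    by (simp add: sgn_eq e norm_divide del: of_real_exp)
  ultimately show ?thesis by (simp add: annulus_cover_def)
qed

lemma annulus_cover_eq_puncture:
  assumes "z \<noteq> 0" shows "annulus_cover z = (1, 1) \<longleftrightarrow> (\<exists>n::int. z = of_real (exp (2 * pi) powi n))"
proof
  assume "annulus_cover z = (1, 1)"
  then have *: "sgn z = 1" "cis (ln (norm z)) = 1" by (auto simp: annulus_cover_def)
  then obtain n :: int where "ln (norm z) = 2 * pi * of_int n" by (auto simp: cis_eq_1)
  then have "norm z = exp (of_int n * (2 * pi))" using assms by (metis exp_ln zero_less_norm_iff mult.commute)
  also have "\<dots> = exp (2 * pi) powi n" by (simp add: exp_power_int)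
  finally have "norm z = exp (2 * pi) powi n" .
  moreover have "z = of_real (norm z)" using *(1) assms by (simp add: sgn_eq)
  ultimately show "\<exists>n::int. z = of_real (exp (2 * pi) powi n)" by metis
next
  assume "\<exists>n::int. z = of_real (exp (2 * pi) powi n)"
  then obtain n :: int where n: "z = of_real (exp (2 * pi) powi n)" by blast
  have "annulus_cover z = annulus_cover (z / of_real (exp (2 * pi) powi n))" using annulus_cover_mult[OF assms] by simp
  also have "z / of_real (exp (2 * pi) powi n) = 1" using n assms by simp
  finally show "annulus_cover z = (1, 1)" by (simp add: annulus_cover_def)
qed

lemma annulus_cover_maps: "z \<in> punctures_complement (exp (2 * pi)) \<longleftrightarrow> z \<noteq> 0 \<and> annulus_cover z \<in> punctured_torus"
  using annulus_cover_eq_puncture[of z]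
  by (auto simp: punctures_complement_def punctured_torus_iff annulus_cover_def norm_sgn)

lemma continuous_on_annulus_cover: "0 \<notin> S \<Longrightarrow> continuous_on S annulus_cover"
  unfolding annulus_cover_def by (intro continuous_intros) auto

text \<open>In the annular cover the lift \<open>g\<close> is closed, winds around 0 and, as
  \<open>c\<close> is simple, is disjoint from its multiples by nontrivial powers of
  \<open>r\<close>. \<open>simple_loop_around_annulus\<close> straightens it to a circle; the
  divisor \<open>r powi n\<close> disappears under the covering map, and the height
  \<open>ln R\<close>, strictly between 0 and \<open>2 * pi\<close>, can be moved to
  \<open>pi\<close>.\<close>

lemma horizontal_simple_loop:
  fixes v :: "int^2"
  assumes c: "loop_in punctured_torus c" "simple_path c" and h: "homology_class c v" and v: "v$1 \<noteq> 0" "v$2 = 0"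
  obtains e :: int where "e \<in> {1, -1}" "homotopic_loops punctured_torus c (\<lambda>s. (cis (of_int e * (2 * pi * s)), -1))"
proof -
  obtain b1 b2 and v' :: "int^2" where b: "continuous_on {0..1} b1" "continuous_on {0..1} b2"
    "\<And>s. s \<in> {0..1} \<Longrightarrow> c s = (cis (b1 s), cis (b2 s))"
    "b1 1 - b1 0 = 2 * pi * of_int (v'$1)" "b2 1 - b2 0 = 2 * pi * of_int (v'$2)" "homology_class c v'"
    using torus_loop_angles[OF c(1)] by blast
  have v': "v' = v" using homology_class_unique[OF b(6) h] .
  define g where "g = (\<lambda>s. exp (Complex (b2 s) (b1 s)))"
  have ng: "norm (g s) = exp (b2 s)" "g s \<noteq> 0" for s by (simp_all add: g_def)
  have sg: "sgn (g s) = cis (b1 s)" for s by (simp add: sgn_eq g_def exp_eq_polar norm_mult)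
  have cg: "annulus_cover (g s) = c s" if "s \<in> {0..1}" for s
    using b(3)[OF that] ng(1)[of s] sg[of s] by (simp add: annulus_cover_def)
  have cT: "c s \<in> punctured_torus" if "s \<in> {0..1}" for s using c(1) that by (auto simp: loop_in_def path_image_def)
  have pg: "path g" unfolding g_def path_def Complex_eq by (intro continuous_intros b(1,2))
  have gl: "pathfinish g = pathstart g"
  proof -
    have "b2 1 = b2 0" "b1 1 = b1 0 + 2 * pi * of_int (v$1)" using b(4,5) v by (simp_all add: v')
    then show ?thesis by (simp add: g_def pathfinish_def pathstart_def exp_eq_polar flip: cis_mult)
  qed
  have inj: "s = t \<or> s = 0 \<and> t = 1 \<or> s = 1 \<and> t = 0" if "s \<in> {0..1}" "t \<in> {0..1}" "c s = c t" for s t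
    using c(2) that unfolding simple_path_def loop_free_def by blast
  have gs: "simple_path g" unfolding simple_path_def loop_free_def using pg inj cg by metis
  have g0: "0 \<notin> path_image g" using ng(2) by (auto simp: path_image_def)
  have wg: "winding_number g 0 = of_int (v$1)"
  proof -
    have "g = exp \<circ> (\<lambda>s. Complex (b2 s) (b1 s))" by (auto simp: g_def)
    moreover have "path (\<lambda>s. Complex (b2 s) (b1 s))" unfolding path_def Complex_eq by (intro continuous_intros b(1,2))
    ultimately have "winding_number g 0 = (Complex (b2 1) (b1 1) - Complex (b2 0) (b1 0)) / (2 * of_real pi * \<i>)"
      using winding_number_compose_exp by (simp add: pathfinish_def pathstart_def)
    also have "Complex (b2 1) (b1 1) - Complex (b2 0) (b1 0) = 2 * of_real pi * \<i> * of_int (v$1)"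
      using b(4,5) v by (simp add: complex_eq_iff v')
    finally show ?thesis by simp
  qed
  have in0: "0 \<in> inside (path_image g)"
    by (rule winding_number_nonzero_in_inside[OF gs gl g0]) (simp add: wg v)
  define r where "r = exp (2 * pi)"
  have r: "r > 1" by (simp add: r_def)
  have disj: "g s \<noteq> of_real (r powi n) * g t" if st: "s \<in> {0..1}" "t \<in> {0..1}" and n: "n \<noteq> 0" for s t and n :: int
  proof
    assume eq: "g s = of_real (r powi n) * g t"
    have rn: "r powi n > 0" using r by simp
    have "annulus_cover (g s / of_real (r powi n)) = annulus_cover (g s)" unfolding r_def by (rule annulus_cover_mult[OF ng(2)])
    moreover have "g s / of_real (r powi n) = g t" using eq r by auto
    ultimately have "c s = c t" using cg st by metis
    then have "g s = g t" using inj[OF st] gl by (auto simp: pathfinish_def pathstart_def)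
    then have "complex_of_real (r powi n) = 1" using eq ng(2)[of t] by simp
    then have "r powi n = 1" by (metis of_real_eq_1_iff)
    then have "exp (of_int n * (2 * pi)) = 1" by (simp add: r_def exp_power_int)
    then show False using n by simp
  qed
  have av: "path_image g \<subseteq> punctures_complement r" 
    using cg cT ng(2) by (auto simp: r_def annulus_cover_maps path_image_def)
  obtain n :: int and R e where R: "e \<in> {1, -1}" "1 < R" "R < r"
    "homotopic_loops (punctures_complement r) (\<lambda>s. g s / of_real (r powi n)) (\<lambda>s. of_real R * cis (e * (2 * pi * s)))"
    by (rule simple_loop_around_annulus[OF gs gl in0 r disj av])
  have h2: "homotopic_loops punctured_torus (annulus_cover \<circ> (\<lambda>s. g s / of_real (r powi n))) (annulus_cover \<circ> (\<lambda>s. of_real R * cis (e * (2 * pi * s))))"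
    by (rule homotopic_loops_continuous_image[OF R(4)])
      (auto simp: r_def annulus_cover_maps intro!: continuous_on_annulus_cover)
  have h3: "annulus_cover \<circ> (\<lambda>s. of_real R * cis (e * (2 * pi * s))) = (\<lambda>s. (cis (e * (2 * pi * s)), cis (ln R)))"
    using R(2) by (auto simp: annulus_cover_def fun_eq_iff sgn_eq norm_mult)
  have h1: "homotopic_loops punctured_torus c (annulus_cover \<circ> (\<lambda>s. g s / of_real (r powi n)))"
    using c(1) cg annulus_cover_mult[OF ng(2)] by (intro homotopic_loops_eq) (auto simp: loop_in_def r_def)
  have h1: "homotopic_loops punctured_torus c (\<lambda>s. (cis (e * (2 * pi * s)), cis (ln R)))"
    using homotopic_loops_trans[OF h1 h2] unfolding h3 .
  have lnR: "0 < ln R" "ln R < 2 * pi" 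
  proof -
    show "0 < ln R" using R(2) by simp
    have "ln R < ln r" using R(2,3) by simp
    then show "ln R < 2 * pi" by (simp add: r_def)
  qed
  have "homotopic_loops punctured_torus (\<lambda>s. (cis (e * (2 * pi * s)), cis (ln R))) (\<lambda>s. (cis (e * (2 * pi * s)), -1))"
    unfolding homotopic_loops
  proof (intro exI[of _ "\<lambda>y. (cis (e * (2 * pi * snd y)), cis ((1 - fst y) * ln R + fst y * pi))"] conjI)
    show "continuous_on ({0..1} \<times> {0..1}) (\<lambda>y. (cis (e * (2 * pi * snd y)), cis ((1 - fst y) * ln R + fst y * pi)))"
      by (intro continuous_intros)
    have "cis ((1 - u) * ln R + u * pi) \<noteq> 1" if u: "u \<in> {0..1}" for u
    proof
      assume "cis ((1 - u) * ln R + u * pi) = 1"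
      then obtain n :: int where n: "(1 - u) * ln R + u * pi = 2 * pi * of_int n" by (auto simp: cis_eq_1)
      have "(1 - u) * ln R + u * pi > 0" using u lnR(1) by (cases "u = 0") (auto intro: add_nonneg_pos)
      moreover have "(1 - u) * ln R + u * pi < 2 * pi"
      proof (cases "u = 0")
        case False
        have "(1 - u) * ln R \<le> (1 - u) * (2 * pi)" using u lnR(2) by (intro mult_left_mono) auto
        moreover have "u * pi > 0" using False u by simp
        ultimately show ?thesis by (simp add: algebra_simps)
      qed (use lnR in auto)
      ultimately have "0 < 2 * pi * real_of_int n" "2 * pi * real_of_int n < 2 * pi * 1" using n by auto
      then have "0 < real_of_int n" "real_of_int n < 1" by (simp_all add: zero_less_mult_iff mult_less_cancel_left_pos)
      then have "0 < n" "n < 1" by simp_all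
      then show False by simp
    qed
    then show "(\<lambda>y. (cis (e * (2 * pi * snd y)), cis ((1 - fst y) * ln R + fst y * pi))) \<in> {0..1} \<times> {0..1} \<rightarrow> punctured_torus"
      by (auto simp: punctured_torus_iff)
    have "cis (e * (2 * pi)) = 1" using R(1) by (auto simp: cis_cnj[symmetric])
    then show "\<forall>t\<in>{0..1}. pathfinish ((\<lambda>y. (cis (e * (2 * pi * snd y)), cis ((1 - fst y) * ln R + fst y * pi))) \<circ> Pair t) =
      pathstart ((\<lambda>y. (cis (e * (2 * pi * snd y)), cis ((1 - fst y) * ln R + fst y * pi))) \<circ> Pair t)"
      by (auto simp: pathfinish_def pathstart_def)
  qed auto
  then have h2: "homotopic_loops punctured_torus c (\<lambda>s. (cis (e * (2 * pi * s)), -1))" using h1 homotopic_loops_trans by blast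
  obtain e' :: int where "e' \<in> {1, -1}" "e = of_int e'" using R(1) by (metis insertE empty_iff insertI1 insertI2 of_int_1 of_int_minus)
  then show ?thesis using that h2 by blast
qed

section \<open>The linear action of the modular group\<close>

lemma torus_linear_cis:
  "torus_linear B (cis x, cis y) = (cis (of_int (B$1$1) * x + of_int (B$1$2) * y), cis (of_int (B$2$1) * x + of_int (B$2$2) * y))"
  by (simp add: torus_linear_def cis_power_int cis_mult)

lemma punctured_torus_cisE:
  assumes "p \<in> punctured_torus" obtains x y where "p = (cis x, cis y)"
proof -
  have "fst p = cis (Arg (fst p))" "snd p = cis (Arg (snd p))"
    using assms cis_Arg[of "fst p"] cis_Arg[of "snd p"] by (auto simp: punctured_torus_iff sgn_eq) (force simp: sgn_eq)+
  then show ?thesis using that by (metis prod.collapse)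
qed

lemma torus_linear_mult:
  assumes "p \<in> punctured_torus"
  shows "torus_linear (A ** B) p = torus_linear A (torus_linear B p)"
proof -
  obtain x y where p: "p = (cis x, cis y)" using punctured_torus_cisE[OF assms] .
  show ?thesis unfolding p torus_linear_cis
    by (simp add: matrix_matrix_mult_def sum_2 algebra_simps)
qed

lemma torus_linear_mat_1: "torus_linear (mat 1) p = p"
  by (cases p) (simp add: torus_linear_def mat_def)

lemma det_1_inverse:
  fixes B :: "int^2^2"
  assumes "det B = 1"
  obtains B' where "B ** B' = mat 1" "B' ** B = mat 1" "det B' = 1"
proof
  let ?B = "vector [vector [B$2$2, - B$1$2], vector [- B$2$1, B$1$1]] :: int^2^2"
  show "B ** ?B = mat 1" "?B ** B = mat 1" "det ?B = 1"
    using assms by (auto simp: matrix_matrix_mult_def vec_eq_iff forall_2 sum_2 mat_def det_2 algebra_simps)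
qed

lemma torus_linear_in_punctured_torus:
  assumes "det B = 1" "p \<in> punctured_torus"
  shows "torus_linear B p \<in> punctured_torus"
proof -
  obtain B' where B': "B' ** B = mat 1" using det_1_inverse[OF assms(1)] .
  obtain x y where p: "p = (cis x, cis y)" using punctured_torus_cisE[OF assms(2)] .
  have "torus_linear B p \<noteq> (1, 1)"
  proof
    assume eq: "torus_linear B p = (1, 1)"
    have "p = torus_linear B' (torus_linear B p)" using torus_linear_mult[OF assms(2), of B' B] B' torus_linear_mat_1 by simp
    then have "p = (1, 1)" using eq by (simp add: torus_linear_def)
    then show False using assms(2) by (simp add: punctured_torus_iff)
  qed
  then show ?thesis unfolding p torus_linear_cis punctured_torus_iff by simp
qed

lemma continuous_on_torus_linear: "continuous_on punctured_torus (torus_linear B)"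
proof -
  have "continuous_on punctured_torus (\<lambda>p. (fst p powi (B$1$1) * snd p powi (B$1$2), fst p powi (B$2$1) * snd p powi (B$2$2)))"
    by (intro continuous_intros) (auto simp: punctured_torus_iff)
  then show ?thesis by (simp add: torus_linear_def case_prod_unfold)
qed

lemma homotopic_loops_torus_linear:
  assumes "homotopic_loops punctured_torus c d" "det B = 1"
  shows "homotopic_loops punctured_torus (torus_linear B \<circ> c) (torus_linear B \<circ> d)"
  using assms torus_linear_in_punctured_torus
  by (intro homotopic_loops_continuous_image[OF assms(1) continuous_on_torus_linear]) auto

lemma loop_in_torus_linear:
  assumes "loop_in punctured_torus c" "det B = 1"
  shows "loop_in punctured_torus (torus_linear B \<circ> c)"
  using assms homotopic_loops_torus_linear[of c c B] homotopic_loops_refl[of punctured_torus c]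
    homotopic_loops_refl[of punctured_torus "torus_linear B \<circ> c"] by (simp add: loop_in_def)

lemma simple_path_torus_linear:
  assumes "loop_in punctured_torus c" "simple_path c" "det B = 1"
  shows "simple_path (torus_linear B \<circ> c)"
proof (rule simple_path_continuous_image[OF assms(2)])
  show "continuous_on (path_image c) (torus_linear B)"
    using assms(1) by (intro continuous_on_subset[OF continuous_on_torus_linear]) (simp add: loop_in_def)
  obtain B' where B': "B' ** B = mat 1" using det_1_inverse[OF assms(3)] .
  have "torus_linear B' (torus_linear B p) = p" if "p \<in> path_image c" for p
    using that assms(1) torus_linear_mult[of p B' B] B' torus_linear_mat_1 by (auto simp: loop_in_def)
  then show "inj_on (torus_linear B) (path_image c)" by (rule inj_on_inverseI)
qed

lemma homology_class_torus_linear: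
  assumes c: "loop_in punctured_torus c" and h: "homology_class c v"
  shows "homology_class (torus_linear B \<circ> c) (B *v v)"
proof -
  obtain b1 b2 and v' :: "int^2" where b: "continuous_on {0..1} b1" "continuous_on {0..1} b2"
    "\<And>s. s \<in> {0..1} \<Longrightarrow> c s = (cis (b1 s), cis (b2 s))"
    "b1 1 - b1 0 = 2 * pi * of_int (v'$1)" "b2 1 - b2 0 = 2 * pi * of_int (v'$2)" "homology_class c v'"
    using torus_loop_angles[OF c(1)] by blast
  have v': "v' = v" using homology_class_unique[OF b(6) h] .
  have e: "b1 1 = b1 0 + 2 * pi * of_int (v$1)" "b2 1 = b2 0 + 2 * pi * of_int (v$2)" using b(4,5) v' by simp_all
  show ?thesis
  proof (rule homology_classI)
    show "continuous_on {0..1} (\<lambda>s. of_int (B$1$1) * b1 s + of_int (B$1$2) * b2 s)"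
      "continuous_on {0..1} (\<lambda>s. of_int (B$2$1) * b1 s + of_int (B$2$2) * b2 s)"
      by (intro continuous_intros b(1,2))+
    show "(torus_linear B \<circ> c) s = (cis (of_int (B$1$1) * b1 s + of_int (B$1$2) * b2 s), cis (of_int (B$2$1) * b1 s + of_int (B$2$2) * b2 s))"
      if "s \<in> {0..1}" for s using b(3)[OF that] by (simp add: torus_linear_cis)
  qed (simp_all add: e matrix_vector_mult_def sum_2 algebra_simps)
qed

lemma homology_class_exists:
  assumes "loop_in punctured_torus c" obtains v where "homology_class c v"
  using torus_loop_angles[OF assms] by metis

section \<open>Classification of essential simple closed curves\<close>

text \<open>The horizontal circle runs at height \<open>pi\<close>, where the second coordinate is
  -1, and so avoids the puncture. The class of its image is the first column of
  \<open>B\<close>.\<close>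

definition standard_loop :: "int^2^2 \<Rightarrow> real \<Rightarrow> complex \<times> complex" where
  "standard_loop B = torus_linear B \<circ> (\<lambda>s. (cis (2 * pi * s), -1))"

lemma loop_in_horizontal: "e \<in> {1, -1} \<Longrightarrow> loop_in punctured_torus (\<lambda>s. (cis (of_int e * (2 * pi * s)), -1))"
proof -
  assume e: "e \<in> {1, -1 :: int}"
  have "cis (of_int e * (2 * pi)) = 1" using e by (auto simp: cis_cnj[symmetric])
  then show ?thesis
    by (auto simp: loop_in_def path_def path_image_def punctured_torus_iff pathfinish_def pathstart_def intro!: continuous_intros)
qed

lemma loop_in_standard_loop: "det B = 1 \<Longrightarrow> loop_in punctured_torus (standard_loop B)"
  unfolding standard_loop_def using loop_in_torus_linear loop_in_horizontal[of 1] by simp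

lemma homology_class_standard_loop: "det B = 1 \<Longrightarrow> homology_class (standard_loop B) (column 1 B)"
proof -
  assume B: "det B = 1"
  have "homology_class (\<lambda>s. (cis (2 * pi * s), -1)) (vector [1, 0])"
    by (rule homology_classI[of "\<lambda>s. 2 * pi * s" "\<lambda>s. pi"]) (auto intro!: continuous_intros)
  then have "homology_class (standard_loop B) (B *v vector [1, 0])" unfolding standard_loop_def
    using homology_class_torus_linear loop_in_horizontal[of 1] by simp
  moreover have "B *v vector [1, 0] = column 1 B"
    by (simp add: vec_eq_iff forall_2 matrix_vector_mult_def sum_2 column_def)
  ultimately show ?thesis by simp
qed

lemma torus_linear_standard_loop: "torus_linear A \<circ> standard_loop B = standard_loop (A ** B)"
  unfolding standard_loop_def
  by (auto simp: fun_eq_iff punctured_torus_iff torus_linear_mult)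

text \<open>A trivial or peripheral loop can be moved into a ball of radius 1/2 around a point whose
  coordinates have norm at least 1; each coordinate then stays in a disc that misses 0.\<close>

lemma homology_class_zero_if_not_essential:
  assumes c: "loop_in punctured_torus c" and h: "homology_class c v" and t: "trivial_loop c \<or> peripheral_loop c"
  shows "v = 0"
proof -
  obtain d z where d: "homotopic_loops punctured_torus c d" "path_image d \<subseteq> ball z (1/2)" "norm (fst z) \<ge> 1" "norm (snd z) \<ge> 1"
  proof (cases "trivial_loop c")
    case True
    then obtain x where x: "homotopic_loops punctured_torus c (\<lambda>s. x)" by (auto simp: trivial_loop_def)
    then have "x \<in> punctured_torus" using homotopic_loops_imp_subset by (fastforce simp: path_image_def)
    then show ?thesis using x by (intro that[of "\<lambda>s. x" x]) (auto simp: path_image_def punctured_torus_iff)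
  next
    case False
    then have "peripheral_loop c" using t by blast
    then obtain d where "homotopic_loops punctured_torus c d" "path_image d \<subseteq> ball (1, 1) (1/2)"
      unfolding peripheral_loop_def by (metis half_gt_zero zero_less_one)
    then show ?thesis by (intro that[of d "(1, 1)"]) auto
  qed
  have ld: "path d" "pathfinish d = pathstart d" using homotopic_loops_imp_path[OF d(1)] homotopic_loops_imp_loop[OF d(1)] by auto
  have *: "winding_number (p \<circ> d) 0 = 0" if p: "p = fst \<or> p = snd" for p :: "complex \<times> complex \<Rightarrow> complex"
  proof (rule winding_number_zero_outside[of _ "ball (p z) (1/2)"])
    show "path (p \<circ> d)" using ld p by (intro path_continuous_image) (auto intro!: continuous_intros)
    show "pathfinish (p \<circ> d) = pathstart (p \<circ> d)" using ld by (simp add: pathfinish_compose pathstart_compose)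
    show "0 \<notin> ball (p z) (1/2)" using p d(3,4) by auto
    have "p y \<in> ball (p z) (1/2)" if "y \<in> path_image d" for y
    proof -
      have "dist (p z) (p y) \<le> dist z y" using p dist_fst_le[of z y] dist_snd_le[of z y] by auto
      also have "dist z y < 1/2" using d(2) that by auto
      finally show ?thesis by simp
    qed
    then show "path_image (p \<circ> d) \<subseteq> ball (p z) (1/2)" unfolding path_image_compose by blast
  qed auto
  have "homology_class d v" using h homology_class_homotopic[OF d(1)] by simp
  then show "v = 0" using *[of fst] *[of snd] by (auto simp: homology_class_def vec_eq_iff forall_2)
qed

lemma essential_scc_standard_loop: "det B = 1 \<Longrightarrow> essential_scc (standard_loop B)"
proof -
  assume B: "det B = 1"
  have "simple_path (\<lambda>s. (cis (2 * pi * s), -1::complex))"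
    unfolding simple_path_def loop_free_def
  proof (intro conjI ballI impI)
    show "path (\<lambda>s. (cis (2 * pi * s), -1::complex))" unfolding path_def by (intro continuous_intros)
    fix s t :: real assume st: "s \<in> {0..1}" "t \<in> {0..1}" "(cis (2 * pi * s), -1::complex) = (cis (2 * pi * t), -1)"
    then have "cis (2 * pi * s - 2 * pi * t) = 1" by (simp add: cis_divide[symmetric])
    then obtain n :: int where "2 * pi * (s - t) = 2 * pi * of_int n" by (auto simp: cis_eq_1 algebra_simps)
    then have n: "s - t = of_int n" by simp
    then have "-1 \<le> real_of_int n" "real_of_int n \<le> 1" using st by auto
    then have "-1 \<le> n" "n \<le> 1" by linarith+
    then have "n = -1 \<or> n = 0 \<or> n = 1" by arith
    then show "s = t \<or> s = 0 \<and> t = 1 \<or> s = 1 \<and> t = 0" using n st by auto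
  qed
  then have s: "simple_path (standard_loop B)" unfolding standard_loop_def
    using simple_path_torus_linear loop_in_horizontal[of 1] B by simp
  have "column 1 B \<noteq> 0"
  proof
    assume "column 1 B = 0"
    then have "B$1$1 = 0" "B$2$1 = 0" by (auto simp: column_def vec_eq_iff forall_2)
    then show False using B by (simp add: det_2)
  qed
  then show ?thesis unfolding essential_scc_def
    using s loop_in_standard_loop[OF B] homology_class_zero_if_not_essential homology_class_standard_loop[OF B] by blast
qed

text \<open>The class \<open>v\<close> is nonzero by \<open>null_homologous_simple_loop\<close>, and
  Bezout coefficients of its entries give a unimodular \<open>A\<close> that makes it horizontal.
  After straightening, the inverse of \<open>A\<close> returns a standard loop; the orientation sign
  \<open>e\<close> is absorbed by the scalar matrix \<open>E\<close>.\<close>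

theorem essential_scc_homotopic_standard_loop:
  assumes "essential_scc c"
  obtains B where "det B = 1" "homotopic_loops punctured_torus c (standard_loop B)"
proof -
  have c: "loop_in punctured_torus c" "simple_path c" and ne: "\<not> trivial_loop c" "\<not> peripheral_loop c"
    using assms by (auto simp: essential_scc_def)
  obtain v where v: "homology_class c v" using homology_class_exists[OF c(1)] .
  have v0: "v \<noteq> 0" using null_homologous_simple_loop[OF c] v ne by auto
  define k where "k = gcd (v$1) (v$2)"
  have k: "k > 0" using v0 by (auto simp: k_def vec_eq_iff forall_2 gcd_pos_int)
  obtain u w where uw: "u * (v$1) + w * (v$2) = k" unfolding k_def using bezout_int by blast
  obtain p q where pq: "v$1 = k * p" "v$2 = k * q" unfolding k_def by (metis dvdE gcd_dvd1 gcd_dvd2)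
  have "k * (u * p + w * q) = k * 1" using uw pq by (simp add: algebra_simps)
  then have uwpq: "u * p + w * q = 1" using k by (metis mult_cancel_left less_irrefl)
  define A where "A = (vector [vector [u, w], vector [- q, p]] :: int^2^2)"
  have A: "det A = 1" using uwpq by (simp add: A_def det_2 algebra_simps)
  have Av: "(A *v v)$1 = k" "(A *v v)$2 = 0"
    using uw pq by (simp_all add: A_def matrix_vector_mult_def sum_2)
  obtain e :: int where e: "e \<in> {1, -1}" "homotopic_loops punctured_torus (torus_linear A \<circ> c) (\<lambda>s. (cis (of_int e * (2 * pi * s)), -1))"
    using horizontal_simple_loop[OF loop_in_torus_linear[OF c(1) A] simple_path_torus_linear[OF c A] homology_class_torus_linear[OF c(1) v]] Av k
    by (metis less_irrefl)
  obtain A' where A': "A' ** A = mat 1" "det A' = 1" using det_1_inverse[OF A] by metis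
  have "homotopic_loops punctured_torus (torus_linear A' \<circ> (torus_linear A \<circ> c)) (torus_linear A' \<circ> (\<lambda>s. (cis (of_int e * (2 * pi * s)), -1)))"
    by (rule homotopic_loops_torus_linear[OF e(2) A'(2)])
  moreover have "homotopic_loops punctured_torus c (torus_linear A' \<circ> (torus_linear A \<circ> c))"
    using c(1) torus_linear_mult[of _ A' A] A'(1) torus_linear_mat_1
    by (intro homotopic_loops_eq) (auto simp: loop_in_def path_image_def subset_eq)
  ultimately have h: "homotopic_loops punctured_torus c (torus_linear A' \<circ> (\<lambda>s. (cis (of_int e * (2 * pi * s)), -1)))"
    using homotopic_loops_trans by blast
  define E where "E = (vector [vector [e, 0], vector [0, e]] :: int^2^2)"
  have E: "det E = 1" using e(1) by (auto simp: E_def det_2)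
  have "(\<lambda>s. (cis (of_int e * (2 * pi * s)), -1)) = standard_loop E"
    using e(1) by (auto simp: standard_loop_def E_def torus_linear_def fun_eq_iff)
  then have "homotopic_loops punctured_torus c (standard_loop (A' ** E))" using h by (simp add: torus_linear_standard_loop)
  moreover have "det (A' ** E) = 1" using A' E by (simp add: det_mul)
  ultimately show ?thesis using that by blast
qed

text \<open>If the first columns agree, \<open>B' ** C\<close> is a unipotent shear. On the
  horizontal circle at height \<open>pi\<close> it acts as a rotation by a multiple of
  \<open>pi\<close>, which can be undone continuously.\<close>

lemma standard_loop_homotopic:
  assumes "det B = 1" "det C = 1" "column 1 B = column 1 C"
  shows "homotopic_loops punctured_torus (standard_loop B) (standard_loop C)"
proof -
  obtain B' where B': "B ** B' = mat 1" "B' ** B = mat 1" "det B' = 1" using det_1_inverse[OF assms(1)] .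
  define D where "D = B' ** C"
  have D: "D$1$1 = 1" "D$2$1 = 0"
  proof -
    have col: "C$i$1 = B$i$1" for i using arg_cong[OF assms(3), of "\<lambda>v. v$i"] by (simp add: column_def)
    have "D$i$1 = (B' ** B)$i$1" for i using col by (simp add: D_def matrix_matrix_mult_def)
    then show "D$1$1 = 1" "D$2$1 = 0" using B'(2) by (simp_all add: mat_def)
  qed
  have dD: "det D = 1" using B'(3) assms(2) by (simp add: D_def det_mul)
  then have D22: "D$2$2 = 1" using D by (simp add: det_2)
  have sD: "standard_loop D = (\<lambda>s. (cis (2 * pi * s + of_int (D$1$2) * pi), cis pi))"
  proof
    fix s
    have "(cis (2 * pi * s), -1) = (cis (2 * pi * s), cis pi)" by simp
    then show "standard_loop D s = (cis (2 * pi * s + of_int (D$1$2) * pi), cis pi)"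
      using D D22 torus_linear_cis[of D "2 * pi * s" pi] by (simp add: standard_loop_def)
  qed
  have s1: "standard_loop (mat 1) = (\<lambda>s. (cis (2 * pi * s), -1))" by (auto simp: standard_loop_def torus_linear_mat_1)
  have "homotopic_loops punctured_torus (standard_loop (mat 1)) (standard_loop D)"
    unfolding homotopic_loops
  proof (intro exI[of _ "\<lambda>y. (cis (2 * pi * snd y + fst y * (of_int (D$1$2) * pi)), -1)"] conjI)
    show "continuous_on ({0..1} \<times> {0..1}) (\<lambda>y. (cis (2 * pi * snd y + fst y * (of_int (D$1$2) * pi)), -1::complex))"
      by (intro continuous_intros)
    show "\<forall>t\<in>{0..1}. pathfinish ((\<lambda>y. (cis (2 * pi * snd y + fst y * (of_int (D$1$2) * pi)), -1)) \<circ> Pair t) =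
        pathstart ((\<lambda>y. (cis (2 * pi * snd y + fst y * (of_int (D$1$2) * pi)), -1)) \<circ> Pair t)"
      by (simp add: pathfinish_def pathstart_def flip: cis_mult)
  qed (auto simp: sD s1 punctured_torus_iff)
  then have "homotopic_loops punctured_torus (torus_linear B \<circ> standard_loop (mat 1)) (torus_linear B \<circ> standard_loop D)"
    by (rule homotopic_loops_torus_linear) (rule assms)
  moreover have "B ** D = C" using B'(1) by (simp add: D_def matrix_mul_assoc)
  ultimately show ?thesis by (simp add: torus_linear_standard_loop)
qed

section \<open>Characters of the fibre group\<close>

lemma homotopic_loops_reversepath:
  assumes "homotopic_loops S p q"
  shows "homotopic_loops S (reversepath p) (reversepath q)"
proof -
  obtain h where h: "continuous_on ({0..1::real} \<times> {0..1}) h" "h \<in> {0..1} \<times> {0..1} \<rightarrow> S"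
    "\<forall>x \<in> {0..1}. h(0,x) = p x" "\<forall>x \<in> {0..1}. h(1,x) = q x" "\<forall>t \<in> {0..1}. pathfinish(h \<circ> Pair t) = pathstart(h \<circ> Pair t)"
    using assms unfolding homotopic_loops by blast
  have "continuous_on ({0..1} \<times> {0..1}) (\<lambda>y. h (fst y, 1 - snd y))"
    by (intro continuous_on_compose2[OF h(1)] continuous_intros) auto
  then show ?thesis unfolding homotopic_loops using h(2-5)
    by (intro exI[of _ "\<lambda>y. h (fst y, 1 - snd y)"]) (auto simp: reversepath_def pathfinish_def pathstart_def)
qed

text \<open>The homotopy is a map of the square. In the convex square one edge is homotopic with
  fixed ends to the path along the other three, whose images are the track \<open>\<delta>\<close>
  of the base point, \<open>q\<close>, and \<open>\<delta>\<close> backwards.\<close>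

lemma homotopic_loops_imp_homotopic_paths_conjugate:
  assumes "homotopic_loops S p q"
  obtains \<delta> where "path \<delta>" "path_image \<delta> \<subseteq> S" "pathstart \<delta> = pathstart p" "pathfinish \<delta> = pathstart q"
    "homotopic_paths S p (\<delta> +++ q +++ reversepath \<delta>)"
proof -
  obtain h where h: "continuous_on ({0..1::real} \<times> {0..1}) h" "h \<in> {0..1} \<times> {0..1} \<rightarrow> S"
    "\<forall>x \<in> {0..1}. h(0,x) = p x" "\<forall>x \<in> {0..1}. h(1,x) = q x" "\<forall>t \<in> {0..1}. pathfinish(h \<circ> Pair t) = pathstart(h \<circ> Pair t)"
    using assms unfolding homotopic_loops by blast
  define \<delta> where "\<delta> = (\<lambda>t. h (t, 0))"
  define Q where "Q = ({0..1} \<times> {0..1} :: (real \<times> real) set)"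
  let ?d = "linepath (0,0) (1,0) +++ linepath (1,0) (1,1) +++ linepath (1,1::real) (0::real,1)"
  have Q: "convex Q" unfolding Q_def by (intro convex_Times) auto
  have seg: "closed_segment x y \<subseteq> Q" if "x \<in> Q" "y \<in> Q" for x y using closed_segment_subset[OF that Q] .
  have "simply_connected Q" using Q by (rule convex_imp_simply_connected)
  then have "homotopic_paths Q (linepath (0,0) (0,1)) ?d"
    using seg unfolding simply_connected_eq_homotopic_paths by (auto simp: path_image_join Q_def)
  then have hh: "homotopic_paths S (h \<circ> linepath (0,0) (0,1)) (h \<circ> ?d)"
    by (rule homotopic_paths_continuous_image) (use h(1,2) in \<open>auto simp: Q_def\<close>)
  have e1: "p t = (h \<circ> linepath (0,0) (0,1)) t" if "t \<in> {0..1}" for t using h(3) that by (simp add: linepath_def)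
  have loop: "h (t, 1) = h (t, 0)" if "t \<in> {0..1}" for t using h(5) that by (simp add: pathfinish_def pathstart_def)
  have e2: "(h \<circ> ?d) t = (\<delta> +++ q +++ reversepath \<delta>) t" if "t \<in> {0..1}" for t
    using that h(4) loop unfolding path_compose_join
    by (auto simp: joinpaths_def linepath_def \<delta>_def reversepath_def algebra_simps)
  have "path p" "path_image p \<subseteq> S" using homotopic_loops_imp_path[OF assms] homotopic_loops_imp_subset[OF assms] by auto
  then have "homotopic_paths S p (h \<circ> linepath (0,0) (0,1))" using e1 by (intro homotopic_paths_eq) auto
  moreover have "homotopic_paths S (h \<circ> ?d) (\<delta> +++ q +++ reversepath \<delta>)"
    using homotopic_paths_imp_path[OF hh] homotopic_paths_imp_subset[OF hh] e2 by (intro homotopic_paths_eq) auto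
  ultimately have "homotopic_paths S p (\<delta> +++ q +++ reversepath \<delta>)" using hh homotopic_paths_trans by blast
  moreover have "path \<delta>" unfolding \<delta>_def path_def by (intro continuous_on_compose2[OF h(1)] continuous_intros) auto
  moreover have "path_image \<delta> \<subseteq> S" using h(2) by (auto simp: path_image_def \<delta>_def)
  moreover have "pathstart \<delta> = pathstart p" "pathfinish \<delta> = pathstart q" using h(3,4) by (auto simp: \<delta>_def pathstart_def pathfinish_def)
  ultimately show ?thesis using that by blast
qed

lemma homotopic_paths_conjugate_join:
  fixes S :: "'a::real_normed_vector set"
  assumes d: "path d" "path_image d \<subseteq> S" "pathfinish d = y" and P: "path P" "path_image P \<subseteq> S" "pathstart P = y" "pathfinish P = y"
    and Q: "path Q" "path_image Q \<subseteq> S" "pathstart Q = y" "pathfinish Q = y"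
  shows "homotopic_paths S ((d +++ P +++ reversepath d) +++ (d +++ Q +++ reversepath d)) (d +++ (P +++ Q) +++ reversepath d)"
proof -
  let ?r = "reversepath d"
  note fs = d P Q path_image_join
  have 1: "homotopic_paths S ((d +++ P +++ ?r) +++ (d +++ Q +++ ?r)) (d +++ ((P +++ ?r) +++ (d +++ Q +++ ?r)))"
    by (rule homotopic_paths_sym[OF homotopic_paths_assoc]) (auto simp: fs)
  have 2: "homotopic_paths S ((P +++ ?r) +++ (d +++ Q +++ ?r)) (P +++ (?r +++ (d +++ Q +++ ?r)))"
    by (rule homotopic_paths_sym[OF homotopic_paths_assoc]) (auto simp: fs)
  have 3: "homotopic_paths S (?r +++ (d +++ Q +++ ?r)) ((?r +++ d) +++ (Q +++ ?r))"
    by (rule homotopic_paths_assoc) (auto simp: fs)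
  have 4: "homotopic_paths S ((?r +++ d) +++ (Q +++ ?r)) (linepath y y +++ (Q +++ ?r))"
    using homotopic_paths_linv[OF d(1,2)] d(3) by (intro homotopic_paths_join) (auto simp: fs)
  have 5: "homotopic_paths S (linepath y y +++ (Q +++ ?r)) (Q +++ ?r)"
    by (rule homotopic_paths_lid') (auto simp: fs)
  have 6: "homotopic_paths S (?r +++ (d +++ Q +++ ?r)) (Q +++ ?r)"
    using 3 4 5 homotopic_paths_trans by blast
  have 7: "homotopic_paths S (P +++ (?r +++ (d +++ Q +++ ?r))) (P +++ (Q +++ ?r))"
    by (rule homotopic_paths_join[OF _ 6]) (auto simp: fs)
  have 8: "homotopic_paths S (P +++ (Q +++ ?r)) ((P +++ Q) +++ ?r)"
    by (rule homotopic_paths_assoc) (auto simp: fs)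
  have 9: "homotopic_paths S ((P +++ ?r) +++ (d +++ Q +++ ?r)) ((P +++ Q) +++ ?r)"
    using 2 7 8 homotopic_paths_trans by blast
  have 10: "homotopic_paths S (d +++ ((P +++ ?r) +++ (d +++ Q +++ ?r))) (d +++ ((P +++ Q) +++ ?r))"
    by (rule homotopic_paths_join[OF _ 9]) (auto simp: fs)
  show ?thesis using 1 10 homotopic_paths_trans by blast
qed

section \<open>Trace identities for matrices of size 2\<close>

lemma trace_2: "trace (A :: 'a::semiring_1^2^2) = A$1$1 + A$2$2"
  by (simp add: trace_def sum_2)

lemma matrix_2_eq_iff: "(A :: 'a^2^2) = B \<longleftrightarrow> A$1$1 = B$1$1 \<and> A$1$2 = B$1$2 \<and> A$2$1 = B$2$1 \<and> A$2$2 = B$2$2"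
  by (auto simp: vec_eq_iff forall_2)

lemma matrix_mult_2: "(A ** (B :: 'a::semiring_1^2^2))$i$j = A$i$1 * B$1$j + A$i$2 * B$2$j"
  by (simp add: matrix_matrix_mult_def sum_2)

lemma right_inverse_2:
  fixes A B :: "'a::comm_ring_1^2^2"
  assumes "det A = 1" "A ** B = mat 1"
  shows "B$1$1 = A$2$2" "B$1$2 = - A$1$2" "B$2$1 = - A$2$1" "B$2$2 = A$1$1"
proof -
  let ?A = "vector [vector [A$2$2, - A$1$2], vector [- A$2$1, A$1$1]] :: 'a^2^2"
  have "?A ** A = mat 1" using assms(1) by (simp add: matrix_2_eq_iff matrix_mult_2 mat_def det_2 algebra_simps)
  then have "B = (?A ** A) ** B" by simp
  also have "\<dots> = ?A ** (A ** B)" by (simp only: matrix_mul_assoc)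
  also have "\<dots> = ?A" using assms(2) by simp
  finally have "B = ?A" .
  then show "B$1$1 = A$2$2" "B$1$2 = - A$1$2" "B$2$1 = - A$2$1" "B$2$2 = A$1$1" by simp_all
qed

text \<open>Cayley-Hamilton: \<open>B + B'\<close> is \<open>trace B\<close> times the identity;
  multiply by \<open>A\<close> and take traces.\<close>

lemma trace_mult_add_trace_mult_inverse:
  fixes A B B' :: "'a::comm_ring_1^2^2"
  assumes "det B = 1" "B ** B' = mat 1"
  shows "trace (A ** B) + trace (A ** B') = trace A * trace B"
  using right_inverse_2[OF assms] by (simp add: trace_2 matrix_mult_2 algebra_simps)

text \<open>Fricke's identity. Multiplying the terms of lower degree by the determinants, which are
  1, makes it homogeneous, a polynomial identity in the eight entries.\<close>

lemma trace_commutator: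
  fixes A B A' B' :: "complex^2^2"
  assumes "det A = 1" "det B = 1" "A ** A' = mat 1" "B ** B' = mat 1"
  shows "trace ((A ** B) ** (A' ** B')) =
    (trace A)^2 + (trace B)^2 + (trace (A ** B))^2 - trace A * trace B * trace (A ** B) - 2"
proof -
  have *: "(a*e+b*g)*(d*h+b*g) + (a*f+b*h)*(-c*h-a*g) + (c*e+d*g)*(-d*f-b*e) + (c*f+d*h)*(c*f+a*e) =
    (a+d)^2 + (e+h)^2 + (a*e+b*g+c*f+d*h)^2 - (a+d)*(e+h)*(a*e+b*g+c*f+d*h) - 2"
    if "a*d - b*c = 1" "e*h - f*g = 1" for a b c d e f g h :: complex
  proof -
    have "(a*e+b*g)*(d*h+b*g) + (a*f+b*h)*(-c*h-a*g) + (c*e+d*g)*(-d*f-b*e) + (c*f+d*h)*(c*f+a*e) -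
     ((a+d)^2 * (e*h - f*g) + (e+h)^2 * (a*d - b*c) + (a*e+b*g+c*f+d*h)^2 - (a+d)*(e+h)*(a*e+b*g+c*f+d*h) - 2 * (a*d - b*c) * (e*h - f*g)) = 0"
      by algebra
    then show ?thesis using that by simp
  qed
  have d: "A$1$1 * A$2$2 - A$1$2 * A$2$1 = 1" "B$1$1 * B$2$2 - B$1$2 * B$2$1 = 1" using assms(1,2) by (simp_all add: det_2)
  show ?thesis using *[OF d] unfolding trace_2 matrix_mult_2 right_inverse_2[OF assms(1,3)] right_inverse_2[OF assms(2,4)]
    by (simp add: algebra_simps)
qed

section \<open>Matrices and traces attached to loops\<close>

lemma SL2_representation_const:
  assumes "SL2_representation M x0 \<rho>" "x0 \<in> M"
  shows "\<rho> (\<lambda>t. x0) = mat 1"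
proof -
  let ?c = "\<lambda>t::real. x0"
  have b: "based_loop M x0 ?c"
    using assms(2) by (auto simp: based_loop_def loop_in_def path_def path_image_def pathstart_def pathfinish_def)
  \<comment> \<open>The constant loop equals its own square, so its matrix is an invertible
    idempotent.\<close>
  have "?c +++ ?c = ?c" by (auto simp: joinpaths_def)
  then have e: "\<rho> ?c ** \<rho> ?c = \<rho> ?c" "det (\<rho> ?c) = 1" using assms(1) b unfolding SL2_representation_def by metis+
  then obtain e' where "e' ** \<rho> ?c = mat 1" using invertible_det_nz[of "\<rho> ?c"] unfolding invertible_def by auto
  then show ?thesis using e(1) by (metis matrix_mul_assoc matrix_mul_lid)
qed

lemma based_loop_reversepath: "based_loop M x0 p \<Longrightarrow> based_loop M x0 (reversepath p)"
  by (auto simp: based_loop_def loop_in_def)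

lemma based_loop_join: "based_loop M x0 p \<Longrightarrow> based_loop M x0 p' \<Longrightarrow> based_loop M x0 (p +++ p')"
  by (auto simp: based_loop_def loop_in_def path_image_join)

text \<open>The loop along \<open>p\<close> and back is contracted in the parameter interval and the
  contraction pushed forward by \<open>p\<close>, because \<open>M\<close> is a set in a bare
  topological space.\<close>

lemma SL2_representation_inverse:
  assumes "SL2_representation M x0 \<rho>" "based_loop M x0 p"
  shows "\<rho> p ** \<rho> (reversepath p) = mat 1"
proof -
  have p: "path p" "path_image p \<subseteq> M" "pathstart p = x0" "pathfinish p = x0" using assms(2) by (auto simp: based_loop_def loop_in_def)
  have x0: "x0 \<in> M" using p pathstart_in_path_image by blast
  define i :: "real \<Rightarrow> real" where "i = (\<lambda>t. t)"
  have i: "path i" "path_image i \<subseteq> {0..1}" by (auto simp: i_def path_def path_image_def intro!: continuous_intros)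
  have "homotopic_paths {0..1} (i +++ reversepath i) (linepath (pathstart i) (pathstart i))"
    by (rule homotopic_paths_rinv[OF i])
  then have "homotopic_paths M (p \<circ> (i +++ reversepath i)) (p \<circ> linepath (pathstart i) (pathstart i))"
    by (rule homotopic_paths_continuous_image) (use p in \<open>auto simp: path_def path_image_def\<close>)
  moreover have "p \<circ> (i +++ reversepath i) = p +++ reversepath p"
    unfolding path_compose_join by (simp add: i_def o_def reversepath_def)
  moreover have "p \<circ> linepath (pathstart i) (pathstart i) = (\<lambda>t. x0)"
    using p(3) by (auto simp: i_def pathstart_def linepath_def)
  ultimately have "homotopic_paths M (p +++ reversepath p) (\<lambda>t. x0)" by simp
  moreover have "based_loop M x0 (p +++ reversepath p)" using assms(2) based_loop_join based_loop_reversepath by blast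
  ultimately have "\<rho> (p +++ reversepath p) = \<rho> (\<lambda>t. x0)" using assms(1) unfolding SL2_representation_def by blast
  then show ?thesis using SL2_representation_const[OF assms(1) x0] assms based_loop_reversepath
    unfolding SL2_representation_def by metis
qed

lemma trace_SL2_representation_homotopic:
  assumes rep: "SL2_representation M x0 \<rho>" and p: "based_loop M x0 p" "based_loop M x0 p'" and h: "homotopic_loops M p p'"
  shows "trace (\<rho> p) = trace (\<rho> p')"
proof -
  obtain d where d: "path d" "path_image d \<subseteq> M" "pathstart d = pathstart p" "pathfinish d = pathstart p'"
    "homotopic_paths M p (d +++ p' +++ reversepath d)"
    using homotopic_loops_imp_homotopic_paths_conjugate[OF h] .
  have bd: "based_loop M x0 d" using d p by (auto simp: based_loop_def loop_in_def)
  have "\<rho> p = \<rho> (d +++ p' +++ reversepath d)" using rep p(1) d(5) unfolding SL2_representation_def by blast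
  also have "\<dots> = \<rho> d ** (\<rho> p' ** \<rho> (reversepath d))"
    using rep bd p(2) based_loop_reversepath[OF bd] based_loop_join unfolding SL2_representation_def by metis
  finally have "trace (\<rho> p) = trace (\<rho> d ** (\<rho> p' ** \<rho> (reversepath d)))" by simp
  also have "\<dots> = trace ((\<rho> p' ** \<rho> (reversepath d)) ** \<rho> d)" by (rule trace_mul_sym)
  also have "(\<rho> p' ** \<rho> (reversepath d)) ** \<rho> d = \<rho> p' ** (\<rho> (reversepath d) ** \<rho> d)" by (simp add: matrix_mul_assoc)
  also have "\<rho> (reversepath d) ** \<rho> d = mat 1" using SL2_representation_inverse[OF rep based_loop_reversepath[OF bd]] by simp
  finally show ?thesis by simp
qed

lemma path_connected_punctured_torus: "path_connected punctured_torus"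
proof -
  define \<Lambda> where "\<Lambda> = {z. torus_cover z = (1, 1)}"
  have "\<Lambda> = (\<Union>n::nat. \<Lambda> \<inter> cball 0 (real n))"
  proof -
    have "\<exists>n::nat. norm z \<le> real n" for z :: complex by (rule real_arch_simple)
    then show ?thesis by fastforce
  qed
  moreover have "countable (\<Union>n::nat. \<Lambda> \<inter> cball 0 (real n))"
    using finite_puncture_lattice[of 0] by (intro countable_UN) (auto simp: \<Lambda>_def countable_finite)
  ultimately have "countable \<Lambda>" by simp
  then have "path_connected (- \<Lambda>)" by (intro path_connected_complement_countable) auto
  then have "path_connected (torus_cover ` (- \<Lambda>))"
    by (intro path_connected_continuous_image continuous_on_torus_cover)
  moreover have "torus_cover ` (- \<Lambda>) = punctured_torus"
  proof
    show "torus_cover ` (- \<Lambda>) \<subseteq> punctured_torus" by (auto simp: torus_cover_in_punctured_torus \<Lambda>_def)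
    show "punctured_torus \<subseteq> torus_cover ` (- \<Lambda>)"
    proof
      fix p assume p: "p \<in> punctured_torus"
      obtain x y where "p = (cis x, cis y)" using punctured_torus_cisE[OF p] .
      then have "p = torus_cover (Complex x y)" by (simp add: torus_cover_def)
      then show "p \<in> torus_cover ` (- \<Lambda>)" using p by (auto simp: \<Lambda>_def punctured_torus_iff)
    qed
  qed
  ultimately show ?thesis by simp
qed

section \<open>Words in the generators as standard loops\<close>

lemma torus_base_in: "torus_base \<in> punctured_torus"
  by (simp add: torus_base_def punctured_torus_iff)

text \<open>Angle functions are interpolated linearly. Equal total increments, which are multiples
  of \<open>2 * pi\<close>, close every intermediate loop.\<close>

lemma homotopic_loops_angles:
  assumes cont: "continuous_on {0..1} b1" "continuous_on {0..1} b2" "continuous_on {0..1} c1" "continuous_on {0..1} c2"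
    and per: "cis (b1 1 - b1 0) = 1" "cis (b2 1 - b2 0) = 1" "c1 1 - c1 0 = b1 1 - b1 0" "c2 1 - c2 0 = b2 1 - b2 0"
    and avoid: "\<And>u s. u \<in> {0..1} \<Longrightarrow> s \<in> {0..1} \<Longrightarrow>
      cis ((1 - u) * b1 s + u * c1 s) \<noteq> 1 \<or> cis ((1 - u) * b2 s + u * c2 s) \<noteq> 1"
  shows "homotopic_loops punctured_torus (\<lambda>s. (cis (b1 s), cis (b2 s))) (\<lambda>s. (cis (c1 s), cis (c2 s)))"
  unfolding homotopic_loops
proof (intro exI[of _ "\<lambda>y. (cis ((1 - fst y) * b1 (snd y) + fst y * c1 (snd y)), cis ((1 - fst y) * b2 (snd y) + fst y * c2 (snd y)))"] conjI ballI)
  show "continuous_on ({0..1} \<times> {0..1}) (\<lambda>y. (cis ((1 - fst y) * b1 (snd y) + fst y * c1 (snd y)), cis ((1 - fst y) * b2 (snd y) + fst y * c2 (snd y))))"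
    by (intro continuous_intros continuous_on_compose2[OF cont(1)] continuous_on_compose2[OF cont(2)]
        continuous_on_compose2[OF cont(3)] continuous_on_compose2[OF cont(4)]) auto
  show "(\<lambda>y. (cis ((1 - fst y) * b1 (snd y) + fst y * c1 (snd y)), cis ((1 - fst y) * b2 (snd y) + fst y * c2 (snd y)))) \<in> {0..1} \<times> {0..1} \<rightarrow> punctured_torus"
    using avoid by (auto simp: punctured_torus_iff)
  fix t :: real assume t: "t \<in> {0..1}"
  have *: "cis ((1 - t) * x1 + t * y1) = cis ((1 - t) * x0 + t * y0)" if "cis (x1 - x0) = 1" "y1 - y0 = x1 - x0" for x0 x1 y0 y1
  proof -
    have "(1 - t) * x1 + t * y1 = ((1 - t) * x0 + t * y0) + (x1 - x0)" using that(2) by (simp add: algebra_simps) (metis add_diff_eq distrib_left diff_add_cancel)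
    then show ?thesis using that(1) by (simp only: cis_mult[symmetric]) simp
  qed
  show "pathfinish ((\<lambda>y. (cis ((1 - fst y) * b1 (snd y) + fst y * c1 (snd y)), cis ((1 - fst y) * b2 (snd y) + fst y * c2 (snd y)))) \<circ> Pair t) =
    pathstart ((\<lambda>y. (cis ((1 - fst y) * b1 (snd y) + fst y * c1 (snd y)), cis ((1 - fst y) * b2 (snd y) + fst y * c2 (snd y)))) \<circ> Pair t)"
    using *[OF per(1,3)] *[OF per(2,4)] by (simp add: pathfinish_def pathstart_def)
qed auto

abbreviation quarter_turn :: "int^2^2" where "quarter_turn \<equiv> vector [vector [0, -1], vector [1, 0]]"
abbreviation shear_up :: "int^2^2" where "shear_up \<equiv> vector [vector [1, 0], vector [1, 1]]"
abbreviation shear_down :: "int^2^2" where "shear_down \<equiv> vector [vector [1, 0], vector [-1, 1]]"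

lemma cis_plus_pi: "cis (x + pi) = - cis x" "cis (pi + x) = - cis x" "cis (x + 2 * pi) = cis x" "cis (2 * pi + x) = cis x"
  "cis (pi * 2) = 1" "cis (- (2 * pi)) = 1" "cis (3 * pi) = -1" "cis (x - pi) = - cis x" "cis (pi - x) = - cis (- x)"
proof -
  have "3 * pi = 2 * pi + pi" by simp
  then show "cis (3 * pi) = -1" by (simp only: cis_mult[symmetric]) simp
  have "pi * 2 = 2 * pi" by simp
  then show "cis (pi * 2) = 1" by (simp only: cis_2pi)
  show "cis (- (2 * pi)) = 1" using cis_cnj[of "2 * pi"] by simp
qed (simp_all add: cis_mult[symmetric] cis_divide[symmetric] divide_inverse)

lemma not_both_multiples:
  assumes "cis x = 1" "cis y = 1" "0 < x - y" "x - y < 2 * pi" shows False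
proof -
  have "cis (x - y) = 1" using assms by (simp add: cis_divide[symmetric])
  then obtain n :: int where n: "x - y = 2 * pi * of_int n" by (auto simp: cis_eq_1)
  then have "0 < 2 * pi * real_of_int n" "2 * pi * real_of_int n < 2 * pi * 1" using assms by auto
  then have "0 < real_of_int n" "real_of_int n < 1" by (simp_all add: zero_less_mult_iff mult_less_cancel_left_pos)
  then have "0 < n" "n < 1" by simp_all
  then show False by simp
qed

lemma loop_a_homotopic: "homotopic_loops punctured_torus loop_a (standard_loop (mat 1))"
proof -
  have "homotopic_loops punctured_torus (\<lambda>s. (cis (2 * pi * s + pi), cis pi)) (\<lambda>s. (cis (2 * pi * s), cis pi))"
    by (rule homotopic_loops_angles[where ?b1.0="\<lambda>s. 2 * pi * s + pi" and ?b2.0="\<lambda>s. pi" and ?c1.0="\<lambda>s. 2 * pi * s" and ?c2.0="\<lambda>s. pi"])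
      (auto intro!: continuous_intros simp: algebra_simps cis_plus_pi)
  then show ?thesis by (simp add: loop_a_def[abs_def] standard_loop_def torus_linear_mat_1 cis_plus_pi o_def)
qed

lemma loop_b_homotopic: "homotopic_loops punctured_torus loop_b (standard_loop quarter_turn)"
proof -
  have "homotopic_loops punctured_torus (\<lambda>s. (cis pi, cis (2 * pi * s + pi))) (\<lambda>s. (cis pi, cis (2 * pi * s)))"
    by (rule homotopic_loops_angles[where ?b2.0="\<lambda>s. 2 * pi * s + pi" and ?b1.0="\<lambda>s. pi" and ?c2.0="\<lambda>s. 2 * pi * s" and ?c1.0="\<lambda>s. pi"])
      (auto intro!: continuous_intros simp: algebra_simps cis_plus_pi)
  then show ?thesis by (simp add: loop_b_def[abs_def] standard_loop_def torus_linear_def cis_plus_pi o_def)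
qed

text \<open>The difference of the two angles of the concatenated loop stays between 0 and
  \<open>2 * pi\<close> and is interpolated to the constant \<open>pi\<close>. For
  \<open>u > 0\<close> it is strictly inside that interval, so the two coordinates cannot both equal
  1; for \<open>u = 0\<close> one of the angles is an odd multiple of \<open>pi\<close>.\<close>

lemma loop_ab_homotopic: "homotopic_loops punctured_torus (loop_a +++ loop_b) (standard_loop shear_up)"
proof -
  define b1 where "b1 = (\<lambda>s::real. min (4 * pi * s + pi) (3 * pi))"
  define b2 where "b2 = (\<lambda>s::real. max pi (4 * pi * s - pi))"
  have b: "b1 s = (if s \<le> 1/2 then 4 * pi * s + pi else 3 * pi)" "b2 s = (if s \<le> 1/2 then pi else 4 * pi * s - pi)" for s
    by (auto simp: b1_def b2_def min_def max_def)
  have c5: "cis (2 * pi * (2 * s - 1)) = cis (4 * pi * s)" for s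
  proof -
    have "4 * pi * s = 2 * pi * (2 * s - 1) + 2 * pi" by (simp add: algebra_simps)
    then show ?thesis by (simp only: cis_plus_pi)
  qed
  have c6: "2 * pi * (2 * s) = 4 * pi * s" for s by simp
  have e1: "(cis (b1 s), cis (b2 s)) = (loop_a +++ loop_b) s" for s
    by (cases "s \<le> 1/2") (simp_all add: joinpaths_def b loop_a_def loop_b_def cis_plus_pi c5 c6)
  have e2: "(cis (2 * pi * s + 2 * pi), cis (2 * pi * s + pi)) = standard_loop shear_up s" for s
    by (simp add: standard_loop_def torus_linear_def cis_plus_pi)
  have "homotopic_loops punctured_torus (\<lambda>s. (cis (b1 s), cis (b2 s))) (\<lambda>s. (cis (2 * pi * s + 2 * pi), cis (2 * pi * s + pi)))"
  proof (rule homotopic_loops_angles)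
    fix u s :: real assume us: "u \<in> {0..1}" "s \<in> {0..1}"
    show "cis ((1 - u) * b1 s + u * (2 * pi * s + 2 * pi)) \<noteq> 1 \<or> cis ((1 - u) * b2 s + u * (2 * pi * s + pi)) \<noteq> 1"
    proof (cases "u = 0")
      case True
      then show ?thesis by (auto simp: b cis_plus_pi)
    next
      case False
      have "0 \<le> b1 s - b2 s" "b1 s - b2 s \<le> 2 * pi" using us by (auto simp: b algebra_simps)
      then have "0 \<le> (1 - u) * (b1 s - b2 s)" "(1 - u) * (b1 s - b2 s) \<le> (1 - u) * (2 * pi)"
        using us by (auto intro!: mult_nonneg_nonneg mult_left_mono)
      moreover have "u * pi > 0" "u * pi < u * (2 * pi)" using False us by auto
      moreover have "((1 - u) * b1 s + u * (2 * pi * s + 2 * pi)) - ((1 - u) * b2 s + u * (2 * pi * s + pi)) = (1 - u) * (b1 s - b2 s) + u * pi"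
        by (simp add: algebra_simps)
      moreover have "(1 - u) * (2 * pi) + u * (2 * pi) = 2 * pi" by (simp add: algebra_simps)
      ultimately show ?thesis using not_both_multiples by (smt (verit))
    qed
  qed (auto intro!: continuous_intros simp: b1_def b2_def cis_plus_pi)
  then show ?thesis unfolding e1 e2 .
qed

text \<open>As for \<open>loop_ab_homotopic\<close>, with the sum of the angles in place of their
  difference: it stays between \<open>2 * pi\<close> and \<open>4 * pi\<close> and is moved to
  \<open>3 * pi\<close>.\<close>

lemma loop_a_rev_b_homotopic: "homotopic_loops punctured_torus (loop_a +++ reversepath loop_b) (standard_loop shear_down)"
proof -
  define b1 where "b1 = (\<lambda>s::real. min (4 * pi * s + pi) (3 * pi))"
  define b2 where "b2 = (\<lambda>s::real. min pi (3 * pi - 4 * pi * s))"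
  have b: "b1 s = (if s \<le> 1/2 then 4 * pi * s + pi else 3 * pi)" "b2 s = (if s \<le> 1/2 then pi else 3 * pi - 4 * pi * s)" for s
    by (auto simp: b1_def b2_def min_def max_def)
  have c3: "cis (3 * pi - x) = - cis (2 * pi - x)" for x
  proof -
    have "3 * pi - x = (2 * pi - x) + pi" by simp
    then show ?thesis by (simp only: cis_plus_pi)
  qed
  have c4: "cis (2 * pi * (1 - (2 * s - 1))) = cis (2 * pi - 4 * pi * s)" for s
  proof -
    have "2 * pi * (1 - (2 * s - 1)) = (2 * pi - 4 * pi * s) + 2 * pi" by (simp add: algebra_simps)
    then show ?thesis by (simp only: cis_plus_pi)
  qed
  have c6: "2 * pi * (2 * s) = 4 * pi * s" for s by simp
  have e1: "(cis (b1 s), cis (b2 s)) = (loop_a +++ reversepath loop_b) s" for s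
    by (cases "s \<le> 1/2") (simp_all add: joinpaths_def b loop_a_def loop_b_def reversepath_def cis_plus_pi c3 c4[simplified] c4 c6)
  have e2: "(cis (2 * pi * s + 2 * pi), cis (pi - 2 * pi * s)) = standard_loop shear_down s" for s
    by (simp add: standard_loop_def torus_linear_def cis_plus_pi power_int_minus)
  have "homotopic_loops punctured_torus (\<lambda>s. (cis (b1 s), cis (b2 s))) (\<lambda>s. (cis (2 * pi * s + 2 * pi), cis (pi - 2 * pi * s)))"
  proof (rule homotopic_loops_angles)
    fix u s :: real assume us: "u \<in> {0..1}" "s \<in> {0..1}"
    show "cis ((1 - u) * b1 s + u * (2 * pi * s + 2 * pi)) \<noteq> 1 \<or> cis ((1 - u) * b2 s + u * (pi - 2 * pi * s)) \<noteq> 1"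
    proof (cases "u = 0")
      case True
      then show ?thesis by (auto simp: b cis_plus_pi)
    next
      case False
      have "2 * pi \<le> b1 s + b2 s" "b1 s + b2 s \<le> 4 * pi" using us by (auto simp: b algebra_simps)
      then have "(1 - u) * (2 * pi) \<le> (1 - u) * (b1 s + b2 s)" "(1 - u) * (b1 s + b2 s) \<le> (1 - u) * (4 * pi)"
        using us by (auto intro!: mult_left_mono)
      moreover have "u * pi > 0" using False us by auto
      moreover have "((1 - u) * b1 s + u * (2 * pi * s + 2 * pi)) - (2 * pi - ((1 - u) * b2 s + u * (pi - 2 * pi * s))) = (1 - u) * (b1 s + b2 s) + 3 * (u * pi) - 2 * pi"
        by (simp add: algebra_simps)
      moreover have "(1 - u) * (2 * pi) + 2 * (u * pi) = 2 * pi" "(1 - u) * (4 * pi) + 4 * (u * pi) = 4 * pi" by (simp_all add: algebra_simps)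
      moreover have "cis (2 * pi - y) = 1" if "cis y = 1" for y using that by (simp add: cis_divide[symmetric])
      ultimately show ?thesis using not_both_multiples by (smt (verit))
    qed
  qed (auto intro!: continuous_intros simp: b1_def b2_def cis_plus_pi)
  then show ?thesis unfolding e1 e2 .
qed

section \<open>Stern--Brocot cones\<close>

definition det2 :: "int \<times> int \<Rightarrow> int \<times> int \<Rightarrow> int" where
  "det2 u v = fst u * snd v - snd u * fst v"

definition comb :: "int \<Rightarrow> int \<Rightarrow> int \<times> int \<Rightarrow> int \<times> int \<Rightarrow> int \<times> int" where
  "comb p q u v = (p * fst u + q * fst v, p * snd u + q * snd v)"

text \<open>For a basis \<open>u, v\<close> these are the primitive vectors strictly inside the
  cone, which form the Stern-Brocot tree with root \<open>u + v\<close>.\<close>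

definition farey_cone :: "int \<times> int \<Rightarrow> int \<times> int \<Rightarrow> (int \<times> int) set" where
  "farey_cone u v = {comb p q u v | p q. p \<ge> 1 \<and> q \<ge> 1 \<and> coprime p q}"

lemma det2_simps: "det2 u (u + v) = det2 u v" "det2 v (u + v) = - det2 u v" "det2 (u + v) v = det2 u v"
  "det2 (u + v) u = - det2 u v"
  by (simp_all add: det2_def algebra_simps)

lemma det2_swap: "det2 v u = - det2 u v"
  by (simp add: det2_def)

lemma comb_inject:
  assumes "\<bar>det2 u v\<bar> = 1" "comb p q u v = comb p' q' u v"
  shows "p = p' \<and> q = q'"
proof -
  have "det2 (comb p q u v) v = p * det2 u v" "det2 u (comb p q u v) = q * det2 u v" for p q
    by (simp_all add: det2_def comb_def algebra_simps)
  then have "p * det2 u v = p' * det2 u v" "q * det2 u v = q' * det2 u v" using assms(2) by metis+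
  then show ?thesis using assms(1) by auto
qed

lemma comb_child: "comb p q u (u + v) = comb (p + q) q u v" "comb p q v (u + v) = comb q (p + q) u v"
  by (simp_all add: comb_def algebra_simps)

lemma farey_cone_swap: "farey_cone u v = farey_cone v u"
proof -
  have "farey_cone u v \<subseteq> farey_cone v u" for u v
  proof
    fix z assume "z \<in> farey_cone u v"
    then obtain p q where z: "z = comb p q u v" "p \<ge> 1" "q \<ge> 1" "coprime p q" unfolding farey_cone_def by auto
    moreover have "comb p q u v = comb q p v u" by (simp add: comb_def)
    ultimately show "z \<in> farey_cone v u" unfolding farey_cone_def
      by (intro CollectI exI[of _ q] exI[of _ p]) (simp add: coprime_commute)
  qed
  then show ?thesis by blast
qed

lemma coprime_add_iff: "coprime (a + b) b \<longleftrightarrow> coprime a b" "coprime b (a + b) \<longleftrightarrow> coprime a b" for a b :: int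
  unfolding coprime_iff_gcd_eq_1 by (metis gcd.commute gcd_add1)+

lemma farey_cone_child:
  "farey_cone u (u + v) = {comb p q u v | p q. q \<ge> 1 \<and> p > q \<and> coprime p q}"
  "farey_cone v (u + v) = {comb p q u v | p q. p \<ge> 1 \<and> q > p \<and> coprime p q}"
proof -
  note c = coprime_add_iff
  show "farey_cone u (u + v) = {comb p q u v | p q. q \<ge> 1 \<and> p > q \<and> coprime p q}"
  proof (intro set_eqI iffI)
    fix z assume "z \<in> farey_cone u (u + v)"
    then obtain p q where "z = comb (p + q) q u v" "p \<ge> 1" "q \<ge> 1" "coprime p q" unfolding farey_cone_def comb_child by auto
    then show "z \<in> {comb p q u v | p q. q \<ge> 1 \<and> p > q \<and> coprime p q}" using c(1)[of p q] by force
  next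
    fix z assume "z \<in> {comb p q u v | p q. q \<ge> 1 \<and> p > q \<and> coprime p q}"
    then obtain p q where "z = comb p q u v" "q \<ge> 1" "p > q" "coprime p q" by auto
    then have "z = comb (p - q) q u (u + v)" "p - q \<ge> 1" "q \<ge> 1" "coprime (p - q) q" using c(1)[of "p - q" q] by (auto simp: comb_child)
    then show "z \<in> farey_cone u (u + v)" unfolding farey_cone_def by blast
  qed
  show "farey_cone v (u + v) = {comb p q u v | p q. p \<ge> 1 \<and> q > p \<and> coprime p q}"
  proof (intro set_eqI iffI)
    fix z assume "z \<in> farey_cone v (u + v)"
    then obtain p q where "z = comb q (p + q) u v" "p \<ge> 1" "q \<ge> 1" "coprime p q" unfolding farey_cone_def comb_child by auto
    then show "z \<in> {comb p q u v | p q. p \<ge> 1 \<and> q > p \<and> coprime p q}" using c(2)[of q p] by force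
  next
    fix z assume "z \<in> {comb p q u v | p q. p \<ge> 1 \<and> q > p \<and> coprime p q}"
    then obtain p q where "z = comb p q u v" "p \<ge> 1" "q > p" "coprime p q" by auto
    then have "z = comb (q - p) p v (u + v)" "q - p \<ge> 1" "p \<ge> 1" "coprime (q - p) p" using c(2)[of p "q - p"] by (auto simp: comb_child)
    then show "z \<in> farey_cone v (u + v)" unfolding farey_cone_def by blast
  qed
qed

lemma comb_1_1: "comb 1 1 u v = u + v" by (simp add: comb_def prod_eq_iff)

text \<open>One step of the subtractive Euclidean algorithm: \<open>p > q\<close> and
  \<open>p < q\<close> select the two subtrees, and coprimality leaves only \<open>p = q = 1\<close>
  for the root.\<close>

lemma farey_cone_rec: "farey_cone u v = insert (u + v) (farey_cone u (u + v) \<union> farey_cone v (u + v))"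
proof (intro set_eqI iffI)
  fix z assume "z \<in> farey_cone u v"
  then obtain p q where z: "z = comb p q u v" "p \<ge> 1" "q \<ge> 1" "coprime p q" unfolding farey_cone_def by auto
  consider "p = q" | "p > q" | "q > p" by linarith
  then show "z \<in> insert (u + v) (farey_cone u (u + v) \<union> farey_cone v (u + v))"
  proof cases
    case 1
    then have "p = 1" using z by (metis coprime_self is_unit_gcd zdvd1_eq abs_of_pos zero_less_one order_less_le_trans)
    then show ?thesis using z 1 by (simp add: comb_1_1)
  qed (use z in \<open>auto simp: farey_cone_child\<close>)
next
  fix z assume "z \<in> insert (u + v) (farey_cone u (u + v) \<union> farey_cone v (u + v))"
  then consider "z = u + v" | "z \<in> farey_cone u (u + v)" | "z \<in> farey_cone v (u + v)" by blast
  then show "z \<in> farey_cone u v"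
  proof cases
    case 1
    then show ?thesis unfolding farey_cone_def by (intro CollectI exI[of _ 1]) (simp add: comb_1_1)
  next
    case 2
    then show ?thesis unfolding farey_cone_child(1) unfolding farey_cone_def by force
  next
    case 3
    then show ?thesis unfolding farey_cone_child(2) unfolding farey_cone_def by force
  qed
qed

lemma farey_cone_disjoint:
  assumes "\<bar>det2 u v\<bar> = 1"
  shows "farey_cone u (u + v) \<inter> farey_cone v (u + v) = {}" "u + v \<notin> farey_cone u (u + v)" "u + v \<notin> farey_cone v (u + v)"
proof -
  show "farey_cone u (u + v) \<inter> farey_cone v (u + v) = {}" unfolding farey_cone_child using comb_inject[OF assms] by fastforce
  have *: "comb p q u v \<noteq> u + v" if "p \<noteq> q" for p q
    using comb_inject[OF assms, of p q 1 1] that by (auto simp: comb_1_1)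
  show "u + v \<notin> farey_cone u (u + v)"
  proof
    assume "u + v \<in> farey_cone u (u + v)"
    then obtain p q where "u + v = comb p q u v" "p > q" unfolding farey_cone_child by auto
    then show False using *[of p q] by simp
  qed
  show "u + v \<notin> farey_cone v (u + v)"
  proof
    assume "u + v \<in> farey_cone v (u + v)"
    then obtain p q where "u + v = comb p q u v" "q > p" unfolding farey_cone_child by auto
    then show False using *[of p q] by simp
  qed
qed

lemma farey_cone_coprime:
  assumes "\<bar>det2 u v\<bar> = 1" "z \<in> farey_cone u v"
  shows "coprime (fst z) (snd z)"
proof (rule coprimeI)
  fix d assume d: "d dvd fst z" "d dvd snd z"
  obtain p q where z: "z = comb p q u v" "coprime p q" using assms(2) unfolding farey_cone_def by auto
  have "det2 z v = p * det2 u v" "det2 u z = q * det2 u v" using z by (simp_all add: det2_def comb_def algebra_simps)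
  moreover have "d dvd det2 z v" "d dvd det2 u z" using d by (simp_all add: det2_def)
  moreover have "det2 u v = 1 \<or> det2 u v = -1" using assms(1) by linarith
  ultimately have "d dvd p" "d dvd q" by auto
  then show "is_unit d" using z(2) by (meson coprime_common_divisor)
qed

section \<open>Exhaustion of a cone by levels and infinite products over it\<close>

fun truncated_cone :: "nat \<Rightarrow> int \<times> int \<Rightarrow> int \<times> int \<Rightarrow> (int \<times> int) set" where
  "truncated_cone 0 u v = {}"
| "truncated_cone (Suc n) u v = insert (u + v) (truncated_cone n u (u + v) \<union> truncated_cone n v (u + v))"

lemma finite_truncated_cone: "finite (truncated_cone n u v)"
  by (induction n arbitrary: u v) auto

lemma truncated_cone_subset: "truncated_cone n u v \<subseteq> farey_cone u v"
proof (induction n arbitrary: u v)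
  case (Suc n)
  show ?case using Suc.IH[of u "u + v"] Suc.IH[of v "u + v"] unfolding farey_cone_rec[of u v] truncated_cone.simps by blast
qed auto

lemma truncated_cone_Suc: "truncated_cone n u v \<subseteq> truncated_cone (Suc n) u v"
proof (induction n arbitrary: u v)
  case (Suc n)
  show ?case using Suc[of u "u + v"] Suc[of v "u + v"] by auto
qed auto

lemma truncated_cone_mono: "m \<le> n \<Longrightarrow> truncated_cone m u v \<subseteq> truncated_cone n u v"
  using lift_Suc_mono_le[of "\<lambda>n. truncated_cone n u v"] truncated_cone_Suc by blast

text \<open>Each Euclidean step lowers \<open>p + q\<close> by at least 1, so the vector with
  coefficients \<open>p\<close>, \<open>q\<close> occurs among the first \<open>p + q\<close>
  levels.\<close>

lemma truncated_cone_exhausts: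
  "p \<ge> 1 \<Longrightarrow> q \<ge> 1 \<Longrightarrow> coprime p q \<Longrightarrow> p + q \<le> int n \<Longrightarrow> comb p q u v \<in> truncated_cone n u v"
proof (induction n arbitrary: p q u v)
  case (Suc n)
  have z: "comb p q u v \<in> farey_cone u v" using Suc.prems unfolding farey_cone_def by auto
  consider "p = q" | "p > q" | "q > p" by linarith
  then show ?case
  proof cases
    case 1
    then have "p = 1" using Suc.prems by (metis coprime_self is_unit_gcd zdvd1_eq abs_of_pos zero_less_one order_less_le_trans)
    then show ?thesis using 1 by (simp add: comb_1_1)
  next
    case 2
    have "coprime (p - q) q" using Suc.prems(3) coprime_add_iff(1)[of "p - q" q] by simp
    then have "comb (p - q) q u (u + v) \<in> truncated_cone n u (u + v)" using Suc.prems 2 by (intro Suc.IH) auto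
    then show ?thesis by (simp add: comb_child)
  next
    case 3
    have "coprime (q - p) p" using Suc.prems(3) coprime_add_iff(2)[of p "q - p"] by (simp add: coprime_commute)
    then have "comb (q - p) p v (u + v) \<in> truncated_cone n v (u + v)" using Suc.prems 3 by (intro Suc.IH) auto
    then show ?thesis by (simp add: comb_child)
  qed
qed auto

text \<open>Unconditional sums over a cone may therefore be evaluated level by level.\<close>

lemma filterlim_truncated_cone: "filterlim (\<lambda>n. truncated_cone n u v) (finite_subsets_at_top (farey_cone u v)) sequentially"
  unfolding filterlim_finite_subsets_at_top
proof (intro allI impI)
  fix X assume X: "finite X \<and> X \<subseteq> farey_cone u v"
  have "\<exists>n. z \<in> truncated_cone n u v" if "z \<in> farey_cone u v" for z
  proof -
    obtain p q where z: "z = comb p q u v" "p \<ge> 1" "q \<ge> 1" "coprime p q" using \<open>z \<in> farey_cone u v\<close> unfolding farey_cone_def by auto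
    then show ?thesis using truncated_cone_exhausts[of p q "nat (p + q)" u v] by auto
  qed
  then obtain k where k: "\<And>z. z \<in> farey_cone u v \<Longrightarrow> z \<in> truncated_cone (k z) u v" by metis
  define N where "N = Max (insert 0 (k ` X))"
  have "X \<subseteq> truncated_cone n u v" if "n \<ge> N" for n
  proof
    fix z assume z: "z \<in> X"
    have "k z \<le> N" unfolding N_def using X z by (intro Max_ge) auto
    then show "z \<in> truncated_cone n u v" using k[of z] z X truncated_cone_mono[of "k z" n u v] that by auto
  qed
  then show "\<forall>\<^sub>F n in sequentially. finite (truncated_cone n u v) \<and> X \<subseteq> truncated_cone n u v \<and> truncated_cone n u v \<subseteq> farey_cone u v"
    unfolding eventually_sequentially using finite_truncated_cone truncated_cone_subset by blast
qed

lemma sum_truncated_cone_tendsto: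
  fixes f :: "int \<times> int \<Rightarrow> 'a :: banach"
  assumes "f summable_on farey_cone u v"
  shows "(\<lambda>n. sum f (truncated_cone n u v)) \<longlonglongrightarrow> infsum f (farey_cone u v)"
  using filterlim_compose[OF _ filterlim_truncated_cone, of "sum f"] has_sum_infsum[OF assms]
  unfolding has_sum_def by blast

lemma truncated_cone_disjoint:
  assumes "\<bar>det2 u v\<bar> = 1"
  shows "truncated_cone n u (u + v) \<inter> truncated_cone n v (u + v) = {}" "u + v \<notin> truncated_cone n u (u + v) \<union> truncated_cone n v (u + v)"
  using farey_cone_disjoint[OF assms] truncated_cone_subset by blast+

lemma sum_truncated_cone_Suc:
  fixes f :: "int \<times> int \<Rightarrow> 'a :: comm_monoid_add"
  assumes "\<bar>det2 u v\<bar> = 1"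
  shows "sum f (truncated_cone (Suc n) u v) = f (u + v) + (sum f (truncated_cone n u (u + v)) + sum f (truncated_cone n v (u + v)))"
  using truncated_cone_disjoint[OF assms, of n] by (simp add: finite_truncated_cone sum.union_disjoint)

lemma prod_truncated_cone_Suc:
  fixes f :: "int \<times> int \<Rightarrow> 'a :: comm_monoid_mult"
  assumes "\<bar>det2 u v\<bar> = 1"
  shows "prod f (truncated_cone (Suc n) u v) = f (u + v) * (prod f (truncated_cone n u (u + v)) * prod f (truncated_cone n v (u + v)))"
  using truncated_cone_disjoint[OF assms, of n] by (simp add: finite_truncated_cone prod.union_disjoint)

text \<open>The product of \<open>R\<close> over the \<open>2 ^ n\<close> edges at depth
  \<open>n\<close>: the remainder when the recursion for \<open>R\<close> is unrolled
  \<open>n\<close> times.\<close>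

fun level_prod :: "(int \<times> int \<Rightarrow> int \<times> int \<Rightarrow> complex) \<Rightarrow> nat \<Rightarrow> int \<times> int \<Rightarrow> int \<times> int \<Rightarrow> complex" where
  "level_prod R 0 u v = R u v"
| "level_prod R (Suc n) u v = level_prod R n u (u + v) * level_prod R n v (u + v)"

text \<open>A product of factors \<open>1 + e\<^sub>i\<close> differs from 1 by at most the
  exponential of the sum of the norms, minus 1. The vertices \<open>u + v\<close> of the edges at
  depth \<open>n\<close> are those added by the next level, hence the difference of truncated
  sums.\<close>

lemma level_prod_bound:
  fixes \<beta> :: "int \<times> int \<Rightarrow> real"
  assumes child: "\<And>u v. Q u v \<Longrightarrow> Q u (u + v) \<and> Q v (u + v)" and det: "\<And>u v. Q u v \<Longrightarrow> \<bar>det2 u v\<bar> = 1"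
    and bound: "\<And>u v. Q u v \<Longrightarrow> norm (R u v - 1) \<le> C * \<beta> (u + v)" and Q: "Q u v"
  shows "norm (level_prod R n u v - 1) \<le> exp (C * (sum \<beta> (truncated_cone (Suc n) u v) - sum \<beta> (truncated_cone n u v))) - 1"
  using Q
proof (induction n arbitrary: u v)
  case 0
  have "norm (R u v - 1) \<le> C * \<beta> (u + v)" by (rule bound[OF 0])
  also have "\<dots> \<le> exp (C * \<beta> (u + v)) - 1" using exp_ge_add_one_self[of "C * \<beta> (u + v)"] by linarith
  finally show ?case by simp
next
  case (Suc n)
  define A where "A = C * (sum \<beta> (truncated_cone (Suc n) u (u + v)) - sum \<beta> (truncated_cone n u (u + v)))"
  define B where "B = C * (sum \<beta> (truncated_cone (Suc n) v (u + v)) - sum \<beta> (truncated_cone n v (u + v)))"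
  define a where "a = level_prod R n u (u + v)"
  define b where "b = level_prod R n v (u + v)"
  have ab: "norm (a - 1) \<le> exp A - 1" "norm (b - 1) \<le> exp B - 1"
    using Suc.IH child[OF Suc.prems] unfolding a_def b_def A_def B_def by auto
  have "a * b - 1 = (a - 1) * (b - 1) + (a - 1) + (b - 1)" by (simp add: algebra_simps)
  then have "norm (a * b - 1) \<le> norm (a - 1) * norm (b - 1) + norm (a - 1) + norm (b - 1)"
    by (metis (no_types) norm_mult norm_triangle_le norm_triangle_ineq add_right_mono order_trans)
  also have "\<dots> \<le> (exp A - 1) * (exp B - 1) + (exp A - 1) + (exp B - 1)"
    using ab norm_ge_zero[of "a - 1"] by (intro add_mono mult_mono) (linarith | simp)+
  also have "\<dots> = exp (A + B) - 1" by (simp add: exp_add algebra_simps)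
  also have "A + B = C * (sum \<beta> (truncated_cone (Suc (Suc n)) u v) - sum \<beta> (truncated_cone (Suc n) u v))"
    unfolding sum_truncated_cone_Suc[OF det[OF Suc.prems]] A_def B_def by (simp add: algebra_simps)
  finally show ?case by (simp add: a_def b_def)
qed

lemma level_prod_recursion:
  assumes child: "\<And>u v. Q u v \<Longrightarrow> Q u (u + v) \<and> Q v (u + v)" and det: "\<And>u v. Q u v \<Longrightarrow> \<bar>det2 u v\<bar> = 1"
    and rec: "\<And>u v. Q u v \<Longrightarrow> R u v = F (u + v) * R u (u + v) * R v (u + v)" and Q: "Q u v"
  shows "R u v = prod F (truncated_cone n u v) * level_prod R n u v"
  using Q
proof (induction n arbitrary: u v)
  case (Suc n)
  have "R u v = F (u + v) * R u (u + v) * R v (u + v)" by (rule rec[OF Suc.prems])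
  also have "R u (u + v) = prod F (truncated_cone n u (u + v)) * level_prod R n u (u + v)" using Suc.IH child[OF Suc.prems] by blast
  also have "R v (u + v) = prod F (truncated_cone n v (u + v)) * level_prod R n v (u + v)" using Suc.IH child[OF Suc.prems] by blast
  finally show ?case unfolding prod_truncated_cone_Suc[OF det[OF Suc.prems]] by (simp add: mult_ac)
qed auto

text \<open>\<open>R u v\<close> is the product of \<open>F\<close> over the first \<open>n\<close>
  levels times the product of \<open>R\<close> over the edges at depth \<open>n\<close>. Summability
  of the majorant \<open>\<beta>\<close> makes its contribution per level tend to 0, so the second
  factor tends to 1.\<close>

lemma cone_product_formula:
  fixes \<beta> :: "int \<times> int \<Rightarrow> real"
  assumes child: "\<And>u v. Q u v \<Longrightarrow> Q u (u + v) \<and> Q v (u + v)" and det: "\<And>u v. Q u v \<Longrightarrow> \<bar>det2 u v\<bar> = 1"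
    and rec: "\<And>u v. Q u v \<Longrightarrow> R u v = F (u + v) * R u (u + v) * R v (u + v)"
    and bound: "\<And>u v. Q u v \<Longrightarrow> norm (R u v - 1) \<le> C * \<beta> (u + v)" and Q: "Q u v"
    and summ: "\<beta> summable_on farey_cone u v" "(\<lambda>z. Ln (F z)) summable_on farey_cone u v"
    and nz: "\<And>z. z \<in> farey_cone u v \<Longrightarrow> F z \<noteq> 0"
  shows "R u v = exp (infsum (\<lambda>z. Ln (F z)) (farey_cone u v))"
proof -
  define B where "B = (\<lambda>n. sum \<beta> (truncated_cone n u v))"
  have B: "B \<longlonglongrightarrow> infsum \<beta> (farey_cone u v)" unfolding B_def by (rule sum_truncated_cone_tendsto[OF summ(1)])
  have "(\<lambda>n. exp (C * (B (Suc n) - B n)) - 1) \<longlonglongrightarrow> exp (C * (infsum \<beta> (farey_cone u v) - infsum \<beta> (farey_cone u v))) - 1"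
    by (intro tendsto_intros B LIMSEQ_Suc)
  then have "(\<lambda>n. exp (C * (B (Suc n) - B n)) - 1) \<longlonglongrightarrow> 0" by simp
  then have "(\<lambda>n. level_prod R n u v - 1) \<longlonglongrightarrow> 0"
    by (rule Lim_null_comparison[rotated]) (use level_prod_bound[where Q=Q and R=R and C=C and \<beta>=\<beta>, OF child det bound Q] in \<open>auto simp: B_def\<close>)
  then have lim1: "(\<lambda>n. level_prod R n u v) \<longlonglongrightarrow> 1" by (simp add: LIM_zero_iff)
  have "prod F (truncated_cone n u v) = exp (sum (\<lambda>z. Ln (F z)) (truncated_cone n u v))" for n
    unfolding exp_sum[OF finite_truncated_cone] using nz truncated_cone_subset by (intro prod.cong refl) (metis exp_Ln subsetD)
  then have eq: "R u v = exp (sum (\<lambda>z. Ln (F z)) (truncated_cone n u v)) * level_prod R n u v" for n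
    using level_prod_recursion[where Q=Q and R=R and F=F, OF child det rec Q] by metis
  have "(\<lambda>n. exp (sum (\<lambda>z. Ln (F z)) (truncated_cone n u v)) * level_prod R n u v) \<longlonglongrightarrow> exp (infsum (\<lambda>z. Ln (F z)) (farey_cone u v)) * 1"
    by (intro tendsto_intros sum_truncated_cone_tendsto summ lim1)
  then have "(\<lambda>n::nat. R u v) \<longlonglongrightarrow> exp (infsum (\<lambda>z. Ln (F z)) (farey_cone u v))"
    unfolding eq[symmetric] by simp
  then show ?thesis by (rule LIMSEQ_unique[OF tendsto_const])
qed

text \<open>\<open>\<nu>\<close> is at least \<open>p + q\<close> on the combination with
  coefficients \<open>p\<close>, \<open>q\<close>, so the sum is dominated by the square of a
  geometric series of ratio \<open>exp (- \<kappa>)\<close>.\<close>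

lemma exp_weight_summable_on_cone:
  fixes \<nu> :: "int \<times> int \<Rightarrow> real"
  assumes det: "\<bar>det2 u v\<bar> = 1" and \<kappa>: "\<kappa> > 0"
    and \<nu>: "\<And>p q. \<nu> (comb p q u v) = of_int p * \<nu> u + of_int q * \<nu> v" "\<nu> u \<ge> 1" "\<nu> v \<ge> 1"
  shows "(\<lambda>z. exp (- \<kappa> * \<nu> z)) summable_on farey_cone u v"
proof (rule nonneg_bdd_above_summable_on)
  define r where "r = exp (- \<kappa>)"
  have r: "0 < r" "r < 1" using \<kappa> by (auto simp: r_def)
  show "bdd_above (sum (\<lambda>z. exp (- \<kappa> * \<nu> z)) ` {X. X \<subseteq> farey_cone u v \<and> finite X})"
  proof (rule bdd_aboveI)
    fix s assume "s \<in> sum (\<lambda>z. exp (- \<kappa> * \<nu> z)) ` {X. X \<subseteq> farey_cone u v \<and> finite X}"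
    then obtain X where X: "X \<subseteq> farey_cone u v" "finite X" "s = sum (\<lambda>z. exp (- \<kappa> * \<nu> z)) X" by auto
    have "\<forall>z\<in>X. \<exists>pq. z = comb (int (fst pq)) (int (snd pq)) u v"
    proof
      fix z assume "z \<in> X"
      then obtain p q where z: "z = comb p q u v" "p \<ge> 1" "q \<ge> 1" using X(1) unfolding farey_cone_def by auto
      then show "\<exists>pq. z = comb (int (fst pq)) (int (snd pq)) u v" by (intro exI[of _ "(nat p, nat q)"]) auto
    qed
    then obtain k where k: "\<And>z. z \<in> X \<Longrightarrow> z = comb (int (fst (k z))) (int (snd (k z))) u v" by metis
    have inj: "inj_on k X" by (rule inj_onI) (metis k)
    obtain N where N: "fst ` k ` X \<subseteq> {..<N}" "snd ` k ` X \<subseteq> {..<N}"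
    proof -
      obtain N1 where "fst ` k ` X \<subseteq> {..<N1}" using X(2) finite_nat_iff_bounded by blast
      moreover obtain N2 where "snd ` k ` X \<subseteq> {..<N2}" using X(2) finite_nat_iff_bounded by blast
      ultimately show ?thesis using that[of "max N1 N2"] by fastforce
    qed
    have "exp (- \<kappa> * \<nu> z) \<le> r ^ fst (k z) * r ^ snd (k z)" if "z \<in> X" for z
    proof -
      have "\<nu> z = real (fst (k z)) * \<nu> u + real (snd (k z)) * \<nu> v" using \<nu>(1) k[OF that] by (metis of_int_of_nat_eq)
      moreover have "real (fst (k z)) * 1 \<le> real (fst (k z)) * \<nu> u" "real (snd (k z)) * 1 \<le> real (snd (k z)) * \<nu> v"
        using mult_left_mono[OF \<nu>(2), of "real (fst (k z))"] mult_left_mono[OF \<nu>(3), of "real (snd (k z))"] by simp_all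
      ultimately have "real (fst (k z)) + real (snd (k z)) \<le> \<nu> z" by simp
      then have "- \<kappa> * \<nu> z \<le> - \<kappa> * (real (fst (k z)) + real (snd (k z)))" using \<kappa> by simp
      then have "exp (- \<kappa> * \<nu> z) \<le> exp (- \<kappa> * (real (fst (k z)) + real (snd (k z))))" by simp
      also have "\<dots> = r ^ fst (k z) * r ^ snd (k z)"
        by (simp add: r_def exp_of_nat_mult[symmetric] exp_add[symmetric] algebra_simps)
      finally show ?thesis .
    qed
    then have "s \<le> (\<Sum>z\<in>X. r ^ fst (k z) * r ^ snd (k z))" unfolding X(3) by (rule sum_mono)
    also have "\<dots> = (\<Sum>pq\<in>k ` X. r ^ fst pq * r ^ snd pq)" using sum.reindex[OF inj, of "\<lambda>pq. r ^ fst pq * r ^ snd pq"] by simp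
    also have "\<dots> \<le> (\<Sum>pq\<in>{..<N} \<times> {..<N}. r ^ fst pq * r ^ snd pq)"
    proof (rule sum_mono2)
      show "k ` X \<subseteq> {..<N} \<times> {..<N}"
      proof
        fix y assume "y \<in> k ` X"
        then have "fst y \<in> {..<N}" "snd y \<in> {..<N}" using N by blast+
        then show "y \<in> {..<N} \<times> {..<N}" by (simp add: mem_Times_iff)
      qed
    qed (use r in auto)
    also have "\<dots> = (\<Sum>p<N. r ^ p) * (\<Sum>q<N. r ^ q)" by (simp add: sum_product sum.cartesian_product case_prod_unfold)
    also have "\<dots> \<le> (1 / (1 - r)) * (1 / (1 - r))"
    proof -
      have "(\<Sum>p<N. r ^ p) \<le> 1 / (1 - r)"
        using r by (simp add: sum_gp_strict divide_right_mono)
      then show ?thesis using r by (intro mult_mono) (auto intro: sum_nonneg)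
    qed
    finally show "s \<le> (1 / (1 - r)) * (1 / (1 - r))" .
  qed
qed auto

section \<open>Generalized Markoff maps\<close>

text \<open>\<open>x\<close> stands for the trace as a function of the slope, \<open>E\<close> for
  \<open>exp \<nu>\<close>, and \<open>lam\<close> selects from a trace the eigenvalue of norm above
  1. As \<open>lam\<close> depends on the value of \<open>x\<close> only, everything built from it
  inherits the invariance of \<open>x\<close>.\<close>

locale weak_markoff_map =
  fixes x :: "int \<times> int \<Rightarrow> complex" and \<mu> E :: complex and lam :: "complex \<Rightarrow> complex"
  assumes neg: "coprime (fst u) (snd u) \<Longrightarrow> x (- u) = x u"
    and edge: "\<bar>det2 u v\<bar> = 1 \<Longrightarrow> x (u + v) + x (u - v) = x u * x v"
    and mu: "\<mu> = 2 - E - 1 / E" and E: "E \<noteq> 0"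
    and lam: "coprime (fst u) (snd u) \<Longrightarrow> lam (x u) + 1 / lam (x u) = x u \<and> norm (lam (x u)) > 1"
begin

text \<open>An edge of the Farey tree that carries the vertex relation. The relation is part of the
  predicate because it is verified at one edge and spreads from there by
  \<open>edge\<close>.\<close>

definition node :: "int \<times> int \<Rightarrow> int \<times> int \<Rightarrow> bool" where
  "node u v \<longleftrightarrow> \<bar>det2 u v\<bar> = 1 \<and> (x u)\<^sup>2 + (x v)\<^sup>2 + (x (u + v))\<^sup>2 - x u * x v * x (u + v) = \<mu>"

text \<open>The square of \<open>l u\<close> is the exponential of the complex length, and
  \<open>F u\<close> that of the summand. The choice of \<open>a\<close> comes from \<open>x\<^sup>2
  - \<mu> = (l\<^sup>2 + E) * (l\<^sup>2 + 1 / E) / l\<^sup>2\<close>, which gives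
  \<open>F = a\<^sup>2 / (x\<^sup>2 - \<mu>)\<close>; with the numerator \<open>P\<close> the
  recursion for \<open>R\<close> becomes a polynomial identity.\<close>

definition "l u = lam (x u)"
definition "a u = l u + E / l u"
definition "F u = (E + (l u)\<^sup>2) / (1 / E + (l u)\<^sup>2)"
definition "P u v = x u * x v + (E - 1) * x (u - v)"
definition "R u v = P u v / (a u * a v)"

lemma node_coprime: assumes "node u v" shows "coprime (fst u) (snd u)" "coprime (fst v) (snd v)" "coprime (fst (u + v)) (snd (u + v))"
proof -
  have *: "coprime (fst u) (snd u)" if "\<bar>det2 u v\<bar> = 1" for u v
  proof (rule coprimeI)
    fix d assume "d dvd fst u" "d dvd snd u"
    then have "d dvd det2 u v" by (simp add: det2_def)
    then show "is_unit d" using that by (metis dvd_abs_iff)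
  qed
  have "\<bar>det2 u v\<bar> = 1" using assms by (simp add: node_def)
  then show "coprime (fst u) (snd u)" "coprime (fst v) (snd v)" "coprime (fst (u + v)) (snd (u + v))"
    using *[of u v] *[of v u] *[of "u + v" v] det2_swap[of v u] by (simp_all add: det2_simps)
qed

lemma node_det: "node u v \<Longrightarrow> \<bar>det2 u v\<bar> = 1" by (simp add: node_def)

lemma node_swap: "node u v \<Longrightarrow> node v u"
  using det2_swap[of v u] by (simp add: node_def add.commute mult.commute add.left_commute)

lemma x_next: "node u v \<Longrightarrow> x (u + (u + v)) = x u * x (u + v) - x v"
proof -
  assume "node u v"
  then have "\<bar>det2 (u + v) u\<bar> = 1" by (simp add: node_def det2_simps)
  from edge[OF this] have "x ((u + v) + u) + x v = x (u + v) * x u" by simp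
  then show ?thesis by (simp add: add.commute eq_diff_eq mult.commute)
qed

lemma x_next': "node u v \<Longrightarrow> x (v + (u + v)) = x v * x (u + v) - x u"
  using x_next[OF node_swap] by (simp add: add.commute)

lemma node_child: "node u v \<Longrightarrow> node u (u + v)" "node u v \<Longrightarrow> node v (u + v)"
proof -
  have *: "node u (u + v)" if "node u v" for u v
  proof -
    have k: "(x u)\<^sup>2 + (x v)\<^sup>2 + (x (u + v))\<^sup>2 - x u * x v * x (u + v) = \<mu>" using that by (simp add: node_def)
    have "(x u)\<^sup>2 + (x (u + v))\<^sup>2 + (x (u + (u + v)))\<^sup>2 - x u * x (u + v) * x (u + (u + v)) = \<mu>"
      unfolding x_next[OF that] k[symmetric] by (simp add: power2_eq_square algebra_simps)
    then show ?thesis using node_det[OF that] by (simp add: node_def det2_simps)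
  qed
  show "node u v \<Longrightarrow> node u (u + v)" "node u v \<Longrightarrow> node v (u + v)"
    using *[of u v] *[of v u] node_swap[of u v] by (simp_all add: add.commute)
qed

lemma l_nz: "coprime (fst u) (snd u) \<Longrightarrow> l u \<noteq> 0" using lam[of u] by (force simp: l_def)

lemma x_l: "coprime (fst u) (snd u) \<Longrightarrow> x u = l u + 1 / l u" using lam[of u] by (simp add: l_def)

lemma x_sq_minus_mu:
  assumes "coprime (fst u) (snd u)"
  shows "(x u)\<^sup>2 - \<mu> = ((l u)\<^sup>2 + E) * ((l u)\<^sup>2 + 1 / E) / (l u)\<^sup>2"
  using l_nz[OF assms] E unfolding mu x_l[OF assms] by (simp add: field_simps power2_eq_square)

end

text \<open>By \<open>x_sq_minus_mu\<close> the condition says that \<open>(l u)\<^sup>2\<close> is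
  neither \<open>- E\<close> nor \<open>- 1 / E\<close>, so \<open>a\<close> does not vanish and
  \<open>F\<close> has neither zeros nor poles.\<close>

locale markoff_map = weak_markoff_map +
  assumes nondeg: "coprime (fst u) (snd u) \<Longrightarrow> (x u)\<^sup>2 \<noteq> \<mu>"
begin

lemma factors_nz:
  assumes "coprime (fst u) (snd u)"
  shows "(l u)\<^sup>2 + E \<noteq> 0" "(l u)\<^sup>2 + 1 / E \<noteq> 0"
  using nondeg[OF assms] x_sq_minus_mu[OF assms] by auto

lemma a_nz: "coprime (fst u) (snd u) \<Longrightarrow> a u \<noteq> 0"
  using factors_nz(1)[of u] l_nz[of u] by (auto simp: a_def field_simps power2_eq_square)

lemma F_nz: "coprime (fst u) (snd u) \<Longrightarrow> F u \<noteq> 0"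
  using factors_nz[of u] by (simp add: F_def add.commute)

lemma F_eq:
  assumes "coprime (fst u) (snd u)"
  shows "F u * ((x u)\<^sup>2 - \<mu>) = (a u)\<^sup>2"
proof -
  have "F u * ((x u)\<^sup>2 - \<mu>) = ((l u)\<^sup>2 + E)\<^sup>2 / (l u)\<^sup>2"
    using factors_nz[OF assms] unfolding x_sq_minus_mu[OF assms] F_def by (simp add: add.commute power2_eq_square)
  also have "\<dots> = (a u)\<^sup>2" using l_nz[OF assms] by (simp add: a_def field_simps power2_eq_square)
  finally show ?thesis .
qed

lemma x_diff: "node u v \<Longrightarrow> x (u - v) = x u * x v - x (u + v)"
  using edge[of u v] node_det by (simp add: algebra_simps eq_diff_eq)

lemma P_child:
  assumes "node u v"
  shows "P u (u + v) = x u * x (u + v) + (E - 1) * x v" "P v (u + v) = x v * x (u + v) + (E - 1) * x u"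
  using neg[OF node_coprime(1)[OF assms]] neg[OF node_coprime(2)[OF assms]] by (simp_all add: P_def)

text \<open>A polynomial identity modulo the vertex relation and
  \<open>E * \<mu> = 2 * E - E\<^sup>2 - 1\<close>. Divided by the factors \<open>a\<close> it
  becomes the recursion for \<open>R\<close>, with \<open>F (u + v)\<close> arising as
  \<open>a\<^sup>2 / (x\<^sup>2 - \<mu>)\<close> at the new vertex.\<close>

lemma P_rec:
  assumes "node u v"
  shows "P u (u + v) * P v (u + v) = P u v * ((x (u + v))\<^sup>2 - \<mu>)"
proof -
  define X Y W where "X = x u" and "Y = x v" and "W = x (u + v)"
  have k: "\<mu> = X\<^sup>2 + Y\<^sup>2 + W\<^sup>2 - X * Y * W" using assms by (simp add: node_def X_def Y_def W_def)
  have Em: "E * \<mu> = 2 * E - E\<^sup>2 - 1" using E unfolding mu by (simp add: field_simps power2_eq_square)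
  have P: "P u v = X * Y + (E - 1) * (X * Y - W)" unfolding P_def x_diff[OF assms] by (simp add: X_def Y_def W_def)
  have "(X * W + (E - 1) * Y) * (Y * W + (E - 1) * X) = (X * Y + (E - 1) * (X * Y - W)) * (W\<^sup>2 - \<mu>)"
    using k Em by algebra
  then show ?thesis unfolding P_child[OF assms] P by (simp add: X_def Y_def W_def)
qed

lemma R_rec:
  assumes "node u v"
  shows "R u v = F (u + v) * R u (u + v) * R v (u + v)"
proof -
  note c = node_coprime[OF assms]
  have nz: "(x (u + v))\<^sup>2 - \<mu> \<noteq> 0" using nondeg[OF c(3)] by simp
  have "F (u + v) = (a (u + v))\<^sup>2 / ((x (u + v))\<^sup>2 - \<mu>)" using F_eq[OF c(3)] nz by (simp add: field_simps)
  then have "F (u + v) * R u (u + v) * R v (u + v) = (a (u + v))\<^sup>2 / ((x (u + v))\<^sup>2 - \<mu>) * (P u (u + v) * P v (u + v)) / (a u * a (u + v) * (a v * a (u + v)))"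
    by (simp add: R_def mult.assoc)
  also have "\<dots> = R u v" unfolding P_rec[OF assms] using a_nz[OF c(1)] a_nz[OF c(2)] a_nz[OF c(3)] nz
    by (simp add: R_def power2_eq_square field_simps)
  finally show ?thesis ..
qed

text \<open>The product of \<open>P u v\<close> with the same expression in which
  \<open>x (u - v)\<close> is exchanged for \<open>x (u + v)\<close> is
  \<open>E * ((x u)\<^sup>2 - \<mu>) * ((x v)\<^sup>2 - \<mu>)\<close>, nonzero by
  \<open>nondeg\<close>. This allows \<open>R\<close> to be cancelled at the end.\<close>

lemma R_nz: 
  assumes "node u v" shows "R u v \<noteq> 0"
proof -
  note c = node_coprime[OF assms]
  define X Y W where "X = x u" and "Y = x v" and "W = x (u + v)"
  have k: "\<mu> = X\<^sup>2 + Y\<^sup>2 + W\<^sup>2 - X * Y * W" using assms by (simp add: node_def X_def Y_def W_def)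
  have Em: "E * \<mu> = 2 * E - E\<^sup>2 - 1" using E unfolding mu by (simp add: field_simps power2_eq_square)
  have P: "P u v = X * Y + (E - 1) * (X * Y - W)" unfolding P_def x_diff[OF assms] by (simp add: X_def Y_def W_def)
  have "(X * Y + (E - 1) * (X * Y - W)) * (X * Y + (E - 1) * W) = E * (X\<^sup>2 - \<mu>) * (Y\<^sup>2 - \<mu>)"
    using k Em by algebra
  then have "P u v \<noteq> 0" unfolding P using nondeg[OF c(1)] nondeg[OF c(2)] E by (auto simp: X_def Y_def)
  then show ?thesis using a_nz[OF c(1)] a_nz[OF c(2)] by (simp add: R_def)
qed

lemma norm_l_gt: "coprime (fst u) (snd u) \<Longrightarrow> norm (l u) > 1" using lam by (simp add: l_def)

lemma norm_x_le: "coprime (fst u) (snd u) \<Longrightarrow> norm (x u) \<le> 2 * norm (l u)"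
proof -
  assume c: "coprime (fst u) (snd u)"
  have "norm (x u) \<le> norm (l u) + norm (1 / l u)" unfolding x_l[OF c] by (rule norm_triangle_ineq)
  moreover have "norm (1 / l u) \<le> 1" using norm_l_gt[OF c] by (simp add: norm_divide divide_le_eq)
  ultimately show ?thesis using norm_l_gt[OF c] by linarith
qed

text \<open>The numerator of \<open>R u (u + v) - 1\<close> is \<open>E - 1\<close> times
  \<open>x v - x (u + v) / l u\<close> plus terms divided by \<open>l (u + v)\<close>. The vertex
  relation factors as \<open>(x v - x (u + v) / l u) * (x v - l u * x (u + v)) = \<mu> - (x
  u)\<^sup>2\<close>; the second factor is large because
  \<open>norm (l u) \<ge> 1 + \<epsilon>\<close>, so the first is of order
  \<open>norm (l u) / norm (x (u + v))\<close>.\<close>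

lemma R_child_bound:
  assumes n: "node u v" and \<epsilon>: "\<epsilon> > 0" "norm (l u) \<ge> 1 + \<epsilon>" and vw: "norm (x v) \<le> norm (x (u + v))"
    and c: "c > 0" "norm (a u) \<ge> c * norm (l u)" "norm (a (u + v)) \<ge> c * norm (l (u + v))" and w0: "x (u + v) \<noteq> 0"
  shows "norm (R u (u + v) - 1) \<le> (norm (E - 1) / c\<^sup>2 * (2 * ((4 + norm \<mu>) * (1 + \<epsilon>) / \<epsilon>) + 8 + 4 * norm (E - 1))) / (norm (x (u + v)))\<^sup>2"
proof -
  note cp = node_coprime[OF n]
  define X Y W L K where "X = norm (x u)" and "Y = norm (x v)" and "W = norm (x (u + v))" and "L = norm (l u)" and "K = norm (l (u + v))"
  define C1 where "C1 = (4 + norm \<mu>) * (1 + \<epsilon>) / \<epsilon>"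
  have W: "W > 0" using w0 by (simp add: W_def)
  have L: "L > 1" "L \<ge> 1 + \<epsilon>" "X \<le> 2 * L" using norm_l_gt[OF cp(1)] \<epsilon> norm_x_le[OF cp(1)] by (simp_all add: L_def X_def)
  have K: "K > 1" "W \<le> 2 * K" using norm_l_gt[OF cp(3)] norm_x_le[OF cp(3)] by (simp_all add: K_def W_def)
  have k: "(x u)\<^sup>2 + (x v)\<^sup>2 + (x (u + v))\<^sup>2 - x u * x v * x (u + v) = \<mu>" using n by (simp add: node_def)
  have main: "norm (x v - x (u + v) / l u) \<le> C1 * L / W"
  proof -
    have eq: "(x v - x (u + v) / l u) * (x v - l u * x (u + v)) = \<mu> - (x u)\<^sup>2"
    proof -
      have "(x v - x (u + v) / l u) * (x v - l u * x (u + v)) = (x v)\<^sup>2 - (l u + 1 / l u) * x v * x (u + v) + (x (u + v))\<^sup>2"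
        using l_nz[OF cp(1)] by (simp add: field_simps power2_eq_square)
      also have "\<dots> = (x v)\<^sup>2 - x u * x v * x (u + v) + (x (u + v))\<^sup>2" by (simp only: x_l[OF cp(1), symmetric])
      also have "\<dots> = \<mu> - (x u)\<^sup>2" using k by (simp add: algebra_simps)
      finally show ?thesis .
    qed
    \<comment> \<open>Subtracting \<open>x v\<close> costs at most one copy of \<open>W\<close>, and
      \<open>L \<ge> 1 + \<epsilon>\<close> leaves the proportion
      \<open>\<epsilon> / (1 + \<epsilon>)\<close> of \<open>L * W\<close>.\<close>
    have lower: "norm (x v - l u * x (u + v)) \<ge> (\<epsilon> / (1 + \<epsilon>)) * L * W"
    proof -
      have "norm (x v - l u * x (u + v)) \<ge> L * W - Y"
        using norm_triangle_ineq2[of "l u * x (u + v)" "x v"] by (simp add: L_def W_def Y_def norm_mult norm_minus_commute)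
      moreover have "Y \<le> W" using vw by (simp add: Y_def W_def)
      moreover have "(\<epsilon> / (1 + \<epsilon>)) * L \<le> L - 1" using \<epsilon>(1) L(2) by (simp add: field_simps)
      then have "(\<epsilon> / (1 + \<epsilon>)) * L * W \<le> (L - 1) * W" using W by (intro mult_right_mono) auto
      ultimately show ?thesis by (simp add: algebra_simps)
    qed
    have pos: "(\<epsilon> / (1 + \<epsilon>)) * L * W > 0" using \<epsilon>(1) L W by simp
    have "norm (\<mu> - (x u)\<^sup>2) \<le> norm \<mu> + X\<^sup>2" unfolding X_def by (metis norm_power norm_triangle_ineq4)
    also have "\<dots> \<le> norm \<mu> * L\<^sup>2 + (2 * L)\<^sup>2"
    proof (intro add_mono power_mono L)
      have "1 \<le> L\<^sup>2" using L by simp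
      then show "norm \<mu> \<le> norm \<mu> * L\<^sup>2" by (simp add: mult_le_cancel_left1)
    qed (simp add: X_def)
    finally have up: "norm (\<mu> - (x u)\<^sup>2) \<le> (4 + norm \<mu>) * L\<^sup>2" by (simp add: algebra_simps power2_eq_square)
    have "norm (x v - x (u + v) / l u) * ((\<epsilon> / (1 + \<epsilon>)) * L * W) \<le> norm (x v - x (u + v) / l u) * norm (x v - l u * x (u + v))"
      by (intro mult_left_mono lower) auto
    also have "\<dots> \<le> (4 + norm \<mu>) * L\<^sup>2" using up unfolding norm_mult[symmetric] eq .
    finally have "norm (x v - x (u + v) / l u) \<le> (4 + norm \<mu>) * L\<^sup>2 / ((\<epsilon> / (1 + \<epsilon>)) * L * W)"
      by (simp only: pos_le_divide_eq[OF pos])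
    also have "\<dots> = C1 * L / W" using \<epsilon>(1) L W by (simp add: C1_def field_simps power2_eq_square)
    finally show ?thesis .
  qed
  have aeq: "a z = x z + (E - 1) / l z" if "coprime (fst z) (snd z)" for z
    unfolding a_def using x_l[OF that] l_nz[OF that] by (simp add: field_simps)
  have a0: "a u \<noteq> 0" "a (u + v) \<noteq> 0" using a_nz cp by auto
  have num: "P u (u + v) - a u * a (u + v) = (E - 1) * ((x v - x (u + v) / l u) - x u / l (u + v) - (E - 1) / (l u * l (u + v)))"
    unfolding P_child[OF n] aeq[OF cp(1)] aeq[OF cp(3)] using l_nz[OF cp(1)] l_nz[OF cp(3)] by (simp add: field_simps)
  have "norm (P u (u + v) - a u * a (u + v)) \<le> norm (E - 1) * (C1 * L / W + X / K + norm (E - 1) / (L * K))"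
    unfolding num norm_mult
  proof (intro mult_left_mono)
    have "norm ((x v - x (u + v) / l u) - x u / l (u + v) - (E - 1) / (l u * l (u + v))) \<le>
      norm (x v - x (u + v) / l u) + norm (x u / l (u + v)) + norm ((E - 1) / (l u * l (u + v)))"
      by (meson add_right_mono norm_triangle_ineq4 order_trans)
    then show "norm ((x v - x (u + v) / l u) - x u / l (u + v) - (E - 1) / (l u * l (u + v))) \<le> C1 * L / W + X / K + norm (E - 1) / (L * K)"
      using main by (simp add: norm_divide norm_mult X_def K_def L_def)
  qed auto
  moreover have "norm (a u * a (u + v)) \<ge> c\<^sup>2 * (L * K)"
  proof -
    have "(c * L) * (c * K) \<le> norm (a u) * norm (a (u + v))" using c K L by (intro mult_mono) (auto simp: L_def K_def)
    then show ?thesis by (simp add: norm_mult power2_eq_square mult_ac)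
  qed
  moreover have "R u (u + v) - 1 = (P u (u + v) - a u * a (u + v)) / (a u * a (u + v))" using a0 by (simp add: R_def field_simps)
  moreover have "0 \<le> C1 * L / W + X / K + norm (E - 1) / (L * K)"
    using L K W \<epsilon>(1) by (intro add_nonneg_nonneg divide_nonneg_nonneg mult_nonneg_nonneg) (auto simp: C1_def X_def)
  ultimately have "norm (R u (u + v) - 1) \<le> norm (E - 1) * (C1 * L / W + X / K + norm (E - 1) / (L * K)) / (c\<^sup>2 * (L * K))"
    using c L K by (simp only: norm_divide) (intro frac_le, auto intro!: mult_nonneg_nonneg)
  also have "\<dots> = norm (E - 1) / c\<^sup>2 * (C1 * (1 / (W * K)) + X / (L * K\<^sup>2) + norm (E - 1) / (L\<^sup>2 * K\<^sup>2))"
    using c L K W by (simp add: field_simps power2_eq_square)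
  also have "\<dots> \<le> norm (E - 1) / c\<^sup>2 * (C1 * (2 / W\<^sup>2) + 8 / W\<^sup>2 + norm (E - 1) * (4 / W\<^sup>2))"
  proof (intro mult_left_mono add_mono)
    have KW: "1 / K \<le> 2 / W" using K W by (simp add: field_simps)
    have "1 / (W * K) = 1 / W * (1 / K)" by simp
    also have "\<dots> \<le> 1 / W * (2 / W)" using W KW by (intro mult_left_mono) auto
    finally show "1 / (W * K) \<le> 2 / W\<^sup>2" by (simp add: power2_eq_square)
    have K2: "1 / K\<^sup>2 \<le> 4 / W\<^sup>2" using power_mono[OF KW, of 2] K by (simp add: power_divide)
    have "X / (L * K\<^sup>2) \<le> 2 * (1 / K\<^sup>2)"
    proof -
      have "X / (L * K\<^sup>2) = (X / L) * (1 / K\<^sup>2)" by simp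
      also have "\<dots> \<le> 2 * (1 / K\<^sup>2)" using L by (intro mult_right_mono) (auto simp: field_simps)
      finally show ?thesis .
    qed
    then show "X / (L * K\<^sup>2) \<le> 8 / W\<^sup>2" using K2 by simp
    have "1 / (L\<^sup>2 * K\<^sup>2) \<le> 1 / K\<^sup>2" using L K by (intro frac_le) (auto simp: mult_le_cancel_right1)
    then have "1 / (L\<^sup>2 * K\<^sup>2) \<le> 4 / W\<^sup>2" using K2 by simp
    then show "norm (E - 1) / (L\<^sup>2 * K\<^sup>2) \<le> norm (E - 1) * (4 / W\<^sup>2)"
      using mult_left_mono[of "1 / (L\<^sup>2 * K\<^sup>2)" "4 / W\<^sup>2" "norm (E - 1)"] by simp
  qed (use \<epsilon> in \<open>auto simp: C1_def\<close>)
  also have "\<dots> = (norm (E - 1) / c\<^sup>2 * (2 * C1 + 8 + 4 * norm (E - 1))) / W\<^sup>2" using W c by (simp add: field_simps)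
  finally show ?thesis unfolding C1_def W_def .
qed

text \<open>A node is expanding if the values of \<open>x\<close> grow geometrically along every branch of the
  tree below it. Along a region with a small value this has to be required for the whole fan of
  neighbours; elsewhere the edge relation propagates it.\<close>

definition fan :: "real \<Rightarrow> int \<times> int \<Rightarrow> int \<times> int \<Rightarrow> bool" where
  "fan \<epsilon> s v \<longleftrightarrow> (\<forall>n. (1 + \<epsilon>) * norm (x (((+) s ^^ n) v)) \<le> norm (x (((+) s ^^ Suc n) v)))"

definition expanding :: "real \<Rightarrow> int \<times> int \<Rightarrow> int \<times> int \<Rightarrow> bool" where
  "expanding \<epsilon> u v \<longleftrightarrow> node u v \<and> (norm (x u) < 4 \<longrightarrow> fan \<epsilon> u v) \<and> (norm (x v) < 4 \<longrightarrow> fan \<epsilon> v u) \<and>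
     (1 + \<epsilon>) * norm (x u) \<le> norm (x (u + v)) \<and> (1 + \<epsilon>) * norm (x v) \<le> norm (x (u + v)) \<and> 4 \<le> norm (x (u + v))"

lemma fan_step: "fan \<epsilon> s v \<Longrightarrow> fan \<epsilon> s (s + v)"
  unfolding fan_def by (metis funpow_Suc_right comp_apply)

lemma expanding_swap: "expanding \<epsilon> u v \<Longrightarrow> expanding \<epsilon> v u"
  unfolding expanding_def by (auto simp: add.commute node_swap)

text \<open>The threshold 4 makes the subtracted \<open>x v\<close> at most a quarter of the product
  \<open>x u * x (u + v)\<close> in norm; hence the factors 3 and 3/4.\<close>

lemma norm_next_ge:
  assumes "node u v" "4 \<le> norm (x u)" "norm (x v) \<le> norm (x (u + v))"
  shows "3 * norm (x (u + v)) \<le> norm (x (u + (u + v)))" "3 / 4 * (norm (x u) * norm (x (u + v))) \<le> norm (x (u + (u + v)))"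
proof -
  have "norm (x u) * norm (x (u + v)) - norm (x v) \<le> norm (x (u + (u + v)))"
    unfolding x_next[OF assms(1)] by (metis norm_mult norm_triangle_ineq2)
  moreover have "4 * norm (x (u + v)) \<le> norm (x u) * norm (x (u + v))" using assms(2) by (intro mult_right_mono) auto
  ultimately show "3 * norm (x (u + v)) \<le> norm (x (u + (u + v)))" "3 / 4 * (norm (x u) * norm (x (u + v))) \<le> norm (x (u + (u + v)))"
    using assms(3) by linarith+
qed

lemma expanding_le:
  assumes "expanding \<epsilon> u v" "0 < \<epsilon>"
  shows "norm (x u) \<le> norm (x (u + v))" "norm (x v) \<le> norm (x (u + v))"
proof -
  have "1 * norm (x u) \<le> (1 + \<epsilon>) * norm (x u)" "1 * norm (x v) \<le> (1 + \<epsilon>) * norm (x v)"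
    using assms(2) by (intro mult_right_mono; simp)+
  then show "norm (x u) \<le> norm (x (u + v))" "norm (x v) \<le> norm (x (u + v))" using assms(1) unfolding expanding_def by linarith+
qed

lemma expanding_next:
  assumes e: "expanding \<epsilon> u v" and \<epsilon>: "0 < \<epsilon>" "\<epsilon> \<le> 1"
  shows "(1 + \<epsilon>) * norm (x (u + v)) \<le> norm (x (u + (u + v)))"
proof (cases "norm (x u) < 4")
  case True
  then have "fan \<epsilon> u v" using e by (simp add: expanding_def)
  then show ?thesis unfolding fan_def by (elim allE[of _ 1]) simp
next
  case False
  then have "3 * norm (x (u + v)) \<le> norm (x (u + (u + v)))"
    using e expanding_le[OF e \<epsilon>(1)] by (intro norm_next_ge) (auto simp: expanding_def)
  moreover have "(1 + \<epsilon>) * norm (x (u + v)) \<le> 3 * norm (x (u + v))" using \<epsilon> by (intro mult_right_mono) auto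
  ultimately show ?thesis by linarith
qed

lemma expanding_child:
  assumes e: "expanding \<epsilon> u v" and \<epsilon>: "0 < \<epsilon>" "\<epsilon> \<le> 1"
  shows "expanding \<epsilon> u (u + v)" "expanding \<epsilon> v (u + v)"
proof -
  have *: "expanding \<epsilon> u (u + v)" if e: "expanding \<epsilon> u v" for u v
  proof -
    have 4: "4 \<le> norm (x (u + v))" using e by (simp add: expanding_def)
    note n = expanding_next[OF e \<epsilon>] 
    have "(1 + \<epsilon>) * norm (x u) \<le> (1 + \<epsilon>) * norm (x (u + v))" using expanding_le[OF e \<epsilon>(1)] \<epsilon> by (intro mult_left_mono) auto
    moreover have "1 * norm (x (u + v)) \<le> (1 + \<epsilon>) * norm (x (u + v))" using \<epsilon> by (intro mult_right_mono) auto
    ultimately show ?thesis using e n 4 fan_step node_child(1)[of u v] unfolding expanding_def by auto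
  qed
  show "expanding \<epsilon> u (u + v)" "expanding \<epsilon> v (u + v)"
    using *[OF e] *[OF expanding_swap[OF e]] by (simp_all add: add.commute)
qed

text \<open>A new value is at least 3/4 of a product of two large ones, so
  \<open>ln (norm (x s)) - ln (4/3)\<close> is superadditive there; next to a region with a small
  value the gain per step is \<open>ln (1 + \<epsilon>)\<close>. An additive \<open>\<nu>\<close>
  scaled by a small \<open>\<kappa>\<close> stays below these quantities on the whole tree below an
  edge once it does so at the edge.\<close>

definition weighted :: "real \<Rightarrow> real \<Rightarrow> (int \<times> int \<Rightarrow> real) \<Rightarrow> int \<times> int \<Rightarrow> bool" where
  "weighted \<epsilon> \<kappa> \<nu> s \<longleftrightarrow> (if norm (x s) < 4 then \<kappa> * \<nu> s \<le> ln (1 + \<epsilon>) else \<kappa> * \<nu> s \<le> ln (norm (x s)) - ln (4/3))"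

definition good :: "real \<Rightarrow> real \<Rightarrow> (int \<times> int \<Rightarrow> real) \<Rightarrow> int \<times> int \<Rightarrow> int \<times> int \<Rightarrow> bool" where
  "good \<epsilon> \<kappa> \<nu> u v \<longleftrightarrow> expanding \<epsilon> u v \<and> weighted \<epsilon> \<kappa> \<nu> u \<and> weighted \<epsilon> \<kappa> \<nu> v \<and> weighted \<epsilon> \<kappa> \<nu> (u + v)"

lemma good_swap: "good \<epsilon> \<kappa> \<nu> u v \<Longrightarrow> good \<epsilon> \<kappa> \<nu> v u"
  by (simp add: good_def expanding_swap add.commute)

lemma good_child:
  assumes g: "good \<epsilon> \<kappa> \<nu> u v" and \<epsilon>: "0 < \<epsilon>" "\<epsilon> \<le> 1" and \<nu>: "\<And>u v. \<nu> (u + v) = \<nu> u + \<nu> v"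
  shows "good \<epsilon> \<kappa> \<nu> u (u + v)" "good \<epsilon> \<kappa> \<nu> v (u + v)"
proof -
  have *: "good \<epsilon> \<kappa> \<nu> u (u + v)" if g: "good \<epsilon> \<kappa> \<nu> u v" for u v
  proof -
    have e: "expanding \<epsilon> u v" and w: "weighted \<epsilon> \<kappa> \<nu> u" "weighted \<epsilon> \<kappa> \<nu> (u + v)" using g by (auto simp: good_def)
    have 4: "4 \<le> norm (x (u + v))" using e by (simp add: expanding_def)
    have n: "(1 + \<epsilon>) * norm (x (u + v)) \<le> norm (x (u + (u + v)))" by (rule expanding_next[OF e \<epsilon>])
    have e': "expanding \<epsilon> u (u + v)" by (rule expanding_child(1)[OF e \<epsilon>])
    have big: "4 \<le> norm (x (u + (u + v)))" using e' by (simp add: expanding_def)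
    have w2: "\<kappa> * \<nu> (u + v) \<le> ln (norm (x (u + v))) - ln (4/3)" using w(2) 4 by (simp add: weighted_def)
    have "\<kappa> * \<nu> (u + (u + v)) = \<kappa> * \<nu> u + \<kappa> * \<nu> (u + v)" unfolding \<nu>[of u "u + v"] by (rule distrib_left)
    also have "\<dots> \<le> ln (norm (x (u + (u + v)))) - ln (4/3)"
    proof (cases "norm (x u) < 4")
      case True
      then have "\<kappa> * \<nu> u \<le> ln (1 + \<epsilon>)" using w(1) by (simp add: weighted_def)
      moreover have "ln (1 + \<epsilon>) + ln (norm (x (u + v))) \<le> ln (norm (x (u + (u + v))))"
      proof -
        have "ln (1 + \<epsilon>) + ln (norm (x (u + v))) = ln ((1 + \<epsilon>) * norm (x (u + v)))" using \<epsilon> 4 by (subst ln_mult) auto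
        also have "\<dots> \<le> ln (norm (x (u + (u + v))))" using n big \<epsilon> 4 by (subst ln_le_cancel_iff) (auto intro!: mult_pos_pos)
        finally show ?thesis .
      qed
      ultimately show ?thesis using w2 by linarith
    next
      case False
      then have "\<kappa> * \<nu> u \<le> ln (norm (x u)) - ln (4/3)" using w(1) by (simp add: weighted_def)
      moreover have "ln (norm (x u)) + ln (norm (x (u + v))) - ln (4/3) \<le> ln (norm (x (u + (u + v))))"
      proof -
        have "ln (norm (x u)) + ln (norm (x (u + v))) - ln (4/3) = ln (3 / 4 * (norm (x u) * norm (x (u + v))))"
        proof -
          have "norm (x u) > 0" "norm (x (u + v)) > 0" using False 4 by linarith+
          then have "ln (3 / 4 * (norm (x u) * norm (x (u + v)))) = ln (3/4) + (ln (norm (x u)) + ln (norm (x (u + v))))"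
            by (subst ln_mult_pos) (auto simp: ln_mult_pos)
          moreover have "ln (3/4) = - ln (4/3::real)" using ln_inverse[of "4/3::real"] by simp
          ultimately show ?thesis by simp
        qed
        also have "\<dots> \<le> ln (norm (x (u + (u + v))))"
          using norm_next_ge(2)[of u v] e expanding_le[OF e \<epsilon>(1)] False 4 big
          by (subst ln_le_cancel_iff) (auto simp: expanding_def intro!: mult_pos_pos)
        finally show ?thesis .
      qed
      ultimately show ?thesis using w2 by linarith
    qed
    finally show ?thesis using e' w big by (auto simp: good_def weighted_def)
  qed
  show "good \<epsilon> \<kappa> \<nu> u (u + v)" "good \<epsilon> \<kappa> \<nu> v (u + v)"
    using *[OF g] *[OF good_swap[OF g]] by (simp_all add: add.commute)
qed

end

section \<open>Growth on all edges from some depth on\<close>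

fun at_level :: "(int \<times> int \<Rightarrow> int \<times> int \<Rightarrow> bool) \<Rightarrow> nat \<Rightarrow> int \<times> int \<Rightarrow> int \<times> int \<Rightarrow> bool" where
  "at_level Q 0 u v \<longleftrightarrow> Q u v"
| "at_level Q (Suc n) u v \<longleftrightarrow> at_level Q n u (u + v) \<and> at_level Q n v (u + v)"

lemma at_level_mono:
  assumes child: "\<And>u v. Q u v \<Longrightarrow> Q u (u + v) \<and> Q v (u + v)" and "at_level Q m u v" "m \<le> n"
  shows "at_level Q n u v"
proof -
  have step: "at_level Q n u v \<Longrightarrow> at_level Q (Suc n) u v" for n u v
  proof (induction n arbitrary: u v)
    case 0
    then show ?case using child[of u v] by simp
  next
    case (Suc n)
    then show ?case by (metis at_level.simps(2))
  qed
  show ?thesis using assms(3,2) by (induction rule: dec_induct) (use step in blast)+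
qed

lemma exists_lower_bound:
  fixes f :: "'a \<Rightarrow> real"
  assumes "finite A" "\<And>z. z \<in> A \<Longrightarrow> f z > 0"
  obtains \<delta> where "0 < \<delta>" "\<delta> \<le> 1" "\<And>z. z \<in> A \<Longrightarrow> \<delta> \<le> f z"
proof (rule that[of "Min (insert 1 (f ` A))"])
  show "0 < Min (insert 1 (f ` A))" using assms by (subst Min_gr_iff) auto
qed (use assms in \<open>auto intro: Min_le\<close>)

lemma farey_cone_child_subset: "farey_cone u (u + v) \<subseteq> farey_cone u v" "farey_cone v (u + v) \<subseteq> farey_cone u v"
  by (subst (2) farey_cone_rec, blast)+

context markoff_map
begin

text \<open>The two sides belong to it because the estimates for an edge also involve the values at
  \<open>u\<close> and \<open>v\<close>.\<close>

definition region :: "int \<times> int \<Rightarrow> int \<times> int \<Rightarrow> (int \<times> int) set" where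
  "region u v = farey_cone u v \<union> {u, v}"

lemma region_child: "region u (u + v) \<subseteq> region u v" "region v (u + v) \<subseteq> region u v"
  unfolding region_def farey_cone_rec[of u v] by auto

lemma region_coprime: "node u v \<Longrightarrow> z \<in> region u v \<Longrightarrow> coprime (fst z) (snd z)"
  using farey_cone_coprime node_coprime node_det unfolding region_def by blast

lemma eventually_child:
  assumes child: "\<And>u v. Q u v \<Longrightarrow> Q u (u + v) \<and> Q v (u + v)"
    and "\<exists>n. at_level Q n u (u + v)" "\<exists>n. at_level Q n v (u + v)"
  shows "\<exists>n. at_level Q n u v"
proof -
  obtain n1 n2 where "at_level Q n1 u (u + v)" "at_level Q n2 v (u + v)" using assms by blast
  then have "at_level Q (Suc (max n1 n2)) u v"
    using at_level_mono[where Q=Q, OF child, of n1 u "u + v" "max n1 n2"] at_level_mono[where Q=Q, OF child, of n2 v "u + v" "max n1 n2"] by simp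
  then show ?thesis ..
qed

text \<open>The quantity \<open>y (Suc k) - L * y k\<close> is divided by \<open>L\<close> at each
  step and stays bounded by its initial norm; once \<open>norm (y k)\<close> exceeds that bound
  divided by \<open>\<epsilon>\<close>, the recurrence is close to multiplication by
  \<open>L\<close>.\<close>

lemma fan_recurrence_growth:
  assumes s: "coprime (fst s) (snd s)" and \<epsilon>: "0 < \<epsilon>" "1 + 2 * \<epsilon> \<le> norm (l s)"
    and rec: "\<And>k. y (Suc (Suc k)) = x s * y (Suc k) - y k"
  obtains B where "\<And>k. B \<le> norm (y k) \<Longrightarrow> (1 + \<epsilon>) * norm (y k) \<le> norm (y (Suc k))"
proof -
  define L where "L = l s"
  have L: "L \<noteq> 0" "x s = L + 1 / L" using l_nz[OF s] x_l[OF s] by (simp_all add: L_def)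
  define z where "z = (\<lambda>k. y (Suc k) - L * y k)"
  have zs: "z (Suc k) = z k / L" for k unfolding z_def rec L(2) using L(1) by (simp add: field_simps)
  have zk: "norm (z k) \<le> norm (z 0)" for k
  proof (induction k)
    case (Suc k)
    have "norm (z (Suc k)) = norm (z k) / norm L" by (simp add: zs norm_divide)
    also have "\<dots> \<le> norm (z k)" using norm_l_gt[OF s] L_def by (simp add: divide_le_eq mult_le_cancel_left1)
    finally show ?case using Suc by linarith
  qed simp
  show ?thesis
  proof (rule that[of "norm (z 0) / \<epsilon>"])
    fix k assume "norm (z 0) / \<epsilon> \<le> norm (y k)"
    then have a: "norm (z 0) \<le> \<epsilon> * norm (y k)" using \<epsilon>(1) by (simp add: field_simps)
    have "norm (L * y k) \<le> norm (y (Suc k)) + norm (z k)" unfolding z_def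
      by (metis norm_triangle_ineq2 norm_minus_commute add.commute diff_le_eq)
    moreover have "(1 + 2 * \<epsilon>) * norm (y k) \<le> norm (L * y k)" using \<epsilon>(2) by (simp add: norm_mult L_def mult_right_mono)
    ultimately show "(1 + \<epsilon>) * norm (y k) \<le> norm (y (Suc k))" using a zk[of k] by (simp add: algebra_simps)
  qed
qed

text \<open>Koenig's lemma: otherwise an infinite path of the tree meets no expanding edge. Its
  vertices are distinct, so finiteness drives \<open>x\<close> to infinity along it. If the path
  finally turns about one fixed region, the linear recurrence of that fan grows geometrically; if
  not, both sides eventually have values above 4 and at some step the new value dominates them.
  Either way an edge of the path is expanding.\<close>

lemma eventually_expanding:
  assumes n0: "node u0 v0" and fin: "\<And>K. finite {z \<in> farey_cone u0 v0. norm (x z) \<le> K}"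
    and \<epsilon>: "0 < \<epsilon>" "\<epsilon> \<le> 1" and lb: "\<And>z. z \<in> region u0 v0 \<Longrightarrow> 1 + 2 * \<epsilon> \<le> norm (l z)"
  shows "\<exists>n. at_level (expanding \<epsilon>) n u0 v0"
proof (rule ccontr)
  assume bad0: "\<nexists>n. at_level (expanding \<epsilon>) n u0 v0"
  \<comment> \<open>A bad edge also keeps its cone and its sides within those of
    \<open>u0, v0\<close>, so that the finiteness and the lower bound for \<open>l\<close> remain
    available along the path.\<close>
  define bad where "bad = (\<lambda>e. node (fst e) (snd e) \<and> region (fst e) (snd e) \<subseteq> region u0 v0 \<and>
      farey_cone (fst e) (snd e) \<subseteq> farey_cone u0 v0 \<and> \<not> (\<exists>n. at_level (expanding \<epsilon>) n (fst e) (snd e)))"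
  define sum' where "sum' = (\<lambda>e :: (int \<times> int) \<times> (int \<times> int). fst e + snd e)"
  have cl: "expanding \<epsilon> u v \<Longrightarrow> expanding \<epsilon> u (u + v) \<and> expanding \<epsilon> v (u + v)" for u v using expanding_child[OF _ \<epsilon>] by blast
  have "\<exists>e. \<forall>n. (bad (e n) \<and> (n = 0 \<longrightarrow> e n = (u0, v0))) \<and>
      (e (Suc n) = (fst (e n), sum' (e n)) \<or> e (Suc n) = (snd (e n), sum' (e n)))"
  proof (rule dependent_nat_choice)
    show "\<exists>e. bad e \<and> (0 = (0::nat) \<longrightarrow> e = (u0, v0))" using bad0 n0 by (intro exI[of _ "(u0, v0)"]) (auto simp: bad_def)
    fix e and n :: nat assume e: "bad e \<and> (n = 0 \<longrightarrow> e = (u0, v0))"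
    obtain u v where uv: "e = (u, v)" by (cases e)
    have b: "node u v" "region u v \<subseteq> region u0 v0" "farey_cone u v \<subseteq> farey_cone u0 v0" "\<not> (\<exists>n. at_level (expanding \<epsilon>) n u v)"
      using e by (auto simp: bad_def uv)
    have "(\<not> (\<exists>n. at_level (expanding \<epsilon>) n u (u + v))) \<or> (\<not> (\<exists>n. at_level (expanding \<epsilon>) n v (u + v)))"
      using eventually_child[where Q="expanding \<epsilon>", OF cl, of u v] b(4) by blast
    then have "bad (u, u + v) \<or> bad (v, u + v)"
      using b node_child[OF b(1)] region_child(1)[of u v] region_child(2)[where u=u and v=v] farey_cone_rec[of u v] by (auto simp: bad_def)
    then show "\<exists>e'. (bad e' \<and> (Suc n = 0 \<longrightarrow> e' = (u0, v0))) \<and> (e' = (fst e, sum' e) \<or> e' = (snd e, sum' e))"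
    proof
      assume "bad (u, u + v)"
      then show ?thesis by (intro exI[of _ "(u, u + v)"]) (simp add: uv sum'_def)
    next
      assume "bad (v, u + v)"
      then show ?thesis by (intro exI[of _ "(v, u + v)"]) (simp add: uv sum'_def)
    qed
  qed
  then obtain e where e: "\<And>n. bad (e n)" "\<And>n. e (Suc n) = (fst (e n), sum' (e n)) \<or> e (Suc n) = (snd (e n), sum' (e n))" by blast
  define w where "w = (\<lambda>n. sum' (e n))"
  have nd: "node (fst (e n)) (snd (e n))" for n using e(1) by (simp add: bad_def)
  have win: "w n \<in> farey_cone (fst (e n)) (snd (e n))" for n unfolding w_def sum'_def by (subst farey_cone_rec) simp
  have dec1: "farey_cone (fst (e (Suc n))) (snd (e (Suc n))) \<subseteq> farey_cone (fst (e n)) (snd (e n))" for n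
    using e(2)[of n] by (elim disjE) (simp_all add: sum'_def farey_cone_child_subset)
  have dec: "farey_cone (fst (e n)) (snd (e n)) \<subseteq> farey_cone (fst (e m)) (snd (e m))" if "m \<le> n" for m n
    using that by (induction rule: dec_induct) (use dec1 in blast)+
  have wnot: "w n \<notin> farey_cone (fst (e (Suc n))) (snd (e (Suc n)))" for n
    using e(2)[of n] farey_cone_disjoint[OF node_det[OF nd[of n]]] by (auto simp: w_def sum'_def)
  have injw: "inj w"
  proof (rule linorder_injI)
    fix m n :: nat assume "m < n"
    then have "w n \<in> farey_cone (fst (e (Suc m))) (snd (e (Suc m)))" using win[of n] dec[of "Suc m" n] by auto
    then show "w m \<noteq> w n" using wnot[of m] by metis
  qed
  have w0: "w n \<in> farey_cone u0 v0" for n using e(1)[of n] win[of n] by (auto simp: bad_def)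
  have big: "\<exists>N. \<forall>n\<ge>N. K < norm (x (w n))" for K
  proof -
    have "finite {n. norm (x (w n)) \<le> K}"
      by (rule finite_imageD[of w]) (use injw w0 in \<open>auto intro!: finite_subset[OF _ fin[of K]] inj_on_subset[OF injw]\<close>)
    then obtain N where "\<And>n. n \<in> {n. norm (x (w n)) \<le> K} \<Longrightarrow> n < N" using finite_nat_set_iff_bounded by metis
    then show ?thesis by (metis mem_Collect_eq not_le)
  qed
  have snd_e: "snd (e (Suc n)) = w n" for n using e(2)[of n] by (auto simp: w_def)
  have notG: "\<not> expanding \<epsilon> (fst (e n)) (snd (e n))" for n
    using e(1)[of n] unfolding bad_def by (metis at_level.simps(1))
  show False
  proof (cases "\<exists>N. \<forall>n\<ge>N. fst (e (Suc n)) = fst (e n)")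
    case True
    then obtain N where N: "\<And>n. n \<ge> N \<Longrightarrow> fst (e (Suc n)) = fst (e n)" by blast
    define s where "s = fst (e N)"
    define y where "y = (\<lambda>k. x (snd (e (N + k))))"
    have fs: "fst (e (N + k)) = s" for k by (induction k) (use N in \<open>auto simp: s_def\<close>)
    have ss: "snd (e (N + Suc k)) = s + snd (e (N + k))" for k
      using snd_e[of "N + k"] fs[of k] by (simp add: w_def sum'_def)
    have sc: "coprime (fst s) (snd s)" using node_coprime(1)[OF nd[of N]] by (simp add: s_def)
    have rec: "y (Suc (Suc k)) = x s * y (Suc k) - y k" for k
    proof -
      have nn: "node s (snd (e (N + k)))" using nd[of "N + k"] fs[of k] by simp
      show ?thesis unfolding y_def ss x_next[OF nn] ..
    qed
    have sr: "s \<in> region u0 v0" using e(1)[of N] by (auto simp: bad_def s_def region_def)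
    obtain B where B: "\<And>k. B \<le> norm (y k) \<Longrightarrow> (1 + \<epsilon>) * norm (y k) \<le> norm (y (Suc k))"
      using fan_recurrence_growth[where y=y, OF sc \<epsilon>(1) lb[OF sr] rec] by metis
    obtain N1 where N1: "\<And>n. n \<ge> N1 \<Longrightarrow> max B (max 4 ((1 + \<epsilon>) * norm (x s))) < norm (x (w n))" using big by blast
    have yb: "max B (max 4 ((1 + \<epsilon>) * norm (x s))) < norm (y (Suc k))" if "k \<ge> N1" for k
      using N1[of "N + k"] that snd_e[of "N + k"] by (simp add: y_def)
    define k0 where "k0 = Suc N1"
    have gr: "(1 + \<epsilon>) * norm (y k) \<le> norm (y (Suc k))" if k: "k \<ge> k0" for k
    proof -
      obtain j where "k = Suc j" "j \<ge> N1" using k by (cases k) (auto simp: k0_def)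
      then show ?thesis using yb[of j] by (intro B) auto
    qed
    have fp: "x (((+) s ^^ n) (snd (e (N + k)))) = y (k + n)" for n k
    proof -
      have "((+) s ^^ n) (snd (e (N + k))) = snd (e (N + (k + n)))"
        by (induction n) (use ss in \<open>auto simp: add.assoc\<close>)
      then show ?thesis by (simp add: y_def)
    qed
    have "fan \<epsilon> s (snd (e (N + k0)))" unfolding fan_def
    proof
      fix n show "(1 + \<epsilon>) * norm (x (((+) s ^^ n) (snd (e (N + k0))))) \<le> norm (x (((+) s ^^ Suc n) (snd (e (N + k0)))))"
        unfolding fp using gr[of "k0 + n"] by simp
    qed
    moreover have yk: "4 < norm (y k0)" "(1 + \<epsilon>) * norm (x s) < norm (y k0)" using yb[of N1] by (auto simp: k0_def)
    moreover have "norm (y k0) \<le> norm (y (Suc k0))"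
    proof -
      have "1 * norm (y k0) \<le> (1 + \<epsilon>) * norm (y k0)" using \<epsilon> by (intro mult_right_mono) auto
      then show ?thesis using gr[of k0] by simp
    qed
    moreover have "x (s + snd (e (N + k0))) = y (Suc k0)" using fp[of 1 k0] by simp
    moreover have "x (snd (e (N + k0))) = y k0" by (simp add: y_def)
    moreover have "node s (snd (e (N + k0)))" using nd[of "N + k0"] fs[of k0] by simp
    ultimately have "expanding \<epsilon> s (snd (e (N + k0)))" unfolding expanding_def using gr[of k0] by auto
    then show False using notG[of "N + k0"] fs[of k0] by simp
  next
    case False
    obtain N where N: "\<And>n. n \<ge> N \<Longrightarrow> 4 < norm (x (w n))" using big by blast
    obtain n1 where n1: "n1 \<ge> Suc N" "fst (e (Suc n1)) \<noteq> fst (e n1)" using False by blast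
    have sides: "4 < norm (x (fst (e n))) \<and> 4 < norm (x (snd (e n)))" if "n \<ge> Suc n1" for n
      using that
    proof (induction rule: dec_induct)
      case base
      obtain j where j: "n1 = Suc j" "j \<ge> N" using n1(1) by (cases n1) auto
      have "fst (e (Suc n1)) = w j" using e(2)[of n1] n1(2) snd_e[of j] j by auto
      then show ?case using N[of j] N[of n1] snd_e[of n1] j by auto
    next
      case (step n)
      have "fst (e (Suc n)) = fst (e n) \<or> fst (e (Suc n)) = snd (e n)" using e(2)[of n] by auto
      then show ?case using step snd_e[of n] N[of n] n1(1) by auto
    qed
    define m where "m = (\<lambda>n. max (norm (x (fst (e n)))) (norm (x (snd (e n)))))"
    \<comment> \<open>If every new value were below the larger of its two neighbours, the maxima
      \<open>m\<close> could not increase and would bound \<open>x\<close> along the path.\<close>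
    have "\<exists>n\<ge>Suc n1. m n \<le> norm (x (w n))"
    proof (rule ccontr)
      assume "\<not> ?thesis"
      then have lt: "norm (x (w n)) < m n" if "n \<ge> Suc n1" for n using that by (meson not_le)
      have mono: "m n \<le> m (Suc n1)" if "n \<ge> Suc n1" for n
        using that
      proof (induction rule: dec_induct)
        case (step n)
        have "m (Suc n) \<le> m n" using e(2)[of n] lt[of n] step(1) snd_e[of n] by (auto simp: m_def w_def)
        then show ?case using step by linarith
      qed simp
      obtain N2 where "\<And>n. n \<ge> N2 \<Longrightarrow> m (Suc n1) < norm (x (w n))" using big by blast
      then show False using lt[of "max N2 (Suc n1)"] mono[of "max N2 (Suc n1)"] by (smt (verit) max.cobounded1 max.cobounded2)
    qed
    then obtain n where n: "n \<ge> Suc n1" "m n \<le> norm (x (w n))" by blast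
    define u v where "u = fst (e n)" and "v = snd (e n)"
    have w: "w n = u + v" by (simp add: w_def sum'_def u_def v_def)
    have s4: "4 < norm (x u)" "4 < norm (x v)" using sides[OF n(1)] by (simp_all add: u_def v_def)
    have le: "norm (x u) \<le> norm (x (u + v))" "norm (x v) \<le> norm (x (u + v))" using n(2) w by (simp_all add: m_def u_def v_def)
    have nuv: "node u v" using nd[of n] by (simp add: u_def v_def)
    have ex: "expanding \<epsilon> u (u + v)" if "node u v" "4 < norm (x u)" "norm (x u) \<le> norm (x (u + v))" "norm (x v) \<le> norm (x (u + v))" for u v
    proof -
      have 3: "3 * norm (x (u + v)) \<le> norm (x (u + (u + v)))" using that by (intro norm_next_ge) auto
      have "(1 + \<epsilon>) * norm (x (u + v)) \<le> 2 * norm (x (u + v))" "(1 + \<epsilon>) * norm (x u) \<le> 2 * norm (x u)" using \<epsilon> by (intro mult_right_mono; simp)+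
      then show ?thesis unfolding expanding_def using that 3 node_child(1)[OF that(1)] by auto
    qed
    have "expanding \<epsilon> u (u + v)" by (rule ex[OF nuv s4(1) le])
    moreover have "expanding \<epsilon> v (u + v)" using ex[OF node_swap[OF nuv]] s4(2) le by (simp add: add.commute)
    ultimately show False using notG[of "Suc n"] e(2)[of n] by (auto simp: sum'_def u_def v_def)
  qed
qed

text \<open>There are finitely many edges at depth \<open>n\<close>, each with three vertices to be
  weighted, so one small \<open>\<kappa>\<close> serves them all.\<close>

lemma at_level_good:
  assumes "at_level (expanding \<epsilon>) n u v" "0 < \<epsilon>"
  shows "\<exists>\<kappa>0>0. \<forall>\<kappa>. 0 < \<kappa> \<and> \<kappa> \<le> \<kappa>0 \<longrightarrow> at_level (good \<epsilon> \<kappa> \<nu>) n u v"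
  using assms(1)
proof (induction n arbitrary: u v)
  case 0
  have e: "expanding \<epsilon> u v" using 0 by simp
  define b where "b = (\<lambda>s. (if norm (x s) < 4 then ln (1 + \<epsilon>) else ln (norm (x s)) - ln (4/3)) / (1 + \<bar>\<nu> s\<bar>))"
  have bpos: "b s > 0" for s
  proof -
    have "ln (4/3) < ln (norm (x s))" if "\<not> norm (x s) < 4" using that by (subst ln_less_cancel_iff) auto
    then show ?thesis using assms(2) by (auto simp: b_def intro!: divide_pos_pos)
  qed
  have fin: "finite {u, v, u + v}" by simp
  obtain \<delta> where \<delta>: "0 < \<delta>" "\<delta> \<le> 1" "\<And>z. z \<in> {u, v, u + v} \<Longrightarrow> \<delta> \<le> b z"
    using exists_lower_bound[OF fin, of b, OF bpos] by blast
  have "weighted \<epsilon> \<kappa> \<nu> s" if "0 < \<kappa>" "\<kappa> \<le> \<delta>" "s \<in> {u, v, u + v}" for \<kappa> s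
  proof -
    have "\<kappa> * \<nu> s \<le> \<kappa> * (1 + \<bar>\<nu> s\<bar>)" using that(1) by (intro mult_left_mono) auto
    also have "\<dots> \<le> b s * (1 + \<bar>\<nu> s\<bar>)" using that \<delta>(3)[OF that(3)] by (intro mult_right_mono) auto
    also have "\<dots> = (if norm (x s) < 4 then ln (1 + \<epsilon>) else ln (norm (x s)) - ln (4/3))" by (simp add: b_def)
    finally show ?thesis by (simp add: weighted_def split: if_splits)
  qed
  then show ?case using e \<delta>(1) by (intro exI[of _ \<delta>]) (auto simp: good_def)
next
  case (Suc n)
  then obtain k1 k2 where "k1 > 0" "\<forall>\<kappa>. 0 < \<kappa> \<and> \<kappa> \<le> k1 \<longrightarrow> at_level (good \<epsilon> \<kappa> \<nu>) n u (u + v)"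
    "k2 > 0" "\<forall>\<kappa>. 0 < \<kappa> \<and> \<kappa> \<le> k2 \<longrightarrow> at_level (good \<epsilon> \<kappa> \<nu>) n v (u + v)" by (metis at_level.simps(2))
  then show ?case by (intro exI[of _ "min k1 k2"]) auto
qed

definition product_formula :: "int \<times> int \<Rightarrow> int \<times> int \<Rightarrow> bool" where
  "product_formula u v \<longleftrightarrow> (\<lambda>z. norm (Ln (F z))) summable_on farey_cone u v \<and> R u v = exp (infsum (\<lambda>z. Ln (F z)) (farey_cone u v))"

text \<open>In \<open>R_rec\<close> the factor \<open>F (u + v)\<close> accounts for the root of the
  cone and the other two factors for its subcones.\<close>

lemma product_formula_child:
  assumes n: "node u v" and 1: "product_formula u (u + v)" and 2: "product_formula v (u + v)"
  shows "product_formula u v"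
proof -
  note d = farey_cone_disjoint[OF node_det[OF n]]
  let ?f = "\<lambda>z. Ln (F z)"
  have s: "(\<lambda>z. norm (?f z)) summable_on farey_cone u (u + v)" "(\<lambda>z. norm (?f z)) summable_on farey_cone v (u + v)"
    using 1 2 by (simp_all add: product_formula_def)
  have s': "?f summable_on farey_cone u (u + v)" "?f summable_on farey_cone v (u + v)" using abs_summable_summable[OF s(1)] abs_summable_summable[OF s(2)] by auto
  have "infsum ?f (farey_cone u v) = ?f (u + v) + infsum ?f (farey_cone u (u + v) \<union> farey_cone v (u + v))"
    unfolding farey_cone_rec[of u v] using d summable_on_Un_disjoint[OF s' d(1)] by (intro infsum_insert) auto
  also have "infsum ?f (farey_cone u (u + v) \<union> farey_cone v (u + v)) = infsum ?f (farey_cone u (u + v)) + infsum ?f (farey_cone v (u + v))"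
    by (rule infsum_Un_disjoint[OF s' d(1)])
  finally have "exp (infsum ?f (farey_cone u v)) = F (u + v) * R u (u + v) * R v (u + v)"
    using 1 2 F_nz[OF node_coprime(3)[OF n]] by (simp add: product_formula_def exp_add)
  moreover have "(\<lambda>z. norm (?f z)) summable_on farey_cone u v"
    unfolding farey_cone_rec[of u v] summable_on_insert_iff using summable_on_Un_disjoint[OF s d(1)] .
  ultimately show ?thesis using R_rec[OF n] by (simp add: product_formula_def)
qed

lemma R_swap: "\<bar>det2 u v\<bar> = 1 \<Longrightarrow> R u v = R v u"
proof -
  assume d: "\<bar>det2 u v\<bar> = 1"
  have "coprime (fst (u - v)) (snd (u - v))"
  proof (rule coprimeI)
    fix d' assume "d' dvd fst (u - v)" "d' dvd snd (u - v)"
    then have "d' dvd det2 (u - v) v" unfolding det2_def by (intro dvd_diff dvd_mult2)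
    moreover have "det2 (u - v) v = det2 u v" by (simp add: det2_def algebra_simps)
    ultimately show "is_unit d'" using d by (metis dvd_abs_iff)
  qed
  from neg[OF this] have "x (v - u) = x (u - v)" by simp
  then show ?thesis by (simp add: R_def P_def mult.commute)
qed

end

section \<open>The product formula on a cone and on a difference of cones\<close>

context markoff_map
begin

lemma norm_x_ge_weighted:
  assumes "weighted \<epsilon> \<kappa> \<nu> z" "4 \<le> norm (x z)"
  shows "exp (\<kappa> * \<nu> z) \<le> norm (x z)"
proof -
  have "\<kappa> * \<nu> z \<le> ln (norm (x z)) - ln (4/3)" using assms by (simp add: weighted_def)
  also have "\<dots> \<le> ln (norm (x z))" by simp
  finally have "\<kappa> * \<nu> z \<le> ln (norm (x z))" .
  moreover have "norm (x z) > 0" using assms(2) by linarith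
  ultimately show ?thesis by (simp only: ln_ge_iff)
qed

lemma F_minus_1:
  assumes "coprime (fst z) (snd z)"
  shows "F z = 1 + (E - 1 / E) / (1 / E + (l z)\<^sup>2)"
  using factors_nz(2)[OF assms] by (simp add: F_def add.commute field_simps)

text \<open>\<open>F\<close> is 1 plus \<open>(E - 1 / E) / (1 / E + l\<^sup>2)\<close>, and
  \<open>norm l \<ge> norm x / 2\<close>. The threshold makes \<open>norm (1 / E)\<close> at most
  \<open>(norm x)\<^sup>2 / 8\<close> and the fraction smaller than 1/2, where the norm of
  \<open>Ln (1 + t)\<close> is at most \<open>2 * norm t\<close>.\<close>

lemma norm_Ln_F_le:
  assumes c: "coprime (fst z) (snd z)" and big: "norm (x z) > 2 + 4 / norm E + 16 * norm (E - 1 / E)"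
  shows "norm (Ln (F z)) \<le> 16 * norm (E - 1 / E) / (norm (x z))\<^sup>2"
proof -
  define X where "X = norm (x z)"
  have X2: "X > 2" "X > 4 / norm E" "X > 16 * norm (E - 1 / E)"
    using big norm_ge_zero[of "E - 1 / E"] divide_nonneg_nonneg[of 4 "norm E"] unfolding X_def by (smt (verit) norm_ge_zero)+
  have L: "norm (l z) \<ge> X / 2" using norm_x_le[OF c] by (simp add: X_def)
  have L2: "norm ((l z)\<^sup>2) \<ge> X\<^sup>2 / 4" using power_mono[OF L, of 2] X2 by (simp add: norm_power power_divide)
  have "1 / norm E < X / 4" using X2(2) by simp
  also have "X / 4 \<le> X\<^sup>2 / 8" using X2(1) by (simp add: power2_eq_square)
  finally have "norm (1 / E) \<le> X\<^sup>2 / 8" by (simp add: norm_divide)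
  then have den: "norm (1 / E + (l z)\<^sup>2) \<ge> X\<^sup>2 / 8"
    using L2 norm_diff_ineq[of "(l z)\<^sup>2" "1 / E"] by (simp add: add.commute)
  define t where "t = (E - 1 / E) / (1 / E + (l z)\<^sup>2)"
  have "norm t = norm (E - 1 / E) / norm (1 / E + (l z)\<^sup>2)" by (simp only: t_def norm_divide)
  also have "\<dots> \<le> norm (E - 1 / E) / (X\<^sup>2 / 8)" using den X2 by (intro divide_left_mono) (auto intro!: mult_pos_pos)
  finally have t: "norm t \<le> 8 * norm (E - 1 / E) / X\<^sup>2" by (simp add: mult.commute)
  have "8 * norm (E - 1 / E) < X / 2" using X2(3) by simp
  also have "X / 2 \<le> X\<^sup>2 / 4" using X2(1) by (simp add: power2_eq_square)
  finally have "8 * norm (E - 1 / E) < X\<^sup>2 / 4" .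
  moreover have X0: "X\<^sup>2 > 0" using X2(1) by simp
  ultimately have "8 * norm (E - 1 / E) < 1 / 2 * X\<^sup>2" by linarith
  then have "8 * norm (E - 1 / E) / X\<^sup>2 < 1 / 2" using X0 by (simp only: pos_divide_less_eq)
  then have "norm (Ln (1 + t)) \<le> 2 * norm t" using t by (intro norm_Ln_le) linarith
  also have "\<dots> \<le> 16 * norm (E - 1 / E) / X\<^sup>2" using t by simp
  finally show ?thesis using F_minus_1[OF c] by (simp add: t_def X_def)
qed

text \<open>At each single vector the bounds come from \<open>norm_l_gt\<close> and
  \<open>a_nz\<close>; they are uniform because only finitely many vectors have small
  \<open>x\<close>, and large \<open>x\<close> forces explicit bounds.\<close>

lemma region_bounds:
  assumes n: "node u0 v0" and fin: "\<And>K. finite {z \<in> farey_cone u0 v0. norm (x z) \<le> K}"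
  obtains \<epsilon> c where "0 < \<epsilon>" "\<epsilon> \<le> 1" "\<And>z. z \<in> region u0 v0 \<Longrightarrow> 1 + 2 * \<epsilon> \<le> norm (l z)"
    "0 < c" "\<And>z. z \<in> region u0 v0 \<Longrightarrow> c * norm (l z) \<le> norm (a z)"
proof -
  have finr: "finite {z \<in> region u0 v0. norm (x z) \<le> K}" for K
    by (rule finite_subset[of _ "{z \<in> farey_cone u0 v0. norm (x z) \<le> K} \<union> {u0, v0}"]) (use fin in \<open>auto simp: region_def\<close>)
  note cp = region_coprime[OF n]
  have h1: "0 < (norm (l z) - 1) / 2" if "z \<in> {z \<in> region u0 v0. norm (x z) \<le> 4}" for z
    using norm_l_gt[OF cp[of z]] that by simp
  obtain \<epsilon> where \<epsilon>: "0 < \<epsilon>" "\<epsilon> \<le> 1" "\<And>z. z \<in> {z \<in> region u0 v0. norm (x z) \<le> 4} \<Longrightarrow> \<epsilon> \<le> (norm (l z) - 1) / 2"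
    using exists_lower_bound[OF finr[of 4], of "\<lambda>z. (norm (l z) - 1) / 2", OF h1] by blast
  \<comment> \<open>Beyond \<open>K\<close>, \<open>norm_x_le\<close> gives
    \<open>norm (l z) > 1 + 2 * norm E\<close>, so the term \<open>E / l z\<close> of
    \<open>a z\<close> is at most half of \<open>l z\<close> in norm.\<close>
  define K where "K = 2 * (1 + 2 * norm E)"
  have h2: "0 < norm (a z) / norm (l z)" if "z \<in> {z \<in> region u0 v0. norm (x z) \<le> K}" for z
    using a_nz[OF cp[of z]] l_nz[OF cp[of z]] that by simp
  obtain c where c: "0 < c" "c \<le> 1" "\<And>z. z \<in> {z \<in> region u0 v0. norm (x z) \<le> K} \<Longrightarrow> c \<le> norm (a z) / norm (l z)"
    using exists_lower_bound[OF finr[of K], of "\<lambda>z. norm (a z) / norm (l z)", OF h2] by blast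
  show ?thesis
  proof (rule that[OF \<epsilon>(1,2)])
    fix z assume z: "z \<in> region u0 v0"
    show "1 + 2 * \<epsilon> \<le> norm (l z)"
    proof (cases "norm (x z) \<le> 4")
      case True
      then show ?thesis using \<epsilon>(3)[of z] z by simp
    next
      case False
      have "norm (x z) \<le> norm (l z) + norm (1 / l z)" unfolding x_l[OF cp[OF z]] by (rule norm_triangle_ineq)
      moreover have "norm (1 / l z) \<le> 1" using norm_l_gt[OF cp[OF z]] by (simp add: norm_divide divide_le_eq)
      ultimately show ?thesis using False \<epsilon>(2) by linarith
    qed
    show "min c (1/2) * norm (l z) \<le> norm (a z)"
    proof (cases "norm (x z) \<le> K")
      case True
      then have "c * norm (l z) \<le> norm (a z)" using c(3)[of z] z l_nz[OF cp[OF z]] by (simp add: field_simps)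
      moreover have "min c (1/2) * norm (l z) \<le> c * norm (l z)" by (intro mult_right_mono) auto
      ultimately show ?thesis by linarith
    next
      case False
      have L: "norm (l z) > 1 + 2 * norm E" using False norm_x_le[OF cp[OF z]] by (simp add: K_def)
      have "norm (E / l z) = norm E / norm (l z)" by (simp add: norm_divide)
      also have "\<dots> \<le> norm E" using norm_l_gt[OF cp[OF z]] by (simp add: divide_le_eq mult_le_cancel_left1)
      also have "\<dots> \<le> norm (l z) / 2" using L by simp
      finally have "norm (l z) / 2 \<le> norm (a z)" unfolding a_def using norm_diff_ineq[of "l z" "E / l z"] by linarith
      moreover have "min c (1/2) * norm (l z) \<le> 1/2 * norm (l z)" by (intro mult_right_mono) auto
      ultimately show ?thesis by linarith
    qed
  qed (use c in auto)
qed

text \<open>From some depth on all edges are expanding and \<open>\<kappa> * \<nu>\<close> bounds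
  the logarithm of \<open>norm x\<close> from below at new vertices. There both
  \<open>norm (R - 1)\<close> and \<open>norm (Ln F)\<close> decay exponentially in
  \<open>\<nu>\<close>, so \<open>cone_product_formula\<close> applies;
  \<open>product_formula_child\<close> carries the result back to the root.\<close>

theorem cone_formula:
  assumes n: "node u0 v0" and fin: "\<And>K. finite {z \<in> farey_cone u0 v0. norm (x z) \<le> K}"
  shows "product_formula u0 v0"
proof -
  note cp = region_coprime[OF n]
  obtain \<epsilon> c where \<epsilon>: "0 < \<epsilon>" "\<epsilon> \<le> 1" and lb: "\<And>z. z \<in> region u0 v0 \<Longrightarrow> 1 + 2 * \<epsilon> \<le> norm (l z)"
    and c: "0 < c" "\<And>z. z \<in> region u0 v0 \<Longrightarrow> c * norm (l z) \<le> norm (a z)"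
    using region_bounds[OF n fin] by metis
  obtain N where N: "at_level (expanding \<epsilon>) N u0 v0" using eventually_expanding[OF n fin \<epsilon> lb] by blast
  define \<sigma> where "\<sigma> = det2 u0 v0"
  \<comment> \<open>The linear function with value 1 at \<open>u0\<close> and \<open>v0\<close>,
    hence \<open>p + q\<close> on \<open>comb p q u0 v0\<close>; the sign \<open>\<sigma>\<close>
    covers both orientations.\<close>
  define \<nu> where "\<nu> = (\<lambda>z. real_of_int (\<sigma> * (det2 z v0 + det2 u0 z)))"
  have "\<sigma> = 1 \<or> \<sigma> = -1" using node_det[OF n] unfolding \<sigma>_def by linarith
  then have \<sigma>: "\<sigma> * \<sigma> = 1" by (elim disjE) simp_all
  have \<nu>add: "\<nu> (u + v) = \<nu> u + \<nu> v" for u v by (simp add: \<nu>_def det2_def algebra_simps)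
  have \<nu>comb: "\<nu> (comb p q u v) = of_int p * \<nu> u + of_int q * \<nu> v" for p q u v
    by (simp add: \<nu>_def det2_def comb_def algebra_simps)
  have \<nu>0: "\<nu> u0 = 1" "\<nu> v0 = 1"
  proof -
    have "det2 u0 u0 = 0" "det2 v0 v0 = 0" by (simp_all add: det2_def)
    then show "\<nu> u0 = 1" "\<nu> v0 = 1" using \<sigma> unfolding \<nu>_def \<sigma>_def[symmetric] by simp_all
  qed
  have \<nu>1: "\<nu> z \<ge> 1" if "z \<in> region u0 v0" for z
    using that \<nu>0 unfolding region_def farey_cone_def by (auto simp: \<nu>comb)
  obtain \<kappa> where \<kappa>: "\<kappa> > 0" "at_level (good \<epsilon> \<kappa> \<nu>) N u0 v0" using at_level_good[OF N \<epsilon>(1), of \<nu>] by blast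
  \<comment> \<open>\<open>Q\<close> describes edges one level below a good edge
    \<open>u, v - u\<close>, because \<open>R_child_bound\<close> estimates \<open>R\<close> on a
    child edge in terms of its parent.\<close>
  define Q where "Q = (\<lambda>u v. good \<epsilon> \<kappa> \<nu> u (v - u) \<and> region u v \<subseteq> region u0 v0 \<and> v - u \<in> region u0 v0)"
  have gch: "good \<epsilon> \<kappa> \<nu> u v \<Longrightarrow> good \<epsilon> \<kappa> \<nu> u (u + v)" "good \<epsilon> \<kappa> \<nu> u v \<Longrightarrow> good \<epsilon> \<kappa> \<nu> v (u + v)" for u v
    using good_child[OF _ \<epsilon> \<nu>add] by blast+
  have Qgood: "good \<epsilon> \<kappa> \<nu> u v" if "Q u v" for u v
    using gch(1)[of u "v - u"] that by (simp add: Q_def)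
  have gnode: "good \<epsilon> \<kappa> \<nu> u v \<Longrightarrow> node u v" for u v by (simp add: good_def expanding_def)
  have Qch: "Q u (u + v) \<and> Q v (u + v)" if "Q u v" for u v
  proof -
    have "good \<epsilon> \<kappa> \<nu> u v" by (rule Qgood[OF that])
    moreover have "u \<in> region u0 v0" "v \<in> region u0 v0" using that by (auto simp: Q_def region_def)
    ultimately show ?thesis using that good_swap region_child(1)[of u v] region_child(2)[where u=u and v=v] by (auto simp: Q_def)
  qed
  have big4: "4 \<le> norm (x v)" "weighted \<epsilon> \<kappa> \<nu> v" if "Q u v" for u v
    using that by (auto simp: Q_def good_def expanding_def)
  have conebig: "z \<in> truncated_cone k u v \<Longrightarrow> Q u v \<Longrightarrow> 4 \<le> norm (x z) \<and> weighted \<epsilon> \<kappa> \<nu> z" for z k u v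
  proof (induction k arbitrary: u v)
    case (Suc k)
    note Q = Qch[OF Suc.prems(2)]
    have "z = u + v \<or> z \<in> truncated_cone k u (u + v) \<or> z \<in> truncated_cone k v (u + v)" using Suc.prems(1) by simp
    then show ?case
    proof (elim disjE)
      assume "z = u + v"
      then show ?thesis using big4[OF Q[THEN conjunct1]] by simp
    next
      assume "z \<in> truncated_cone k u (u + v)"
      then show ?thesis using Suc.IH Q by blast
    next
      assume "z \<in> truncated_cone k v (u + v)"
      then show ?thesis using Suc.IH Q by blast
    qed
  qed auto
  have conebig': "4 \<le> norm (x z) \<and> weighted \<epsilon> \<kappa> \<nu> z" if "z \<in> farey_cone u v" "Q u v" for z u v
  proof -
    obtain p q where z: "z = comb p q u v" "p \<ge> 1" "q \<ge> 1" "coprime p q" using \<open>z \<in> farey_cone u v\<close> unfolding farey_cone_def by auto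
    then have "z \<in> truncated_cone (nat (p + q)) u v" using truncated_cone_exhausts[of p q "nat (p + q)" u v] by simp
    then show ?thesis using conebig that(2) by blast
  qed
  define \<beta> where "\<beta> = (\<lambda>z. exp (- \<kappa> * \<nu> z))"
  define C where "C = norm (E - 1) / c\<^sup>2 * (2 * ((4 + norm \<mu>) * (1 + \<epsilon>) / \<epsilon>) + 8 + 4 * norm (E - 1))"
  have C0: "C \<ge> 0" using \<epsilon> by (auto simp: C_def)
  have bound: "norm (R u v - 1) \<le> C * \<beta> (u + v)" if q: "Q u v" for u v
  proof -
    have g: "good \<epsilon> \<kappa> \<nu> u (v - u)" and r: "u \<in> region u0 v0" "v \<in> region u0 v0" "v - u \<in> region u0 v0"
      using q by (auto simp: Q_def region_def)
    have ex: "expanding \<epsilon> u (v - u)" using g by (simp add: good_def)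
    have v4: "4 \<le> norm (x v)" "weighted \<epsilon> \<kappa> \<nu> v" using big4[OF q] by auto
    have vv: "u + (v - u) = v" by simp
    have "norm (R u (u + (v - u)) - 1) \<le> C / (norm (x (u + (v - u))))\<^sup>2"
      unfolding C_def
    proof (rule R_child_bound[OF gnode[OF g] \<epsilon>(1)])
      show "1 + \<epsilon> \<le> norm (l u)" using lb[OF r(1)] \<epsilon>(1) by linarith
      show "norm (x (v - u)) \<le> norm (x (u + (v - u)))" by (rule expanding_le(2)[OF ex \<epsilon>(1)])
      show "x (u + (v - u)) \<noteq> 0" using v4 by auto
    qed (use c r in auto)
    then have "norm (R u v - 1) \<le> C / (norm (x v))\<^sup>2" unfolding vv .
    also have "\<dots> \<le> C / exp (\<kappa> * \<nu> (u + v))"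
    proof (intro divide_left_mono C0)
      have "exp (\<kappa> * \<nu> v) ^ 2 \<le> (norm (x v))\<^sup>2" using norm_x_ge_weighted[OF v4(2,1)] by (intro power_mono) auto
      \<comment> \<open>As \<open>v\<close> is the sum of \<open>u\<close> and \<open>v - u\<close>,
        \<open>\<nu> u\<close> is smaller than \<open>\<nu> v\<close>. The square in the bound at
        \<open>v\<close> thus pays for the vertex \<open>u + v\<close>, over which
        \<open>level_prod_bound\<close> sums.\<close>
      moreover have "exp (\<kappa> * \<nu> (u + v)) \<le> exp (\<kappa> * \<nu> v) ^ 2"
      proof -
        have "\<nu> v = \<nu> u + \<nu> (v - u)" using \<nu>add[of u "v - u"] by simp
        then have "\<nu> (u + v) \<le> 2 * \<nu> v" using \<nu>1[OF r(3)] by (simp add: \<nu>add)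
        then have "\<kappa> * \<nu> (u + v) \<le> \<kappa> * (2 * \<nu> v)" using \<kappa>(1) by (intro mult_left_mono) auto
        then show ?thesis by (simp add: exp_double[symmetric] mult.left_commute)
      qed
      ultimately show "exp (\<kappa> * \<nu> (u + v)) \<le> (norm (x v))\<^sup>2" by linarith
      have "norm (x v) > 0" using v4 by linarith
      then show "0 < (norm (x v))\<^sup>2 * exp (\<kappa> * \<nu> (u + v))" by simp
    qed
    also have "\<dots> = C * \<beta> (u + v)" by (simp add: \<beta>_def exp_minus field_simps)
    finally show ?thesis .
  qed
  have PQ: "product_formula u v" if q: "Q u v" for u v
  proof -
    have nuv: "node u v" by (rule gnode[OF Qgood[OF q]])
    have sub: "region u v \<subseteq> region u0 v0" "farey_cone u v \<subseteq> region u0 v0" using q by (auto simp: Q_def region_def)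
    have uv1: "\<nu> u \<ge> 1" "\<nu> v \<ge> 1" using \<nu>1 sub(1) by (auto simp: region_def)
    have sb: "\<beta> summable_on farey_cone u v" unfolding \<beta>_def
      by (rule exp_weight_summable_on_cone[OF node_det[OF nuv] \<kappa>(1) \<nu>comb uv1])
    define K where "K = 2 + 4 / norm E + 16 * norm (E - 1 / E)"
    define D where "D = 16 * norm (E - 1 / E)"
    have finK: "finite {z \<in> farey_cone u v. norm (x z) \<le> K}"
      by (rule finite_subset[of _ "{z \<in> farey_cone u0 v0. norm (x z) \<le> K} \<union> {u0, v0}"]) (use fin sub in \<open>auto simp: region_def\<close>)
    have "(\<lambda>z. norm (Ln (F z))) summable_on farey_cone u v - {z \<in> farey_cone u v. norm (x z) \<le> K}"
    proof (rule summable_on_comparison_test)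
      show "(\<lambda>z. D * \<beta> z) summable_on farey_cone u v - {z \<in> farey_cone u v. norm (x z) \<le> K}"
        by (intro summable_on_cmult_right summable_on_subset_banach[OF sb]) auto
      fix z assume z: "z \<in> farey_cone u v - {z \<in> farey_cone u v. norm (x z) \<le> K}"
      have zb: "4 \<le> norm (x z)" "weighted \<epsilon> \<kappa> \<nu> z" using conebig'[of z u v] z q by auto
      have "norm (Ln (F z)) \<le> D / (norm (x z))\<^sup>2" unfolding D_def
        using z cp sub(2) by (intro norm_Ln_F_le) (auto simp: K_def)
      also have "\<dots> \<le> D / exp (\<kappa> * \<nu> z)"
      proof (intro divide_left_mono)
        have "norm (x z) * 1 \<le> norm (x z) * norm (x z)" using zb by (intro mult_left_mono) auto
        then show "exp (\<kappa> * \<nu> z) \<le> (norm (x z))\<^sup>2" using norm_x_ge_weighted[OF zb(2,1)] by (simp add: power2_eq_square)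
        have "norm (x z) > 0" using zb by linarith
        then show "0 < (norm (x z))\<^sup>2 * exp (\<kappa> * \<nu> z)" by simp
      qed (simp add: D_def)
      also have "\<dots> = D * \<beta> z" by (simp add: \<beta>_def exp_minus field_simps)
      finally show "norm (Ln (F z)) \<le> D * \<beta> z" .
    qed auto
    then have "(\<lambda>z. norm (Ln (F z))) summable_on (farey_cone u v - {z \<in> farey_cone u v. norm (x z) \<le> K}) \<union> {z \<in> farey_cone u v. norm (x z) \<le> K}"
      using finK by (intro summable_on_Un_disjoint) auto
    moreover have "(farey_cone u v - {z \<in> farey_cone u v. norm (x z) \<le> K}) \<union> {z \<in> farey_cone u v. norm (x z) \<le> K} = farey_cone u v" by blast
    ultimately have s: "(\<lambda>z. norm (Ln (F z))) summable_on farey_cone u v" by simp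
    moreover have "R u v = exp (infsum (\<lambda>z. Ln (F z)) (farey_cone u v))"
    proof (rule cone_product_formula[where Q=Q and C=C and \<beta>=\<beta>])
      show "R u v = F (u + v) * R u (u + v) * R v (u + v)" if "Q u v" for u v by (rule R_rec[OF gnode[OF Qgood[OF that]]])
      show "\<bar>det2 u v\<bar> = 1" if "Q u v" for u v by (rule node_det[OF gnode[OF Qgood[OF that]]])
      show "F z \<noteq> 0" if "z \<in> farey_cone u v" for z using that sub(2) cp F_nz by blast
      show "(\<lambda>z. Ln (F z)) summable_on farey_cone u v" by (rule abs_summable_summable[OF s])
    qed (use Qch bound q sb in auto)
    ultimately show ?thesis by (simp add: product_formula_def)
  qed
  have "at_level (good \<epsilon> \<kappa> \<nu>) k u v \<Longrightarrow> node u v \<Longrightarrow> region u v \<subseteq> region u0 v0 \<Longrightarrow> product_formula u v" for k u v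
  proof (induction k arbitrary: u v)
    case 0
    then have g: "good \<epsilon> \<kappa> \<nu> u v" by simp
    have "u \<in> region u0 v0" "v \<in> region u0 v0" using 0 by (auto simp: region_def)
    then have "Q u (u + v)" "Q v (u + v)" using g good_swap[OF g] 0(3) region_child(1)[of u v] region_child(2)[where u=u and v=v]
      by (auto simp: Q_def)
    then show ?case using PQ product_formula_child[OF 0(2)] by blast
  next
    case (Suc k)
    have "product_formula u (u + v)" "product_formula v (u + v)"
      using Suc.IH[of u "u + v"] Suc.IH[of v "u + v"] Suc.prems node_child[OF Suc.prems(2)] region_child(1)[of u v] region_child(2)[where u=u and v=v] by auto
    then show ?case by (rule product_formula_child[OF Suc.prems(2)])
  qed
  then show ?thesis using \<kappa>(2) n by blast
qed

text \<open>Descent along the path of the tree which leads from the cone of \<open>u, v\<close> to a smaller cone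
  spanned by nonnegative combinations of \<open>u\<close> and \<open>v\<close>.\<close>

lemma cone_difference_formula:
  fixes p q p' q' :: int
  assumes "node u v" "p \<ge> 0" "q \<ge> 0" "p' \<ge> 0" "q' \<ge> 0" "p * q' - p' * q = 1"
    and "\<And>K. finite {z \<in> farey_cone u v - farey_cone (comb p q u v) (comb p' q' u v). norm (x z) \<le> K}"
  shows "(\<lambda>z. norm (Ln (F z))) summable_on (farey_cone u v - farey_cone (comb p q u v) (comb p' q' u v)) \<and>
    farey_cone (comb p q u v) (comb p' q' u v) \<subseteq> farey_cone u v \<and>
    R u v = exp (infsum (\<lambda>z. Ln (F z)) (farey_cone u v - farey_cone (comb p q u v) (comb p' q' u v))) * R (comb p q u v) (comb p' q' u v)"
  using assms
proof (induction "nat (p + q + p' + q')" arbitrary: u v p q p' q' rule: less_induct)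
  case less
  note n = less.prems(1) and fin = less.prems(7)
  let ?f = "\<lambda>z. Ln (F z)"
  define T where "T = farey_cone (comb p q u v) (comb p' q' u v)"
  \<comment> \<open>\<open>a\<close> is the side whose subcone contains the target cone
    \<open>T\<close>. The subcone at \<open>b\<close> is then disjoint from \<open>T\<close>, so it
    inherits the finiteness and has a product formula of its own; only the subcone at
    \<open>a\<close> is left to the induction.\<close>
  have step: ?case
    if IH: "(\<lambda>z. norm (?f z)) summable_on (farey_cone a (u + v) - T) \<and> T \<subseteq> farey_cone a (u + v) \<and>
        R a (u + v) = exp (infsum ?f (farey_cone a (u + v) - T)) * R (comb p q u v) (comb p' q' u v)"
      and ab: "a = u \<and> b = v \<or> a = v \<and> b = u" for a b
  proof -
    have nab: "node a b" "b + a = u + v" "a + b = u + v" using ab n node_swap[OF n] by (elim disjE; simp add: add.commute)+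
    have cuv: "farey_cone u v = farey_cone a b" using ab farey_cone_swap[of u v] by (elim disjE) simp_all
    note d = farey_cone_disjoint[OF node_det[OF nab(1)], unfolded nab]
    have rec: "farey_cone u v - T = insert (u + v) ((farey_cone a (u + v) - T) \<union> farey_cone b (u + v))"
      using farey_cone_rec[of a b] d IH unfolding cuv nab by blast
    have "product_formula b (u + v)"
    proof (rule cone_formula)
      show "node b (u + v)" using node_child(2)[OF nab(1)] nab by simp
      show "finite {z \<in> farey_cone b (u + v). norm (x z) \<le> K}" for K
        by (rule finite_subset[OF _ fin[of K]]) (use rec in \<open>auto simp: T_def\<close>)
    qed
    then have b: "(\<lambda>z. norm (?f z)) summable_on farey_cone b (u + v)" "R b (u + v) = exp (infsum ?f (farey_cone b (u + v)))"
      by (simp_all add: product_formula_def)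
    have d': "(farey_cone a (u + v) - T) \<inter> farey_cone b (u + v) = {}" using d by blast
    have s: "?f summable_on (farey_cone a (u + v) - T)" "?f summable_on farey_cone b (u + v)" using abs_summable_summable[of ?f] IH b(1) by auto
    have sU: "?f summable_on ((farey_cone a (u + v) - T) \<union> farey_cone b (u + v))" by (rule summable_on_Un_disjoint[OF s d'])
    have "(\<lambda>z. norm (?f z)) summable_on (farey_cone u v - T)" unfolding rec summable_on_insert_iff
      using IH b d' by (intro summable_on_Un_disjoint) auto
    moreover have "infsum ?f (farey_cone u v - T) = ?f (u + v) + (infsum ?f (farey_cone a (u + v) - T) + infsum ?f (farey_cone b (u + v)))"
      unfolding rec infsum_Un_disjoint[OF s d', symmetric] using d sU by (intro infsum_insert) auto
    moreover have "R u v = F (u + v) * R a (u + v) * R b (u + v)" using R_rec[OF n] ab by auto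
    moreover have "T \<subseteq> farey_cone u v" using IH farey_cone_rec[of a b] cuv nab by auto
    ultimately show ?thesis using IH b F_nz[OF node_coprime(3)[OF n]] by (simp add: T_def[symmetric] exp_add mult_ac)
  qed
  \<comment> \<open>With nonnegative entries and determinant 1, the two coefficient vectors can lie
    strictly on different sides of the diagonal only for the identity matrix; otherwise both belong
    to the same child cone.\<close>
  consider "p = 1 \<and> q = 0 \<and> p' = 0 \<and> q' = 1" | "p \<ge> q \<and> p' \<ge> q' \<and> q + q' \<ge> 1 \<and> \<not> (p = 1 \<and> q = 0 \<and> p' = 0 \<and> q' = 1)"
    | "p \<le> q \<and> p' \<le> q' \<and> p + p' \<ge> 1"
  proof -
    have "False" if "p > q" "p' < q'" "\<not> (p = 1 \<and> q = 0 \<and> p' = 0 \<and> q' = 1)"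
    proof -
      have "p * q' \<ge> (q + 1) * (p' + 1)" using that less.prems by (intro mult_mono) auto
      then have "q + p' \<le> 0" using less.prems(6) by (simp add: algebra_simps)
      then have "q = 0" "p' = 0" using less.prems by auto
      then have "p * q' = 1" using less.prems(6) by simp
      then have "p = 1 \<and> q' = 1" using less.prems(2) zmult_eq_1_iff by auto
      then show False using that \<open>q = 0\<close> \<open>p' = 0\<close> by blast
    qed
    moreover have "False" if "p < q" "p' > q'"
    proof -
      have "p * q' \<le> q * p'" using that less.prems by (intro mult_mono) auto
      then show False using less.prems(6) by (simp add: mult.commute)
    qed
    moreover have "q + q' \<ge> 1"
    proof (rule ccontr)
      assume "\<not> q + q' \<ge> 1"
      then have "q = 0" "q' = 0" using less.prems(3,5) by linarith+
      then show False using less.prems(6) by simp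
    qed
    moreover have "p + p' \<ge> 1"
    proof (rule ccontr)
      assume "\<not> p + p' \<ge> 1"
      then have "p = 0" "p' = 0" using less.prems(2,4) by linarith+
      then show False using less.prems(6) by simp
    qed
    ultimately show ?thesis using that by (cases "p \<ge> q"; cases "p' \<ge> q'"; cases "p = q"; cases "p' = q'") (auto simp: not_le)
  qed
  then show ?case
  proof cases
    case 1
    then have "comb p q u v = u" "comb p' q' u v = v" by (simp_all add: comb_def prod_eq_iff)
    then show ?thesis by simp
  next
    case 2
    have e: "comb (p - q) q u (u + v) = comb p q u v" "comb (p' - q') q' u (u + v) = comb p' q' u v" by (simp_all add: comb_child)
    have h: "(\<lambda>z. norm (?f z)) summable_on (farey_cone u (u + v) - farey_cone (comb (p - q) q u (u + v)) (comb (p' - q') q' u (u + v))) \<and>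
        farey_cone (comb (p - q) q u (u + v)) (comb (p' - q') q' u (u + v)) \<subseteq> farey_cone u (u + v) \<and>
        R u (u + v) = exp (infsum ?f (farey_cone u (u + v) - farey_cone (comb (p - q) q u (u + v)) (comb (p' - q') q' u (u + v)))) * R (comb (p - q) q u (u + v)) (comb (p' - q') q' u (u + v))"
    proof (rule less.hyps)
      show "node u (u + v)" by (rule node_child(1)[OF n])
      show "finite {z \<in> farey_cone u (u + v) - farey_cone (comb (p - q) q u (u + v)) (comb (p' - q') q' u (u + v)). norm (x z) \<le> K}" for K
        unfolding e by (rule finite_subset[OF _ fin[of K]]) (use farey_cone_child_subset(1)[of u v] in auto)
    qed (use 2 less.prems in \<open>auto simp: algebra_simps\<close>)
    show ?thesis by (rule step[OF h[unfolded e, folded T_def], where b=v]) simp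
  next
    case 3
    have e: "comb (q - p) p v (u + v) = comb p q u v" "comb (q' - p') p' v (u + v) = comb p' q' u v" by (simp_all add: comb_child)
    \<comment> \<open>The two target vectors change places so that the determinant remains 1; cones
      and \<open>R\<close> are symmetric in their arguments.\<close>
    have h: "(\<lambda>z. norm (?f z)) summable_on (farey_cone v (u + v) - farey_cone (comb (q' - p') p' v (u + v)) (comb (q - p) p v (u + v))) \<and>
        farey_cone (comb (q' - p') p' v (u + v)) (comb (q - p) p v (u + v)) \<subseteq> farey_cone v (u + v) \<and>
        R v (u + v) = exp (infsum ?f (farey_cone v (u + v) - farey_cone (comb (q' - p') p' v (u + v)) (comb (q - p) p v (u + v)))) * R (comb (q' - p') p' v (u + v)) (comb (q - p) p v (u + v))"
    proof (rule less.hyps)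
      show "node v (u + v)" by (rule node_child(2)[OF n])
      show "finite {z \<in> farey_cone v (u + v) - farey_cone (comb (q' - p') p' v (u + v)) (comb (q - p) p v (u + v)). norm (x z) \<le> K}" for K
        unfolding e farey_cone_swap[of "comb p' q' u v"]
        by (rule finite_subset[OF _ fin[of K]]) (use farey_cone_child_subset(2)[where u=u and v=v] in auto)
    qed (use 3 less.prems in \<open>auto simp: algebra_simps\<close>)
    have R: "R (comb p' q' u v) (comb p q u v) = R (comb p q u v) (comb p' q' u v)"
    proof (rule R_swap)
      have "det2 (comb p' q' u v) (comb p q u v) = - (p * q' - p' * q) * det2 u v" by (simp add: det2_def comb_def algebra_simps)
      then show "\<bar>det2 (comb p' q' u v) (comb p q u v)\<bar> = 1" using less.prems(6) node_det[OF n] by simp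
    qed
    show ?thesis by (rule step[OF h[unfolded e R farey_cone_swap[of "comb p' q' u v"], folded T_def], where b=u]) simp
  qed
qed

end

section \<open>A fundamental domain for a positive matrix\<close>

locale positive_matrix =
  fixes a b c d :: int
  assumes pos: "a \<ge> 1" "b \<ge> 1" "c \<ge> 1" "d \<ge> 1" and det: "a * d - b * c = 1"
begin

definition W :: "int \<times> int \<Rightarrow> int \<times> int" where
  "W z = (a * fst z + b * snd z, c * fst z + d * snd z)"

definition W' :: "int \<times> int \<Rightarrow> int \<times> int" where
  "W' z = (d * fst z - b * snd z, - c * fst z + a * snd z)"

definition domain :: "(int \<times> int) set" where
  "domain = farey_cone (1, 0) (0, 1) - farey_cone (a, c) (b, d)"

lemma W_inverse: "W' (W z) = z" "W (W' z) = z"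
proof -
  have d: "a * d = 1 + b * c" using det by simp
  show "W' (W z) = z"
    by (rule prod_eqI; simp add: W_def W'_def algebra_simps; use d in algebra)
  show "W (W' z) = z"
    by (rule prod_eqI; simp add: W_def W'_def algebra_simps; use d in algebra)
qed

lemma W_minus: "W (- z) = - W z" by (simp add: W_def)

lemma Wn_minus: "(W ^^ n) (- z) = - (W ^^ n) z" by (induction n) (simp_all add: W_minus)

lemma inj_W: "inj W" by (rule inj_on_inverseI[of _ W']) (simp add: W_inverse)

lemma quadrant: "z \<in> farey_cone (1, 0) (0, 1) \<longleftrightarrow> fst z \<ge> 1 \<and> snd z \<ge> 1 \<and> coprime (fst z) (snd z)"
  by (cases z) (auto simp: farey_cone_def comb_def)

lemma W_quadrant: "W z \<in> farey_cone (a, c) (b, d) \<longleftrightarrow> z \<in> farey_cone (1, 0) (0, 1)"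
proof -
  have *: "comb p q (a, c) (b, d) = W (p, q)" for p q by (simp add: comb_def W_def mult.commute)
  have "W z \<in> farey_cone (a, c) (b, d) \<longleftrightarrow> (\<exists>p q. W z = W (p, q) \<and> p \<ge> 1 \<and> q \<ge> 1 \<and> coprime p q)"
    unfolding farey_cone_def * by blast
  also have "\<dots> \<longleftrightarrow> z \<in> farey_cone (1, 0) (0, 1)"
    unfolding quadrant by (cases z) (auto dest: injD[OF inj_W])
  finally show ?thesis .
qed

lemma coprime_W: "coprime (fst (W z)) (snd (W z)) \<longleftrightarrow> coprime (fst z) (snd z)"
proof -
  have 1: "coprime (fst (W z)) (snd (W z))" if "coprime (fst z) (snd z)" for z
  proof (rule coprimeI)
    fix k assume k: "k dvd fst (W z)" "k dvd snd (W z)"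
    then have "k dvd fst (W' (W z))" "k dvd snd (W' (W z))" unfolding W'_def by (auto intro: dvd_diff dvd_add)
    then show "is_unit k" using coprime_common_divisor[OF that] by (simp only: W_inverse)
  qed
  have 2: "coprime (fst z) (snd z)" if "coprime (fst (W z)) (snd (W z))" for z
  proof (rule coprimeI)
    fix k assume k: "k dvd fst z" "k dvd snd z"
    then have "k dvd fst (W z)" "k dvd snd (W z)" unfolding W_def by auto
    then show "is_unit k" using coprime_common_divisor[OF that] by blast
  qed
  show ?thesis using 1 2 by blast
qed

lemma coprime_Wn: "coprime (fst ((W ^^ n) z)) (snd ((W ^^ n) z)) \<longleftrightarrow> coprime (fst z) (snd z)"
  by (induction n) (simp_all add: coprime_W)

lemma W_pos: "fst z \<ge> 0 \<Longrightarrow> snd z \<ge> 0 \<Longrightarrow> z \<noteq> 0 \<Longrightarrow> fst (W z) \<ge> 1 \<and> snd (W z) \<ge> 1"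
proof -
  assume z: "fst z \<ge> 0" "snd z \<ge> 0" "z \<noteq> 0"
  have "fst z + snd z \<ge> 1" using z by (auto simp: prod_eq_iff)
  moreover have "1 * fst z \<le> a * fst z" "1 * snd z \<le> b * snd z" "1 * fst z \<le> c * fst z" "1 * snd z \<le> d * snd z"
    using z pos by (intro mult_right_mono; simp)+
  ultimately show ?thesis unfolding W_def by simp
qed

lemma W_increases: "fst z \<ge> 1 \<Longrightarrow> snd z \<ge> 1 \<Longrightarrow> fst z + snd z < fst (W z) + snd (W z)"
proof -
  assume z: "fst z \<ge> 1" "snd z \<ge> 1"
  have "1 * fst z \<le> a * fst z" "1 * snd z \<le> b * snd z" "1 * fst z \<le> c * fst z" "1 * snd z \<le> d * snd z"
    using z pos by (intro mult_right_mono; simp)+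
  then show ?thesis using z unfolding W_def fst_conv snd_conv by linarith
qed

text \<open>The inverse matrix has positive diagonal and negative off-diagonal entries, so nothing
  cancels when it is applied to a vector with coordinates of opposite signs: such a vector has a
  longer preimage.\<close>

lemma W_mixed_decreases:
  assumes "fst (W z) * snd (W z) < 0"
  shows "\<bar>fst (W z)\<bar> + \<bar>snd (W z)\<bar> < \<bar>fst z\<bar> + \<bar>snd z\<bar>"
proof -
  define p q where "p = fst (W z)" and "q = snd (W z)"
  have z: "fst z = d * p - b * q" "snd z = - c * p + a * q"
    using W_inverse(1)[of z] by (simp_all add: W'_def p_def q_def prod_eq_iff)
  have "(p > 0 \<and> q < 0) \<or> (p < 0 \<and> q > 0)" using assms by (simp add: p_def q_def mult_less_0_iff)
  then have "\<bar>fst z\<bar> = d * \<bar>p\<bar> + b * \<bar>q\<bar> \<and> \<bar>snd z\<bar> = c * \<bar>p\<bar> + a * \<bar>q\<bar>"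
  proof (elim disjE conjE)
    assume s: "p > 0" "q < 0"
    have "d * p > 0" "b * q < 0" "c * p > 0" "a * q < 0" using s pos by (auto simp: mult_less_0_iff)
    then show "\<bar>fst z\<bar> = d * \<bar>p\<bar> + b * \<bar>q\<bar> \<and> \<bar>snd z\<bar> = c * \<bar>p\<bar> + a * \<bar>q\<bar>" using s unfolding z by simp_all
  next
    assume s: "p < 0" "q > 0"
    have "d * p < 0" "b * q > 0" "c * p < 0" "a * q > 0" using s pos by (auto simp: mult_less_0_iff)
    then show "\<bar>fst z\<bar> = d * \<bar>p\<bar> + b * \<bar>q\<bar> \<and> \<bar>snd z\<bar> = c * \<bar>p\<bar> + a * \<bar>q\<bar>" using s unfolding z by simp_all
  qed
  moreover have "1 * \<bar>p\<bar> \<le> d * \<bar>p\<bar>" "1 * \<bar>p\<bar> \<le> c * \<bar>p\<bar>" "1 * \<bar>q\<bar> \<le> b * \<bar>q\<bar>" "1 * \<bar>q\<bar> \<le> a * \<bar>q\<bar>"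
    using pos by (intro mult_right_mono; simp)+
  moreover have "p \<noteq> 0" using assms by (auto simp: p_def)
  ultimately show ?thesis unfolding p_def[symmetric] q_def[symmetric] by linarith
qed

text \<open>The length falls as long as the images are mixed, so this comes to an end; an image in a
  closed quadrant is moved into the open one by one more application of \<open>W\<close>.\<close>

lemma enters_quadrant:
  assumes "z \<noteq> 0"
  shows "\<exists>n. (fst ((W ^^ n) z) \<ge> 1 \<and> snd ((W ^^ n) z) \<ge> 1) \<or> (fst ((W ^^ n) z) \<le> -1 \<and> snd ((W ^^ n) z) \<le> -1)"
  using assms
proof (induction "nat (\<bar>fst z\<bar> + \<bar>snd z\<bar>)" arbitrary: z rule: less_induct)
  case less
  show ?case
  proof (cases "fst (W z) * snd (W z) < 0")
    case True
    then have "nat (\<bar>fst (W z)\<bar> + \<bar>snd (W z)\<bar>) < nat (\<bar>fst z\<bar> + \<bar>snd z\<bar>)" using W_mixed_decreases by fastforce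
    moreover have "W z \<noteq> 0" using True by auto
    ultimately obtain n where "(fst ((W ^^ n) (W z)) \<ge> 1 \<and> snd ((W ^^ n) (W z)) \<ge> 1) \<or> (fst ((W ^^ n) (W z)) \<le> -1 \<and> snd ((W ^^ n) (W z)) \<le> -1)"
      using less.hyps by blast
    then show ?thesis by (intro exI[of _ "Suc n"]) (simp add: funpow_swap1)
  next
    case False
    have nz: "W z \<noteq> 0"
    proof
      assume "W z = 0"
      then have "W' (W z) = 0" by (simp add: W'_def prod_eq_iff)
      then show False using less.prems by (simp add: W_inverse)
    qed
    have "(fst (W z) \<ge> 0 \<and> snd (W z) \<ge> 0) \<or> (fst (W z) \<le> 0 \<and> snd (W z) \<le> 0)"
      using False by (smt (verit) mult_neg_pos mult_pos_neg)
    then show ?thesis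
    proof
      assume "fst (W z) \<ge> 0 \<and> snd (W z) \<ge> 0"
      then have "fst (W (W z)) \<ge> 1 \<and> snd (W (W z)) \<ge> 1" using W_pos nz by blast
      then show ?thesis by (intro exI[of _ 2]) (simp add: numeral_2_eq_2)
    next
      assume "fst (W z) \<le> 0 \<and> snd (W z) \<le> 0"
      then have "fst (W (- W z)) \<ge> 1 \<and> snd (W (- W z)) \<ge> 1" using nz by (intro W_pos) auto
      then show ?thesis by (intro exI[of _ 2]) (simp add: numeral_2_eq_2 W_minus)
    qed
  qed
qed

text \<open>In the smaller cone \<open>W\<close> can be undone within the quadrant, which lowers the
  sum of the coordinates until the domain is reached.\<close>

lemma quadrant_reduces:
  assumes "y \<in> farey_cone (1, 0) (0, 1)"
  shows "\<exists>m. \<exists>y'\<in>domain. y = (W ^^ m) y'"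
  using assms
proof (induction "nat (fst y + snd y)" arbitrary: y rule: less_induct)
  case less
  show ?case
  proof (cases "y \<in> farey_cone (a, c) (b, d)")
    case False
    then show ?thesis using less.prems by (intro exI[of _ 0]) (auto simp: domain_def)
  next
    case True
    define u where "u = W' y"
    have yu: "y = W u" by (simp add: u_def W_inverse)
    then have u: "u \<in> farey_cone (1, 0) (0, 1)" using True W_quadrant by blast
    then have u1: "fst u \<ge> 1" "snd u \<ge> 1" by (simp_all add: quadrant)
    then have "nat (fst u + snd u) < nat (fst y + snd y)" using W_increases[OF u1] yu by simp
    then obtain m y' where "y' \<in> domain" "u = (W ^^ m) y'" using less.hyps u by blast
    then show ?thesis using yu by (intro exI[of _ "Suc m"]) auto
  qed
qed

lemma domain_surj:
  assumes "coprime (fst z) (snd z)"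
  shows "\<exists>n. \<exists>y\<in>domain. \<exists>s\<in>{1, -1}. (W ^^ n) z = (s * fst y, s * snd y) \<or> z = (s * fst ((W ^^ n) y), s * snd ((W ^^ n) y))"
proof -
  have "z \<noteq> 0" using assms by auto
  then obtain n where n: "(fst ((W ^^ n) z) \<ge> 1 \<and> snd ((W ^^ n) z) \<ge> 1) \<or> (fst ((W ^^ n) z) \<le> -1 \<and> snd ((W ^^ n) z) \<le> -1)"
    using enters_quadrant by blast
  obtain s :: int where s: "s \<in> {1, -1}" "s * fst ((W ^^ n) z) \<ge> 1" "s * snd ((W ^^ n) z) \<ge> 1"
    using n by (elim disjE) (auto intro: that[of 1] that[of "-1"])
  have cs: "coprime (s * fst z') (s * snd z') \<longleftrightarrow> coprime (fst z') (snd z')" for z' :: "int \<times> int" using s(1) by auto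
  have "(s * fst ((W ^^ n) z), s * snd ((W ^^ n) z)) \<in> farey_cone (1, 0) (0, 1)"
    unfolding quadrant fst_conv snd_conv cs coprime_Wn using s assms by blast
  then obtain m y where y: "y \<in> domain" "(s * fst ((W ^^ n) z), s * snd ((W ^^ n) z)) = (W ^^ m) y" using quadrant_reduces by blast
  have sW: "(W ^^ k) (s * fst z', s * snd z') = (s * fst ((W ^^ k) z'), s * snd ((W ^^ k) z'))" for k z'
    using s(1) Wn_minus[of k z'] by (auto simp: uminus_prod_def)
  have ss: "(s * fst z', s * snd z') = z'' \<longleftrightarrow> z' = (s * fst z'', s * snd z'')" for z' z'' :: "int \<times> int"
    using s(1) by (auto simp: prod_eq_iff)
  have injn: "(W ^^ k) z' = (W ^^ k) z'' \<longleftrightarrow> z' = z''" for k z' z''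
    using inj_W by (induction k) (auto dest: injD)
  show ?thesis
  proof (cases "m \<le> n")
    case True
    then obtain k where k: "n = m + k" using le_Suc_ex by blast
    have "(W ^^ m) (s * fst ((W ^^ k) z), s * snd ((W ^^ k) z)) = (W ^^ m) y"
      unfolding sW using y(2) k by (simp add: funpow_add)
    then have "(s * fst ((W ^^ k) z), s * snd ((W ^^ k) z)) = y" using injn by blast
    then show ?thesis using ss y(1) s(1) by blast
  next
    case False
    then obtain k where k: "m = n + k" using le_Suc_ex by (metis nat_le_linear)
    have "(W ^^ n) (s * fst z, s * snd z) = (W ^^ n) ((W ^^ k) y)"
      unfolding sW using y(2) k by (simp add: funpow_add)
    then have "(s * fst z, s * snd z) = (W ^^ k) y" using injn by blast
    then show ?thesis using ss y(1) s(1) by blast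
  qed
qed

text \<open>Images of the quadrant under \<open>W\<close> stay in it, which excludes
  \<open>s = -1\<close>; after one application they lie in the smaller cone, which the domain
  omits.\<close>

lemma domain_inj:
  assumes y: "y \<in> domain" "y' \<in> domain" and s: "s \<in> {1, -1 :: int}" and eq: "(W ^^ n) y = (s * fst y', s * snd y')"
  shows "n = 0 \<and> y = y'"
proof -
  have q: "y \<in> farey_cone (1, 0) (0, 1)" "y' \<in> farey_cone (1, 0) (0, 1)" using y by (auto simp: domain_def)
  have Wq: "(W ^^ k) y \<in> farey_cone (1, 0) (0, 1)" for k
  proof (induction k)
    case (Suc k)
    then have "fst ((W ^^ k) y) \<ge> 1" "snd ((W ^^ k) y) \<ge> 1" by (simp_all add: quadrant)
    then have "fst (W ((W ^^ k) y)) \<ge> 1 \<and> snd (W ((W ^^ k) y)) \<ge> 1" by (intro W_pos) auto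
    then show ?case using Suc coprime_W unfolding quadrant by simp
  qed (use q in simp)
  have s1: "s = 1"
  proof (rule ccontr)
    assume "s \<noteq> 1"
    then have "(W ^^ n) y = - y'" using eq s by (auto simp: uminus_prod_def)
    then show False using Wq[of n] q(2) by (simp add: quadrant)
  qed
  then have eq': "(W ^^ n) y = y'" using eq by simp
  have "n = 0"
  proof (rule ccontr)
    assume "n \<noteq> 0"
    then obtain k where "n = Suc k" using not0_implies_Suc by blast
    then have "y' = W ((W ^^ k) y)" using eq' by simp
    then have "y' \<in> farey_cone (a, c) (b, d)" using W_quadrant Wq[of k] by simp
    then show False using y(2) by (simp add: domain_def)
  qed
  then show ?thesis using eq' by simp
qed

end

section \<open>Markoff maps invariant under a positive matrix\<close>

text \<open>Finiteness is stated on the fundamental domain, because this is what discreteness of the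
  spectrum provides: distinct vectors of the domain correspond to distinct geodesics.\<close>

locale invariant_markoff_map = weak_markoff_map x \<mu> E lam + positive_matrix A B C D
  for x \<mu> E lam A B C D +
  assumes root: "node (1, 0) (0, 1)"
    and invariant: "coprime (fst z) (snd z) \<Longrightarrow> x (W z) = x z"
    and finite_bounded: "finite {z \<in> domain. norm (x z) \<le> K}"
begin

lemma x_Wn: "coprime (fst z) (snd z) \<Longrightarrow> x ((W ^^ n) z) = x z"
  by (induction n) (simp_all add: invariant coprime_Wn)

lemma domain_coprime: "y \<in> domain \<Longrightarrow> coprime (fst y) (snd y)"
  using quadrant by (auto simp: domain_def)

lemma x_equals_value_on_domain:
  assumes "coprime (fst z) (snd z)"
  obtains y where "y \<in> domain" "x y = x z"
proof -
  obtain n y s where y: "y \<in> domain" "s \<in> {1, -1 :: int}"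
    and e: "(W ^^ n) z = (s * fst y, s * snd y) \<or> z = (s * fst ((W ^^ n) y), s * snd ((W ^^ n) y))"
    using domain_surj[OF assms] by blast
  have s: "x (s * fst w, s * snd w) = x w" if "coprime (fst w) (snd w)" for w
    using y(2) neg[OF that] by (auto simp: uminus_prod_def)
  have cy: "coprime (fst y) (snd y)" by (rule domain_coprime[OF y(1)])
  from e have "x y = x z"
  proof
    assume "(W ^^ n) z = (s * fst y, s * snd y)"
    then show ?thesis using x_Wn[OF assms, of n] s[OF cy] by simp
  next
    assume "z = (s * fst ((W ^^ n) y), s * snd ((W ^^ n) y))"
    then show ?thesis using x_Wn[OF cy, of n] s[of "(W ^^ n) y"] cy coprime_Wn[of n y] by simp
  qed
  then show ?thesis using that y(1) by blast
qed

lemma x_nz: "coprime (fst z) (snd z) \<Longrightarrow> x z \<noteq> 0"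
proof
  assume c: "coprime (fst z) (snd z)" and "x z = 0"
  then have "l z + 1 / l z = 0" using x_l[OF c] by simp
  then have "(l z)\<^sup>2 = -1" using l_nz[OF c] by (simp add: field_simps power2_eq_square eq_neg_iff_add_eq_0)
  then have "norm (l z) ^ 2 = 1" by (simp flip: norm_power)
  moreover have "norm (l z) > 1" using lam[OF c] by (simp add: l_def)
  ultimately show False by (simp add: power2_eq_1_iff)
qed

text \<open>Invariance repeats every value infinitely often in the quadrant, so it is the set of
  bounded values, not the set of vectors, that is finite.\<close>

lemma finite_bounded_values: "finite (x ` {z \<in> farey_cone (1, 0) (0, 1). norm (x z) \<le> K})"
proof (rule finite_subset)
  show "x ` {z \<in> farey_cone (1, 0) (0, 1). norm (x z) \<le> K} \<subseteq> x ` {z \<in> domain. norm (x z) \<le> K}"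
  proof
    fix t assume "t \<in> x ` {z \<in> farey_cone (1, 0) (0, 1). norm (x z) \<le> K}"
    then obtain z where z: "z \<in> farey_cone (1, 0) (0, 1)" "norm (x z) \<le> K" "t = x z" by blast
    obtain y where y: "y \<in> domain" "x y = x z" using x_equals_value_on_domain[of z] z(1) quadrant by blast
    have "y \<in> {z \<in> domain. norm (x z) \<le> K}" using y z(2) by simp
    then show "t \<in> x ` {z \<in> domain. norm (x z) \<le> K}" unfolding z(3) y(2)[symmetric] by (rule imageI)
  qed
qed (rule finite_imageI[OF finite_bounded])

text \<open>Every vertex of the tree arises as the sum of the two sides of an edge, and the vertex
  relation has been carried down to that edge.\<close>

lemma cone_element_is_sum:
  assumes "node u v" "z \<in> farey_cone u v" "fst u \<ge> 0" "snd u \<ge> 0" "fst v \<ge> 0" "snd v \<ge> 0"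
  shows "\<exists>u' v'. node u' v' \<and> z = u' + v' \<and> fst u' \<ge> 0 \<and> snd u' \<ge> 0 \<and> fst v' \<ge> 0 \<and> snd v' \<ge> 0"
proof -
  have *: "\<exists>u' v'. node u' v' \<and> z = u' + v' \<and> fst u' \<ge> 0 \<and> snd u' \<ge> 0 \<and> fst v' \<ge> 0 \<and> snd v' \<ge> 0"
    if "z \<in> truncated_cone k u v" "node u v" "fst u \<ge> 0" "snd u \<ge> 0" "fst v \<ge> 0" "snd v \<ge> 0" for k u v
    using that
  proof (induction k arbitrary: u v)
    case (Suc k)
    have n: "node u (u + v)" "node v (u + v)" using node_child[OF Suc.prems(2)] by auto
    have nn: "fst (u + v) \<ge> 0" "snd (u + v) \<ge> 0" using Suc.prems by simp_all
    have "z = u + v \<or> z \<in> truncated_cone k u (u + v) \<or> z \<in> truncated_cone k v (u + v)" using Suc.prems(1) by simp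
    then show ?case
    proof (elim disjE)
      assume "z = u + v"
      then show ?thesis using Suc.prems by blast
    next
      assume "z \<in> truncated_cone k u (u + v)"
      then show ?thesis by (rule Suc.IH[OF _ n(1) Suc.prems(3,4) nn])
    next
      assume "z \<in> truncated_cone k v (u + v)"
      then show ?thesis by (rule Suc.IH[OF _ n(2) Suc.prems(5,6) nn])
    qed
  qed simp
  obtain p q where z: "z = comb p q u v" "p \<ge> 1" "q \<ge> 1" "coprime p q" using assms(2) unfolding farey_cone_def by auto
  then have "z \<in> truncated_cone (nat (p + q)) u v" using truncated_cone_exhausts[of p q "nat (p + q)" u v] by simp
  then show ?thesis by (rule *[OF _ assms(1,3-6)])
qed

text \<open>If \<open>x y = l + 1/l\<close> squares to \<open>\<mu>\<close>, the vertex relation factors, and the values along one of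
  the two sides of the fan at \<open>y\<close> form a geometric progression of ratio \<open>1/l\<close>. These are infinitely
  many distinct bounded values.\<close>

lemma degenerate_fan:
  assumes n: "node u v" and y: "(x (u + v))\<^sup>2 = \<mu>" and h: "x v = x u / l (u + v)"
    and nn: "fst v \<ge> 0" "snd v \<ge> 0" "u + v \<in> farey_cone (1, 0) (0, 1)"
  shows False
proof -
  define w t where "w = u + v" and "t = l (u + v)"
  \<comment> \<open>The vectors \<open>v + k w\<close>: the half of the fan at \<open>w\<close>
    beginning with \<open>v\<close>, along which \<open>h\<close> removes the growing solution of
    the recurrence.\<close>
  define z where "z = (\<lambda>k::nat. (fst v + int k * fst w, snd v + int k * snd w))"
  note c = node_coprime[OF n]
  have t: "t \<noteq> 0" "norm t > 1" using l_nz[OF c(3)] lam[OF c(3)] by (auto simp: t_def l_def)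
  have xw: "x w = t + 1 / t" using x_l[OF c(3)] by (simp add: w_def t_def)
  have det: "\<bar>det2 v w\<bar> = 1" using node_det[OF n] by (simp add: w_def det2_simps)
  have rec: "x (z (Suc (Suc k))) = x w * x (z (Suc k)) - x (z k)" for k
  proof -
    have "det2 w (z (Suc k)) = - det2 v w" by (simp add: z_def det2_def algebra_simps)
    then have "\<bar>det2 (z (Suc k)) w\<bar> = 1" using det det2_swap[of w "z (Suc k)"] by simp
    from edge[OF this] have "x (z (Suc k) + w) + x (z (Suc k) - w) = x (z (Suc k)) * x w" .
    moreover have "z (Suc k) + w = z (Suc (Suc k))" "z (Suc k) - w = z k" by (simp_all add: z_def prod_eq_iff algebra_simps)
    ultimately show ?thesis by (simp add: algebra_simps eq_diff_eq)
  qed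
  have z0: "z 0 = v" by (simp add: z_def)
  have z1: "z (Suc 0) = v + (u + v)" by (simp add: z_def w_def prod_eq_iff)
  have x1: "x (z (Suc 0)) = x v / t"
  proof -
    have "x (z (Suc 0)) = x v * x w - x u" unfolding z1 using x_next'[OF n] by (simp add: w_def)
    moreover have "x u = t * x v" using h t(1) by (simp add: t_def)
    ultimately show ?thesis using xw t(1) by (simp add: field_simps)
  qed
  have xz: "x (z k) = x v / t ^ k \<and> x (z (Suc k)) = x v / t ^ Suc k" for k
  proof (induction k)
    case (Suc k)
    have "x (z (Suc (Suc k))) = (t + 1 / t) * (x v / t ^ Suc k) - x v / t ^ k"
      using rec[of k] Suc by (simp only: xw)
    also have "\<dots> = x v / t ^ Suc (Suc k)" using t(1) by (simp add: field_simps)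
    finally show ?case using Suc by simp
  qed (use z0 x1 in simp)
  have q: "z (Suc k) \<in> farey_cone (1, 0) (0, 1)" for k
  proof -
    have "z (Suc k) = comb 1 (int (Suc k)) v w" by (simp add: z_def comb_def)
    then have "z (Suc k) \<in> farey_cone v w" unfolding farey_cone_def by (intro CollectI exI[of _ 1] exI[of _ "int (Suc k)"]) simp
    then have "coprime (fst (z (Suc k))) (snd (z (Suc k)))" by (rule farey_cone_coprime[OF det])
    moreover have w1: "fst w \<ge> 1" "snd w \<ge> 1" using nn(3) quadrant by (auto simp: w_def)
    have "1 * 1 \<le> int (Suc k) * fst w" "1 * 1 \<le> int (Suc k) * snd w" using w1 by (intro mult_mono; simp)+
    then have "fst (z (Suc k)) \<ge> 1" "snd (z (Suc k)) \<ge> 1" using nn(1,2) unfolding z_def fst_conv snd_conv by linarith+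
    ultimately show ?thesis using quadrant by blast
  qed
  have b: "norm (x (z (Suc k))) \<le> norm (x v)" for k
  proof -
    have "norm (t ^ Suc k) \<ge> 1" using t(2) by (simp only: norm_power) (intro one_le_power, simp)
    then have "norm (x v) / norm (t ^ Suc k) \<le> norm (x v) / 1" by (intro divide_left_mono) auto
    then show ?thesis using xz[of k] by (simp only: norm_divide div_by_1)
  qed
  have "inj (\<lambda>k. x (z (Suc k)))"
  proof (rule injI)
    fix i j assume "x (z (Suc i)) = x (z (Suc j))"
    then have "x v / t ^ Suc i = x v / t ^ Suc j" using xz by simp
    then have "t ^ Suc i = t ^ Suc j" using x_nz[OF c(2)] t(1) by (simp add: field_simps)
    then have "norm t ^ Suc i = norm t ^ Suc j" by (metis norm_power)
    then show "i = j" using power_inject_exp[OF t(2)] t(1) by simp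
  qed
  moreover have "range (\<lambda>k. x (z (Suc k))) \<subseteq> x ` {z \<in> farey_cone (1, 0) (0, 1). norm (x z) \<le> norm (x v)}"
    using q b by blast
  then have "finite (range (\<lambda>k. x (z (Suc k))))" by (rule finite_subset) (rule finite_bounded_values)
  ultimately show False using range_inj_infinite by blast
qed

lemma nondegenerate:
  assumes c: "coprime (fst z) (snd z)"
  shows "(x z)\<^sup>2 \<noteq> \<mu>"
proof
  assume z: "(x z)\<^sup>2 = \<mu>"
  obtain y where y: "y \<in> domain" "x y = x z" using x_equals_value_on_domain[OF c] by blast
  have yq: "y \<in> farey_cone (1, 0) (0, 1)" using y(1) by (simp add: domain_def)
  obtain u v where uv: "node u v" "y = u + v" "fst u \<ge> 0" "snd u \<ge> 0" "fst v \<ge> 0" "snd v \<ge> 0"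
    using cone_element_is_sum[OF root yq] by auto
  define t where "t = l (u + v)"
  have t: "t \<noteq> 0" "x (u + v) = t + 1 / t" using l_nz x_l node_coprime(3)[OF uv(1)] by (auto simp: t_def)
  have m: "(x (u + v))\<^sup>2 = \<mu>" using y(2) z uv(2) by simp
  \<comment> \<open>Once \<open>\<mu>\<close> cancels, the vertex relation is a quadratic form in
    \<open>x u\<close> and \<open>x v\<close> with root ratios \<open>t\<close> and
    \<open>1 / t\<close>; the two roots correspond to the two halves of the fan.\<close>
  have "(x u)\<^sup>2 + (x v)\<^sup>2 - x u * x v * (t + 1 / t) = 0"
  proof -
    have "(x u)\<^sup>2 + (x v)\<^sup>2 - x u * x v * x (u + v) = 0" using uv(1) unfolding node_def m by (simp add: algebra_simps)
    then show ?thesis by (simp only: t(2))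
  qed
  moreover have "(x u)\<^sup>2 + (x v)\<^sup>2 - x u * x v * (t + 1 / t) = (x v - x u / t) * (x v - x u * t)"
    using t(1) by (simp add: field_simps power2_eq_square)
  ultimately have "x v = x u / t \<or> x v = x u * t" by simp
  then show False
  proof
    assume "x v = x u / t"
    then show False using degenerate_fan[OF uv(1) m] uv yq by (simp add: t_def)
  next
    assume "x v = x u * t"
    then have "x u = x v / t" using t(1) by simp
    then show False using degenerate_fan[OF node_swap[OF uv(1)]] m uv yq by (simp add: t_def add.commute)
  qed
qed

sublocale markoff_map x \<mu> E lam by unfold_locales (rule nondegenerate)

theorem domain_identity:
  "(\<lambda>z. norm (Ln (F z))) summable_on domain" "exp (infsum (\<lambda>z. Ln (F z)) domain) = 1"
proof -
  have e: "comb A C (1, 0) (0, 1) = (A, C)" "comb B D (1, 0) (0, 1) = (B, D)" by (simp_all add: comb_def)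
  \<comment> \<open>\<open>P\<close> involves the difference of its two arguments, so invariance is
    also applied at \<open>(1, -1)\<close>.\<close>
  have W: "(A, C) = W (1, 0)" "(B, D) = W (0, 1)" "(A, C) - (B, D) = W (1, -1)" by (simp_all add: W_def)
  have "R (A, C) (B, D) = R (1, 0) (0, 1)"
  proof -
    have x: "x (A, C) = x (1, 0)" "x (B, D) = x (0, 1)" "x ((A, C) - (B, D)) = x ((1, 0) - (0, 1))"
      unfolding W(3) unfolding W(1,2) by (simp_all add: invariant)
    have a: "a (A, C) = a (1, 0)" "a (B, D) = a (0, 1)" by (simp_all only: a_def l_def x)
    show ?thesis unfolding R_def P_def by (simp only: x a)
  qed
  moreover have "finite {z \<in> farey_cone (1, 0) (0, 1) - farey_cone (comb A C (1, 0) (0, 1)) (comb B D (1, 0) (0, 1)). norm (x z) \<le> K}" for K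
    using finite_bounded[of K] by (simp only: domain_def e)
  then have "(\<lambda>z. norm (Ln (F z))) summable_on domain \<and> R (1, 0) (0, 1) = exp (infsum (\<lambda>z. Ln (F z)) domain) * R (A, C) (B, D)"
    using cone_difference_formula[OF root, of A C B D] pos det unfolding e domain_def by simp
  moreover have "R (1, 0) (0, 1) \<noteq> 0" by (rule R_nz[OF root])
  ultimately show "(\<lambda>z. norm (Ln (F z))) summable_on domain" "exp (infsum (\<lambda>z. Ln (F z)) domain) = 1" by auto
qed

end

section \<open>Reduction of hyperbolic matrices\<close>

abbreviation mat2 :: "int \<Rightarrow> int \<Rightarrow> int \<Rightarrow> int \<Rightarrow> int^2^2" where
  "mat2 a b c d \<equiv> vector [vector [a, b], vector [c, d]]"

text \<open>Among the conjugates by products of elementary matrices, one with the smallest difference of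
  the diagonal entries has entries of constant sign, possibly after a quarter turn.\<close>

lemma hyperbolic_conjugate_positive:
  fixes H :: "int^2^2"
  assumes H: "det H = 1" "\<bar>trace H\<bar> > 2"
    and Q: "Q (mat 1)"
    and shear: "\<And>B k. det B = 1 \<Longrightarrow> Q B \<Longrightarrow> \<bar>k\<bar> = 1 \<Longrightarrow> Q (B ** mat2 1 k 0 1) \<and> Q (B ** mat2 1 0 k 1)"
  obtains B s a b c d where "Q B" "det B = 1" "s \<in> {1, -1}" "a \<ge> 1" "b \<ge> 1" "c \<ge> 1" "d \<ge> 1" "a * d - b * c = 1"
    "H ** B = B ** mat2 (s * a) (s * b) (s * c) (s * d)"
proof -
  note obt = that
  \<comment> \<open>The matrix of \<open>H\<close> in the basis \<open>B\<close> is recorded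
    together with \<open>Q B\<close>, since \<open>Q\<close> can be carried only along shears by 1
    or -1.\<close>
  define G where "G = (\<lambda>B a b c d. Q B \<and> det B = 1 \<and> H ** B = B ** mat2 a b c d \<and> a + d = trace H \<and> a * d - b * c = 1)"
  have conj: "H ** (B ** S) = (B ** S) ** (S' ** N ** S)" if "H ** B = B ** N" "S ** S' = mat 1" for B S S' N :: "int^2^2"
  proof -
    have "(B ** S) ** (S' ** N ** S) = B ** (S ** S') ** N ** S" by (simp only: matrix_mul_assoc)
    then show ?thesis using that by (simp add: matrix_mul_assoc)
  qed
  have up: "G (B ** mat2 1 k 0 1) (a - k * c) (b + k * (a - d) - c) c (d + k * c)" if g: "G B a b c d" and k: "\<bar>k\<bar> = 1" for B a b c d k
  proof -
    have kk: "k * k = 1" using k by (metis abs_mult_self_eq mult_1)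
    have "mat2 1 k 0 1 ** mat2 1 (-k) 0 1 = mat 1" by (simp add: matrix_2_eq_iff matrix_mult_2 mat_def)
    then have "H ** (B ** mat2 1 k 0 1) = (B ** mat2 1 k 0 1) ** (mat2 1 (-k) 0 1 ** mat2 a b c d ** mat2 1 k 0 1)"
      using g unfolding G_def by (intro conj) simp_all
    also have "mat2 1 (-k) 0 1 ** mat2 a b c d ** mat2 1 k 0 1 = mat2 (a - k * c) (b + k * (a - d) - (k * k) * c) c (d + k * c)"
      by (simp add: matrix_2_eq_iff matrix_mult_2 algebra_simps)
    finally have "H ** (B ** mat2 1 k 0 1) = (B ** mat2 1 k 0 1) ** mat2 (a - k * c) (b + k * (a - d) - c) c (d + k * c)"
      by (simp only: kk mult_1)
    moreover have "(a - k * c) * (d + k * c) - (b + k * (a - d) - c) * c = a * d - b * c - (k * k - 1) * (c * c)"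
      by (simp add: algebra_simps)
    moreover have "det (B ** mat2 1 k 0 1) = 1" using g unfolding G_def det_mul by (simp add: det_2)
    ultimately show ?thesis using g shear[of B k] k kk unfolding G_def by simp
  qed
  have low: "G (B ** mat2 1 0 k 1) (a + k * b) b (c + k * (d - a) - b) (d - k * b)" if g: "G B a b c d" and k: "\<bar>k\<bar> = 1" for B a b c d k
  proof -
    have kk: "k * k = 1" using k by (metis abs_mult_self_eq mult_1)
    have "mat2 1 0 k 1 ** mat2 1 0 (-k) 1 = mat 1" by (simp add: matrix_2_eq_iff matrix_mult_2 mat_def)
    then have "H ** (B ** mat2 1 0 k 1) = (B ** mat2 1 0 k 1) ** (mat2 1 0 (-k) 1 ** mat2 a b c d ** mat2 1 0 k 1)"
      using g unfolding G_def by (intro conj) simp_all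
    also have "mat2 1 0 (-k) 1 ** mat2 a b c d ** mat2 1 0 k 1 = mat2 (a + k * b) b (c + k * (d - a) - (k * k) * b) (d - k * b)"
      by (simp add: matrix_2_eq_iff matrix_mult_2 algebra_simps)
    finally have "H ** (B ** mat2 1 0 k 1) = (B ** mat2 1 0 k 1) ** mat2 (a + k * b) b (c + k * (d - a) - b) (d - k * b)"
      by (simp only: kk mult_1)
    moreover have "(a + k * b) * (d - k * b) - b * (c + k * (d - a) - b) = a * d - b * c - (k * k - 1) * (b * b)"
      by (simp add: algebra_simps)
    moreover have "det (B ** mat2 1 0 k 1) = 1" using g unfolding G_def det_mul by (simp add: det_2)
    ultimately show ?thesis using g shear[of B k] k kk unfolding G_def by simp
  qed
  have "G (mat 1) (H$1$1) (H$1$2) (H$2$1) (H$2$2)"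
    unfolding G_def using H Q by (simp add: matrix_2_eq_iff matrix_mult_2 trace_2 det_2 mat_def)
  then obtain t where "case t of (B, a, b, c, d) \<Rightarrow> G B a b c d" by (metis (lifting) case_prod_conv)
  then obtain t where t: "case t of (B, a, b, c, d) \<Rightarrow> G B a b c d"
    "\<And>t'. (case t' of (B, a, b, c, d) \<Rightarrow> G B a b c d) \<Longrightarrow> (case t of (B, a, b, c, d) \<Rightarrow> nat \<bar>d - a\<bar>) \<le> (case t' of (B, a, b, c, d) \<Rightarrow> nat \<bar>d - a\<bar>)"
    using ex_has_least_nat[of "\<lambda>t. case t of (B, a, b, c, d) \<Rightarrow> G B a b c d" t "\<lambda>t. case t of (B, a, b, c, d) \<Rightarrow> nat \<bar>d - a\<bar>"] by blast
  obtain B a b c d where te: "t = (B, a, b, c, d)" by (cases t)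
  have g: "G B a b c d" using t(1) te by simp
  have least: "\<bar>d - a\<bar> \<le> \<bar>d' - a'\<bar>" if "G B' a' b' c' d'" for B' a' b' c' d'
    using t(2)[of "(B', a', b', c', d')"] that te by simp
  \<comment> \<open>The shears change \<open>d - a\<close> by \<open>2 * c\<close> or
    \<open>2 * b\<close> in either direction, so minimality bounds \<open>\<bar>d - a\<bar>\<close>
    by \<open>\<bar>c\<bar>\<close> and by \<open>\<bar>b\<bar>\<close>.\<close>
  have "\<bar>d - a\<bar> \<le> \<bar>d - a + 2 * c\<bar>" "\<bar>d - a\<bar> \<le> \<bar>d - a - 2 * c\<bar>"
    using least[OF up[OF g, of 1]] least[OF up[OF g, of "-1"]] by simp_all
  then have xc: "c \<noteq> 0 \<Longrightarrow> \<bar>d - a\<bar> \<le> \<bar>c\<bar>" by linarith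
  have "\<bar>d - a\<bar> \<le> \<bar>d - a + 2 * b\<bar>" "\<bar>d - a\<bar> \<le> \<bar>d - a - 2 * b\<bar>"
    using least[OF low[OF g, of 1]] least[OF low[OF g, of "-1"]] by simp_all
  then have xb: "b \<noteq> 0 \<Longrightarrow> \<bar>d - a\<bar> \<le> \<bar>b\<bar>" by linarith
  have tr: "a + d = trace H" and dt: "a * d = 1 + b * c" using g by (simp_all add: G_def algebra_simps)
  have bc0: "b * c \<noteq> 0"
  proof
    assume "b * c = 0"
    then have "a * d = 1" using dt by simp
    then have "(a = 1 \<and> d = 1) \<or> (a = -1 \<and> d = -1)" by (simp add: zmult_eq_1_iff)
    then show False using tr H(2) by auto
  qed
  \<comment> \<open>The discriminant \<open>(trace H)\<^sup>2 - 4\<close> equals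
    \<open>(d - a)\<^sup>2 + 4 * b * c\<close>. Were \<open>b * c\<close> negative,
    \<open>(d - a)\<^sup>2\<close> would exceed \<open>\<bar>b * c\<bar>\<close>, against the bound
    from minimality.\<close>
  have sq: "(d - a) * (d - a) = (trace H) * (trace H) - 4 - 4 * (b * c)"
    using dt unfolding tr[symmetric] by (simp add: algebra_simps)
  have H9: "trace H * trace H \<ge> 9"
  proof -
    have "3 * 3 \<le> \<bar>trace H\<bar> * \<bar>trace H\<bar>" using H(2) by (intro mult_mono) auto
    then show ?thesis by simp
  qed
  have "\<bar>d - a\<bar> * \<bar>d - a\<bar> \<le> \<bar>b\<bar> * \<bar>c\<bar>" using xb xc bc0 by (intro mult_mono) auto
  then have "(d - a) * (d - a) \<le> \<bar>b * c\<bar>" by (simp add: abs_mult)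
  then have bc: "b * c \<ge> 1" using sq H9 bc0 by linarith
  then have ad: "a * d \<ge> 2" using dt by simp
  have pos2: "(u \<ge> 1 \<and> v \<ge> 1) \<or> (u \<le> -1 \<and> v \<le> -1)" if "u * v \<ge> 1" for u v :: int
  proof -
    have "u * v > 0" using that by linarith
    then show ?thesis unfolding zero_less_mult_iff by linarith
  qed
  \<comment> \<open>Three alternating shears by -1, 1 and -1 compose to a quarter turn, which
    exchanges the diagonal entries and both exchanges and negates the others.\<close>
  have quarter: "\<exists>B'. G B' d (- c) (- b) a"
  proof -
    have "G (B ** mat2 1 (-1) 0 1) (a + c) (b - a + d - c) c (d - c)" using up[OF g, of "-1"] by (simp add: algebra_simps)
    from low[OF this, of 1] have "G (B ** mat2 1 (-1) 0 1 ** mat2 1 0 1 1) (b + d) (b - a + d - c) (- b) (a - b)"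
      by (simp add: algebra_simps)
    from up[OF this, of "-1"] show ?thesis by (auto simp: algebra_simps)
  qed
  have fin: thesis if g: "G B a b c d" and s: "s \<in> {1, -1}" "s * a \<ge> 1" "s * b \<ge> 1" "s * c \<ge> 1" "s * d \<ge> 1" for B a b c d s
  proof -
    have ss: "s * (s * u) = u" for u using s(1) by auto
    show thesis
    proof (rule obt[of B s "s * a" "s * b" "s * c" "s * d"])
      have "s * a * (s * d) - s * b * (s * c) = s * (s * (a * d - b * c))" by (simp add: algebra_simps)
      then show "s * a * (s * d) - s * b * (s * c) = 1" using g by (simp add: ss G_def)
    qed (use g s in \<open>simp_all add: ss G_def\<close>)
  qed
  consider "a \<ge> 1 \<and> d \<ge> 1 \<and> b \<ge> 1 \<and> c \<ge> 1" | "a \<ge> 1 \<and> d \<ge> 1 \<and> b \<le> -1 \<and> c \<le> -1"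
    | "a \<le> -1 \<and> d \<le> -1 \<and> b \<ge> 1 \<and> c \<ge> 1" | "a \<le> -1 \<and> d \<le> -1 \<and> b \<le> -1 \<and> c \<le> -1"
    using pos2[OF bc] pos2[of a d] ad by linarith
  then show thesis
  proof cases
    case 1 then show thesis using fin[OF g, of 1] by simp
  next
    case 4 then show thesis using fin[OF g, of "-1"] by simp
  next
    case 2 then show thesis using fin[of _ d "- c" "- b" a 1] quarter by auto
  next
    case 3 then show thesis using fin[of _ d "- c" "- b" a "-1"] quarter by auto
  qed
qed

lemma reversepath_compose: "reversepath (h \<circ> c) = h \<circ> reversepath c"
  by (simp add: reversepath_def fun_eq_iff)

lemma column_1_2: "column 1 (B :: 'a^2^2) = column 1 C \<longleftrightarrow> B$1$1 = C$1$1 \<and> B$2$1 = C$2$1"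
  by (simp add: column_def vec_eq_iff forall_2)

lemma coprime_imp_first_column:
  fixes u :: "int \<times> int"
  assumes "coprime (fst u) (snd u)"
  obtains B :: "int^2^2" where "det B = 1" "B$1$1 = fst u" "B$2$1 = snd u"
proof -
  obtain r s where "r * fst u + s * snd u = 1" using assms bezout_int[of "fst u" "snd u"] by auto
  then show ?thesis by (intro that[of "vector [vector [fst u, - s], vector [snd u, r]]"]) (simp_all add: det_2 algebra_simps)
qed

text \<open>The matrix \<open>- mat 1\<close> reverses the horizontal circle, because the height -1
  is its own inverse; the general case is the image of this under \<open>B\<close>.\<close>

lemma standard_loop_uminus: "standard_loop (- B) = reversepath (standard_loop B)"
proof -
  have m: "standard_loop (- mat 1) = reversepath (standard_loop (mat 1))"
  proof
    fix s
    have "torus_linear (- mat 1) (cis (2 * pi * s), cis pi) = torus_linear (mat 1) (cis (2 * pi * (1 - s)), cis pi)"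
      unfolding torus_linear_cis by (simp add: mat_def right_diff_distrib complex_eq_iff cos_diff sin_diff)
    then show "standard_loop (- mat 1) s = reversepath (standard_loop (mat 1)) s"
      by (simp add: standard_loop_def reversepath_def)
  qed
  have "standard_loop (- B) = torus_linear B \<circ> standard_loop (- mat 1)"
  proof -
    have "B ** (- mat 1) = - B" by (simp add: matrix_2_eq_iff matrix_mult_2 mat_def)
    then show ?thesis by (simp add: torus_linear_standard_loop)
  qed
  also have "\<dots> = reversepath (torus_linear B \<circ> standard_loop (mat 1))" unfolding m by (simp only: reversepath_compose)
  also have "\<dots> = reversepath (standard_loop B)" by (simp add: torus_linear_standard_loop)
  finally show ?thesis .
qed

section \<open>The trace function of the representation on loops of the fibre\<close>

locale bundle_character =
  fixes f f' :: "complex \<times> complex \<Rightarrow> complex \<times> complex" and H :: "int^2^2"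
    and M :: "'m::topological_space set" and q :: "(complex \<times> complex) \<times> real \<Rightarrow> 'm"
    and \<rho> :: "(real \<Rightarrow> 'm) \<Rightarrow> complex^2^2"
  assumes homeo: "homeomorphism punctured_torus punctured_torus f f'" and mapping_class: "has_mapping_class f H"
    and fibration: "mapping_torus f M q" and rep: "SL2_representation M (bundle_base q) \<rho>"
begin

lemma det_H: "det H = 1" using mapping_class by (simp add: has_mapping_class_def)

lemma continuous_q: "continuous_on (punctured_torus \<times> UNIV) q" "q \<in> punctured_torus \<times> UNIV \<rightarrow> M"
proof -
  have "continuous_map (top_of_set (punctured_torus \<times> UNIV)) (top_of_set M) q"
    using fibration quotient_imp_continuous_map unfolding mapping_torus_def by blast
  then show "continuous_on (punctured_torus \<times> UNIV) q" "q \<in> punctured_torus \<times> UNIV \<rightarrow> M"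
    by (auto simp: continuous_map_iff_continuous2)
qed

definition fiber :: "complex \<times> complex \<Rightarrow> 'm" where "fiber p = q (p, 0)"

lemma fiber_loop_eq: "fiber_loop q c = fiber \<circ> c" by (simp add: fiber_loop_def fiber_def o_def)

lemma continuous_fiber: "continuous_on punctured_torus fiber" "fiber \<in> punctured_torus \<rightarrow> M"
proof -
  show "continuous_on punctured_torus fiber" unfolding fiber_def
    by (intro continuous_on_compose2[OF continuous_q(1)] continuous_intros) auto
  show "fiber \<in> punctured_torus \<rightarrow> M" using continuous_q(2) by (auto simp: fiber_def)
qed

lemma homotopic_loops_fiber:
  "homotopic_loops punctured_torus c d \<Longrightarrow> homotopic_loops M (fiber \<circ> c) (fiber \<circ> d)"
  by (rule homotopic_loops_continuous_image[OF _ continuous_fiber])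

lemma homotopic_paths_fiber:
  "homotopic_paths punctured_torus c d \<Longrightarrow> homotopic_paths M (fiber \<circ> c) (fiber \<circ> d)"
  by (rule homotopic_paths_continuous_image[OF _ continuous_fiber])

abbreviation based :: "(real \<Rightarrow> complex \<times> complex) \<Rightarrow> bool" where
  "based g \<equiv> based_loop punctured_torus torus_base g"

lemma based_fiber: "based g \<Longrightarrow> based_loop M (bundle_base q) (fiber \<circ> g)"
proof -
  assume g: "based g"
  then have "homotopic_loops M (fiber \<circ> g) (fiber \<circ> g)"
    by (intro homotopic_loops_fiber) (auto simp: based_loop_def loop_in_def homotopic_loops_refl)
  then show ?thesis using g
    by (auto simp: based_loop_def loop_in_def homotopic_loops_refl pathstart_def fiber_def bundle_base_def)
qed

definition conjugated :: "(real \<Rightarrow> complex \<times> complex) \<Rightarrow> (real \<Rightarrow> complex \<times> complex) \<Rightarrow> real \<Rightarrow> complex \<times> complex" where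
  "conjugated d c = d +++ c +++ reversepath d"

definition path_from_base :: "(real \<Rightarrow> complex \<times> complex) \<Rightarrow> complex \<times> complex \<Rightarrow> bool" where
  "path_from_base d y \<longleftrightarrow> path d \<and> path_image d \<subseteq> punctured_torus \<and> pathstart d = torus_base \<and> pathfinish d = y"

lemma path_from_base_exists: "y \<in> punctured_torus \<Longrightarrow> \<exists>d. path_from_base d y"
  using path_connected_punctured_torus torus_base_in unfolding path_connected_def path_from_base_def by blast

lemma conjugated:
  assumes c: "loop_in punctured_torus c" and d: "path_from_base d (pathstart c)"
  shows "based (conjugated d c)" "homotopic_loops punctured_torus (conjugated d c) c"
proof -
  show "based (conjugated d c)" using c d
    unfolding based_loop_def loop_in_def path_from_base_def conjugated_def by (simp add: subset_path_image_join)
  show "homotopic_loops punctured_torus (conjugated d c) c" unfolding conjugated_def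
    using c d by (intro homotopic_loops_conjugate) (auto simp: loop_in_def path_from_base_def)
qed

lemma based_representative_exists:
  assumes "loop_in punctured_torus c"
  shows "\<exists>g. based g \<and> homotopic_loops punctured_torus g c"
proof -
  have "pathstart c \<in> punctured_torus" using assms pathstart_in_path_image by (auto simp: loop_in_def)
  then show ?thesis using conjugated[OF assms] path_from_base_exists by blast
qed

text \<open>The trace of a free loop, through an arbitrary based representative. It is constant on
  free homotopy classes in \<open>M\<close>, which are coarser than those in the fibre; invariance
  under the monodromy rests on this.\<close>

definition tr :: "(real \<Rightarrow> complex \<times> complex) \<Rightarrow> complex" where
  "tr c = trace (\<rho> (fiber \<circ> (SOME g. based g \<and> homotopic_loops punctured_torus g c)))"

lemma tr_eq:
  assumes g: "based g" "homotopic_loops M (fiber \<circ> g) (fiber \<circ> c)" and c: "loop_in punctured_torus c"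
  shows "tr c = trace (\<rho> (fiber \<circ> g))"
proof -
  define g' where "g' = (SOME g. based g \<and> homotopic_loops punctured_torus g c)"
  have g': "based g'" "homotopic_loops punctured_torus g' c"
    using someI_ex[OF based_representative_exists[OF c]] by (simp_all add: g'_def)
  have "homotopic_loops M (fiber \<circ> g') (fiber \<circ> g)"
    using homotopic_loops_trans[OF homotopic_loops_fiber[OF g'(2)] homotopic_loops_sym[OF g(2)]] .
  then have "trace (\<rho> (fiber \<circ> g')) = trace (\<rho> (fiber \<circ> g))"
    by (rule trace_SL2_representation_homotopic[OF rep based_fiber[OF g'(1)] based_fiber[OF g(1)]])
  then show ?thesis by (simp add: tr_def g'_def)
qed

lemma tr_based: "based g \<Longrightarrow> tr g = trace (\<rho> (fiber \<circ> g))"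
  by (intro tr_eq homotopic_loops_fiber) (auto simp: based_loop_def loop_in_def homotopic_loops_refl)

lemma loop_in_homotopic:
  assumes "homotopic_loops S c d" shows "loop_in S c" "loop_in S d"
  using homotopic_loops_imp_path[OF assms] homotopic_loops_imp_subset[OF assms] homotopic_loops_imp_loop[OF assms]
  by (simp_all add: loop_in_def)

lemma tr_homotopic_in_bundle:
  assumes "loop_in punctured_torus c" "loop_in punctured_torus d" "homotopic_loops M (fiber \<circ> c) (fiber \<circ> d)"
  shows "tr c = tr d"
proof -
  obtain g where g: "based g" "homotopic_loops punctured_torus g c" using based_representative_exists[OF assms(1)] by blast
  note h = homotopic_loops_fiber[OF g(2)]
  show ?thesis using tr_eq[OF g(1) h assms(1)] tr_eq[OF g(1) homotopic_loops_trans[OF h assms(3)] assms(2)] by simp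
qed

lemma tr_homotopic: "homotopic_loops punctured_torus c d \<Longrightarrow> tr c = tr d"
  using tr_homotopic_in_bundle loop_in_homotopic homotopic_loops_fiber by blast

lemma trace_inverse: 
  fixes A B :: "complex^2^2"
  shows "det A = 1 \<Longrightarrow> A ** B = mat 1 \<Longrightarrow> trace B = trace A"
  using right_inverse_2[of A B] by (simp add: trace_2)

lemma \<rho>_reversepath: "based g \<Longrightarrow> \<rho> (fiber \<circ> g) ** \<rho> (fiber \<circ> reversepath g) = mat 1"
  using SL2_representation_inverse[OF rep based_fiber, of g] by (simp only: reversepath_compose)

lemma \<rho>_join: "based g \<Longrightarrow> based g' \<Longrightarrow> \<rho> (fiber \<circ> (g +++ g')) = \<rho> (fiber \<circ> g) ** \<rho> (fiber \<circ> g')"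
  using rep based_fiber unfolding SL2_representation_def path_compose_join by blast

lemma \<rho>_det: "based g \<Longrightarrow> det (\<rho> (fiber \<circ> g)) = 1"
  using rep based_fiber unfolding SL2_representation_def by blast

lemma \<rho>_homotopic: "based g \<Longrightarrow> homotopic_paths punctured_torus g g' \<Longrightarrow> \<rho> (fiber \<circ> g) = \<rho> (fiber \<circ> g')"
  using rep based_fiber homotopic_paths_fiber unfolding SL2_representation_def by blast

lemma tr_reversepath:
  assumes "loop_in punctured_torus c"
  shows "tr (reversepath c) = tr c"
proof -
  obtain g where g: "based g" "homotopic_loops punctured_torus g c" using based_representative_exists[OF assms] by blast
  have "tr (reversepath c) = tr (reversepath g)" using tr_homotopic[OF homotopic_loops_reversepath[OF g(2)]] by simp
  also have "\<dots> = trace (\<rho> (fiber \<circ> reversepath g))" by (rule tr_based[OF based_loop_reversepath[OF g(1)]])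
  also have "\<dots> = trace (\<rho> (fiber \<circ> g))" by (rule trace_inverse[OF \<rho>_det[OF g(1)] \<rho>_reversepath[OF g(1)]])
  also have "\<dots> = tr c" using tr_based[OF g(1)] tr_homotopic[OF g(2)] by simp
  finally show ?thesis .
qed

text \<open>Conjugating \<open>P\<close> and \<open>Q\<close> by one path from the base point makes
  both based and respects concatenation and reversal up to homotopy, so the trace relation of
  \<open>trace_mult_add_trace_mult_inverse\<close> applies.\<close>

lemma tr_join:
  assumes P: "loop_in punctured_torus P" "pathstart P = y" and Q: "loop_in punctured_torus Q" "pathstart Q = y"
  shows "tr (P +++ Q) + tr (P +++ reversepath Q) = tr P * tr Q"
proof -
  have "y \<in> punctured_torus" using P pathstart_in_path_image[of P] by (auto simp: loop_in_def)
  then obtain d where d: "path_from_base d y" using path_from_base_exists by blast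
  have dd: "path d" "path_image d \<subseteq> punctured_torus" "pathfinish d = y" using d by (auto simp: path_from_base_def)
  have rQ: "loop_in punctured_torus (reversepath Q)" "pathstart (reversepath Q) = y" using Q by (auto simp: loop_in_def)
  define gP where "gP = conjugated d P"
  define gQ where "gQ = conjugated d Q"
  have b: "based gP" "based gQ" "based (conjugated d (reversepath Q))"
    using conjugated(1) P Q rQ d by (simp_all add: gP_def gQ_def)
  have join: "tr (P +++ c) = trace (\<rho> (fiber \<circ> gP) ** \<rho> (fiber \<circ> conjugated d c))" if c: "loop_in punctured_torus c" "pathstart c = y" for c
  proof -
    have Pc: "loop_in punctured_torus (P +++ c)" "pathstart (P +++ c) = y" using P c by (auto simp: loop_in_def path_image_join)
    have bc: "based (conjugated d c)" using conjugated(1) c d by simp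
    have "homotopic_paths punctured_torus (gP +++ conjugated d c) (conjugated d (P +++ c))"
      unfolding gP_def conjugated_def using dd P c by (intro homotopic_paths_conjugate_join) (auto simp: loop_in_def)
    then have "\<rho> (fiber \<circ> (gP +++ conjugated d c)) = \<rho> (fiber \<circ> conjugated d (P +++ c))"
      by (rule \<rho>_homotopic[OF based_loop_join[OF b(1) bc]])
    moreover have "tr (P +++ c) = trace (\<rho> (fiber \<circ> conjugated d (P +++ c)))"
      using Pc d by (intro tr_eq homotopic_loops_fiber conjugated) auto
    ultimately show ?thesis using \<rho>_join[OF b(1) bc] by simp
  qed
  have "homotopic_paths punctured_torus (reversepath gQ) (conjugated d (reversepath Q))"
  proof -
    have "reversepath gQ = (d +++ reversepath Q) +++ reversepath d"
      unfolding gQ_def conjugated_def using dd Q by (simp add: reversepath_joinpaths loop_in_def)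
    then show ?thesis unfolding conjugated_def
      using homotopic_paths_sym[OF homotopic_paths_assoc[of d punctured_torus "reversepath Q" "reversepath d"]] dd rQ by (simp add: loop_in_def)
  qed
  then have r: "\<rho> (fiber \<circ> reversepath gQ) = \<rho> (fiber \<circ> conjugated d (reversepath Q))"
    by (rule \<rho>_homotopic[OF based_loop_reversepath[OF b(2)]])
  have "tr (P +++ Q) + tr (P +++ reversepath Q) = trace (\<rho> (fiber \<circ> gP) ** \<rho> (fiber \<circ> gQ)) + trace (\<rho> (fiber \<circ> gP) ** \<rho> (fiber \<circ> reversepath gQ))"
    using join[OF Q] join[OF rQ] r by (simp add: gQ_def)
  also have "\<dots> = trace (\<rho> (fiber \<circ> gP)) * trace (\<rho> (fiber \<circ> gQ))"
    by (rule trace_mult_add_trace_mult_inverse[OF \<rho>_det[OF b(2)] \<rho>_reversepath[OF b(2)]])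
  also have "trace (\<rho> (fiber \<circ> gP)) = tr P" unfolding gP_def using P d by (intro tr_eq[symmetric] homotopic_loops_fiber conjugated) auto
  also have "trace (\<rho> (fiber \<circ> gQ)) = tr Q" unfolding gQ_def using Q d by (intro tr_eq[symmetric] homotopic_loops_fiber conjugated) auto
  finally show ?thesis .
qed

lemma f_maps: "continuous_on punctured_torus f" "f \<in> punctured_torus \<rightarrow> punctured_torus"
  using homeo by (auto simp: homeomorphism_def)

lemma loop_in_f: "loop_in punctured_torus c \<Longrightarrow> loop_in punctured_torus (f \<circ> c)"
  using homotopic_loops_continuous_image[OF _ f_maps, of c c] homotopic_loops_refl loop_in_homotopic
  by (auto simp: loop_in_def homotopic_loops_refl)

text \<open>The loop is pushed once around the base circle: \<open>q (c s, 1 - u)\<close> begins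
  with \<open>q (c s, 1) = q (f (c s), 0)\<close>, by the gluing, and ends with \<open>c\<close> in
  the fibre.\<close>

lemma tr_f:
  assumes c: "loop_in punctured_torus c"
  shows "tr (f \<circ> c) = tr c"
proof (rule tr_homotopic_in_bundle[OF loop_in_f[OF c] c])
  have c': "path c" "\<And>s. s \<in> {0..1} \<Longrightarrow> c s \<in> punctured_torus" "c 1 = c 0"
    using c by (auto simp: loop_in_def path_image_def pathfinish_def pathstart_def)
  have q1: "q (p, 1) = q (f p, 0)" if "p \<in> punctured_torus" for p
  proof -
    have "f p \<in> punctured_torus" using f_maps(2) that by blast
    then have "q (p, 1) = q (f p, 0) \<longleftrightarrow> (\<exists>n::nat. (f p = (f ^^ n) p \<and> 0 = 1 - real n) \<or> (p = (f ^^ n) (f p) \<and> 1 = 0 - real n))"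
      using fibration that unfolding mapping_torus_def by blast
    also have "\<dots>" by (intro exI[of _ 1]) simp
    finally show ?thesis by simp
  qed
  show "homotopic_loops M (fiber \<circ> (f \<circ> c)) (fiber \<circ> c)"
    unfolding homotopic_loops
  proof (intro exI[of _ "\<lambda>y. q (c (snd y), 1 - fst y)"] conjI)
    show "continuous_on ({0..1} \<times> {0..1}) (\<lambda>y. q (c (snd y), 1 - fst y))"
    proof (intro continuous_on_compose2[OF continuous_q(1)] continuous_intros)
      show "continuous_on ({0..1} \<times> {0..1}) (\<lambda>y. c (snd y))"
        by (rule continuous_on_compose2[OF c'(1)[unfolded path_def]]) (auto intro!: continuous_intros)
    qed (use c' in auto)
    show "(\<lambda>y. q (c (snd y), 1 - fst y)) \<in> {0..1} \<times> {0..1} \<rightarrow> M" using c'(2) continuous_q(2) by auto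
    show "\<forall>x\<in>{0..1}. q (c (snd (0, x)), 1 - fst (0, x)) = (fiber \<circ> (f \<circ> c)) x" using q1 c'(2) by (simp add: fiber_def)
    show "\<forall>x\<in>{0..1}. q (c (snd (1, x)), 1 - fst (1, x)) = (fiber \<circ> c) x" by (simp add: fiber_def)
    show "\<forall>t\<in>{0..1}. pathfinish ((\<lambda>y. q (c (snd y), 1 - fst y)) \<circ> Pair t) = pathstart ((\<lambda>y. q (c (snd y), 1 - fst y)) \<circ> Pair t)"
      using c'(3) by (simp add: pathfinish_def pathstart_def)
  qed
qed

lemma f_homotopic_linear:
  assumes c: "loop_in punctured_torus c"
  shows "homotopic_loops punctured_torus (f \<circ> c) (torus_linear H \<circ> c)"
proof -
  have "homotopic_with_canon (\<lambda>h. \<exists>h'. homeomorphism punctured_torus punctured_torus h h') punctured_torus punctured_torus f (torus_linear H)"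
    using mapping_class by (simp add: has_mapping_class_def)
  then have "homotopic_with_canon (\<lambda>h. pathfinish (h \<circ> c) = pathstart (h \<circ> c)) punctured_torus punctured_torus f (torus_linear H)"
    by (rule homotopic_with_mono) (use c in \<open>auto simp: loop_in_def pathfinish_compose pathstart_compose\<close>)
  then show ?thesis unfolding homotopic_loops_def
    by (rule homotopic_with_compose_continuous_right[where p = "\<lambda>r. pathfinish r = pathstart r"])
      (use c in \<open>auto simp: loop_in_def path_def path_image_def\<close>)
qed

text \<open>A primitive vector is completed to a unimodular matrix, and by
  \<open>standard_loop_homotopic\<close> the second column does not affect the value. At vectors
  that are not primitive the value is unspecified.\<close>

definition x :: "int \<times> int \<Rightarrow> complex" where
  "x u = tr (standard_loop (SOME B. det B = 1 \<and> B$1$1 = fst u \<and> B$2$1 = snd u))"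

lemma x_eq:
  assumes "det B = 1"
  shows "x (B$1$1, B$2$1) = tr (standard_loop B)"
proof -
  define C where "C = (SOME C :: int^2^2. det C = 1 \<and> C$1$1 = B$1$1 \<and> C$2$1 = B$2$1)"
  have "det C = 1 \<and> C$1$1 = B$1$1 \<and> C$2$1 = B$2$1" unfolding C_def by (rule someI[of _ B]) (use assms in simp)
  then have "homotopic_loops punctured_torus (standard_loop C) (standard_loop B)"
    by (intro standard_loop_homotopic) (simp_all add: assms column_1_2)
  from tr_homotopic[OF this] show ?thesis by (simp add: x_def C_def)
qed

lemma x_neg:
  assumes "coprime (fst u) (snd u)"
  shows "x (- u) = x u"
proof -
  obtain B :: "int^2^2" where B: "det B = 1" "B$1$1 = fst u" "B$2$1 = snd u" using coprime_imp_first_column[OF assms] .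
  have "tr (standard_loop (- B)) = tr (standard_loop B)"
    unfolding standard_loop_uminus using tr_reversepath[OF loop_in_standard_loop[OF B(1)]] .
  moreover have "det (- B) = 1" using B(1) by (simp add: det_2)
  ultimately have "x ((- B)$1$1, (- B)$2$1) = x (B$1$1, B$2$1)" using x_eq B(1) by metis
  moreover have "- u = ((- B)$1$1, (- B)$2$1)" "u = (B$1$1, B$2$1)" using B by (simp_all add: prod_eq_iff)
  ultimately show ?thesis by simp
qed

lemma based_generators: "based loop_a" "based loop_b"
  using loop_in_homotopic(1)[OF loop_a_homotopic] loop_in_homotopic(1)[OF loop_b_homotopic]
  by (auto simp: based_loop_def pathstart_def loop_a_def loop_b_def torus_base_def)

lemma tr_linear_image:
  assumes "det B = 1" "det C = 1" "homotopic_loops punctured_torus c (standard_loop C)"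
  shows "tr (torus_linear B \<circ> c) = x ((B ** C)$1$1, (B ** C)$2$1)"
proof -
  have "det (B ** C) = 1" using assms by (simp add: det_mul)
  then show ?thesis using tr_homotopic[OF homotopic_loops_torus_linear[OF assms(3,1)]] x_eq[of "B ** C"]
    by (simp add: torus_linear_standard_loop)
qed

text \<open>The loops \<open>a\<close>, \<open>b\<close>, \<open>ab\<close> and \<open>a\<close>
  followed by \<open>b\<close> reversed have slopes \<open>(1, 0)\<close>, \<open>(0, 1)\<close>,
  \<open>(1, 1)\<close> and \<open>(1, -1)\<close>. A matrix with columns \<open>u\<close>,
  \<open>v\<close> carries these to \<open>u\<close>, \<open>v\<close>, \<open>u + v\<close> and
  \<open>u - v\<close>, and \<open>tr_join\<close> applies to the images. Determinant -1 is reduced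
  to 1 by exchanging \<open>u\<close> and \<open>v\<close>.\<close>

lemma x_edge:
  assumes "\<bar>det2 u v\<bar> = 1"
  shows "x (u + v) + x (u - v) = x u * x v"
proof -
  have *: "x (u + v) + x (u - v) = x u * x v" if d: "det2 u v = 1" for u v
  proof -
    define B :: "int^2^2" where "B = vector [vector [fst u, fst v], vector [snd u, snd v]]"
    have B: "det B = 1" using d by (simp add: B_def det_2 det2_def mult.commute)
    have l: "loop_in punctured_torus loop_a" "loop_in punctured_torus loop_b" using based_generators by (auto simp: based_loop_def)
    have "pathstart (torus_linear B \<circ> loop_b) = pathstart (torus_linear B \<circ> loop_a)"
      using based_generators by (simp add: pathstart_compose based_loop_def)
    from tr_join[OF loop_in_torus_linear[OF l(1) B] refl loop_in_torus_linear[OF l(2) B] this]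
    have "tr (torus_linear B \<circ> (loop_a +++ loop_b)) + tr (torus_linear B \<circ> (loop_a +++ reversepath loop_b)) =
        tr (torus_linear B \<circ> loop_a) * tr (torus_linear B \<circ> loop_b)"
      by (simp only: path_compose_join reversepath_compose)
    moreover have "tr (torus_linear B \<circ> (loop_a +++ loop_b)) = x (u + v)"
      using tr_linear_image[OF B _ loop_ab_homotopic] by (simp add: det_2 matrix_mult_2 B_def plus_prod_def)
    moreover have "tr (torus_linear B \<circ> (loop_a +++ reversepath loop_b)) = x (u - v)"
      using tr_linear_image[OF B _ loop_a_rev_b_homotopic] by (simp add: det_2 matrix_mult_2 B_def minus_prod_def)
    moreover have "tr (torus_linear B \<circ> loop_a) = x u"
      using tr_linear_image[OF B _ loop_a_homotopic] by (simp add: B_def)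
    moreover have "tr (torus_linear B \<circ> loop_b) = x v"
      using tr_linear_image[OF B _ loop_b_homotopic] by (simp add: det_2 matrix_mult_2 B_def)
    ultimately show ?thesis by simp
  qed
  consider "det2 u v = 1" | "det2 v u = 1" using assms det2_swap[of u v] by linarith
  then show ?thesis
  proof cases
    case 2
    have c: "coprime (fst (u - v)) (snd (u - v))"
    proof (rule coprimeI)
      fix k assume "k dvd fst (u - v)" "k dvd snd (u - v)"
      then have "k dvd fst v * snd (u - v) - snd v * fst (u - v)" by (intro dvd_diff dvd_mult)
      also have "\<dots> = 1" using 2 by (simp add: det2_def algebra_simps)
      finally show "is_unit k" .
    qed
    have "x (v - u) = x (u - v)" using x_neg[OF c] by simp
    then show ?thesis using *[OF 2] by (simp add: add.commute mult.commute)
  qed (rule *)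
qed

text \<open>Fricke's identity \<open>trace_commutator\<close> for the two generators; it identifies
  the constant of the vertex relation as \<open>\<tau> + 2\<close>.\<close>

lemma x_vertex:
  "(x (1, 0))\<^sup>2 + (x (0, 1))\<^sup>2 + (x ((1, 0) + (0, 1)))\<^sup>2 - x (1, 0) * x (0, 1) * x ((1, 0) + (0, 1)) = boundary_trace q \<rho> + 2"
proof -
  note b = based_generators
  have A: "x (1, 0) = trace (\<rho> (fiber \<circ> loop_a))"
    using x_eq[OF det_I] tr_homotopic[OF loop_a_homotopic] tr_based[OF b(1)] by (simp add: mat_def)
  have B: "x (0, 1) = trace (\<rho> (fiber \<circ> loop_b))"
    using x_eq[of quarter_turn] tr_homotopic[OF loop_b_homotopic] tr_based[OF b(2)] by (simp add: det_2)
  have AB: "x ((1, 0) + (0, 1)) = trace (\<rho> (fiber \<circ> loop_a) ** \<rho> (fiber \<circ> loop_b))"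
    using x_eq[of shear_up] tr_homotopic[OF loop_ab_homotopic] tr_based[OF based_loop_join[OF b]] \<rho>_join[OF b] by (simp add: det_2)
  have "boundary_trace q \<rho> = trace ((\<rho> (fiber \<circ> loop_a) ** \<rho> (fiber \<circ> loop_b)) ** (\<rho> (fiber \<circ> reversepath loop_a) ** \<rho> (fiber \<circ> reversepath loop_b)))"
    unfolding boundary_trace_def fiber_loop_eq loop_commutator_def
    using b by (simp add: \<rho>_join based_loop_join based_loop_reversepath)
  then show ?thesis unfolding A B AB
    using trace_commutator[OF \<rho>_det[OF b(1)] \<rho>_det[OF b(2)] \<rho>_reversepath[OF b(1)] \<rho>_reversepath[OF b(2)]] by simp
qed

end

section \<open>Complex lengths\<close>

lemma arcosh_branch_carcosh: "arcosh_branch z (carcosh z)"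
  unfolding carcosh_def by (rule theI'[OF arcosh_branch_ex1])

lemma exp_carcosh_add_inverse: "exp (carcosh z) + 1 / exp (carcosh z) = 2 * z"
proof -
  have "cosh (carcosh z) = z" using arcosh_branch_carcosh by (simp add: arcosh_branch_def)
  then show ?thesis by (simp add: cosh_def exp_minus inverse_eq_divide scaleR_conv_of_real field_simps)
qed

text \<open>If the real part of the inverse hyperbolic cosine vanished, \<open>z\<close> would be
  twice a real cosine and lie in the excluded interval.\<close>

lemma norm_exp_carcosh_gt:
  assumes "z \<notin> complex_of_real ` {-2..2}"
  shows "norm (exp (carcosh (z / 2))) > 1"
proof -
  define w where "w = carcosh (z / 2)"
  have w: "cosh w = z / 2" "Re w \<ge> 0" using arcosh_branch_carcosh[of "z / 2"] by (auto simp: arcosh_branch_def w_def)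
  have "Re w \<noteq> 0"
  proof
    assume "Re w = 0"
    then have "w = \<i> * of_real (Im w)" by (simp add: complex_eq_iff)
    then have "cosh w = cos (of_real (Im w))" by (metis cosh_conv_cos cos_minus minus_mult_minus mult.assoc mult_1 mult_minus_left i_squared power2_eq_square)
    then have "z = of_real (2 * cos (Im w))" using w(1) by (simp add: cos_of_real)
    moreover have "2 * cos (Im w) \<in> {-2..2}" by simp
    ultimately show False using assms by blast
  qed
  then show ?thesis using w(2) by (simp add: w_def)
qed

text \<open>Bounded traces have bounded lengths, which turns discreteness of lengths into finiteness
  for traces: \<open>exp w\<close> differs from \<open>z\<close> by \<open>1 / exp w\<close>, of
  norm at most 1.\<close>

lemma Re_carcosh_le:
  assumes "norm z \<le> K"
  shows "Re (carcosh (z / 2)) \<le> ln (K + 1)"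
proof -
  define w where "w = carcosh (z / 2)"
  have w: "exp w + 1 / exp w = z" "Re w \<ge> 0"
    using exp_carcosh_add_inverse[of "z / 2"] arcosh_branch_carcosh[of "z / 2"] by (auto simp: w_def arcosh_branch_def)
  have "norm (exp w) \<le> norm z + norm (1 / exp w)" unfolding w(1)[symmetric] using norm_triangle_ineq4[of "exp w + 1 / exp w" "1 / exp w"] by simp
  moreover have "norm (1 / exp w) \<le> 1" using w(2) by (simp add: norm_divide)
  ultimately have "exp (Re w) \<le> K + 1" using assms by simp
  moreover have "K + 1 > 0" using calculation exp_gt_zero[of "Re w"] by linarith
  ultimately show ?thesis by (simp add: w_def ln_ge_iff)
qed

section \<open>Orbits of slopes\<close>

definition signed :: "int \<Rightarrow> int \<times> int \<Rightarrow> int \<times> int" where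
  "signed s u = (s * fst u, s * snd u)"

definition mat_act :: "int^2^2 \<Rightarrow> int \<times> int \<Rightarrow> int \<times> int" where
  "mat_act B u = (B$1$1 * fst u + B$1$2 * snd u, B$2$1 * fst u + B$2$2 * snd u)"

lemma mat_act_mult: "mat_act (A ** B) u = mat_act A (mat_act B u)"
  by (simp add: mat_act_def matrix_mult_2 algebra_simps)

lemma mat_act_1: "mat_act (mat 1) u = u"
  by (simp add: mat_act_def mat_def)

lemma mat_act_signed: "mat_act B (signed s u) = signed s (mat_act B u)"
  by (simp add: mat_act_def signed_def algebra_simps)

lemma mat_act_pow_signed: "(mat_act B ^^ n) (signed s u) = signed s ((mat_act B ^^ n) u)"
  by (induction n) (simp_all add: mat_act_signed)

lemma mat_act_add: "mat_act B (u + v) = mat_act B u + mat_act B v" "mat_act B (u - v) = mat_act B u - mat_act B v"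
  by (simp_all add: mat_act_def algebra_simps)

lemma mat_act_uminus: "mat_act B (- u) = - mat_act B u"
  by (simp add: mat_act_def)

lemma signed_signed: "signed s (signed t u) = signed (s * t) u"
  by (simp add: signed_def)

lemma signed_1: "signed 1 u = u" "signed (- 1) u = - u"
  by (simp_all add: signed_def prod_eq_iff)

lemma det2_mat_act: "det B = 1 \<Longrightarrow> det2 (mat_act B u) (mat_act B v) = det2 u v"
proof -
  assume "det B = 1"
  moreover have "det2 (mat_act B u) (mat_act B v) = det B * det2 u v" by (simp add: det2_def mat_act_def det_2 algebra_simps)
  ultimately show ?thesis by simp
qed

lemma inj_mat_act: "det B = 1 \<Longrightarrow> inj (mat_act B)"
  by (rule det_1_inverse[of B], assumption) (metis injI mat_act_1 mat_act_mult)

lemma mat_act_coprime: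
  assumes "det B = 1" "coprime (fst u) (snd u)"
  shows "coprime (fst (mat_act B u)) (snd (mat_act B u))"
proof (rule coprimeI)
  obtain B' where B': "B' ** B = mat 1" using det_1_inverse[OF assms(1)] .
  fix k assume "k dvd fst (mat_act B u)" "k dvd snd (mat_act B u)"
  then have "k dvd fst (mat_act B' (mat_act B u))" "k dvd snd (mat_act B' (mat_act B u))" by (simp_all add: mat_act_def)
  then show "is_unit k" using coprime_common_divisor[OF assms(2)] by (simp only: mat_act_mult[symmetric] B' mat_act_1)
qed

text \<open>Two independent exponents in place of negative powers make symmetry and transitivity
  direct; \<open>same_slope_orbit_iff\<close> returns to the form with one exponent used by
  \<open>same_orbit\<close>.\<close>

definition same_slope_orbit :: "int^2^2 \<Rightarrow> int \<times> int \<Rightarrow> int \<times> int \<Rightarrow> bool" where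
  "same_slope_orbit H u w \<longleftrightarrow> (\<exists>m n. \<exists>s\<in>{1, -1}. (mat_act H ^^ m) u = signed s ((mat_act H ^^ n) w))"

lemma same_slope_orbit_refl: "same_slope_orbit H u u"
  unfolding same_slope_orbit_def by (intro exI[of _ 0] bexI[of _ 1]) (simp_all add: signed_1)

lemma same_slope_orbit_sym: "same_slope_orbit H u w \<Longrightarrow> same_slope_orbit H w u"
  unfolding same_slope_orbit_def
proof (elim exE bexE)
  fix m n s assume s: "s \<in> {1, -1 :: int}" and "(mat_act H ^^ m) u = signed s ((mat_act H ^^ n) w)"
  then have "signed s ((mat_act H ^^ m) u) = signed (s * s) ((mat_act H ^^ n) w)" by (simp add: signed_signed)
  moreover have "s * s = 1" using s by auto
  ultimately have "(mat_act H ^^ n) w = signed s ((mat_act H ^^ m) u)" by (simp add: signed_1)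
  then show "\<exists>m n. \<exists>s\<in>{1, -1}. (mat_act H ^^ m) w = signed s ((mat_act H ^^ n) u)" using s by blast
qed

lemma same_slope_orbit_trans:
  assumes "same_slope_orbit H u w" "same_slope_orbit H w z"
  shows "same_slope_orbit H u z"
proof -
  obtain m n s where 1: "s \<in> {1, -1 :: int}" "(mat_act H ^^ m) u = signed s ((mat_act H ^^ n) w)"
    using assms(1) unfolding same_slope_orbit_def by blast
  obtain k j t where 2: "t \<in> {1, -1 :: int}" "(mat_act H ^^ k) w = signed t ((mat_act H ^^ j) z)"
    using assms(2) unfolding same_slope_orbit_def by blast
  have "(mat_act H ^^ (k + m)) u = signed s ((mat_act H ^^ (k + n)) w)"
    by (simp add: funpow_add 1 mat_act_pow_signed)
  also have "\<dots> = signed s ((mat_act H ^^ n) ((mat_act H ^^ k) w))" by (subst add.commute) (simp add: funpow_add)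
  also have "\<dots> = signed (s * t) ((mat_act H ^^ (n + j)) z)" by (simp add: 2 mat_act_pow_signed signed_signed funpow_add)
  finally show ?thesis unfolding same_slope_orbit_def using 1(1) 2(1) by (intro exI[of _ "k + m"] exI[of _ "n + j"] bexI[of _ "s * t"]) auto
qed

lemma same_slope_orbit_iff:
  assumes "det H = 1"
  shows "same_slope_orbit H u w \<longleftrightarrow> (\<exists>n. \<exists>s\<in>{1, -1}. (mat_act H ^^ n) u = signed s w \<or> u = signed s ((mat_act H ^^ n) w))"
proof
  assume "same_slope_orbit H u w"
  then obtain m n s where s: "s \<in> {1, -1 :: int}" and e: "(mat_act H ^^ m) u = signed s ((mat_act H ^^ n) w)"
    unfolding same_slope_orbit_def by blast
  have inj: "inj (mat_act H ^^ k)" for k by (rule inj_fn[OF inj_mat_act[OF assms]])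
  show "\<exists>n. \<exists>s\<in>{1, -1}. (mat_act H ^^ n) u = signed s w \<or> u = signed s ((mat_act H ^^ n) w)"
  proof (cases "n \<le> m")
    case True
    then obtain k where "m = n + k" using le_Suc_ex by blast
    then have "(mat_act H ^^ n) ((mat_act H ^^ k) u) = (mat_act H ^^ n) (signed s w)"
      using e by (simp add: funpow_add mat_act_pow_signed)
    then have "(mat_act H ^^ k) u = signed s w" using injD[OF inj] by blast
    then show ?thesis using s by blast
  next
    case False
    then obtain k where "n = m + k" using le_Suc_ex nat_le_linear by blast
    then have "(mat_act H ^^ m) u = (mat_act H ^^ m) (signed s ((mat_act H ^^ k) w))"
      using e by (simp add: funpow_add mat_act_pow_signed)
    then have "u = signed s ((mat_act H ^^ k) w)" using injD[OF inj] by blast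
    then show ?thesis using s by blast
  qed
next
  assume "\<exists>n. \<exists>s\<in>{1, -1}. (mat_act H ^^ n) u = signed s w \<or> u = signed s ((mat_act H ^^ n) w)"
  then obtain n s where "s \<in> {1, -1 :: int}" "(mat_act H ^^ n) u = signed s ((mat_act H ^^ 0) w) \<or> (mat_act H ^^ 0) u = signed s ((mat_act H ^^ n) w)"
    by auto
  then show "same_slope_orbit H u w" unfolding same_slope_orbit_def by blast
qed

section \<open>Slopes of curves and the geodesics of the bundle\<close>

context bundle_character
begin

definition slope :: "(real \<Rightarrow> complex \<times> complex) \<Rightarrow> int \<times> int \<Rightarrow> bool" where
  "slope c u \<longleftrightarrow> (\<exists>B. det B = 1 \<and> B$1$1 = fst u \<and> B$2$1 = snd u \<and> homotopic_loops punctured_torus c (standard_loop B))"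

lemma essential_scc_slope: "essential_scc c \<Longrightarrow> \<exists>u. slope c u"
  by (rule essential_scc_homotopic_standard_loop, assumption) (metis slope_def fst_conv snd_conv)

lemma slope_loop_in: "slope c u \<Longrightarrow> loop_in punctured_torus c"
  using loop_in_homotopic(1) unfolding slope_def by blast

lemma slope_standard_loop: "det B = 1 \<Longrightarrow> slope (standard_loop B) (B$1$1, B$2$1)"
  unfolding slope_def using loop_in_standard_loop[of B] by (intro exI[of _ B]) (simp add: homotopic_loops_refl loop_in_def)

text \<open>Standard loops with equal first columns are homotopic, and homology tells different
  first columns apart.\<close>

lemma homotopic_iff_slope_eq:
  assumes "slope c u" "slope d w"
  shows "homotopic_loops punctured_torus c d \<longleftrightarrow> u = w"
proof -
  obtain B where B: "det B = 1" "B$1$1 = fst u" "B$2$1 = snd u" "homotopic_loops punctured_torus c (standard_loop B)"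
    using assms(1) unfolding slope_def by blast
  obtain C where C: "det C = 1" "C$1$1 = fst w" "C$2$1 = snd w" "homotopic_loops punctured_torus d (standard_loop C)"
    using assms(2) unfolding slope_def by blast
  show ?thesis
  proof
    assume "homotopic_loops punctured_torus c d"
    then have "homotopic_loops punctured_torus (standard_loop B) (standard_loop C)"
      using homotopic_loops_trans[OF homotopic_loops_sym[OF B(4)]] homotopic_loops_trans[OF _ C(4)] by blast
    then have "column 1 B = column 1 C"
      using homology_class_unique homology_class_homotopic homology_class_standard_loop[OF B(1)] homology_class_standard_loop[OF C(1)] by blast
    then show "u = w" using B C by (simp add: column_1_2 prod_eq_iff)
  next
    assume "u = w"
    then have "homotopic_loops punctured_torus (standard_loop B) (standard_loop C)"
      using B C by (intro standard_loop_homotopic) (simp_all add: column_1_2)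
    then show "homotopic_loops punctured_torus c d"
      using homotopic_loops_trans[OF B(4)] homotopic_loops_trans[OF _ homotopic_loops_sym[OF C(4)]] by blast
  qed
qed

lemma slope_f: "slope c u \<Longrightarrow> slope (f \<circ> c) (mat_act H u)"
proof -
  assume "slope c u"
  then obtain B where B: "det B = 1" "B$1$1 = fst u" "B$2$1 = snd u" "homotopic_loops punctured_torus c (standard_loop B)"
    unfolding slope_def by blast
  have "homotopic_loops punctured_torus (f \<circ> c) (torus_linear H \<circ> c)"
    by (rule f_homotopic_linear[OF loop_in_homotopic(1)[OF B(4)]])
  then have "homotopic_loops punctured_torus (f \<circ> c) (standard_loop (H ** B))"
    using homotopic_loops_trans[OF _ homotopic_loops_torus_linear[OF B(4) det_H]] by (simp add: torus_linear_standard_loop)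
  moreover have "det (H ** B) = 1" using det_H B(1) by (simp add: det_mul)
  ultimately show ?thesis unfolding slope_def
    by (intro exI[of _ "H ** B"]) (simp add: matrix_mult_2 mat_act_def B)
qed

lemma slope_f_pow: "slope c u \<Longrightarrow> slope ((f ^^ n) \<circ> c) ((mat_act H ^^ n) u)"
proof (induction n)
  case (Suc n)
  then show ?case using slope_f[of "(f ^^ n) \<circ> c" "(mat_act H ^^ n) u"] by (simp add: comp_def)
qed simp

lemma slope_reversepath: "slope c u \<Longrightarrow> slope (reversepath c) (- u)"
proof -
  assume "slope c u"
  then obtain B where B: "det B = 1" "B$1$1 = fst u" "B$2$1 = snd u" "homotopic_loops punctured_torus c (standard_loop B)"
    unfolding slope_def by blast
  then have "homotopic_loops punctured_torus (reversepath c) (standard_loop (- B))"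
    using homotopic_loops_reversepath standard_loop_uminus by metis
  moreover have "det (- B) = 1" using B(1) by (simp add: det_2)
  ultimately show ?thesis unfolding slope_def using B by (intro exI[of _ "- B"]) simp
qed

lemma tr_slope: "slope c u \<Longrightarrow> tr c = x u"
  unfolding slope_def using tr_homotopic x_eq by (metis prod.collapse)

lemma same_orbit_iff:
  assumes c: "slope c u" and d: "slope d w"
  shows "same_orbit f c d \<longleftrightarrow> same_slope_orbit H u w"
proof -
  have un: "unoriented_homotopic c d \<longleftrightarrow> (\<exists>s\<in>{1, -1}. u = signed s w)" if "slope c u" "slope d w" for c d u w
    using homotopic_iff_slope_eq[OF that] homotopic_iff_slope_eq[OF that(1) slope_reversepath[OF that(2)]]
    by (simp add: unoriented_homotopic_def signed_1)
  show ?thesis unfolding same_orbit_def same_slope_orbit_iff[OF det_H]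
    using un[OF slope_f_pow[OF c] d] un[OF c slope_f_pow[OF d]] by blast
qed

definition geodesic_of :: "int \<times> int \<Rightarrow> (real \<Rightarrow> complex \<times> complex) set" where
  "geodesic_of u = {d. essential_scc d \<and> (\<exists>w. slope d w \<and> same_slope_orbit H u w)}"

lemma geodesic_of_slope: "slope c u \<Longrightarrow> {d. essential_scc d \<and> same_orbit f c d} = geodesic_of u"
  unfolding geodesic_of_def using essential_scc_slope same_orbit_iff by blast

lemma essential_scc_with_slope:
  assumes "coprime (fst u) (snd u)"
  shows "\<exists>c. essential_scc c \<and> slope c u"
proof -
  obtain B :: "int^2^2" where "det B = 1" "B$1$1 = fst u" "B$2$1 = snd u" using coprime_imp_first_column[OF assms] .
  then show ?thesis using slope_standard_loop[of B] essential_scc_standard_loop[of B] by (intro exI[of _ "standard_loop B"]) simp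
qed

lemma slope_coprime: "slope c u \<Longrightarrow> coprime (fst u) (snd u)"
proof (rule coprimeI)
  fix k assume "slope c u" and k: "k dvd fst u" "k dvd snd u"
  then obtain B :: "int^2^2" where B: "det B = 1" "B$1$1 = fst u" "B$2$1 = snd u" unfolding slope_def by blast
  have "k dvd B$1$1 * B$2$2 - B$1$2 * B$2$1" unfolding B using k by simp
  then show "is_unit k" using B(1) by (simp add: det_2)
qed

lemma fiber_geodesics_eq: "fiber_geodesics f = geodesic_of ` {u. coprime (fst u) (snd u)}"
proof (intro equalityI subsetI)
  fix \<sigma> assume "\<sigma> \<in> fiber_geodesics f"
  then obtain c where c: "essential_scc c" "\<sigma> = {d. essential_scc d \<and> same_orbit f c d}" unfolding fiber_geodesics_def by blast
  then obtain u where "slope c u" using essential_scc_slope by blast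
  then show "\<sigma> \<in> geodesic_of ` {u. coprime (fst u) (snd u)}" using geodesic_of_slope slope_coprime c(2) by blast
next
  fix \<sigma> assume "\<sigma> \<in> geodesic_of ` {u. coprime (fst u) (snd u)}"
  then obtain u where u: "coprime (fst u) (snd u)" "\<sigma> = geodesic_of u" by blast
  obtain c where c: "essential_scc c" "slope c u" using essential_scc_with_slope[OF u(1)] by blast
  then show "\<sigma> \<in> fiber_geodesics f" unfolding fiber_geodesics_def u(2) using geodesic_of_slope[OF c(2)] by blast
qed

lemma geodesic_of_eq_iff:
  assumes "coprime (fst w) (snd w)"
  shows "geodesic_of u = geodesic_of w \<longleftrightarrow> same_slope_orbit H u w"
proof
  obtain c where c: "essential_scc c" "slope c w" using essential_scc_with_slope[OF assms] by blast
  assume "geodesic_of u = geodesic_of w"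
  moreover have "c \<in> geodesic_of w" using c same_slope_orbit_refl[of H] unfolding geodesic_of_def by blast
  ultimately obtain w' where w': "slope c w'" "same_slope_orbit H u w'" unfolding geodesic_of_def by blast
  have "homotopic_loops punctured_torus c c" using slope_loop_in[OF c(2)] by (simp add: homotopic_loops_refl loop_in_def)
  then show "same_slope_orbit H u w" using w' homotopic_iff_slope_eq[OF w'(1) c(2)] by simp
next
  assume "same_slope_orbit H u w"
  then show "geodesic_of u = geodesic_of w" unfolding geodesic_of_def
    using same_slope_orbit_trans same_slope_orbit_sym by blast
qed

lemma x_mat_act_H: "coprime (fst u) (snd u) \<Longrightarrow> x (mat_act H u) = x u"
proof -
  assume "coprime (fst u) (snd u)"
  then obtain c where c: "slope c u" using essential_scc_with_slope by blast
  show ?thesis using tr_f[OF slope_loop_in[OF c]] tr_slope[OF c] tr_slope[OF slope_f[OF c]] by simp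
qed

lemma x_signed: "coprime (fst u) (snd u) \<Longrightarrow> s \<in> {1, -1} \<Longrightarrow> x (signed s u) = x u"
  using x_neg[of u] signed_1[of u] by (elim insertE emptyE) simp_all

lemma x_mat_act_pow: "coprime (fst u) (snd u) \<Longrightarrow> x ((mat_act H ^^ n) u) = x u \<and> coprime (fst ((mat_act H ^^ n) u)) (snd ((mat_act H ^^ n) u))"
  by (induction n) (simp_all add: x_mat_act_H mat_act_coprime[OF det_H])

lemma x_same_slope_orbit:
  assumes "same_slope_orbit H u w" "coprime (fst u) (snd u)" "coprime (fst w) (snd w)"
  shows "x u = x w"
proof -
  obtain m n s where "s \<in> {1, -1 :: int}" "(mat_act H ^^ m) u = signed s ((mat_act H ^^ n) w)"
    using assms(1) unfolding same_slope_orbit_def by blast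
  then show ?thesis using x_mat_act_pow[OF assms(2), of m] x_mat_act_pow[OF assms(3), of n] x_signed by metis
qed

text \<open>Every representative has trace \<open>x u\<close>, so the choice made in
  \<open>geodesic_trace\<close> has no influence.\<close>

lemma represents_geodesic_of:
  assumes "coprime (fst u) (snd u)"
  shows "\<exists>g. represents g (geodesic_of u)" "represents g (geodesic_of u) \<Longrightarrow> trace (\<rho> (fiber_loop q g)) = x u"
proof -
  obtain c where c: "essential_scc c" "slope c u" using essential_scc_with_slope[OF assms] by blast
  then have "c \<in> geodesic_of u" using same_slope_orbit_refl[of H] unfolding geodesic_of_def by blast
  then show "\<exists>g. represents g (geodesic_of u)"
    using based_representative_exists[OF slope_loop_in[OF c(2)]] unfolding represents_def by blast
  assume "represents g (geodesic_of u)"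
  then obtain d w where d: "based g" "homotopic_loops punctured_torus g d" "slope d w" "same_slope_orbit H u w"
    unfolding represents_def geodesic_of_def by blast
  have "trace (\<rho> (fiber_loop q g)) = tr g" using tr_based[OF d(1)] by (simp add: fiber_loop_eq)
  also have "\<dots> = x w" using tr_homotopic[OF d(2)] tr_slope[OF d(3)] by simp
  also have "\<dots> = x u" by (rule x_same_slope_orbit[OF d(4) assms slope_coprime[OF d(3)], symmetric])
  finally show "trace (\<rho> (fiber_loop q g)) = x u" .
qed

lemma complex_length_geodesic_of:
  assumes "coprime (fst u) (snd u)"
  shows "complex_length q \<rho> (geodesic_of u) = 2 * carcosh (x u / 2)"
  unfolding complex_length_def geodesic_trace_def
  using represents_geodesic_of(2)[OF assms someI_ex[OF represents_geodesic_of(1)[OF assms]]] by simp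

end

context weak_markoff_map
begin

text \<open>By \<open>edge\<close>, \<open>x (u + v)\<close> and \<open>x (u - v)\<close> are the
  two roots of the vertex relation read as a quadratic equation, so it holds on both sides of the
  pair \<open>u, v\<close>.\<close>

lemma node_flip:
  assumes "node u v"
  shows "node u (- v)"
proof -
  note c = node_coprime[OF assms]
  have "x (u + v) + x (u - v) = x u * x v" by (rule edge[OF node_det[OF assms]])
  then have d: "x (u - v) = x u * x v - x (u + v)" by (simp add: algebra_simps eq_diff_eq)
  have "\<bar>det2 u (- v)\<bar> = 1" using node_det[OF assms] by (simp add: det2_def)
  moreover have "(x u)\<^sup>2 + (x v)\<^sup>2 + (x u * x v - x (u + v))\<^sup>2 - x u * x v * (x u * x v - x (u + v)) = \<mu>"
    using assms unfolding node_def by (simp add: algebra_simps power2_eq_square)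
  ultimately show ?thesis using neg[OF c(2)] d by (simp add: node_def)
qed

lemma node_shear: "node u v \<Longrightarrow> node u (u + v)" "node u v \<Longrightarrow> node u (v - u)"
proof -
  show "node u v \<Longrightarrow> node u (u + v)" by (rule node_child)
  assume "node u v"
  from node_flip[OF node_child(1)[OF node_flip[OF this]]] show "node u (v - u)" by simp
qed

end

theorem theorem5p3:
  fixes f f' :: "complex \<times> complex \<Rightarrow> complex \<times> complex"
    and H :: "int^2^2"
    and M :: "'m::topological_space set"
    and q :: "(complex \<times> complex) \<times> real \<Rightarrow> 'm"
    and \<rho> :: "(real \<Rightarrow> 'm) \<Rightarrow> complex^2^2"
    and \<tau> \<mu> \<nu> :: complex
  assumes monodromy: "homeomorphism punctured_torus punctured_torus f f'"
      "has_mapping_class f H"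
    and hyperbolic: "\<bar>trace H\<bar> > 2"
    and fibration: "mapping_torus f M q"
    and deformed: "incomplete_deformation M (bundle_base q) \<rho>"
    and tau: "\<tau> = boundary_trace q \<rho>" "\<tau> \<noteq> 2"
    and mu: "\<mu> = \<tau> + 2"
    and nu: "\<nu> = carcosh (1 - \<mu> / 2)"
    and geodesics: "\<And>\<sigma> g. \<sigma> \<in> fiber_geodesics f \<Longrightarrow> represents g \<sigma> \<Longrightarrow>
      trace (\<rho> (fiber_loop q g)) \<notin> complex_of_real ` {-2..2}"
    and discrete: "discrete_fiber_spectrum f q \<rho>"
  shows "(\<lambda>\<sigma>. norm (mcshane_term \<nu> (complex_length q \<rho> \<sigma>))) summable_on fiber_geodesics f \<and>
    (\<exists>k::int. (\<Sum>\<^sub>\<infinity>\<sigma>\<in>fiber_geodesics f. mcshane_term \<nu> (complex_length q \<rho> \<sigma>))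
       = 2 * of_real pi * \<i> * of_int k)"
proof -
  have "SL2_representation M (bundle_base q) \<rho>"
    using deformed unfolding incomplete_deformation_def hyperbolic_structure_def by blast
  then interpret bundle_character f f' H M q \<rho> by unfold_locales (use monodromy fibration in auto)
  \<comment> \<open>The eigenvalue of norm above 1 of an element of trace \<open>z\<close>; its
    square is the exponential of the complex length.\<close>
  define lam where "lam = (\<lambda>z. exp (carcosh (z / 2)))"
  have E: "\<mu> = 2 - exp \<nu> - 1 / exp \<nu>" using exp_carcosh_add_inverse[of "1 - \<mu> / 2"] nu by (simp add: algebra_simps)
  have lam: "lam (x u) + 1 / lam (x u) = x u \<and> norm (lam (x u)) > 1" if c: "coprime (fst u) (snd u)" for u
  proof -
    obtain g where "represents g (geodesic_of u)" using represents_geodesic_of(1)[OF c] by blast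
    moreover have "geodesic_of u \<in> fiber_geodesics f" using c fiber_geodesics_eq by blast
    ultimately have "x u \<notin> complex_of_real ` {-2..2}" using geodesics represents_geodesic_of(2)[OF c] by metis
    then show ?thesis using norm_exp_carcosh_gt exp_carcosh_add_inverse[of "x u / 2"] by (simp add: lam_def)
  qed
  interpret X: weak_markoff_map x \<mu> "exp \<nu>" lam
    by unfold_locales (use x_neg x_edge E lam in auto)
  have root: "X.node (1, 0) (0, 1)" unfolding X.node_def using x_vertex tau(1) mu by (simp add: det2_def)
  \<comment> \<open>The vertex relation at the basis formed by the columns of \<open>B\<close>. It
    is known at the standard basis, and the shears of the reduction carry it to a basis in which
    \<open>H\<close> is positive up to sign.\<close>
  define Q where "Q = (\<lambda>B. X.node (mat_act B (1, 0)) (mat_act B (0, 1)))"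
  have Q1: "Q (mat 1)" using root by (simp add: Q_def mat_act_1)
  have shear: "Q (B ** mat2 1 k 0 1) \<and> Q (B ** mat2 1 0 k 1)" if "Q B" "\<bar>k\<bar> = 1" for B k
  proof -
    define u v where "u = mat_act B (1, 0)" and "v = mat_act B (0, 1)"
    have n: "X.node u v" "X.node v u" using that(1) X.node_swap[of u v] by (simp_all add: Q_def u_def v_def)
    have "k = 1 \<or> k = -1" using that(2) by linarith
    then show ?thesis
    proof
      assume k: "k = 1"
      have "mat_act (B ** mat2 1 k 0 1) (1, 0) = u" "mat_act (B ** mat2 1 k 0 1) (0, 1) = u + v"
        "mat_act (B ** mat2 1 0 k 1) (1, 0) = v + u" "mat_act (B ** mat2 1 0 k 1) (0, 1) = v"
        by (simp_all add: u_def v_def k mat_act_def matrix_mult_2)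
      then show ?thesis using X.node_shear(1)[OF n(1)] X.node_swap[OF X.node_shear(1)[OF n(2)]] by (simp add: Q_def)
    next
      assume k: "k = -1"
      have "mat_act (B ** mat2 1 k 0 1) (1, 0) = u" "mat_act (B ** mat2 1 k 0 1) (0, 1) = v - u"
        "mat_act (B ** mat2 1 0 k 1) (1, 0) = u - v" "mat_act (B ** mat2 1 0 k 1) (0, 1) = v"
        by (simp_all add: u_def v_def k mat_act_def matrix_mult_2)
      then show ?thesis using X.node_shear(2)[OF n(1)] X.node_swap[OF X.node_shear(2)[OF n(2)]] by (simp add: Q_def)
    qed
  qed
  obtain B t a b c d where B: "Q B" "det B = 1" and t: "t \<in> {1, -1}" and pos: "a \<ge> 1" "b \<ge> 1" "c \<ge> 1" "d \<ge> 1" "a * d - b * c = 1"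
    and HB: "H ** B = B ** mat2 (t * a) (t * b) (t * c) (t * d)"
    using hyperbolic_conjugate_positive[where Q = Q, OF det_H hyperbolic Q1] shear by blast
  interpret W: positive_matrix a b c d by unfold_locales (use pos in auto)
  define y where "y = (\<lambda>z. x (mat_act B z))"
  note coprime_B = mat_act_coprime[OF B(2)]
  \<comment> \<open>In the basis \<open>B\<close> the monodromy acts as \<open>W\<close> up to the
    sign \<open>t\<close>, which is harmless because slopes are unoriented.\<close>
  have act: "mat_act H (mat_act B z) = signed t (mat_act B (W.W z))" for z
  proof -
    have "mat_act H (mat_act B z) = mat_act B (mat_act (mat2 (t * a) (t * b) (t * c) (t * d)) z)"
      by (simp only: mat_act_mult[symmetric] HB)
    also have "mat_act (mat2 (t * a) (t * b) (t * c) (t * d)) z = signed t (W.W z)"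
      by (simp add: mat_act_def signed_def W.W_def algebra_simps)
    finally show ?thesis by (simp only: mat_act_signed)
  qed
  have act_pow: "\<exists>s\<in>{1, -1}. (mat_act H ^^ n) (mat_act B z) = signed s (mat_act B ((W.W ^^ n) z))" for n z
  proof (induction n)
    case (Suc n)
    then obtain s where s: "s \<in> {1, -1 :: int}" "(mat_act H ^^ n) (mat_act B z) = signed s (mat_act B ((W.W ^^ n) z))" by blast
    then have "(mat_act H ^^ Suc n) (mat_act B z) = signed (s * t) (mat_act B ((W.W ^^ Suc n) z))"
      by (simp add: mat_act_signed act signed_signed)
    moreover have "s * t \<in> {1, -1}" using s(1) t by auto
    ultimately show ?case by blast
  qed (simp add: signed_1)
  have orbit: "same_slope_orbit H (mat_act B z) (mat_act B w) \<longleftrightarrow> (\<exists>n. \<exists>s\<in>{1, -1}. (W.W ^^ n) z = signed s w \<or> z = signed s ((W.W ^^ n) w))" for z w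
  proof -
    have 1: "(\<exists>s\<in>{1, -1}. (mat_act H ^^ n) (mat_act B z) = signed s (mat_act B w)) \<longleftrightarrow> (\<exists>s\<in>{1, -1}. (W.W ^^ n) z = signed s w)" for n z w
    proof -
      obtain r where r: "r \<in> {1, -1 :: int}" "(mat_act H ^^ n) (mat_act B z) = signed r (mat_act B ((W.W ^^ n) z))" using act_pow by blast
      have rr: "signed r (signed r u) = u" for u using r(1) by (auto simp: signed_def)
      have "(mat_act H ^^ n) (mat_act B z) = signed s (mat_act B w) \<longleftrightarrow> (W.W ^^ n) z = signed (r * s) w" for s
      proof -
        have "signed r (mat_act B ((W.W ^^ n) z)) = signed s (mat_act B w) \<longleftrightarrow> mat_act B ((W.W ^^ n) z) = signed r (signed s (mat_act B w))"
          by (metis rr)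
        also have "\<dots> \<longleftrightarrow> mat_act B ((W.W ^^ n) z) = mat_act B (signed (r * s) w)" by (simp only: mat_act_signed signed_signed)
        also have "\<dots> \<longleftrightarrow> (W.W ^^ n) z = signed (r * s) w" by (rule inj_eq[OF inj_mat_act[OF B(2)]])
        finally show ?thesis by (simp only: r(2))
      qed
      then show ?thesis using r(1) by auto
    qed
    have 2: "(\<exists>s\<in>{1, -1}. u = signed s w) \<longleftrightarrow> (\<exists>s\<in>{1, -1}. w = signed s u)" for u w
      by (auto simp: signed_1)
    show ?thesis unfolding same_slope_orbit_iff[OF det_H] bex_disj_distrib ex_disj_distrib
      using 1[of _ z w] 1[of _ w z] 2[of "mat_act B z"] 2[of z] by simp
  qed
  have dc: "coprime (fst (mat_act B z)) (snd (mat_act B z))" if "z \<in> W.domain" for z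
    using that W.quadrant[of z] coprime_B by (simp add: W.domain_def)
  \<comment> \<open>Slopes modulo sign and \<open>H\<close> have exactly one representative in the
    domain: existence is \<open>W.domain_surj\<close>, uniqueness \<open>W.domain_inj\<close>. The
    sum over geodesics thus becomes a sum over the domain.\<close>
  have bij: "bij_betw (\<lambda>z. geodesic_of (mat_act B z)) W.domain (fiber_geodesics f)"
    unfolding bij_betw_def
  proof
    show "inj_on (\<lambda>z. geodesic_of (mat_act B z)) W.domain"
    proof (rule inj_onI)
      fix z w assume zw: "z \<in> W.domain" "w \<in> W.domain" "geodesic_of (mat_act B z) = geodesic_of (mat_act B w)"
      have "same_slope_orbit H (mat_act B z) (mat_act B w)" by (rule geodesic_of_eq_iff[OF dc[OF zw(2)], THEN iffD1, OF zw(3)])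
      then obtain n s where s: "s \<in> {1, -1 :: int}" "(W.W ^^ n) z = signed s w \<or> z = signed s ((W.W ^^ n) w)"
        unfolding orbit by blast
      have "(W.W ^^ n) z = signed s w \<or> (W.W ^^ n) w = signed s z" using s by (auto simp: signed_def)
      then show "z = w" using W.domain_inj[OF zw(1,2) s(1)] W.domain_inj[OF zw(2,1) s(1)] by (auto simp: signed_def)
    qed
    show "(\<lambda>z. geodesic_of (mat_act B z)) ` W.domain = fiber_geodesics f"
    proof (intro equalityI subsetI)
      fix \<sigma> assume "\<sigma> \<in> (\<lambda>z. geodesic_of (mat_act B z)) ` W.domain"
      then show "\<sigma> \<in> fiber_geodesics f" using dc fiber_geodesics_eq by blast
    next
      fix \<sigma> assume "\<sigma> \<in> fiber_geodesics f"
      then obtain u where u: "coprime (fst u) (snd u)" "\<sigma> = geodesic_of u" using fiber_geodesics_eq by blast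
      obtain B' where B': "B ** B' = mat 1" "det B' = 1" using det_1_inverse[OF B(2)] .
      define z where "z = mat_act B' u"
      have z: "mat_act B z = u" by (simp only: z_def mat_act_mult[symmetric] B' mat_act_1)
      have "coprime (fst z) (snd z)" unfolding z_def by (rule mat_act_coprime[OF B'(2) u(1)])
      then obtain n w s where w: "w \<in> W.domain" "s \<in> {1, -1 :: int}" "(W.W ^^ n) z = signed s w \<or> z = signed s ((W.W ^^ n) w)"
        using W.domain_surj[of z] unfolding signed_def by blast
      then have "same_slope_orbit H u (mat_act B w)" unfolding z[symmetric] orbit by blast
      then have "\<sigma> = geodesic_of (mat_act B w)" using geodesic_of_eq_iff[OF dc[OF w(1)]] u(2) by blast
      then show "\<sigma> \<in> (\<lambda>z. geodesic_of (mat_act B z)) ` W.domain" using w(1) by blast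
    qed
  qed
  interpret Y: weak_markoff_map y \<mu> "exp \<nu>" lam
  proof unfold_locales
    show "y (- u) = y u" if "coprime (fst u) (snd u)" for u
      using x_neg[OF coprime_B[OF that]] by (simp only: y_def mat_act_uminus)
    show "y (u + v) + y (u - v) = y u * y v" if "\<bar>det2 u v\<bar> = 1" for u v
      using x_edge[of "mat_act B u" "mat_act B v"] that by (simp only: y_def mat_act_add det2_mat_act[OF B(2)])
    show "lam (y u) + 1 / lam (y u) = y u \<and> 1 < norm (lam (y u))" if "coprime (fst u) (snd u)" for u
      using lam[OF coprime_B[OF that]] by (simp only: y_def)
  qed (use E in auto)
  have finite_domain: "finite {z \<in> W.domain. norm (y z) \<le> K}" for K
  proof (rule finite_imageD)
    \<comment> \<open>Twice the bound of \<open>Re_carcosh_le\<close>, the length being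
      \<open>2 * carcosh\<close>; the maximum with 1 makes it positive, as
      \<open>discrete_fiber_spectrum\<close> requires.\<close>
    define \<kappa> where "\<kappa> = max 1 (2 * ln (K + 1))"
    have "(\<lambda>z. geodesic_of (mat_act B z)) ` {z \<in> W.domain. norm (y z) \<le> K} \<subseteq> {\<sigma> \<in> fiber_geodesics f. Re (complex_length q \<rho> \<sigma>) \<le> \<kappa>}"
    proof
      fix \<sigma> assume "\<sigma> \<in> (\<lambda>z. geodesic_of (mat_act B z)) ` {z \<in> W.domain. norm (y z) \<le> K}"
      then obtain z where z: "z \<in> W.domain" "norm (y z) \<le> K" "\<sigma> = geodesic_of (mat_act B z)" by blast
      have "Re (complex_length q \<rho> \<sigma>) = 2 * Re (carcosh (y z / 2))"
        unfolding z(3) complex_length_geodesic_of[OF dc[OF z(1)]] by (simp add: y_def)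
      then have "Re (complex_length q \<rho> \<sigma>) \<le> \<kappa>" using Re_carcosh_le[OF z(2)] by (simp add: \<kappa>_def)
      moreover have "\<sigma> \<in> fiber_geodesics f" using z dc fiber_geodesics_eq by blast
      ultimately show "\<sigma> \<in> {\<sigma> \<in> fiber_geodesics f. Re (complex_length q \<rho> \<sigma>) \<le> \<kappa>}" by blast
    qed
    moreover have "\<kappa> > 0" by (simp add: \<kappa>_def)
    ultimately show "finite ((\<lambda>z. geodesic_of (mat_act B z)) ` {z \<in> W.domain. norm (y z) \<le> K})"
      using discrete finite_subset unfolding discrete_fiber_spectrum_def by blast
    show "inj_on (\<lambda>z. geodesic_of (mat_act B z)) {z \<in> W.domain. norm (y z) \<le> K}"
      using bij by (auto simp: bij_betw_def intro: inj_on_subset)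
  qed
  interpret Z: invariant_markoff_map y \<mu> "exp \<nu>" lam a b c d
  proof unfold_locales
    show "Y.node (1, 0) (0, 1)"
      using B(1) unfolding Y.node_def unfolding Q_def X.node_def y_def mat_act_add det2_mat_act[OF B(2)] .
    show "y (W.W z) = y z" if c: "coprime (fst z) (snd z)" for z
    proof -
      have "coprime (fst (mat_act B (W.W z))) (snd (mat_act B (W.W z)))" using coprime_B W.coprime_W c by simp
      then have "x (mat_act H (mat_act B z)) = x (mat_act B (W.W z))" unfolding act using x_signed t by blast
      then show ?thesis using x_mat_act_H[OF coprime_B[OF c]] by (simp add: y_def)
    qed
  qed (rule finite_domain)
  have g: "mcshane_term \<nu> (complex_length q \<rho> (geodesic_of (mat_act B z))) = Ln (Y.F z)" if "z \<in> W.domain" for z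
  proof -
    have "exp (2 * carcosh (y z / 2)) = (Y.l z)\<^sup>2" unfolding Y.l_def by (simp add: lam_def exp_double)
    then show ?thesis unfolding complex_length_geodesic_of[OF dc[OF that]] mcshane_term_def Y.F_def
      by (simp add: y_def exp_minus inverse_eq_divide)
  qed
  have "(\<lambda>\<sigma>. norm (mcshane_term \<nu> (complex_length q \<rho> \<sigma>))) summable_on fiber_geodesics f \<longleftrightarrow>
      (\<lambda>z. norm (Ln (Y.F z))) summable_on W.domain"
    unfolding summable_on_reindex_bij_betw[OF bij, symmetric] by (rule summable_on_cong) (simp add: g)
  moreover have "(\<Sum>\<^sub>\<infinity>\<sigma>\<in>fiber_geodesics f. mcshane_term \<nu> (complex_length q \<rho> \<sigma>)) = infsum (\<lambda>z. Ln (Y.F z)) W.domain"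
    unfolding infsum_reindex_bij_betw[OF bij, symmetric] by (rule infsum_cong) (simp add: g)
  \<comment> \<open>The sum of principal logarithms has exponential 1, which determines it up to a
    multiple of \<open>2 * pi * \<i>\<close>.\<close>
  moreover obtain k :: int where "infsum (\<lambda>z. Ln (Y.F z)) W.domain = of_int (2 * k) * of_real pi * \<i>"
  proof -
    obtain k :: int where "Re (infsum (\<lambda>z. Ln (Y.F z)) W.domain) = 0" "Im (infsum (\<lambda>z. Ln (Y.F z)) W.domain) = of_int (2 * k) * pi"
      using Z.domain_identity(2) unfolding exp_eq_1 by blast
    then show ?thesis by (intro that[of k]) (simp add: complex_eq_iff)
  qed
  ultimately show ?thesis using Z.domain_identity(1) by (intro conjI exI[of _ k]) simp_all
qed

end
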